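(* Let $t$ be a seed of maximal rank with vertex set $I$, $D$ a finite set disjoint from $I$, $\nu\in\mathbb Z^{D\times I}$ a lifting matrix on $t$, ${\uparrow}t$ the associated monomial lifting and ${\uparrow}t^D$ the seed obtained from ${\uparrow}t$ by making the vertices in $D$ highly-frozen. Suppose that $\overline{\mathcal A}({\uparrow}t^D)$ is a finitely generated $\mathbb C$-algebra. Let $\mathfrak X=\mathrm{Spec}(\overline{\mathcal A}({\uparrow}t^D))$, $Y=\mathrm{Spec}(\overline{\mathcal A}(t))$, and let $\phi_\nu:\mathbb G_m^D\times Y\to\mathfrak X$ be the open embedding induced by $\overline{\mathcal A}({\uparrow}t^D)\subseteq\overline{\mathcal A}({\uparrow}t)\simeq\mathbb C[x_d^{\pm1}]_{d\in D}\otimes\overline{\mathcal A}(t)$. Then: (1) $\mathfrak X$ is noetherian, normal and integral. (2) For each $d\in D$, the zero locus $V({\uparrow}x_d)$ of ${\uparrow}x_d$ in $\mathfrak X$ is irreducible; and if $\mathcal{CV}_d:\mathbb C(\mathfrak X)\to\mathbb Z\cup\{\infty\}$ is the valuation associated with the divisor $V({\uparrow}x_d)$, then $\mathcal{CV}_{d_1}({\uparrow}x_{d_2})=\delta_{d_1,d_2}$ for all $d_1,d_2\in D$. (3) The map $\phi_\nu:\mathbb G_m^D\times Y\to\mathfrak X\setminus\bigcup_dV({\uparrow}x_d)$ is an isomorphism such that $\phi_\nu^*({\uparrow}x_d)=x_d\otimes1$, where the collection of the $x_d$ is a basis of the character group $X(\mathbb G_m^D)$. Moreover, $Y$ is an irreducible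 $\mathbb C$-scheme.
   Context: Cluster conventions. A seed $t$ of a field extension $\mathbb K$ of $\mathbb C$ is a tuple $(I_{uf},I_{sf},I_{hf},B,x)$: disjoint finite sets of unfrozen (mutable), semi-frozen and highly-frozen vertices, $I=I_{uf}\sqcup I_{sf}\sqcup I_{hf}$; an integer matrix $B=(b_{i,j})\in\mathbb Z^{I\times I_{uf}}$ whose restriction to $I_{uf}\times I_{uf}$ is skew-symmetrizable; and $x=(x_i)_{i\in I}\in(\mathbb K^* )^I$ a transcendence basis of $\mathbb K$ over $\mathbb C$. Write $b^+=\max(b,0)$, $b^-=\max(-b,0)$. For $k\in I_{uf}$, the mutation $\mu_k(t)$ has the same vertex sets, matrix $b'_{i,j}=-b_{i,j}$ if $i=k$ or $j=k$, $b'_{i,j}=b_{i,j}+b_{i,k}^+b_{k,j}^+-b_{i,k}^-b_{k,j}^-$ otherwise, and cluster $x'_i=x_i$ for $i\neq k$, $x_k'=x_k^{-1}\bigl(\prod_ix_i^{b_{i,k}^+}+\prod_ix_i^{b_{i,k}^-}\bigr)$. Seeds related by finitely many mutations are equivalent ($\sim$). $\mathcal L(t)=\mathbb C[x_i]_{i\in I_{hf}}[x_i^{\pm1}]_{i\in I_{sf}\sqcup I_{uf}}$ and $\overline{\mathcal A}(t)=\bigcap_{t'\sim t}\mathcal L(t')$. The seed is of maximal rank if $B$ is. Monomial lifting. Let $\mathbb L=\mathbb K(x_d)_{d\in D}$ with $(x_d)_{d\in D}$ algebraically independent over $\mathbb K$. For $\nu\in\mathbb Z^{D\times I}$, ${\uparrow}t$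 is the seed of $\mathbb L$ with mutable vertices $I_{uf}$, semi-frozen vertices $I_{sf}\sqcup D$, highly-frozen vertices $I_{hf}$, exchange matrix $\begin{pmatrix}B\\-\nu B\end{pmatrix}$, and cluster ${\uparrow}x_i=x_i\prod_{d}x_d^{\nu_{d,i}}$ for $i\in I$, ${\uparrow}x_d=x_d$ for $d\in D$. The seed ${\uparrow}t^D$ is the same except that its semi-frozen set is $I_{sf}$ and its highly-frozen set is $I_{hf}\sqcup D$. The map $\phi_\nu$. When $t$ is of maximal rank one has $\overline{\mathcal A}({\uparrow}t)=\overline{\mathcal A}(t)[x_d^{\pm1}]_{d\in D}$, identified with $\mathbb C[x_d^{\pm1}]_d\otimes\overline{\mathcal A}(t)$ by ${\uparrow}x_i\mapsto\prod_dx_d^{\nu_{d,i}}\otimes x_i$ ($i\in I$), ${\uparrow}x_d\mapsto x_d\otimes1$; here $\mathbb G_m^D=\mathrm{Spec}\,\mathbb C[x_d^{\pm1}]_d$. Moreover $\overline{\mathcal A}({\uparrow}t)$ is the localization of $\overline{\mathcal A}({\uparrow}t^D)$ at $\prod_d{\uparrow}x_d$, so this yields the open embedding $\phi_\nu$. *)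

theory Defs
  imports
    "HOL-Algebra.Algebra"
    "HOL-Algebra.Algebraic_Closure_Type"
    "HOL-Analysis.Abstract_Topology"
    "HOL-Library.Poly_Mapping"
    "HOL-Library.Extended"
begin

section \<open>Localizations and normal domains\<close>

text \<open>
  For a prime ideal \<open>P\<close> of a commutative ring \<open>R\<close>, \<open>fraction R P a s\<close> is the class of
  \<open>a / s\<close> in the localization \<open>R\<^sub>P\<close>, as a set of pairs. For a domain \<open>R\<close>, the fraction
  field is the localization at the zero ideal. The unions in the ring operations range over
  representatives; all the classes occurring in such a union are equal.
\<close>

definition fraction :: "('a, 'm) ring_scheme \<Rightarrow> 'a set \<Rightarrow> 'a \<Rightarrow> 'a \<Rightarrow> ('a \<times> 'a) set" where
  "fraction R P a s = {(b, t). b \<in> carrier R \<and> t \<in> carrier R - P \<and>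
     (\<exists>u \<in> carrier R - P. u \<otimes>\<^bsub>R\<^esub> (a \<otimes>\<^bsub>R\<^esub> t \<ominus>\<^bsub>R\<^esub> b \<otimes>\<^bsub>R\<^esub> s) = \<zero>\<^bsub>R\<^esub>)}"

definition local_ring_at :: "('a, 'm) ring_scheme \<Rightarrow> 'a set \<Rightarrow> ('a \<times> 'a) set ring" where
  "local_ring_at R P = \<lparr>
     carrier = {fraction R P a s | a s. a \<in> carrier R \<and> s \<in> carrier R - P},
     monoid.mult = (\<lambda>\<XX> \<YY>. \<Union>(a, s)\<in>\<XX>. \<Union>(b, t)\<in>\<YY>. fraction R P (a \<otimes>\<^bsub>R\<^esub> b) (s \<otimes>\<^bsub>R\<^esub> t)),
     one = fraction R P \<one>\<^bsub>R\<^esub> \<one>\<^bsub>R\<^esub>,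
     ring.zero = fraction R P \<zero>\<^bsub>R\<^esub> \<one>\<^bsub>R\<^esub>,
     add = (\<lambda>\<XX> \<YY>. \<Union>(a, s)\<in>\<XX>. \<Union>(b, t)\<in>\<YY>.
              fraction R P (a \<otimes>\<^bsub>R\<^esub> t \<oplus>\<^bsub>R\<^esub> b \<otimes>\<^bsub>R\<^esub> s) (s \<otimes>\<^bsub>R\<^esub> t)) \<rparr>"

definition local_ring_map :: "('b, 'n) ring_scheme \<Rightarrow> ('a \<Rightarrow> 'b) \<Rightarrow> 'b set \<Rightarrow> ('a \<times> 'a) set \<Rightarrow> ('b \<times> 'b) set" where
  "local_ring_map S h Q \<XX> = (\<Union>(a, s)\<in>\<XX>. fraction S Q (h a) (h s))"

definition integrally_closed_domain :: "('a, 'm) ring_scheme \<Rightarrow> bool" where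
  "integrally_closed_domain R \<longleftrightarrow> domain R \<and>
     (let F = local_ring_at R {\<zero>\<^bsub>R\<^esub>}; emb = (\<lambda>a. fraction R {\<zero>\<^bsub>R\<^esub>} a \<one>\<^bsub>R\<^esub>) in
      \<forall>z \<in> carrier F.
        (\<exists>(n::nat) c. (\<forall>i<n. c i \<in> carrier R) \<and>
           z [^]\<^bsub>F\<^esub> n \<oplus>\<^bsub>F\<^esub> (\<Oplus>\<^bsub>F\<^esub>i\<in>{..<n}. emb (c i) \<otimes>\<^bsub>F\<^esub> z [^]\<^bsub>F\<^esub> i) = \<zero>\<^bsub>F\<^esub>)
        \<longrightarrow> z \<in> emb ` carrier R)"


section \<open>Spaces with a sheaf of rings\<close>

record ('p, 's) ringed_space =
  points :: "'p topology"
  sections :: "'p set \<Rightarrow> 's ring"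
  res :: "'p set \<Rightarrow> 'p set \<Rightarrow> 's \<Rightarrow> 's"  \<comment> \<open>\<open>res \<XX> U V\<close> restricts from \<open>U\<close> to \<open>V\<close>\<close>

definition germ :: "('p, 's) ringed_space \<Rightarrow> 'p \<Rightarrow> 'p set \<Rightarrow> 's \<Rightarrow> ('p set \<times> 's) set" where
  "germ \<XX> x U s = {(V, t). openin (points \<XX>) V \<and> x \<in> V \<and> t \<in> carrier (sections \<XX> V) \<and>
     (\<exists>W. openin (points \<XX>) W \<and> x \<in> W \<and> W \<subseteq> U \<inter> V \<and> res \<XX> U W s = res \<XX> V W t)}"

definition stalk_op ::
  "('p, 's) ringed_space \<Rightarrow> 'p \<Rightarrow> ('p set \<Rightarrow> 's \<Rightarrow> 's \<Rightarrow> 's) \<Rightarrow>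
     ('p set \<times> 's) set \<Rightarrow> ('p set \<times> 's) set \<Rightarrow> ('p set \<times> 's) set" where
  "stalk_op \<XX> x f a b = (\<Union>(U, s)\<in>a. \<Union>(V, t)\<in>b.
     germ \<XX> x (U \<inter> V) (f (U \<inter> V) (res \<XX> U (U \<inter> V) s) (res \<XX> V (U \<inter> V) t)))"

definition stalk :: "('p, 's) ringed_space \<Rightarrow> 'p \<Rightarrow> ('p set \<times> 's) set ring" where
  "stalk \<XX> x = (let T = topspace (points \<XX>) in \<lparr>
     carrier = {germ \<XX> x U s | U s. openin (points \<XX>) U \<and> x \<in> U \<and> s \<in> carrier (sections \<XX> U)},
     monoid.mult = stalk_op \<XX> x (\<lambda>W. monoid.mult (sections \<XX> W)),
     one = germ \<XX> x T \<one>\<^bsub>sections \<XX> T\<^esub>,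
     ring.zero = germ \<XX> x T \<zero>\<^bsub>sections \<XX> T\<^esub>,
     add = stalk_op \<XX> x (\<lambda>W. add (sections \<XX> W)) \<rparr>)"

definition open_subspace :: "('p, 's) ringed_space \<Rightarrow> 'p set \<Rightarrow> ('p, 's) ringed_space" where
  "open_subspace \<XX> U = \<XX>\<lparr>points := subtopology (points \<XX>) U\<rparr>"

definition preim :: "('p, 's) ringed_space \<Rightarrow> ('p \<Rightarrow> 'q) \<Rightarrow> 'q set \<Rightarrow> 'p set" where
  "preim \<XX> f V = {x \<in> topspace (points \<XX>). f x \<in> V}"

text \<open>
  A morphism \<open>\<XX> \<rightarrow> \<YY>\<close> is a pair of a continuous map \<open>f\<close> and ring homomorphisms
  \<open>f\<^sup># V : \<O>\<^sub>\<YY>(V) \<rightarrow> \<O>\<^sub>\<XX>(f\<^sup>-\<^sup>1(V))\<close> compatible with restriction. The last condition says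
  that the maps induced on stalks reflect units, i.e. are local homomorphisms when the stalks
  are local rings.
\<close>

definition lrs_morphism ::
  "('p, 's) ringed_space \<Rightarrow> ('q, 't) ringed_space \<Rightarrow> ('p \<Rightarrow> 'q) \<Rightarrow> ('q set \<Rightarrow> 't \<Rightarrow> 's) \<Rightarrow> bool" where
  "lrs_morphism \<XX> \<YY> f fs \<longleftrightarrow>
     continuous_map (points \<XX>) (points \<YY>) f \<and>
     (\<forall>V. openin (points \<YY>) V \<longrightarrow> fs V \<in> ring_hom (sections \<YY> V) (sections \<XX> (preim \<XX> f V))) \<and>
     (\<forall>V W s. openin (points \<YY>) V \<and> openin (points \<YY>) W \<and> W \<subseteq> V \<and> s \<in> carrier (sections \<YY> V) \<longrightarrow>
        fs W (res \<YY> V W s) = res \<XX> (preim \<XX> f V) (preim \<XX> f W) (fs V s)) \<and>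
     (\<forall>x V s. x \<in> topspace (points \<XX>) \<and> openin (points \<YY>) V \<and> f x \<in> V \<and> s \<in> carrier (sections \<YY> V) \<and>
        germ \<XX> x (preim \<XX> f V) (fs V s) \<in> Units (stalk \<XX> x) \<longrightarrow>
        germ \<YY> (f x) V s \<in> Units (stalk \<YY> (f x)))"

definition lrs_iso ::
  "('p, 's) ringed_space \<Rightarrow> ('q, 't) ringed_space \<Rightarrow> ('p \<Rightarrow> 'q) \<Rightarrow> ('q set \<Rightarrow> 't \<Rightarrow> 's) \<Rightarrow> bool" where
  "lrs_iso \<XX> \<YY> f fs \<longleftrightarrow> lrs_morphism \<XX> \<YY> f fs \<and>
     (\<exists>g gs. lrs_morphism \<YY> \<XX> g gs \<and>
        (\<forall>x \<in> topspace (points \<XX>). g (f x) = x) \<and>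
        (\<forall>y \<in> topspace (points \<YY>). f (g y) = y) \<and>
        (\<forall>V s. openin (points \<YY>) V \<and> s \<in> carrier (sections \<YY> V) \<longrightarrow> gs (preim \<XX> f V) (fs V s) = s) \<and>
        (\<forall>U s. openin (points \<XX>) U \<and> s \<in> carrier (sections \<XX> U) \<longrightarrow> fs (preim \<YY> g U) (gs U s) = s))"


section \<open>Affine schemes\<close>

definition Spec :: "('a, 'm) ring_scheme \<Rightarrow> 'a set set" where
  "Spec R = {P. primeideal P R}"

definition zero_locus :: "('a, 'm) ring_scheme \<Rightarrow> 'a set \<Rightarrow> 'a set set" where
  "zero_locus R E = {P \<in> Spec R. E \<subseteq> P}"

definition zariski :: "('a, 'm) ring_scheme \<Rightarrow> 'a set topology" where
  "zariski R = topology (\<lambda>U. \<exists>E \<subseteq> carrier R. U = Spec R - zero_locus R E)"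

lemma istopology_zariski:
  assumes "cring R"
  shows "istopology (\<lambda>U. \<exists>E \<subseteq> carrier R. U = Spec R - zero_locus R E)"
proof -
  interpret cring R by fact
  let ?open = "\<lambda>U. \<exists>E \<subseteq> carrier R. U = Spec R - zero_locus R E"
  have int: "?open (S \<inter> S')" if S: "?open S" and S': "?open S'" for S S'
  proof -
    from S obtain A where A: "A \<subseteq> carrier R" "S = Spec R - zero_locus R A" by blast
    from S' obtain B where B: "B \<subseteq> carrier R" "S' = Spec R - zero_locus R B" by blast
    define E where "E = (\<lambda>(a, b). a \<otimes>\<^bsub>R\<^esub> b) ` (A \<times> B)"
    have "E \<subseteq> carrier R" using A B by (auto simp: E_def)
    moreover have "E \<subseteq> P \<longleftrightarrow> A \<subseteq> P \<or> B \<subseteq> P" if "P \<in> Spec R" for P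
    proof -
      from that interpret P: primeideal P R by (simp add: Spec_def)
      show ?thesis
      proof (intro iffI)
        assume E: "E \<subseteq> P"
        show "A \<subseteq> P \<or> B \<subseteq> P"
        proof (rule ccontr)
          assume "\<not> (A \<subseteq> P \<or> B \<subseteq> P)"
          then obtain a b where ab: "a \<in> A" "a \<notin> P" "b \<in> B" "b \<notin> P" by blast
          then have "a \<otimes>\<^bsub>R\<^esub> b \<in> P" using E by (auto simp: E_def)
          then show False using P.I_prime[of a b] ab A B by blast
        qed
      next
        assume "A \<subseteq> P \<or> B \<subseteq> P"
        then show "E \<subseteq> P"
        proof
          assume "A \<subseteq> P"
          then show ?thesis using B P.I_r_closed by (auto simp: E_def subset_iff)
        next
          assume "B \<subseteq> P"
          then show ?thesis using A P.I_l_closed by (auto simp: E_def subset_iff)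
        qed
      qed
    qed
    then have "S \<inter> S' = Spec R - zero_locus R E"
      unfolding A(2) B(2) zero_locus_def by blast
    ultimately show ?thesis by blast
  qed
  have un: "?open (\<Union>\<K>)" if K: "\<forall>S\<in>\<K>. ?open S" for \<K>
  proof (intro exI conjI)
    let ?E = "\<Union>{E. E \<subseteq> carrier R \<and> Spec R - zero_locus R E \<in> \<K>}"
    show "?E \<subseteq> carrier R" by blast
    show "\<Union>\<K> = Spec R - zero_locus R ?E"
    proof (intro equalityI subsetI)
      fix P assume "P \<in> \<Union>\<K>"
      then obtain S where S: "S \<in> \<K>" "P \<in> S" by blast
      from bspec[OF K S(1)] obtain E where E: "E \<subseteq> carrier R" "S = Spec R - zero_locus R E" by blast
      then show "P \<in> Spec R - zero_locus R ?E"
        using S unfolding zero_locus_def by blast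
    next
      fix P assume "P \<in> Spec R - zero_locus R ?E"
      then show "P \<in> \<Union>\<K>" unfolding zero_locus_def by blast
    qed
  qed
  show ?thesis
    unfolding istopology_def
  proof (rule conjI)
    show "\<forall>S S'. ?open S \<longrightarrow> ?open S' \<longrightarrow> ?open (S \<inter> S')"
      by (intro allI impI) (rule int)
    show "\<forall>\<K>. (\<forall>S\<in>\<K>. ?open S) \<longrightarrow> ?open (\<Union>\<K>)"
      by (intro allI impI) (rule un)
  qed
qed

text \<open>
  Sections over \<open>U\<close> are families of elements of the local rings \<open>R\<^sub>P\<close>, \<open>P \<in> U\<close>, which are
  locally given by a single fraction.
\<close>

definition spec_sections :: "('a, 'm) ring_scheme \<Rightarrow> 'a set set \<Rightarrow> ('a set \<Rightarrow> ('a \<times> 'a) set) set" where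
  "spec_sections R U = {s \<in> (\<Pi>\<^sub>E P\<in>U. carrier (local_ring_at R P)).
     \<forall>P \<in> U. \<exists>V a f. openin (zariski R) V \<and> P \<in> V \<and> V \<subseteq> U \<and> a \<in> carrier R \<and> f \<in> carrier R \<and>
        (\<forall>Q \<in> V. f \<notin> Q \<and> s Q = fraction R Q a f)}"

definition affine_scheme :: "('a, 'm) ring_scheme \<Rightarrow> ('a set, 'a set \<Rightarrow> ('a \<times> 'a) set) ringed_space" where
  "affine_scheme R = \<lparr>
     points = zariski R,
     sections = (\<lambda>U. \<lparr>
       carrier = spec_sections R U,
       monoid.mult = (\<lambda>s t. \<lambda>P\<in>U. s P \<otimes>\<^bsub>local_ring_at R P\<^esub> t P),
       one = (\<lambda>P\<in>U. \<one>\<^bsub>local_ring_at R P\<^esub>),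
       ring.zero = (\<lambda>P\<in>U. \<zero>\<^bsub>local_ring_at R P\<^esub>),
       add = (\<lambda>s t. \<lambda>P\<in>U. s P \<oplus>\<^bsub>local_ring_at R P\<^esub> t P) \<rparr>),
     res = (\<lambda>U V s. restrict s V) \<rparr>"

definition global_section :: "('a, 'm) ring_scheme \<Rightarrow> 'a \<Rightarrow> 'a set \<Rightarrow> ('a \<times> 'a) set" where
  "global_section R a = (\<lambda>P\<in>Spec R. fraction R P a \<one>\<^bsub>R\<^esub>)"

text \<open>The morphism \<open>Spec S \<rightarrow> Spec R\<close> induced by a ring homomorphism \<open>h : R \<rightarrow> S\<close>.\<close>

definition spec_map :: "('a, 'm) ring_scheme \<Rightarrow> ('a \<Rightarrow> 'b) \<Rightarrow> 'b set \<Rightarrow> 'a set" where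
  "spec_map R h Q = {a \<in> carrier R. h a \<in> Q}"

definition spec_comap ::
  "('a, 'm) ring_scheme \<Rightarrow> ('b, 'n) ring_scheme \<Rightarrow> ('a \<Rightarrow> 'b) \<Rightarrow> 'a set set \<Rightarrow>
     ('a set \<Rightarrow> ('a \<times> 'a) set) \<Rightarrow> ('b set \<Rightarrow> ('b \<times> 'b) set)" where
  "spec_comap R S h V s =
     (\<lambda>Q\<in>{Q \<in> Spec S. spec_map R h Q \<in> V}. local_ring_map S h Q (s (spec_map R h Q)))"


section \<open>Properties of schemes and valuations of divisors\<close>

text \<open>
  A space is covered by finitely many spectra of noetherian rings. Since an affine open \<open>U\<close> is the
  spectrum of its ring of sections, it is no restriction that these rings have the type of sections.
\<close>

definition noetherian_scheme :: "('p, 's) ringed_space \<Rightarrow> bool" where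
  "noetherian_scheme \<XX> \<longleftrightarrow>
     (\<exists>\<U>. finite \<U> \<and> (\<forall>U\<in>\<U>. openin (points \<XX>) U) \<and> \<Union>\<U> = topspace (points \<XX>) \<and>
        (\<forall>U\<in>\<U>. \<exists>(R :: 's ring) f fs. cring R \<and> noetherian_ring R \<and>
           lrs_iso (open_subspace \<XX> U) (affine_scheme R) f fs))"

definition normal_scheme :: "('p, 's) ringed_space \<Rightarrow> bool" where
  "normal_scheme \<XX> \<longleftrightarrow> (\<forall>x \<in> topspace (points \<XX>). integrally_closed_domain (stalk \<XX> x))"

definition integral_scheme :: "('p, 's) ringed_space \<Rightarrow> bool" where
  "integral_scheme \<XX> \<longleftrightarrow> topspace (points \<XX>) \<noteq> {} \<and>
     (\<forall>U. openin (points \<XX>) U \<and> U \<noteq> {} \<longrightarrow> domain (sections \<XX> U))"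

definition irreducible_in :: "'p topology \<Rightarrow> 'p set \<Rightarrow> bool" where
  "irreducible_in T Z \<longleftrightarrow> Z \<subseteq> topspace T \<and> Z \<noteq> {} \<and>
     (\<forall>F G. closedin T F \<and> closedin T G \<and> Z \<subseteq> F \<union> G \<longrightarrow> Z \<subseteq> F \<or> Z \<subseteq> G)"

definition irreducible_closed :: "'p topology \<Rightarrow> 'p set \<Rightarrow> bool" where
  "irreducible_closed T Z \<longleftrightarrow> closedin T Z \<and> irreducible_in T Z"

text \<open>Irreducible closed subsets of codimension one.\<close>

definition prime_divisor :: "('p, 's) ringed_space \<Rightarrow> 'p set \<Rightarrow> bool" where
  "prime_divisor \<XX> Z \<longleftrightarrow> irreducible_closed (points \<XX>) Z \<and>
     (\<exists>W. irreducible_closed (points \<XX>) W \<and> Z \<subset> W) \<and>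
     \<not> (\<exists>W W'. irreducible_closed (points \<XX>) W \<and> irreducible_closed (points \<XX>) W' \<and> Z \<subset> W \<and> W \<subset> W')"

definition generic_point :: "('p, 's) ringed_space \<Rightarrow> 'p set \<Rightarrow> 'p" where
  "generic_point \<XX> Z = (THE x. x \<in> topspace (points \<XX>) \<and> points \<XX> closure_of {x} = Z)"

definition function_field :: "('p, 's) ringed_space \<Rightarrow> ('p set \<times> 's) set ring" where
  "function_field \<XX> = stalk \<XX> (generic_point \<XX> (topspace (points \<XX>)))"

definition rational_function :: "('p, 's) ringed_space \<Rightarrow> 'p set \<Rightarrow> 's \<Rightarrow> ('p set \<times> 's) set" where
  "rational_function \<XX> U s = germ \<XX> (generic_point \<XX> (topspace (points \<XX>))) U s"

text \<open>Normalized discrete valuations, with values in \<open>\<int> \<union> {\<infinity>}\<close>.\<close>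

definition discrete_valuation :: "('a, 'm) ring_scheme \<Rightarrow> ('a \<Rightarrow> int extended) \<Rightarrow> bool" where
  "discrete_valuation F v \<longleftrightarrow> field F \<and>
     (\<forall>z \<in> carrier F. v z \<noteq> Minf \<and> (v z = Pinf \<longleftrightarrow> z = \<zero>\<^bsub>F\<^esub>)) \<and>
     (\<forall>z \<in> carrier F. \<forall>w \<in> carrier F. v (z \<otimes>\<^bsub>F\<^esub> w) = v z + v w) \<and>
     (\<forall>z \<in> carrier F. \<forall>w \<in> carrier F. min (v z) (v w) \<le> v (z \<oplus>\<^bsub>F\<^esub> w)) \<and>
     (\<exists>z \<in> carrier F. v z = 1)"

text \<open>
  The valuation of the function field associated with a prime divisor \<open>Z\<close> is the normalized discrete
  valuation whose valuation ring is the local ring of \<open>\<XX>\<close> at the generic point of \<open>Z\<close>.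
\<close>

definition divisor_valuation ::
  "('p, 's) ringed_space \<Rightarrow> 'p set \<Rightarrow> (('p set \<times> 's) set \<Rightarrow> int extended) \<Rightarrow> bool" where
  "divisor_valuation \<XX> Z v \<longleftrightarrow> prime_divisor \<XX> Z \<and> discrete_valuation (function_field \<XX>) v \<and>
     {z \<in> carrier (function_field \<XX>). 0 \<le> v z} =
     {rational_function \<XX> U s | U s.
        openin (points \<XX>) U \<and> generic_point \<XX> Z \<in> U \<and> s \<in> carrier (sections \<XX> U)}"


section \<open>Tensor products of algebras\<close>

text \<open>
  \<open>pre_tensor R S\<close> is the monoid ring over \<open>\<int>\<close> of the multiplicative monoid of pairs. Its quotient
  by the bilinearity relations is the tensor product of \<open>R\<close> and \<open>S\<close> over the ring of scalars \<open>'c\<close>,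
  which acts through \<open>i : 'c \<rightarrow> R\<close> and \<open>j : 'c \<rightarrow> S\<close>.
\<close>

definition pre_tensor :: "('a, 'm) ring_scheme \<Rightarrow> ('b, 'n) ring_scheme \<Rightarrow> ('a \<times> 'b \<Rightarrow>\<^sub>0 int) ring" where
  "pre_tensor R S = \<lparr>
     carrier = {u. Poly_Mapping.keys u \<subseteq> carrier R \<times> carrier S},
     monoid.mult = (\<lambda>u v. frag_extend (\<lambda>(a, b).
        frag_extend (\<lambda>(a', b'). frag_of (a \<otimes>\<^bsub>R\<^esub> a', b \<otimes>\<^bsub>S\<^esub> b')) v) u),
     one = frag_of (\<one>\<^bsub>R\<^esub>, \<one>\<^bsub>S\<^esub>),
     ring.zero = 0,
     add = (+) \<rparr>"

definition tensor_ideal ::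
  "('c \<Rightarrow> 'a) \<Rightarrow> ('c \<Rightarrow> 'b) \<Rightarrow> ('a, 'm) ring_scheme \<Rightarrow> ('b, 'n) ring_scheme \<Rightarrow> ('a \<times> 'b \<Rightarrow>\<^sub>0 int) set" where
  "tensor_ideal i j R S = genideal (pre_tensor R S)
     ({frag_of (a \<oplus>\<^bsub>R\<^esub> a', b) - frag_of (a, b) - frag_of (a', b) | a a' b.
         a \<in> carrier R \<and> a' \<in> carrier R \<and> b \<in> carrier S} \<union>
      {frag_of (a, b \<oplus>\<^bsub>S\<^esub> b') - frag_of (a, b) - frag_of (a, b') | a b b'.
         a \<in> carrier R \<and> b \<in> carrier S \<and> b' \<in> carrier S} \<union>
      {frag_of (i c \<otimes>\<^bsub>R\<^esub> a, b) - frag_of (a, j c \<otimes>\<^bsub>S\<^esub> b) | a b c.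
         a \<in> carrier R \<and> b \<in> carrier S})"

definition tensor ::
  "('c \<Rightarrow> 'a) \<Rightarrow> ('c \<Rightarrow> 'b) \<Rightarrow> ('a, 'm) ring_scheme \<Rightarrow> ('b, 'n) ring_scheme \<Rightarrow> ('a \<times> 'b \<Rightarrow>\<^sub>0 int) set ring" where
  "tensor i j R S = pre_tensor R S Quot tensor_ideal i j R S"

definition pure_tensor ::
  "('c \<Rightarrow> 'a) \<Rightarrow> ('c \<Rightarrow> 'b) \<Rightarrow> ('a, 'm) ring_scheme \<Rightarrow> ('b, 'n) ring_scheme \<Rightarrow>
     'a \<Rightarrow> 'b \<Rightarrow> ('a \<times> 'b \<Rightarrow>\<^sub>0 int) set" where
  "pure_tensor i j R S a b = tensor_ideal i j R S +>\<^bsub>pre_tensor R S\<^esub> frag_of (a, b)"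


section \<open>Subalgebras of a field extension of \<open>\<complex>\<close>\<close>

text \<open>
  All algebras live in a field \<open>'l\<close> which is an extension of \<open>\<complex>\<close> via \<open>\<iota> :: complex \<Rightarrow> 'l\<close>.
\<close>

abbreviation ambient :: "'l::field ring" where
  "ambient \<equiv> ring_of_type_algebra"

definition sub_ring :: "'l::field set \<Rightarrow> 'l ring" where
  "sub_ring A = ambient\<lparr>carrier := A\<rparr>"

definition gen_algebra :: "(complex \<Rightarrow> 'l::field) \<Rightarrow> 'l set \<Rightarrow> 'l set" where
  "gen_algebra \<iota> S = generate_ring ambient (range \<iota> \<union> S)"

definition finitely_generated_algebra :: "(complex \<Rightarrow> 'l::field) \<Rightarrow> 'l set \<Rightarrow> bool" where
  "finitely_generated_algebra \<iota> A \<longleftrightarrow> (\<exists>S. finite S \<and> S \<subseteq> A \<and> A = gen_algebra \<iota> S)"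

text \<open>Polynomials are finitely supported functions on exponent vectors \<open>'v \<Rightarrow>\<^sub>0 nat\<close>.\<close>

definition algebraically_independent :: "'l::field set \<Rightarrow> 'v set \<Rightarrow> ('v \<Rightarrow> 'l) \<Rightarrow> bool" where
  "algebraically_independent F I x \<longleftrightarrow>
     (\<forall>p :: ('v \<Rightarrow>\<^sub>0 nat) \<Rightarrow>\<^sub>0 'l.
        (\<forall>m \<in> Poly_Mapping.keys p. Poly_Mapping.keys m \<subseteq> I \<and> Poly_Mapping.lookup p m \<in> F) \<and>
        (\<Sum>m\<in>Poly_Mapping.keys p. Poly_Mapping.lookup p m *
           (\<Prod>i\<in>Poly_Mapping.keys m. x i ^ Poly_Mapping.lookup m i)) = 0
        \<longrightarrow> p = 0)"

definition transcendence_basis :: "(complex \<Rightarrow> 'l::field) \<Rightarrow> 'l set \<Rightarrow> 'v set \<Rightarrow> ('v \<Rightarrow> 'l) \<Rightarrow> bool" where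
  "transcendence_basis \<iota> K I x \<longleftrightarrow> x ` I \<subseteq> K \<and> algebraically_independent (range \<iota>) I x \<and>
     (\<forall>z \<in> K. \<not> ring.transcendental ambient (generate_field ambient (range \<iota> \<union> x ` I)) z)"


section \<open>Seeds and upper cluster algebras\<close>

record ('v, 'l) seed =
  uf :: "'v set"
  sf :: "'v set"
  hf :: "'v set"
  exm :: "'v \<Rightarrow> 'v \<Rightarrow> int"
  clv :: "'v \<Rightarrow> 'l"

definition vertices :: "('v, 'l) seed \<Rightarrow> 'v set" where
  "vertices t = uf t \<union> sf t \<union> hf t"

text \<open>
  The exchange matrix \<open>exm t\<close> is only meaningful on \<open>vertices t \<times> uf t\<close>, and the cluster
  \<open>clv t\<close> on \<open>vertices t\<close>.
\<close>

definition is_seed :: "(complex \<Rightarrow> 'l::field) \<Rightarrow> 'l set \<Rightarrow> ('v, 'l) seed \<Rightarrow> bool" where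
  "is_seed \<iota> K t \<longleftrightarrow>
     finite (uf t) \<and> finite (sf t) \<and> finite (hf t) \<and>
     uf t \<inter> sf t = {} \<and> uf t \<inter> hf t = {} \<and> sf t \<inter> hf t = {} \<and>
     (\<exists>s :: 'v \<Rightarrow> int. (\<forall>i \<in> uf t. s i > 0) \<and>
        (\<forall>i \<in> uf t. \<forall>j \<in> uf t. s i * exm t i j = - (s j * exm t j i))) \<and>
     (\<forall>i \<in> vertices t. clv t i \<noteq> 0) \<and>
     transcendence_basis \<iota> K (vertices t) (clv t)"

definition pos_part :: "int \<Rightarrow> int" where "pos_part b = max b 0"
definition neg_part :: "int \<Rightarrow> int" where "neg_part b = max (- b) 0"

definition mutate :: "'v \<Rightarrow> ('v, 'l::field) seed \<Rightarrow> ('v, 'l) seed" where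
  "mutate k t = t\<lparr>
     exm := (\<lambda>i j. if i = k \<or> j = k then - exm t i j
        else exm t i j + pos_part (exm t i k) * pos_part (exm t k j)
                       - neg_part (exm t i k) * neg_part (exm t k j)),
     clv := (clv t)(k := inverse (clv t k) *
        ((\<Prod>i\<in>vertices t. clv t i powi pos_part (exm t i k)) +
         (\<Prod>i\<in>vertices t. clv t i powi neg_part (exm t i k)))) \<rparr>"

inductive mutation_equivalent :: "('v, 'l::field) seed \<Rightarrow> ('v, 'l) seed \<Rightarrow> bool" for t where
  refl: "mutation_equivalent t t"
| step: "mutation_equivalent t t' \<Longrightarrow> k \<in> uf t' \<Longrightarrow> mutation_equivalent t (mutate k t')"

definition seed_laurent :: "(complex \<Rightarrow> 'l::field) \<Rightarrow> ('v, 'l) seed \<Rightarrow> 'l set" where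
  "seed_laurent \<iota> t = gen_algebra \<iota>
     (clv t ` vertices t \<union> (\<lambda>i. inverse (clv t i)) ` (sf t \<union> uf t))"

definition upper_cluster_algebra :: "(complex \<Rightarrow> 'l::field) \<Rightarrow> ('v, 'l) seed \<Rightarrow> 'l set" where
  "upper_cluster_algebra \<iota> t = (\<Inter>t' \<in> {t'. mutation_equivalent t t'}. seed_laurent \<iota> t')"

definition columns_independent :: "'v set \<Rightarrow> 'v set \<Rightarrow> ('v \<Rightarrow> 'v \<Rightarrow> int) \<Rightarrow> bool" where
  "columns_independent I J B \<longleftrightarrow>
     (\<forall>c :: 'v \<Rightarrow> rat. (\<forall>i \<in> I. (\<Sum>j\<in>J. c j * of_int (B i j)) = 0) \<longrightarrow> (\<forall>j \<in> J. c j = 0))"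

definition matrix_rank :: "'v set \<Rightarrow> 'v set \<Rightarrow> ('v \<Rightarrow> 'v \<Rightarrow> int) \<Rightarrow> nat" where
  "matrix_rank I J B = Max {card S | S. S \<subseteq> J \<and> columns_independent I S B}"

definition maximal_rank :: "('v, 'l) seed \<Rightarrow> bool" where
  "maximal_rank t \<longleftrightarrow>
     matrix_rank (vertices t) (uf t) (exm t) = min (card (vertices t)) (card (uf t))"


section \<open>Monomial liftings\<close>

definition lift_seed :: "'v set \<Rightarrow> ('v \<Rightarrow> 'l) \<Rightarrow> ('v \<Rightarrow> 'v \<Rightarrow> int) \<Rightarrow> ('v, 'l::field) seed \<Rightarrow> ('v, 'l) seed" where
  "lift_seed D x \<nu> t = \<lparr>
     uf = uf t, sf = sf t \<union> D, hf = hf t,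
     exm = (\<lambda>r j. if r \<in> D then - (\<Sum>i\<in>vertices t. \<nu> r i * exm t i j) else exm t r j),
     clv = (\<lambda>r. if r \<in> D then x r else clv t r * (\<Prod>d\<in>D. x d powi \<nu> d r)) \<rparr>"

definition lift_seed_hf :: "'v set \<Rightarrow> ('v \<Rightarrow> 'l) \<Rightarrow> ('v \<Rightarrow> 'v \<Rightarrow> int) \<Rightarrow> ('v, 'l::field) seed \<Rightarrow> ('v, 'l) seed" where
  "lift_seed_hf D x \<nu> t = (lift_seed D x \<nu> t)\<lparr>sf := sf t, hf := hf t \<union> D\<rparr>"

definition torus_ring :: "(complex \<Rightarrow> 'l::field) \<Rightarrow> 'v set \<Rightarrow> ('v \<Rightarrow> 'l) \<Rightarrow> 'l ring" where
  "torus_ring \<iota> D x = sub_ring (gen_algebra \<iota> (x ` D \<union> (\<lambda>d. inverse (x d)) ` D))"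

text \<open>
  The identification of the upper cluster algebra of \<open>\<up>t\<close>, which is \<open>\<A>(t)[x\<^sub>d\<^sup>\<plusminus>\<^sup>1]\<close>, with
  \<open>\<complex>[x\<^sub>d\<^sup>\<plusminus>\<^sup>1] \<otimes> \<A>(t)\<close>: the product of \<open>p\<close> and \<open>a\<close> in the ambient field goes to \<open>p \<otimes> a\<close>. As
  \<open>\<up>x\<^sub>i = (\<Prod>d. x\<^sub>d powi \<nu>\<^sub>d\<^sub>i) * x\<^sub>i\<close>, it sends \<open>\<up>x\<^sub>i\<close> to
  \<open>(\<Prod>d. x\<^sub>d powi \<nu>\<^sub>d\<^sub>i) \<otimes> x\<^sub>i\<close> and \<open>\<up>x\<^sub>d\<close> to \<open>x\<^sub>d \<otimes> 1\<close>.
\<close>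

definition lifting_identification ::
  "(complex \<Rightarrow> 'l::field) \<Rightarrow> 'v set \<Rightarrow> ('v \<Rightarrow> 'l) \<Rightarrow> ('v \<Rightarrow> 'v \<Rightarrow> int) \<Rightarrow> ('v, 'l) seed \<Rightarrow>
     ('l \<Rightarrow> ('l \<times> 'l \<Rightarrow>\<^sub>0 int) set) \<Rightarrow> bool" where
  "lifting_identification \<iota> D x \<nu> t h \<longleftrightarrow>
     (let P = torus_ring \<iota> D x; Q = sub_ring (upper_cluster_algebra \<iota> t) in
      h \<in> ring_iso (sub_ring (upper_cluster_algebra \<iota> (lift_seed D x \<nu> t))) (tensor \<iota> \<iota> P Q) \<and>
      (\<forall>p \<in> carrier P. \<forall>a \<in> carrier Q. h (p * a) = pure_tensor \<iota> \<iota> P Q p a))"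

text \<open>
  Characters of the torus \<open>Spec \<complex>[x\<^sub>d\<^sup>\<plusminus>\<^sup>1]\<close>: a morphism to \<open>\<G>\<^sub>m\<close> is an invertible function \<open>u\<close>,
  and it is a homomorphism of group schemes iff \<open>\<Delta> u = u \<otimes> u\<close>, where the comultiplication \<open>\<Delta>\<close>
  is determined by \<open>\<Delta> x\<^sub>d = x\<^sub>d \<otimes> x\<^sub>d\<close>.
\<close>

definition torus_comultiplication ::
  "(complex \<Rightarrow> 'l::field) \<Rightarrow> 'v set \<Rightarrow> ('v \<Rightarrow> 'l) \<Rightarrow> ('l \<Rightarrow> ('l \<times> 'l \<Rightarrow>\<^sub>0 int) set) \<Rightarrow> bool" where
  "torus_comultiplication \<iota> D x \<Delta> \<longleftrightarrow>
     (let P = torus_ring \<iota> D x in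
      \<Delta> \<in> ring_hom P (tensor \<iota> \<iota> P P) \<and>
      (\<forall>c. \<Delta> (\<iota> c) = pure_tensor \<iota> \<iota> P P (\<iota> c) 1) \<and>
      (\<forall>d \<in> D. \<Delta> (x d) = pure_tensor \<iota> \<iota> P P (x d) (x d)))"

definition torus_characters :: "(complex \<Rightarrow> 'l::field) \<Rightarrow> 'v set \<Rightarrow> ('v \<Rightarrow> 'l) \<Rightarrow> 'l monoid" where
  "torus_characters \<iota> D x =
     (let P = torus_ring \<iota> D x in
      \<lparr> carrier = {u \<in> Units P. \<exists>\<Delta>. torus_comultiplication \<iota> D x \<Delta> \<and>
                                    \<Delta> u = pure_tensor \<iota> \<iota> P P u u},
        monoid.mult = (*), one = 1 \<rparr>)"

definition abelian_group_basis :: "('a, 'm) monoid_scheme \<Rightarrow> 'v set \<Rightarrow> ('v \<Rightarrow> 'a) \<Rightarrow> bool" where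
  "abelian_group_basis G D x \<longleftrightarrow> comm_group G \<and> x ` D \<subseteq> carrier G \<and>
     bij_betw (\<lambda>n. \<Otimes>\<^bsub>G\<^esub>d\<in>D. x d [^]\<^bsub>G\<^esub> n d) (D \<rightarrow>\<^sub>E (UNIV :: int set)) (carrier G)"

end

theory Submission
  imports Defs
begin

text \<open>
  All rings of the theorem are integral domains with an injection into the ambient field. For such
  a ring \<open>R\<close>, with fractions evaluated in the field, the local ring at a prime is a subring
  (\<open>loc\<close>), the sections over an open set form the intersection of the local rings of its points
  (\<open>spec_sections_eq\<close>), the stalks are the local rings again (\<open>stalk_carrier\<close>), and the map on
  sections induced by an injective homomorphism leaves the value in the field unchanged
  (\<open>comap_sec\<close>). This turns every statement on schemes into one on subrings of a field, and the
  spectrum of a localization at \<open>f\<close> becomes isomorphic to the complement of the zero locus of \<open>f\<close>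
  (\<open>localization.iso\<close>).

  Normality comes from a property that is inherited by intersections: \<open>z\<close> lies in \<open>A\<close> as soon as all
  \<open>c * z ^ n\<close> do, for some \<open>c \<noteq> 0\<close>. It holds for fields, passes from \<open>A\<close> to \<open>A[a]\<close> and
  \<open>A[a, 1 / a]\<close> for \<open>a\<close> transcendental over \<open>A\<close>, hence holds for the Laurent rings of all seeds and for
  the upper cluster algebra, their intersection (\<open>UU_completely_closed\<close>); and it implies integral
  closedness. A finitely generated algebra is noetherian by the basis theorem (\<open>noeth_generated\<close>).

  The divisors rest on one observation about a highly-frozen vertex \<open>d\<close>. In each Laurent ring
  \<open>x\<^sub>d\<close> is a polynomial variable, so it is prime, and since the two monomials of an exchange binomial
  have no common factor, \<open>x\<^sub>d\<close> does not divide the binomial. Adjacent Laurent rings become equal when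
  the binomial is inverted, so if \<open>z\<close> lies in one of them and \<open>x\<^sub>d\<^sup>m z\<close> in the next, then \<open>z\<close> lies in the
  next (\<open>remove_frozen_denominator\<close>). Consequently divisibility by \<open>x\<^sub>d\<close> in the upper cluster
  algebra can be tested in a single Laurent ring, which makes \<open>x\<^sub>d\<close> a prime element with finite
  multiplicities (\<open>frozen_prime\<close>). The local ring at the ideal of such an element is a discrete
  valuation ring, and every normalized valuation with that valuation ring takes the value one at
  \<open>x\<^sub>d\<close> and zero at the elements that are not multiples of \<open>x\<^sub>d\<close>, such as the other frozen variables
  (\<open>divisor_valuation_values\<close>).

  The same observation shows that inverting frozen variables commutes with forming the upper cluster
  algebra (\<open>UU_unfreeze\<close>). Moreover mutating a lifting gives a lifting of the mutated seed
  (\<open>mutate_lift\<close>), and coefficients of Laurent polynomials in the independent \<open>x\<^sub>d\<close> are unique, so the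
  upper cluster algebra of \<open>\<up>t\<close> is the ring of Laurent polynomials in the \<open>x\<^sub>d\<close> over that of \<open>t\<close>
  (\<open>UU_lift\<close>). Multiplication identifies it with the tensor product, because a tensor has a normal form
  \<open>\<Sum>m. x\<^sup>m \<otimes> c m\<close> whose coefficients can be read off from the product
  (\<open>laurent_tensor.theta_iso\<close>). Together this exhibits the tensor product as the localization at
  \<open>\<Prod>d. x\<^sub>d\<close>, whence the open embedding. Finally, a character is a grouplike element of the Laurent
  ring, and these are exactly the monomials (\<open>grouplike_monomial\<close>).
\<close>


section \<open>Rings embedded in a field\<close>

lemma ambient_simps [simp]:
  "carrier (ambient :: 'l::field ring) = UNIV"
  "\<one>\<^bsub>(ambient :: 'l ring)\<^esub> = 1" "\<zero>\<^bsub>(ambient :: 'l ring)\<^esub> = 0"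
  "x \<otimes>\<^bsub>(ambient :: 'l ring)\<^esub> y = x * y" "x \<oplus>\<^bsub>(ambient :: 'l ring)\<^esub> y = x + y"
  by (simp_all add: ring_of_type_algebra_def)

lemma sub_ring_simps [simp]:
  "carrier (sub_ring (A :: 'l::field set)) = A"
  "\<one>\<^bsub>sub_ring A\<^esub> = 1" "\<zero>\<^bsub>sub_ring A\<^esub> = 0"
  "x \<otimes>\<^bsub>sub_ring A\<^esub> y = x * y" "x \<oplus>\<^bsub>sub_ring A\<^esub> y = x + y"
  by (simp_all add: sub_ring_def)

lemma cring_ambient: "cring (ambient :: 'l::field ring)"
  by (rule cring_from_type_algebra)

lemma ambient_a_inv [simp]: "\<ominus>\<^bsub>(ambient :: 'l::field ring)\<^esub> x = - x"
proof -
  interpret cring "ambient :: 'l ring" by (rule cring_ambient)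
  show ?thesis by (rule minus_equality) auto
qed

text \<open>
  The operations of local rings and stalks are unions over representatives; this evaluates them.
\<close>

lemma UN2_const:
  assumes "\<exists>p. p \<in> A" "\<exists>q. q \<in> B" "\<And>p q. p \<in> A \<Longrightarrow> q \<in> B \<Longrightarrow> F p q = Y"
  shows "(\<Union>p\<in>A. \<Union>q\<in>B. F p q) = Y"
proof -
  have "(\<Union>p\<in>A. \<Union>q\<in>B. F p q) = (\<Union>p\<in>A. \<Union>q\<in>B. Y)" using assms(3) by simp
  then show ?thesis using assms(1,2) by auto
qed

definition subring_set :: "'l::field set \<Rightarrow> bool" where
  "subring_set A \<longleftrightarrow> 1 \<in> A \<and> (\<forall>x\<in>A. \<forall>y\<in>A. x - y \<in> A \<and> x * y \<in> A)"

lemma subring_setD: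
  assumes "subring_set A"
  shows "1 \<in> A" "0 \<in> A" "x \<in> A \<Longrightarrow> - x \<in> A" "x \<in> A \<Longrightarrow> y \<in> A \<Longrightarrow> x + y \<in> A"
    "x \<in> A \<Longrightarrow> y \<in> A \<Longrightarrow> x - y \<in> A" "x \<in> A \<Longrightarrow> y \<in> A \<Longrightarrow> x * y \<in> A"
proof -
  show 1: "1 \<in> A" using assms by (auto simp: subring_set_def)
  show d: "x - y \<in> A" if "x \<in> A" "y \<in> A" for x y
    using assms that by (auto simp: subring_set_def)
  show "x * y \<in> A" if "x \<in> A" "y \<in> A" using assms that by (auto simp: subring_set_def)
  show 0: "0 \<in> A" using d[OF 1 1] by simp
  show m: "- x \<in> A" if "x \<in> A" for x using d[OF 0 that] by simp
  show "x + y \<in> A" if "x \<in> A" "y \<in> A" using d[OF that(1) m[OF that(2)]] by simp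
qed

lemma subring_set_power: "subring_set A \<Longrightarrow> x \<in> A \<Longrightarrow> x ^ n \<in> A"
  by (induction n) (auto intro: subring_setD)

lemma subring_set_sum: "subring_set A \<Longrightarrow> (\<And>i. i \<in> I \<Longrightarrow> f i \<in> A) \<Longrightarrow> sum f I \<in> A"
  by (induction I rule: infinite_finite_induct) (auto intro: subring_setD)

lemma subring_set_prod: "subring_set A \<Longrightarrow> (\<And>i. i \<in> I \<Longrightarrow> f i \<in> A) \<Longrightarrow> prod f I \<in> A"
  by (induction I rule: infinite_finite_induct) (auto intro: subring_setD)

text \<open>Inverting an element inside the field: the fractions whose denominator is a power of \<open>y\<close>.\<close>

lemma fractions_subring:
  assumes A: "subring_set A" and y: "y \<in> A"
  shows "subring_set {z. \<exists>n. y ^ n * z \<in> A}" "A \<subseteq> {z. \<exists>n. y ^ n * z \<in> A}"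
proof -
  note AD = subring_setD[OF A]
  have yn: "y ^ n \<in> A" for n by (rule subring_set_power[OF A y])
  show sub: "A \<subseteq> {z. \<exists>n. y ^ n * z \<in> A}" by (auto intro: exI[of _ 0])
  show "subring_set {z. \<exists>n. y ^ n * z \<in> A}"
    unfolding subring_set_def
  proof (intro conjI ballI)
    show "1 \<in> {z. \<exists>n. y ^ n * z \<in> A}" using sub AD(1) by blast
    fix u v assume "u \<in> {z. \<exists>n. y ^ n * z \<in> A}" "v \<in> {z. \<exists>n. y ^ n * z \<in> A}"
    then obtain m n where mn: "y ^ m * u \<in> A" "y ^ n * v \<in> A" by blast
    have "y ^ (m + n) * (u - v) = y ^ n * (y ^ m * u) - y ^ m * (y ^ n * v)"
      by (simp add: power_add algebra_simps)
    also have "\<dots> \<in> A" by (rule AD(5)[OF AD(6)[OF yn mn(1)] AD(6)[OF yn mn(2)]])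
    finally show "u - v \<in> {z. \<exists>n. y ^ n * z \<in> A}" by blast
    have "y ^ (m + n) * (u * v) = (y ^ m * u) * (y ^ n * v)" by (simp add: power_add algebra_simps)
    also have "\<dots> \<in> A" by (rule AD(6)[OF mn])
    finally show "u * v \<in> {z. \<exists>n. y ^ n * z \<in> A}" by blast
  qed
qed
lemma cring_sub_ring: "subring_set A \<Longrightarrow> cring (sub_ring A)"
  apply (rule cringI)
    apply (rule abelian_groupI)
         apply (auto simp: algebra_simps intro: subring_setD)[6]
  subgoal for x by (rule bexI[of _ "- x"]) (auto intro: subring_setD)
  apply (rule comm_monoidI)
  by (auto simp: algebra_simps intro: subring_setD)

text \<open>
  For records of operations that are known only through a surjection from a ring, as for local
  rings, rings of sections and stalks.
\<close>

lemma cring_transport: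
  assumes "cring R" and im: "f ` carrier R = carrier S"
    and mult: "\<And>x y. x \<in> carrier R \<Longrightarrow> y \<in> carrier R \<Longrightarrow> f x \<otimes>\<^bsub>S\<^esub> f y = f (x \<otimes>\<^bsub>R\<^esub> y)"
    and add: "\<And>x y. x \<in> carrier R \<Longrightarrow> y \<in> carrier R \<Longrightarrow> f x \<oplus>\<^bsub>S\<^esub> f y = f (x \<oplus>\<^bsub>R\<^esub> y)"
    and one: "\<one>\<^bsub>S\<^esub> = f \<one>\<^bsub>R\<^esub>" and zero: "\<zero>\<^bsub>S\<^esub> = f \<zero>\<^bsub>R\<^esub>"
  shows "cring S"
proof -
  interpret R: cring R by fact
  have ex: "\<exists>x'\<in>carrier R. x = f x'" if "x \<in> carrier S" for x using that im by blast
  have cl: "f x \<in> carrier S" if "x \<in> carrier R" for x using that im by blast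
  show ?thesis
  proof (rule cringI)
    show "abelian_group S"
    proof (rule abelian_groupI)
      fix x y z assume "x \<in> carrier S" "y \<in> carrier S" "z \<in> carrier S"
      then show "x \<oplus>\<^bsub>S\<^esub> y \<oplus>\<^bsub>S\<^esub> z = x \<oplus>\<^bsub>S\<^esub> (y \<oplus>\<^bsub>S\<^esub> z)"
        by (auto dest!: ex simp: add R.a_assoc)
    next
      fix x assume "x \<in> carrier S"
      then obtain x' where x': "x' \<in> carrier R" "x = f x'" using ex by blast
      show "\<exists>y\<in>carrier S. y \<oplus>\<^bsub>S\<^esub> x = \<zero>\<^bsub>S\<^esub>"
        by (rule bexI[of _ "f (\<ominus>\<^bsub>R\<^esub> x')"]) (use x' in \<open>auto simp: add zero R.l_neg cl\<close>)
    qed (auto dest!: ex simp: add zero cl R.a_comm)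
    show "comm_monoid S"
    proof (rule comm_monoidI)
      fix x y z assume "x \<in> carrier S" "y \<in> carrier S" "z \<in> carrier S"
      then show "x \<otimes>\<^bsub>S\<^esub> y \<otimes>\<^bsub>S\<^esub> z = x \<otimes>\<^bsub>S\<^esub> (y \<otimes>\<^bsub>S\<^esub> z)"
        by (auto dest!: ex simp: mult R.m_assoc)
    qed (auto dest!: ex simp: mult one cl R.m_comm)
    show "\<And>x y z. x \<in> carrier S \<Longrightarrow> y \<in> carrier S \<Longrightarrow> z \<in> carrier S \<Longrightarrow>
        (x \<oplus>\<^bsub>S\<^esub> y) \<otimes>\<^bsub>S\<^esub> z = x \<otimes>\<^bsub>S\<^esub> z \<oplus>\<^bsub>S\<^esub> y \<otimes>\<^bsub>S\<^esub> z"
      by (auto dest!: ex simp: mult add R.l_distr)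
  qed
qed

lemma openin_zariski:
  "cring R \<Longrightarrow> openin (zariski R) U \<longleftrightarrow> (\<exists>E \<subseteq> carrier R. U = Spec R - zero_locus R E)"
  unfolding zariski_def by (subst topology_inverse') (auto intro: istopology_zariski)

lemma topspace_zariski:
  assumes "cring R" shows "topspace (zariski R) = Spec R"
proof -
  interpret cring R by fact
  have "zero_locus R {\<one>\<^bsub>R\<^esub>} = {}"
    by (auto simp: zero_locus_def Spec_def dest: primeideal.I_notcarr
        ideal.one_imp_carrier[OF primeideal.axioms(1)])
  then have "openin (zariski R) (Spec R)"
    by (subst openin_zariski[OF assms]) (rule exI[of _ "{\<one>\<^bsub>R\<^esub>}"], auto)
  moreover have "U \<subseteq> Spec R" if "openin (zariski R) U" for U
    using that by (auto simp: openin_zariski[OF assms])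
  ultimately show ?thesis by (metis openin_subset openin_topspace subset_antisym)
qed

lemma basic_open:
  assumes "cring R" "f \<in> carrier R" shows "openin (zariski R) {P \<in> Spec R. f \<notin> P}"
  unfolding openin_zariski[OF assms(1)]
  by (rule exI[of _ "{f}"]) (use assms in \<open>auto simp: zero_locus_def\<close>)

lemma SpecD:
  assumes "P \<in> Spec R"
  shows "P \<subseteq> carrier R" "\<zero>\<^bsub>R\<^esub> \<in> P" "\<one>\<^bsub>R\<^esub> \<notin> P"
    "a \<in> carrier R \<Longrightarrow> b \<in> carrier R \<Longrightarrow> a \<otimes>\<^bsub>R\<^esub> b \<in> P \<longleftrightarrow> a \<in> P \<or> b \<in> P"
    "a \<in> P \<Longrightarrow> b \<in> P \<Longrightarrow> a \<oplus>\<^bsub>R\<^esub> b \<in> P"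
    "a \<in> P \<Longrightarrow> \<ominus>\<^bsub>R\<^esub> a \<in> P"
proof -
  interpret P: primeideal P R using assms by (simp add: Spec_def)
  show "P \<subseteq> carrier R" by (rule P.a_subset)
  show "\<zero>\<^bsub>R\<^esub> \<in> P" by simp
  show "\<one>\<^bsub>R\<^esub> \<notin> P" using P.one_imp_carrier P.I_notcarr by auto
  show "a \<otimes>\<^bsub>R\<^esub> b \<in> P \<longleftrightarrow> a \<in> P \<or> b \<in> P" if "a \<in> carrier R" "b \<in> carrier R"
    using P.I_prime[OF that] P.I_l_closed P.I_r_closed that by blast
  show "a \<oplus>\<^bsub>R\<^esub> b \<in> P" if "a \<in> P" "b \<in> P" using that by (rule additive_subgroup.a_closed[OF P.additive_subgroup_axioms])
  show "\<ominus>\<^bsub>R\<^esub> a \<in> P" if "a \<in> P" using that by (rule additive_subgroup.a_inv_closed[OF P.additive_subgroup_axioms])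
qed

lemma affine_simps [simp]:
  "points (affine_scheme R) = zariski R" "res (affine_scheme R) U V s = restrict s V"
  "carrier (sections (affine_scheme R) U) = spec_sections R U"
  by (simp_all add: affine_scheme_def)

lemma subspace_simps [simp]:
  "points (open_subspace \<XX> U0) = subtopology (points \<XX>) U0"
  "sections (open_subspace \<XX> U0) = sections \<XX>" "res (open_subspace \<XX> U0) = res \<XX>"
  by (simp_all add: open_subspace_def)

text \<open>
  For an integral domain inside a field every local ring is a subring of that field, all
  restriction maps are inclusions, and the structure sheaf becomes an intersection of subrings.
  Stating this for a ring with an injective homomorphism to a field, instead of for subsets of the
  field, makes it apply also to rings such as tensor products, whose elements are not elements
  of the field.
\<close>

locale embedded = R?: cring R for R (structure) +
  fixes \<phi> :: "'a \<Rightarrow> 'l::field"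
  assumes hom: "\<phi> \<in> ring_hom R ambient" and inj: "inj_on \<phi> (carrier R)"
begin

text \<open>
  The field-side counterparts of the scheme-theoretic objects: \<open>loc P\<close> is the local ring at \<open>P\<close>
  and \<open>reg U\<close> the ring of functions regular on \<open>U\<close>, as subrings of the field, while \<open>fr P z\<close>,
  \<open>sec U z\<close> and \<open>gm U0 P z\<close> are the fraction, the section and the germ with value \<open>z\<close>. Germs are
  taken on an open subscheme \<open>U0\<close>, so that morphisms into an open complement are covered.
\<close>

definition loc :: "'a set \<Rightarrow> 'l set" where
  "loc P = {\<phi> a / \<phi> s | a s. a \<in> carrier R \<and> s \<in> carrier R - P}"

definition fr :: "'a set \<Rightarrow> 'l \<Rightarrow> ('a \<times> 'a) set" where
  "fr P z = {(b, t). b \<in> carrier R \<and> t \<in> carrier R - P \<and> \<phi> b / \<phi> t = z}"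

definition reg :: "'a set set \<Rightarrow> 'l set" where
  "reg U = {z. \<forall>P\<in>U. z \<in> loc P}"

definition sec :: "'a set set \<Rightarrow> 'l \<Rightarrow> 'a set \<Rightarrow> ('a \<times> 'a) set" where
  "sec U z = (\<lambda>P\<in>U. fr P z)"

definition gm :: "'a set set \<Rightarrow> 'a set \<Rightarrow> 'l \<Rightarrow> ('a set set \<times> ('a set \<Rightarrow> ('a \<times> 'a) set)) set" where
  "gm U0 P z = {(V, sec V z) | V. openin (zariski R) V \<and> V \<subseteq> U0 \<and> P \<in> V \<and> z \<in> reg V}"

lemma cring_R: "cring R"
  by (rule R.is_cring)

lemma phi_mult: "a \<in> carrier R \<Longrightarrow> b \<in> carrier R \<Longrightarrow> \<phi> (a \<otimes> b) = \<phi> a * \<phi> b"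
  and phi_add: "a \<in> carrier R \<Longrightarrow> b \<in> carrier R \<Longrightarrow> \<phi> (a \<oplus> b) = \<phi> a + \<phi> b"
  and phi_one: "\<phi> \<one> = 1"
  using hom by (auto simp: ring_hom_def)

lemma phi_zero: "\<phi> \<zero> = 0"
  using ring_hom_zero[OF hom R.ring_axioms] cring.axioms(1)[OF cring_ambient] by simp

lemma phi_minus: "a \<in> carrier R \<Longrightarrow> \<phi> (\<ominus> a) = - \<phi> a"
  using phi_add[of a "\<ominus> a"] phi_zero R.r_neg[of a] by (simp add: eq_neg_iff_add_eq_0 add.commute)

lemma phi_eq: "a \<in> carrier R \<Longrightarrow> b \<in> carrier R \<Longrightarrow> \<phi> a = \<phi> b \<longleftrightarrow> a = b"
  using inj by (auto dest: inj_onD)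

lemma phi_eq0: "a \<in> carrier R \<Longrightarrow> \<phi> a = 0 \<longleftrightarrow> a = \<zero>"
  using phi_eq[of a \<zero>] phi_zero by simp

lemma phi_diff: "a \<in> carrier R \<Longrightarrow> b \<in> carrier R \<Longrightarrow> \<phi> (a \<ominus> b) = \<phi> a - \<phi> b"
  by (simp add: a_minus_def phi_add phi_minus)

lemma phi_power: "a \<in> carrier R \<Longrightarrow> \<phi> (a [^] (n::nat)) = \<phi> a ^ n"
  by (induction n) (auto simp: phi_one phi_mult)

lemma domain: "domain R"
proof (rule domainI)
  show "cring R" by (rule R.is_cring)
  show "\<one> \<noteq> \<zero>" using phi_one phi_zero by auto
  show "a = \<zero> \<or> b = \<zero>" if "a \<otimes> b = \<zero>" "a \<in> carrier R" "b \<in> carrier R" for a b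
    using that phi_mult[of a b] phi_zero by (auto simp: phi_eq0)
qed

lemma zero_in_Spec: "{\<zero>} \<in> Spec R"
  using domain.zeroprimeideal[OF domain] by (simp add: Spec_def)

lemma phi_nz: "P \<in> Spec R \<Longrightarrow> s \<in> carrier R - P \<Longrightarrow> \<phi> s \<noteq> 0"
  using SpecD(2)[of P R] phi_eq0 by auto

lemma fraction_eq:
  assumes P: "P \<in> Spec R" and "a \<in> carrier R" "s \<in> carrier R - P"
  shows "fraction R P a s = fr P (\<phi> a / \<phi> s)"
proof -
  \<comment> \<open>In a domain the annihilating factor \<open>u\<close> can be cancelled, so equal fractions have equal values.\<close>
  have "(\<exists>u\<in>carrier R - P. u \<otimes> (a \<otimes> t \<ominus> b \<otimes> s) = \<zero>) \<longleftrightarrow> \<phi> b / \<phi> t = \<phi> a / \<phi> s" (is "?l \<longleftrightarrow> ?r")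
    if bt: "b \<in> carrier R" "t \<in> carrier R - P" for b t
  proof -
    have "?r \<longleftrightarrow> \<phi> (a \<otimes> t \<ominus> b \<otimes> s) = 0"
      using assms bt phi_nz[OF P] by (auto simp: phi_diff phi_mult field_simps)
    moreover have "\<phi> (u \<otimes> (a \<otimes> t \<ominus> b \<otimes> s)) = 0 \<longleftrightarrow> \<phi> (a \<otimes> t \<ominus> b \<otimes> s) = 0"
      if "u \<in> carrier R - P" for u
      using assms bt that phi_nz[OF P that] by (subst phi_mult) auto
    moreover have "u \<otimes> (a \<otimes> t \<ominus> b \<otimes> s) = \<zero> \<longleftrightarrow> \<phi> (u \<otimes> (a \<otimes> t \<ominus> b \<otimes> s)) = 0"
      if "u \<in> carrier R - P" for u
      using assms bt that by (subst phi_eq0) auto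
    moreover have "\<one> \<in> carrier R - P" using SpecD(3)[OF P] by simp
    ultimately show ?thesis by blast
  qed
  then show ?thesis unfolding fraction_def fr_def by auto
qed

lemma locI: "a \<in> carrier R \<Longrightarrow> s \<in> carrier R - P \<Longrightarrow> \<phi> a / \<phi> s \<in> loc P"
  by (auto simp: loc_def)

lemma fr_nonempty: "z \<in> loc P \<Longrightarrow> \<exists>b t. (b, t) \<in> fr P z"
  by (auto simp: loc_def fr_def)

lemma fr_inj: "z \<in> loc P \<Longrightarrow> fr P z = fr P w \<Longrightarrow> z = w"
  using fr_nonempty[of z P] by (auto simp: fr_def)

lemma loc_carrier: "P \<in> Spec R \<Longrightarrow> a \<in> carrier R \<Longrightarrow> \<phi> a \<in> loc P"
  using locI[of a \<one> P] SpecD(3)[of P R] by (simp add: phi_one)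

lemma subring_loc:
  assumes P: "P \<in> Spec R" shows "subring_set (loc P)"
  unfolding subring_set_def
proof (intro conjI ballI)
  show "1 \<in> loc P" using loc_carrier[OF P, of \<one>] phi_one by simp
  fix x y assume "x \<in> loc P" "y \<in> loc P"
  then obtain a s b t where *: "a \<in> carrier R" "s \<in> carrier R - P" "x = \<phi> a / \<phi> s"
    "b \<in> carrier R" "t \<in> carrier R - P" "y = \<phi> b / \<phi> t" by (auto simp: loc_def)
  have st: "s \<otimes> t \<in> carrier R - P" using * SpecD(4)[OF P, of s t] by auto
  have nz: "\<phi> s \<noteq> 0" "\<phi> t \<noteq> 0" using * phi_nz[OF P] by auto
  have "x - y = \<phi> (a \<otimes> t \<ominus> b \<otimes> s) / \<phi> (s \<otimes> t)"
    unfolding *(3,6) using *(1,2,4,5) nz by (simp add: phi_diff phi_mult diff_frac_eq)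
  then show "x - y \<in> loc P" using locI[of "a \<otimes> t \<ominus> b \<otimes> s", OF _ st] * by simp
  have "x * y = \<phi> (a \<otimes> b) / \<phi> (s \<otimes> t)" using * by (simp add: phi_mult)
  then show "x * y \<in> loc P" using locI[of "a \<otimes> b", OF _ st] * by simp
qed

lemma local_ring_carrier:
  assumes P: "P \<in> Spec R" shows "carrier (local_ring_at R P) = fr P ` loc P"
proof (intro equalityI subsetI)
  fix Z assume "Z \<in> carrier (local_ring_at R P)"
  then obtain a s where "Z = fraction R P a s" "a \<in> carrier R" "s \<in> carrier R - P"
    by (auto simp: local_ring_at_def)
  then show "Z \<in> fr P ` loc P" using fraction_eq[OF P, of a s] locI[of a s P] by auto
next
  fix Z assume "Z \<in> fr P ` loc P"
  then obtain a s where "Z = fr P (\<phi> a / \<phi> s)" "a \<in> carrier R" "s \<in> carrier R - P"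
    by (auto simp: loc_def)
  then show "Z \<in> carrier (local_ring_at R P)"
    using fraction_eq[OF P, of a s] unfolding local_ring_at_def by auto
qed

lemma local_ring_ops:
  assumes P: "P \<in> Spec R"
  shows "\<one>\<^bsub>local_ring_at R P\<^esub> = fr P 1" "\<zero>\<^bsub>local_ring_at R P\<^esub> = fr P 0"
    and "z \<in> loc P \<Longrightarrow> w \<in> loc P \<Longrightarrow> fr P z \<otimes>\<^bsub>local_ring_at R P\<^esub> fr P w = fr P (z * w)"
    and "z \<in> loc P \<Longrightarrow> w \<in> loc P \<Longrightarrow> fr P z \<oplus>\<^bsub>local_ring_at R P\<^esub> fr P w = fr P (z + w)"
proof -
  have 1: "\<one> \<in> carrier R - P" using SpecD(3)[OF P] by simp
  show "\<one>\<^bsub>local_ring_at R P\<^esub> = fr P 1" "\<zero>\<^bsub>local_ring_at R P\<^esub> = fr P 0"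
    using fraction_eq[OF P _ 1] by (simp_all add: local_ring_at_def phi_one phi_zero)
next
  assume zw: "z \<in> loc P" "w \<in> loc P"
  have ne: "\<exists>p. p \<in> fr P z" "\<exists>p. p \<in> fr P w" using zw fr_nonempty by blast+
  have *: "fraction R P (a \<otimes> b) (s \<otimes> t) = fr P (z * w) \<and>
      fraction R P (a \<otimes> t \<oplus> b \<otimes> s) (s \<otimes> t) = fr P (z + w)"
    if "(a, s) \<in> fr P z" "(b, t) \<in> fr P w" for a s b t
  proof -
    have m: "a \<in> carrier R" "s \<in> carrier R - P" "b \<in> carrier R" "t \<in> carrier R - P"
      "\<phi> a / \<phi> s = z" "\<phi> b / \<phi> t = w" using that by (auto simp: fr_def)
    have st: "s \<otimes> t \<in> carrier R - P" using m SpecD(4)[OF P, of s t] by auto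
    have nz: "\<phi> s \<noteq> 0" "\<phi> t \<noteq> 0" using m phi_nz[OF P] by auto
    have "\<phi> (a \<otimes> b) / \<phi> (s \<otimes> t) = z * w" "\<phi> (a \<otimes> t \<oplus> b \<otimes> s) / \<phi> (s \<otimes> t) = z + w"
      unfolding m(5,6)[symmetric] using m(1-4) nz by (simp_all add: phi_mult phi_add add_frac_eq)
    then show ?thesis
      using m(1-4) by (auto simp: fraction_eq[OF P _ st])
  qed
  show "fr P z \<otimes>\<^bsub>local_ring_at R P\<^esub> fr P w = fr P (z * w)"
    unfolding local_ring_at_def monoid.simps ring.simps case_prod_beta
    by (rule UN2_const[OF ne]) (use * in auto)
  show "fr P z \<oplus>\<^bsub>local_ring_at R P\<^esub> fr P w = fr P (z + w)"
    unfolding local_ring_at_def monoid.simps ring.simps case_prod_beta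
    by (rule UN2_const[OF ne]) (use * in auto)
qed

lemma cring_local_ring:
  assumes P: "P \<in> Spec R" shows "cring (local_ring_at R P)"
  by (rule cring_transport[OF cring_sub_ring[OF subring_loc[OF P]], of "fr P"])
    (auto simp: local_ring_ops[OF P] local_ring_carrier[OF P])

lemma open_zariski: "openin (zariski R) U \<longleftrightarrow> (\<exists>E \<subseteq> carrier R. U = Spec R - zero_locus R E)"
  by (rule openin_zariski[OF R.is_cring])

lemma open_subset: "openin (zariski R) U \<Longrightarrow> U \<subseteq> Spec R"
  by (auto simp: open_zariski)

text \<open>
  The zero ideal is the generic point: it lies in every prime ideal, and an open set contains with
  a prime ideal all smaller ones.
\<close>

lemma zero_in_open:
  assumes "openin (zariski R) U" "U \<noteq> {}" shows "{\<zero>} \<in> U"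
proof -
  obtain E where E: "E \<subseteq> carrier R" "U = Spec R - zero_locus R E" using assms by (auto simp: open_zariski)
  obtain P where P: "P \<in> U" using assms by blast
  then have "P \<in> Spec R" "\<not> E \<subseteq> P" using E by (auto simp: zero_locus_def)
  then have "\<not> E \<subseteq> {\<zero>}" using SpecD(2)[of P R] by auto
  then show ?thesis using E zero_in_Spec by (auto simp: zero_locus_def)
qed

lemma global_section_eq:
  "a \<in> carrier R \<Longrightarrow> global_section R a = sec (Spec R) (\<phi> a)"
  unfolding global_section_def sec_def
  by (rule restrict_ext) (use fraction_eq SpecD(3)[of _ R] phi_one in auto)
lemma subring_reg: "U \<subseteq> Spec R \<Longrightarrow> subring_set (reg U)"
  using subring_loc unfolding subring_set_def reg_def by blast

lemma reg_mono: "V \<subseteq> U \<Longrightarrow> z \<in> reg U \<Longrightarrow> z \<in> reg V"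
  by (auto simp: reg_def)

text \<open>A fraction stays regular wherever its denominator does not vanish.\<close>

lemma loc_reg:
  assumes U: "openin (zariski R) U" "P \<in> U" and z: "z \<in> loc P"
  shows "\<exists>V. openin (zariski R) V \<and> P \<in> V \<and> V \<subseteq> U \<and> z \<in> reg V"
proof -
  obtain a s where as: "a \<in> carrier R" "s \<in> carrier R - P" "z = \<phi> a / \<phi> s" using z by (auto simp: loc_def)
  let ?V = "U \<inter> {Q \<in> Spec R. s \<notin> Q}"
  have "z \<in> reg ?V" using as locI by (auto simp: reg_def)
  moreover have "openin (zariski R) ?V" using U basic_open[OF R.is_cring, of s] as by blast
  moreover have "P \<in> ?V" using U as open_subset by auto
  ultimately show ?thesis by blast
qed

text \<open>
  A section is determined by one element of the field: two local expressions of it agree at the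
  generic point, which lies in every nonempty open set.
\<close>

lemma spec_sections_eq:
  assumes U: "openin (zariski R) U" shows "spec_sections R U = sec U ` reg U"
proof (intro equalityI subsetI)
  fix s assume s: "s \<in> spec_sections R U"
  show "s \<in> sec U ` reg U"
  proof (cases "U = {}")
    case True
    then have "s = sec U 0" "0 \<in> reg U" using s by (auto simp: spec_sections_def sec_def reg_def)
    then show ?thesis by blast
  next
    case False
    have loc_s: "\<exists>V a f. openin (zariski R) V \<and> P \<in> V \<and> V \<subseteq> U \<and> a \<in> carrier R \<and> f \<in> carrier R \<and>
        (\<forall>Q \<in> V. f \<notin> Q \<and> s Q = fraction R Q a f)" if "P \<in> U" for P
      using s that by (simp add: spec_sections_def)
    \<comment> \<open>The local value of the section is still allowed to depend on the neighbourhood.\<close>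
    have near: "\<exists>V w. openin (zariski R) V \<and> P \<in> V \<and> (\<forall>Q\<in>V. w \<in> loc Q \<and> s Q = fr Q w)" if P: "P \<in> U" for P
    proof -
      from loc_s[OF P] obtain V where "\<exists>a f. openin (zariski R) V \<and> P \<in> V \<and> V \<subseteq> U \<and>
        a \<in> carrier R \<and> f \<in> carrier R \<and> (\<forall>Q \<in> V. f \<notin> Q \<and> s Q = fraction R Q a f)" ..
      then obtain a where "\<exists>f. openin (zariski R) V \<and> P \<in> V \<and> V \<subseteq> U \<and>
        a \<in> carrier R \<and> f \<in> carrier R \<and> (\<forall>Q \<in> V. f \<notin> Q \<and> s Q = fraction R Q a f)" ..
      then obtain f where "openin (zariski R) V \<and> P \<in> V \<and> V \<subseteq> U \<and>
        a \<in> carrier R \<and> f \<in> carrier R \<and> (\<forall>Q \<in> V. f \<notin> Q \<and> s Q = fraction R Q a f)" ..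
      then have V: "openin (zariski R) V" "P \<in> V" "V \<subseteq> U" "a \<in> carrier R" "f \<in> carrier R"
        "\<And>Q. Q \<in> V \<Longrightarrow> f \<notin> Q \<and> s Q = fraction R Q a f" by simp_all
      have "\<phi> a / \<phi> f \<in> loc Q \<and> s Q = fr Q (\<phi> a / \<phi> f)" if Q: "Q \<in> V" for Q
      proof -
        have "Q \<in> Spec R" "f \<in> carrier R - Q" using open_subset[OF V(1)] Q V(5) V(6)[OF Q] by auto
        then show ?thesis using V(6)[OF Q] fraction_eq[of Q a f] locI[of a f Q] V(4) by simp
      qed
      then show ?thesis using V(1,2) by blast
    qed
    have g: "{\<zero>} \<in> U" using zero_in_open[OF U False] .
    then obtain z where z: "z \<in> loc {\<zero>}" "s {\<zero>} = fr {\<zero>} z" using near[OF g] by metis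
    have all: "z \<in> loc P \<and> s P = fr P z" if P: "P \<in> U" for P
    proof -
      obtain V w where V: "openin (zariski R) V" "P \<in> V" "\<And>Q. Q \<in> V \<Longrightarrow> w \<in> loc Q \<and> s Q = fr Q w"
        using near[OF P] by metis
      have "{\<zero>} \<in> V" using zero_in_open[OF V(1)] V(2) by auto
      then have "w = z" using V(3)[of "{\<zero>}"] z fr_inj by metis
      then show ?thesis using V by auto
    qed
    have "s = sec U z"
    proof (rule extensionalityI[of _ U])
      show "s \<in> extensional U" using s by (auto simp: spec_sections_def PiE_def)
      show "sec U z \<in> extensional U" by (simp add: sec_def)
      show "\<And>P. P \<in> U \<Longrightarrow> s P = sec U z P" using all by (simp add: sec_def)
    qed
    moreover have "z \<in> reg U" using all by (simp add: reg_def)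
    ultimately show ?thesis by blast
  qed
next
  fix s assume "s \<in> sec U ` reg U"
  then obtain z where z: "z \<in> reg U" "s = sec U z" by blast
  have "\<exists>V a f. openin (zariski R) V \<and> P \<in> V \<and> V \<subseteq> U \<and> a \<in> carrier R \<and> f \<in> carrier R \<and>
        (\<forall>Q \<in> V. f \<notin> Q \<and> s Q = fraction R Q a f)" if P: "P \<in> U" for P
  proof -
    obtain a f where af: "a \<in> carrier R" "f \<in> carrier R - P" "z = \<phi> a / \<phi> f"
      using z P by (auto simp: reg_def loc_def)
    let ?V = "U \<inter> {Q \<in> Spec R. f \<notin> Q}"
    have 1: "openin (zariski R) ?V" using U basic_open[OF R.is_cring, of f] af by auto
    have 2: "P \<in> ?V" using P af open_subset[OF U] by auto
    have 3: "f \<notin> Q \<and> s Q = fraction R Q a f" if Q: "Q \<in> ?V" for Q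
    proof -
      have "Q \<in> Spec R" "f \<in> carrier R - Q" "Q \<in> U" using Q af(2) by simp_all
      then show ?thesis using fraction_eq[of Q a f] af(1) z(2) by (simp add: sec_def af(3))
    qed
    show ?thesis
      by (rule exI[of _ ?V], rule exI[of _ a], rule exI[of _ f]) 
        (intro conjI ballI 1 2 af(1) Int_lower1 DiffD1[OF af(2)], insert 3, blast+)
  qed
  moreover have "s \<in> (\<Pi>\<^sub>E P\<in>U. carrier (local_ring_at R P))"
    using z open_subset[OF U] by (auto simp: sec_def reg_def local_ring_carrier subset_iff)
  ultimately show "s \<in> spec_sections R U" by (auto simp: spec_sections_def)
qed

lemma open_subspace_whole: "open_subspace (affine_scheme R) (Spec R) = affine_scheme R"
  using topspace_zariski[OF R.is_cring] subtopology_topspace[of "zariski R"]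
  by (simp add: open_subspace_def)

lemma sections_ops:
  assumes U: "U \<subseteq> Spec R"
  shows "\<one>\<^bsub>sections (affine_scheme R) U\<^esub> = sec U 1" "\<zero>\<^bsub>sections (affine_scheme R) U\<^esub> = sec U 0"
    and "z \<in> reg U \<Longrightarrow> w \<in> reg U \<Longrightarrow> sec U z \<otimes>\<^bsub>sections (affine_scheme R) U\<^esub> sec U w = sec U (z * w)"
    and "z \<in> reg U \<Longrightarrow> w \<in> reg U \<Longrightarrow> sec U z \<oplus>\<^bsub>sections (affine_scheme R) U\<^esub> sec U w = sec U (z + w)"
  using U by (auto simp: affine_scheme_def sec_def local_ring_ops reg_def subset_iff intro!: restrict_ext)

lemma restrict_sec: "V \<subseteq> U \<Longrightarrow> restrict (sec U z) V = sec V z"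
  by (auto simp: sec_def restrict_def fun_eq_iff)

lemma sec_inj: "z \<in> reg U \<Longrightarrow> P \<in> U \<Longrightarrow> sec U z = sec U w \<Longrightarrow> z = w"
  by (metis (no_types, lifting) fr_inj mem_Collect_eq reg_def restrict_apply' sec_def)

lemma open_in_subspace:
  "openin (zariski R) U0 \<Longrightarrow> openin (subtopology (zariski R) U0) V \<longleftrightarrow> openin (zariski R) V \<and> V \<subseteq> U0"
  by (simp add: openin_open_subtopology)

text \<open>
  Two sections have the same germ only if they have the same value, since the value can be recovered
  on any smaller neighbourhood; so germs do not remember where a section was defined.
\<close>

lemma germ_eq:
  assumes U0: "openin (zariski R) U0" and U: "openin (zariski R) U" "U \<subseteq> U0" "P \<in> U" and z: "z \<in> reg U"
  shows "germ (open_subspace (affine_scheme R) U0) P U (sec U z) = gm U0 P z"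
proof (intro equalityI subsetI)
  fix p assume "p \<in> germ (open_subspace (affine_scheme R) U0) P U (sec U z)"
  then obtain V t W where p: "p = (V, t)" and V: "openin (zariski R) V" "V \<subseteq> U0" "P \<in> V"
    and t: "t \<in> spec_sections R V" and W: "P \<in> W" "W \<subseteq> U \<inter> V" "restrict (sec U z) W = restrict t W"
    by (auto simp: germ_def open_in_subspace[OF U0])
  obtain w where w: "w \<in> reg V" "t = sec V w" using t V by (auto simp: spec_sections_eq)
  have "sec W z = sec W w" using W w by (metis Int_subset_iff restrict_sec)
  moreover have "z \<in> reg W" using z W reg_mono by blast
  ultimately have "z = w" using sec_inj W(1) by blast
  then show "p \<in> gm U0 P z" using p V w by (auto simp: gm_def)
next
  fix p assume "p \<in> gm U0 P z"
  then obtain V where V: "p = (V, sec V z)" "openin (zariski R) V" "V \<subseteq> U0" "P \<in> V" "z \<in> reg V"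
    by (auto simp: gm_def)
  have "openin (zariski R) (U \<inter> V)" "P \<in> U \<inter> V" using U V by auto
  moreover have "restrict (sec U z) (U \<inter> V) = restrict (sec V z) (U \<inter> V)" by (simp add: restrict_sec)
  ultimately have "\<exists>W. (openin (zariski R) W \<and> W \<subseteq> U0) \<and> P \<in> W \<and> W \<subseteq> U \<inter> V \<and>
      restrict (sec U z) W = restrict (sec V z) W" using U(2) by blast
  moreover have "sec V z \<in> spec_sections R V" using V by (simp add: spec_sections_eq)
  ultimately show "p \<in> germ (open_subspace (affine_scheme R) U0) P U (sec U z)"
    unfolding germ_def using V(1-4) by (simp add: open_in_subspace[OF U0])
qed

lemma gm_nonempty:
  assumes "openin (zariski R) U0" "P \<in> U0" "z \<in> loc P" shows "\<exists>p. p \<in> gm U0 P z"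
  using loc_reg[OF assms] by (auto simp: gm_def)

lemma gm_inj:
  assumes "openin (zariski R) U0" "P \<in> U0" "z \<in> loc P" "gm U0 P z = gm U0 P w" shows "z = w"
proof -
  obtain V where V: "(V, sec V z) \<in> gm U0 P z" "P \<in> V" "z \<in> reg V"
    using gm_nonempty[OF assms(1-3)] by (auto simp: gm_def)
  then have "sec V z = sec V w" using assms(4) by (auto simp: gm_def)
  then show ?thesis using V sec_inj by blast
qed

lemma stalk_carrier:
  assumes U0: "openin (zariski R) U0" and P: "P \<in> U0"
  shows "carrier (stalk (open_subspace (affine_scheme R) U0) P) = gm U0 P ` loc P"
proof -
  have *: "carrier (stalk (open_subspace (affine_scheme R) U0) P) =
      {germ (open_subspace (affine_scheme R) U0) P U s | U s.
        (openin (zariski R) U \<and> U \<subseteq> U0) \<and> P \<in> U \<and> s \<in> spec_sections R U}"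
    by (simp add: stalk_def Let_def open_in_subspace[OF U0])
  show ?thesis
  proof (intro equalityI subsetI)
    fix g assume "g \<in> carrier (stalk (open_subspace (affine_scheme R) U0) P)"
    then obtain U s where g: "g = germ (open_subspace (affine_scheme R) U0) P U s"
      and U: "openin (zariski R) U" "U \<subseteq> U0" "P \<in> U" and s: "s \<in> spec_sections R U"
      unfolding * by blast
    obtain z where z: "z \<in> reg U" "s = sec U z" using s unfolding spec_sections_eq[OF U(1)] by blast
    have "g = gm U0 P z" using g z germ_eq[OF U0 U] by simp
    moreover have "z \<in> loc P" using z U by (auto simp: reg_def)
    ultimately show "g \<in> gm U0 P ` loc P" by blast
  next
    fix g assume "g \<in> gm U0 P ` loc P"
    then obtain z where z: "z \<in> loc P" "g = gm U0 P z" by blast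
    obtain V where V: "openin (zariski R) V" "P \<in> V" "V \<subseteq> U0" "z \<in> reg V"
      using loc_reg[OF U0 P z(1)] by blast
    have "g = germ (open_subspace (affine_scheme R) U0) P V (sec V z)"
      using germ_eq[OF U0] V z by simp
    moreover have "sec V z \<in> spec_sections R V" using V by (simp add: spec_sections_eq)
    ultimately show "g \<in> carrier (stalk (open_subspace (affine_scheme R) U0) P)"
      unfolding * using V by blast
  qed
qed

lemma stalk_ops:
  assumes U0: "openin (zariski R) U0" and P: "P \<in> U0"
  defines "S \<equiv> stalk (open_subspace (affine_scheme R) U0) P"
  shows "\<one>\<^bsub>S\<^esub> = gm U0 P 1" "\<zero>\<^bsub>S\<^esub> = gm U0 P 0"
    and "z \<in> loc P \<Longrightarrow> w \<in> loc P \<Longrightarrow> gm U0 P z \<otimes>\<^bsub>S\<^esub> gm U0 P w = gm U0 P (z * w)"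
    and "z \<in> loc P \<Longrightarrow> w \<in> loc P \<Longrightarrow> gm U0 P z \<oplus>\<^bsub>S\<^esub> gm U0 P w = gm U0 P (z + w)"
proof -
  have UU: "U0 \<subseteq> Spec R" using open_subset[OF U0] .
  have 01: "0 \<in> reg U0" "1 \<in> reg U0" using subring_reg[OF UU] by (auto intro: subring_setD)
  have top: "topspace (points (open_subspace (affine_scheme R) U0)) = U0"
    using UU topspace_zariski[OF R.is_cring] by auto
  show "\<one>\<^bsub>S\<^esub> = gm U0 P 1" "\<zero>\<^bsub>S\<^esub> = gm U0 P 0"
    using germ_eq[OF U0 U0 subset_refl P] 01 
    by (simp_all add: S_def stalk_def Let_def top sections_ops[OF UU] del: subspace_simps(1))
next
  assume zw: "z \<in> loc P" "w \<in> loc P"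
  note ne = gm_nonempty[OF U0 P zw(1)] gm_nonempty[OF U0 P zw(2)]
  \<comment> \<open>Both operations of the stalk at once: \<open>f\<close> is the operation on sections and \<open>y\<close> the resulting value.\<close>
  have *: "stalk_op (open_subspace (affine_scheme R) U0) P f (gm U0 P z) (gm U0 P w) = gm U0 P y"
    if y: "\<And>W. W \<subseteq> Spec R \<Longrightarrow> z \<in> reg W \<Longrightarrow> w \<in> reg W \<Longrightarrow> f W (sec W z) (sec W w) = sec W y \<and> y \<in> reg W"
    for f y
  proof -
    have G: "germ (open_subspace (affine_scheme R) U0) P (fst p \<inter> fst q)
         (f (fst p \<inter> fst q) (res (open_subspace (affine_scheme R) U0) (fst p) (fst p \<inter> fst q) (snd p))
         (res (open_subspace (affine_scheme R) U0) (fst q) (fst p \<inter> fst q) (snd q))) = gm U0 P y"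
      if pq: "p \<in> gm U0 P z" "q \<in> gm U0 P w" for p q
    proof -
      obtain U V where p: "p = (U, sec U z)" "q = (V, sec V w)" and
        U: "openin (zariski R) U" "U \<subseteq> U0" "P \<in> U" "z \<in> reg U" and
        V: "openin (zariski R) V" "V \<subseteq> U0" "P \<in> V" "w \<in> reg V" using pq by (auto simp: gm_def)
      have W: "openin (zariski R) (U \<inter> V)" "U \<inter> V \<subseteq> U0" "P \<in> U \<inter> V" using U V by auto
      have "z \<in> reg (U \<inter> V)" "w \<in> reg (U \<inter> V)" using U V reg_mono[of "U \<inter> V"] by blast+
      then have "f (U \<inter> V) (sec (U \<inter> V) z) (sec (U \<inter> V) w) = sec (U \<inter> V) y" "y \<in> reg (U \<inter> V)"
        using y[OF open_subset[OF W(1)]] by simp_all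
      then show ?thesis using germ_eq[OF U0 W] p by (simp add: restrict_sec)
    qed
    show ?thesis unfolding stalk_op_def case_prod_beta by (rule UN2_const[OF ne]) (rule G)
  qed
  show "gm U0 P z \<otimes>\<^bsub>S\<^esub> gm U0 P w = gm U0 P (z * w)"
    unfolding S_def stalk_def Let_def monoid.simps ring.simps
  proof (rule *)
    fix W assume W: "W \<subseteq> Spec R" "z \<in> reg W" "w \<in> reg W"
    show "sec W z \<otimes>\<^bsub>sections (open_subspace (affine_scheme R) U0) W\<^esub> sec W w = sec W (z * w) \<and> z * w \<in> reg W"
      using sections_ops[OF W(1)] subring_setD(6)[OF subring_reg[OF W(1)]] W(2,3) by simp
  qed
  show "gm U0 P z \<oplus>\<^bsub>S\<^esub> gm U0 P w = gm U0 P (z + w)"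
    unfolding S_def stalk_def Let_def monoid.simps ring.simps
  proof (rule *)
    fix W assume W: "W \<subseteq> Spec R" "z \<in> reg W" "w \<in> reg W"
    show "sec W z \<oplus>\<^bsub>sections (open_subspace (affine_scheme R) U0) W\<^esub> sec W w = sec W (z + w) \<and> z + w \<in> reg W"
      using sections_ops[OF W(1)] subring_setD(4)[OF subring_reg[OF W(1)]] W(2,3) by simp
  qed
qed

lemma gm_Units:
  assumes U0: "openin (zariski R) U0" and P: "P \<in> U0" and z: "z \<in> loc P"
  shows "gm U0 P z \<in> Units (stalk (open_subspace (affine_scheme R) U0) P) \<longleftrightarrow> z \<noteq> 0 \<and> inverse z \<in> loc P"
    (is "?l \<longleftrightarrow> ?r")
proof
  have sr: "subring_set (loc P)" using subring_loc open_subset[OF U0] P by blast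
  show ?r if l: ?l
  proof -
    obtain w where w: "w \<in> loc P" "gm U0 P (z * w) = gm U0 P 1"
      using l z stalk_ops(1)[OF U0 P] stalk_ops(3)[OF U0 P z]
      unfolding Units_def stalk_carrier[OF U0 P] by auto
    then have "z * w = 1" using gm_inj[OF U0 P] z sr subring_setD(6) by metis
    then show ?r using w by (metis inverse_unique mult_zero_left zero_neq_one)
  qed
  show ?l if ?r
    using that z by (auto simp: Units_def stalk_carrier[OF U0 P] stalk_ops[OF U0 P] intro!: bexI[of _ "inverse z"])
qed

end


section \<open>Morphisms of spectra\<close>

lemma cring_idealI:
  assumes "cring R" "I \<subseteq> carrier R" "\<zero>\<^bsub>R\<^esub> \<in> I"
    and add: "\<And>a b. a \<in> I \<Longrightarrow> b \<in> I \<Longrightarrow> a \<oplus>\<^bsub>R\<^esub> b \<in> I"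
    and mult: "\<And>a r. a \<in> I \<Longrightarrow> r \<in> carrier R \<Longrightarrow> r \<otimes>\<^bsub>R\<^esub> a \<in> I"
  shows "ideal I R"
proof -
  interpret cring R by fact
  have m: "\<ominus>\<^bsub>R\<^esub> a \<in> I" if "a \<in> I" for a
    using mult[OF that, of "\<ominus>\<^bsub>R\<^esub> \<one>\<^bsub>R\<^esub>"] that assms(2) by (auto simp: l_minus subset_iff)
  show ?thesis
  proof (rule idealI)
    show "ring R" by (rule ring_axioms)
    show "subgroup I (add_monoid R)"
      by (rule add.subgroupI) (use assms m in \<open>auto simp: a_inv_def\<close>)
    show "x \<otimes>\<^bsub>R\<^esub> a \<in> I" if "a \<in> I" "x \<in> carrier R" for a x using mult that .
    show "a \<otimes>\<^bsub>R\<^esub> x \<in> I" if "a \<in> I" "x \<in> carrier R" for a x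
      using mult[OF that] m_comm[of a x] that assms(2) by auto
  qed
qed

lemma SpecI:
  assumes "cring R" "I \<subseteq> carrier R" "\<zero>\<^bsub>R\<^esub> \<in> I" "\<one>\<^bsub>R\<^esub> \<notin> I"
    and "\<And>a b. a \<in> I \<Longrightarrow> b \<in> I \<Longrightarrow> a \<oplus>\<^bsub>R\<^esub> b \<in> I"
    and "\<And>a r. a \<in> I \<Longrightarrow> r \<in> carrier R \<Longrightarrow> r \<otimes>\<^bsub>R\<^esub> a \<in> I"
    and "\<And>a b. a \<in> carrier R \<Longrightarrow> b \<in> carrier R \<Longrightarrow> a \<otimes>\<^bsub>R\<^esub> b \<in> I \<Longrightarrow> a \<in> I \<or> b \<in> I"
  shows "I \<in> Spec R"
proof -
  interpret cring R by fact
  have "primeideal I R"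
    by (rule primeidealI[OF cring_idealI]) (use assms in auto)
  then show ?thesis by (simp add: Spec_def)
qed

lemma spec_map_Spec:
  assumes R: "cring R" and S: "cring S" and h: "h \<in> ring_hom R S" and Q: "Q \<in> Spec S"
  shows "spec_map R h Q \<in> Spec R"
proof -
  interpret R: cring R by fact
  interpret S: cring S by fact
  note hm = ring_hom_memE[OF h] ring_hom_zero[OF h R.ring_axioms S.ring_axioms]
  show ?thesis
    by (rule SpecI[OF R]) (use SpecD[OF Q] hm in \<open>auto simp: spec_map_def\<close>)
qed

lemma embedded_comp:
  assumes "embedded S \<psi>" "cring R" and h: "h \<in> ring_hom R S" "inj_on h (carrier R)"
  shows "embedded R (\<psi> \<circ> h)"
proof -
  interpret S: embedded S \<psi> by fact
  note hm = ring_hom_memE[OF h(1)]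
  show ?thesis
  proof (intro embedded.intro embedded_axioms.intro)
    show "\<psi> \<circ> h \<in> ring_hom R ambient"
      by (rule ring_hom_memI) (auto simp: hm S.phi_mult S.phi_add S.phi_one)
    show "inj_on (\<psi> \<circ> h) (carrier R)"
      using h(2) S.inj hm(1) by (auto intro!: comp_inj_on intro: inj_on_subset)
  qed fact
qed

text \<open>
  Sections over an open set and stalks of a spectrum arise in this way, with \<open>f\<close> assigning to a value
  in the field the section or the germ that has it.
\<close>

lemma embedded_transport:
  assumes A: "subring_set (A :: 'l::field set)" and im: "f ` A = carrier S" and inj: "inj_on f A"
    and mult: "\<And>x y. x \<in> A \<Longrightarrow> y \<in> A \<Longrightarrow> f x \<otimes>\<^bsub>S\<^esub> f y = f (x * y)"
    and add: "\<And>x y. x \<in> A \<Longrightarrow> y \<in> A \<Longrightarrow> f x \<oplus>\<^bsub>S\<^esub> f y = f (x + y)"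
    and one: "\<one>\<^bsub>S\<^esub> = f 1" and zero: "\<zero>\<^bsub>S\<^esub> = f 0"
  shows "embedded S (inv_into A f)"
proof (intro embedded.intro embedded_axioms.intro)
  show "cring S"
    by (rule cring_transport[OF cring_sub_ring[OF A], of f]) (simp_all add: im mult add one zero)
  show "inv_into A f \<in> ring_hom S ambient"
    by (rule ring_hom_memI) (use inj subring_setD[OF A] in \<open>auto simp: im[symmetric] mult add one\<close>)
  show "inj_on (inv_into A f) (carrier S)" using im inj_on_inv_into[of "carrier S" f A] by simp
qed

text \<open>
  The general form of a morphism between open subschemes of such spectra that keeps the value of
  every section. Compatibility with the ring operations and with restriction is then automatic, and
  locality says that a value which is invertible in the local ring upstairs is invertible downstairs.
\<close>

lemma lrs_morphism_embedded:
  assumes "embedded R \<phi>" "embedded S \<psi>"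
    and U0: "openin (zariski R) U0" and U1: "openin (zariski S) U1"
    and f: "\<And>Q. Q \<in> U1 \<Longrightarrow> f Q \<in> U0"
    and cont: "\<And>V. openin (zariski R) V \<Longrightarrow> V \<subseteq> U0 \<Longrightarrow> openin (zariski S) {Q \<in> U1. f Q \<in> V}"
    and fs: "\<And>V z. openin (zariski R) V \<Longrightarrow> V \<subseteq> U0 \<Longrightarrow> z \<in> embedded.reg R \<phi> V \<Longrightarrow>
        z \<in> embedded.reg S \<psi> {Q \<in> U1. f Q \<in> V} \<and>
        fs V (embedded.sec R \<phi> V z) = embedded.sec S \<psi> {Q \<in> U1. f Q \<in> V} z"
    and loc: "\<And>Q z. Q \<in> U1 \<Longrightarrow> z \<in> embedded.loc R \<phi> (f Q) \<Longrightarrow> z \<noteq> 0 \<Longrightarrow>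
        inverse z \<in> embedded.loc S \<psi> Q \<Longrightarrow> inverse z \<in> embedded.loc R \<phi> (f Q)"
  shows "lrs_morphism (open_subspace (affine_scheme S) U1) (open_subspace (affine_scheme R) U0) f fs"
proof -
  interpret E: embedded R \<phi> by fact
  interpret F: embedded S \<psi> by fact
  have top: "topspace (subtopology (zariski R) U0) = U0" "topspace (subtopology (zariski S) U1) = U1"
    using E.open_subset[OF U0] F.open_subset[OF U1] topspace_zariski[OF E.cring_R] topspace_zariski[OF F.cring_R]
    by auto
  have pre: "preim (open_subspace (affine_scheme S) U1) f V = {Q \<in> U1. f Q \<in> V}" for V
    by (auto simp: preim_def top simp del: topspace_subtopology)
  note [simp] = E.open_in_subspace[OF U0] F.open_in_subspace[OF U1]
  have sub: "{Q \<in> U1. f Q \<in> V} \<subseteq> Spec S" for V using F.open_subset[OF U1] by auto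
  have subR: "V \<subseteq> Spec R" if "V \<subseteq> U0" for V using E.open_subset[OF U0] that by auto
  show ?thesis
    unfolding lrs_morphism_def
  proof (intro conjI allI impI; (elim conjE)?)
    show "continuous_map (points (open_subspace (affine_scheme S) U1)) (points (open_subspace (affine_scheme R) U0)) f"
      using f cont by (auto simp: continuous_map_def top simp del: topspace_subtopology)
  next
    fix V assume "openin (points (open_subspace (affine_scheme R) U0)) V"
    then have V: "openin (zariski R) V" "V \<subseteq> U0" by auto
    have carr: "spec_sections R V = E.sec V ` E.reg V" using E.spec_sections_eq V by simp
    have carr': "F.sec {Q \<in> U1. f Q \<in> V} z \<in> spec_sections S {Q \<in> U1. f Q \<in> V}"
      if "z \<in> F.reg {Q \<in> U1. f Q \<in> V}" for z
      using F.spec_sections_eq[OF cont[OF V]] that by simp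
    have sr: "subring_set (E.reg V)" using E.subring_reg subR V by blast
    show "fs V \<in> ring_hom (sections (open_subspace (affine_scheme R) U0) V)
        (sections (open_subspace (affine_scheme S) U1) (preim (open_subspace (affine_scheme S) U1) f V))"
      unfolding pre subspace_simps
    proof (rule ring_hom_memI)
      show "fs V \<one>\<^bsub>sections (affine_scheme R) V\<^esub> = \<one>\<^bsub>sections (affine_scheme S) {Q \<in> U1. f Q \<in> V}\<^esub>"
        using fs[OF V, of 1] subring_setD(1)[OF sr] by (simp add: E.sections_ops[OF subR[OF V(2)]] F.sections_ops[OF sub])
    next
      fix s assume "s \<in> carrier (sections (affine_scheme R) V)"
      then obtain z where z: "z \<in> E.reg V" "s = E.sec V z" by (auto simp: carr)
      then show "fs V s \<in> carrier (sections (affine_scheme S) {Q \<in> U1. f Q \<in> V})"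
        using fs[OF V z(1)] carr' by simp
      fix t assume "t \<in> carrier (sections (affine_scheme R) V)"
      then obtain w where w: "w \<in> E.reg V" "t = E.sec V w" by (auto simp: carr)
      have "z * w \<in> E.reg V" "z + w \<in> E.reg V" using sr z w by (auto intro: subring_setD)
      then show "fs V (s \<otimes>\<^bsub>sections (affine_scheme R) V\<^esub> t) =
             fs V s \<otimes>\<^bsub>sections (affine_scheme S) {Q \<in> U1. f Q \<in> V}\<^esub> fs V t"
        "fs V (s \<oplus>\<^bsub>sections (affine_scheme R) V\<^esub> t) =
             fs V s \<oplus>\<^bsub>sections (affine_scheme S) {Q \<in> U1. f Q \<in> V}\<^esub> fs V t"
        using z w fs[OF V] by (simp_all add: E.sections_ops[OF subR[OF V(2)]] F.sections_ops[OF sub])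
    qed
  next
    fix V W s
    assume "openin (points (open_subspace (affine_scheme R) U0)) V"
      "openin (points (open_subspace (affine_scheme R) U0)) W" and WV: "W \<subseteq> V"
      and s: "s \<in> carrier (sections (open_subspace (affine_scheme R) U0) V)"
    then have V: "openin (zariski R) V" "V \<subseteq> U0" and W: "openin (zariski R) W" "W \<subseteq> U0" by auto
    obtain z where z: "z \<in> E.reg V" "s = E.sec V z" using s V by (auto simp: E.spec_sections_eq)
    have "z \<in> E.reg W" using E.reg_mono WV z(1) .
    moreover have "{Q \<in> U1. f Q \<in> W} \<subseteq> {Q \<in> U1. f Q \<in> V}" using WV by blast
    ultimately show "fs W (res (open_subspace (affine_scheme R) U0) V W s) =
       res (open_subspace (affine_scheme S) U1) (preim (open_subspace (affine_scheme S) U1) f V)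
        (preim (open_subspace (affine_scheme S) U1) f W) (fs V s)"
      using fs[OF V z(1)] fs[OF W, of z] WV z(2) by (simp add: pre E.restrict_sec F.restrict_sec)
  next
    fix Q V s
    assume Q: "Q \<in> topspace (points (open_subspace (affine_scheme S) U1))"
      and "openin (points (open_subspace (affine_scheme R) U0)) V" and fQ: "f Q \<in> V"
      and s: "s \<in> carrier (sections (open_subspace (affine_scheme R) U0) V)"
      and un: "germ (open_subspace (affine_scheme S) U1) Q (preim (open_subspace (affine_scheme S) U1) f V) (fs V s)
        \<in> Units (stalk (open_subspace (affine_scheme S) U1) Q)"
    then have V: "openin (zariski R) V" "V \<subseteq> U0" by auto
    have Q: "Q \<in> U1" using Q top by (simp del: topspace_subtopology)
    obtain z where z: "z \<in> E.reg V" "s = E.sec V z" using s V by (auto simp: E.spec_sections_eq)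
    have zl: "z \<in> E.loc (f Q)" using z fQ by (auto simp: E.reg_def)
    have zr: "z \<in> F.reg {Q \<in> U1. f Q \<in> V}" and zs: "fs V s = F.sec {Q \<in> U1. f Q \<in> V} z"
      using fs[OF V z(1)] z(2) by auto
    have zQ: "z \<in> F.loc Q" using zr Q fQ by (auto simp: F.reg_def)
    have "F.gm U1 Q z \<in> Units (stalk (open_subspace (affine_scheme S) U1) Q)"
      using un F.germ_eq[OF U1 cont[OF V] _ _ zr, of Q] Q fQ unfolding pre zs by auto
    then have "z \<noteq> 0" "inverse z \<in> F.loc Q" using F.gm_Units[OF U1 Q zQ] by auto
    then have "E.gm U0 (f Q) z \<in> Units (stalk (open_subspace (affine_scheme R) U0) (f Q))"
      using E.gm_Units[OF U0 f[OF Q] zl] loc[OF Q zl] by auto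
    then show "germ (open_subspace (affine_scheme R) U0) (f Q) V s
        \<in> Units (stalk (open_subspace (affine_scheme R) U0) (f Q))"
      using E.germ_eq[OF U0 V fQ z(1)] z(2) by simp
  qed
qed

text \<open>
  If \<open>S\<close> is embedded by \<open>\<psi>\<close> and \<open>h : R \<rightarrow> S\<close> is injective, then \<open>R\<close> is embedded by \<open>\<psi> \<circ> h\<close> in the
  same field, and pulling back a function does not change its value in that field.
\<close>

locale embedded_hom = S?: embedded S \<psi> + R?: cring R
  for S (structure) and \<psi> :: "'b \<Rightarrow> 'l::field" and R :: "('a, 'm) ring_scheme" (structure) +
  fixes h :: "'a \<Rightarrow> 'b"
  assumes h: "h \<in> ring_hom R S" and inj_h: "inj_on h (carrier R)"
begin

lemma embedded_R: "embedded R (\<psi> \<circ> h)"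
  by (rule embedded_comp[OF S.embedded_axioms R.is_cring h inj_h])

sublocale E: embedded R "\<psi> \<circ> h"
  by (rule embedded_R)

lemma h_closed: "a \<in> carrier R \<Longrightarrow> h a \<in> carrier S"
  using h by (auto simp: ring_hom_def)

lemma h_eq: "a \<in> carrier R \<Longrightarrow> b \<in> carrier S \<Longrightarrow> h a = b \<longleftrightarrow> \<psi> (h a) = \<psi> b"
  using S.phi_eq[of "h a" b] h_closed by auto

lemma map_Spec: "Q \<in> Spec S \<Longrightarrow> spec_map R h Q \<in> Spec R"
  by (rule spec_map_Spec[OF R.is_cring S.cring_R h])

lemma mem_spec_map: "a \<in> spec_map R h Q \<longleftrightarrow> a \<in> carrier R \<and> h a \<in> Q"
  by (simp add: spec_map_def)

lemma loc_mono: "z \<in> E.loc (spec_map R h Q) \<Longrightarrow> z \<in> S.loc Q"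
  using h_closed unfolding E.loc_def S.loc_def by (fastforce simp: mem_spec_map)

lemma local_ring_map_fr:
  assumes Q: "Q \<in> Spec S" and z: "z \<in> E.loc (spec_map R h Q)"
  shows "local_ring_map S h Q (E.fr (spec_map R h Q) z) = S.fr Q z"
proof -
  have "fraction S Q (h a) (h s) = S.fr Q z" if "(a, s) \<in> E.fr (spec_map R h Q) z" for a s
  proof -
    have *: "a \<in> carrier R" "s \<in> carrier R" "s \<notin> spec_map R h Q" "\<psi> (h a) / \<psi> (h s) = z"
      using that by (auto simp: E.fr_def)
    then have "h s \<in> carrier S - Q" using h_closed mem_spec_map by auto
    then show ?thesis using S.fraction_eq[OF Q, of "h a" "h s"] * h_closed by simp
  qed
  moreover obtain b t where "(b, t) \<in> E.fr (spec_map R h Q) z" using E.fr_nonempty[OF z] by blast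
  ultimately show ?thesis unfolding local_ring_map_def by auto
qed

lemma comap_sec:
  assumes z: "z \<in> E.reg V"
  shows "spec_comap R S h V (E.sec V z) = S.sec {Q \<in> Spec S. spec_map R h Q \<in> V} z"
  using z unfolding spec_comap_def S.sec_def E.sec_def
  by (intro restrict_ext) (auto simp: local_ring_map_fr E.reg_def)

lemma reg_pull: "z \<in> E.reg V \<Longrightarrow> z \<in> S.reg {Q \<in> Spec S. spec_map R h Q \<in> V}"
  using loc_mono by (auto simp: E.reg_def S.reg_def)

lemma comap_global_section:
  assumes "a \<in> carrier R"
  shows "spec_comap R S h (Spec R) (global_section R a) = global_section S (h a)"
proof -
  have "{Q \<in> Spec S. spec_map R h Q \<in> Spec R} = Spec S" using map_Spec by auto
  moreover have "(\<psi> \<circ> h) a \<in> E.reg (Spec R)" using E.loc_carrier[OF _ assms] by (simp add: E.reg_def)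
  ultimately show ?thesis
    using comap_sec E.global_section_eq[OF assms] S.global_section_eq[OF h_closed[OF assms]] by simp
qed
lemma continuous_spec_map:
  assumes "openin (zariski R) V" shows "openin (zariski S) {Q \<in> Spec S. spec_map R h Q \<in> V}"
proof -
  obtain E where E: "E \<subseteq> carrier R" "V = Spec R - zero_locus R E" using assms by (auto simp: E.open_zariski)
  have "{Q \<in> Spec S. spec_map R h Q \<in> V} = Spec S - zero_locus S (h ` E)"
  proof -
    have "E \<subseteq> spec_map R h Q \<longleftrightarrow> h ` E \<subseteq> Q" for Q using E(1) unfolding spec_map_def by blast
    then show ?thesis using E(2) map_Spec by (auto simp: zero_locus_def)
  qed
  moreover have "h ` E \<subseteq> carrier S" using E h_closed by auto
  ultimately show ?thesis by (auto simp: S.open_zariski)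
qed

text \<open>
  If \<open>b / t\<close> is inverse to \<open>h a / h s\<close> then \<open>b * h a = h s * t\<close> lies outside \<open>Q\<close>, and so \<open>h a\<close>
  lies outside \<open>Q\<close>.
\<close>

lemma local_hom:
  assumes Q: "Q \<in> Spec S" and z: "z \<in> E.loc (spec_map R h Q)" "z \<noteq> 0" "inverse z \<in> S.loc Q"
  shows "inverse z \<in> E.loc (spec_map R h Q)"
proof -
  obtain a s where a: "a \<in> carrier R" "s \<in> carrier R" "h s \<notin> Q" "z = \<psi> (h a) / \<psi> (h s)"
    using z(1) by (auto simp: E.loc_def mem_spec_map)
  obtain b t where b: "b \<in> carrier S" "t \<in> carrier S - Q" "inverse z = \<psi> b / \<psi> t"
    using z(3) by (auto simp: S.loc_def)
  have nz: "\<psi> (h s) \<noteq> 0" "\<psi> t \<noteq> 0" using S.phi_nz[OF Q] a b h_closed by auto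
  have "\<psi> b / \<psi> t * (\<psi> (h a) / \<psi> (h s)) = 1" using z(2) a(4) b(3) by (metis left_inverse)
  then have "\<psi> (b \<otimes>\<^bsub>S\<^esub> h a) = \<psi> (h s \<otimes>\<^bsub>S\<^esub> t)"
    using a b nz h_closed by (simp add: S.phi_mult field_simps)
  then have "b \<otimes>\<^bsub>S\<^esub> h a = h s \<otimes>\<^bsub>S\<^esub> t" using S.phi_eq a b h_closed by auto
  moreover have "h s \<otimes>\<^bsub>S\<^esub> t \<notin> Q" using SpecD(4)[OF Q, of "h s" t] a b h_closed by auto
  ultimately have "h a \<notin> Q" using SpecD(4)[OF Q, of b "h a"] a b h_closed by auto
  then have "(\<psi> \<circ> h) s / (\<psi> \<circ> h) a \<in> E.loc (spec_map R h Q)"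
    using a by (intro E.locI) (auto simp: mem_spec_map)
  then show ?thesis using a(4) by simp
qed

lemma morphism:
  assumes U0: "openin (zariski R) U0" and "\<And>Q. Q \<in> Spec S \<Longrightarrow> spec_map R h Q \<in> U0"
  shows "lrs_morphism (affine_scheme S) (open_subspace (affine_scheme R) U0) (spec_map R h) (spec_comap R S h)"
proof -
  have U1: "openin (zariski S) (Spec S)"
    using topspace_zariski[OF S.cring_R] by (metis openin_topspace)
  have "lrs_morphism (open_subspace (affine_scheme S) (Spec S)) (open_subspace (affine_scheme R) U0)
      (spec_map R h) (spec_comap R S h)"
    by (rule lrs_morphism_embedded[OF E.embedded_axioms S.embedded_axioms U0 U1])
      (use assms continuous_spec_map reg_pull comap_sec local_hom in auto)
  then show ?thesis by (simp only: S.open_subspace_whole)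
qed

end

text \<open>
  \<open>S\<close> is a localization of \<open>R\<close> at \<open>F\<close>: the last condition says that every element of \<open>S\<close> is of
  the form \<open>h a / h F\<^sup>n\<close>. Writing it without division makes it usable in \<open>S\<close> and in the field alike.
\<close>

locale localization = embedded_hom S \<psi> R h
  for S (structure) and \<psi> :: "'b \<Rightarrow> 'l::field" and R :: "('a, 'm) ring_scheme" (structure) and h :: "'a \<Rightarrow> 'b" +
  fixes F :: 'a
  assumes F: "F \<in> carrier R" and F_unit: "h F \<in> Units S"
    and fracs: "\<And>s. s \<in> carrier S \<Longrightarrow> \<exists>a\<in>carrier R. \<exists>n::nat. \<psi> s * \<psi> (h F) ^ n = \<psi> (h a)"
begin

text \<open>
  \<open>extend P\<close> is the ideal of \<open>S\<close> generated by the image of \<open>P\<close>, which inverts \<open>spec_map\<close> on the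
  complement of the zero locus of \<open>F\<close>.
\<close>

definition U0 where "U0 = {P \<in> Spec R. F \<notin> P}"

definition extend :: "'a set \<Rightarrow> 'b set" where
  "extend P = {s \<in> carrier S. \<exists>a\<in>P. \<exists>n::nat. \<psi> s * \<psi> (h F) ^ n = \<psi> (h a)}"

lemma U0: "openin (zariski R) U0"
  unfolding U0_def by (rule basic_open[OF R.is_cring F])

lemma unit_notin: "Q \<in> Spec S \<Longrightarrow> h F \<notin> Q"
proof
  assume Q: "Q \<in> Spec S" "h F \<in> Q"
  obtain u where "u \<in> carrier S" "u \<otimes>\<^bsub>S\<^esub> h F = \<one>\<^bsub>S\<^esub>" using F_unit by (auto simp: Units_def)
  then show False using SpecD(3)[OF Q(1)] SpecD(4)[OF Q(1), of u "h F"] Q h_closed[OF F] by auto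
qed

lemma psiF: "\<psi> (h F) \<noteq> 0"
  using S.phi_nz[OF S.zero_in_Spec, of "h F"] unit_notin[OF S.zero_in_Spec] h_closed[OF F] by auto

lemma power_F: "\<psi> (h F) ^ n = \<psi> (h (F [^]\<^bsub>R\<^esub> n))"
  using E.phi_power[OF F] by simp

lemma power_notin: "P \<in> U0 \<Longrightarrow> F [^]\<^bsub>R\<^esub> (n::nat) \<notin> P"
proof (induction n)
  case 0 then show ?case using SpecD(3)[of P R] by (auto simp: U0_def)
next
  case (Suc n) then show ?case using SpecD(4)[of P R "F [^]\<^bsub>R\<^esub> n" F] F by (auto simp: U0_def)
qed

lemma spec_map_U0: "Q \<in> Spec S \<Longrightarrow> spec_map R h Q \<in> U0"
  using map_Spec unit_notin by (auto simp: U0_def mem_spec_map)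

text \<open>Membership in the extended ideal does not depend on the chosen denominator.\<close>

lemma extend_iff:
  assumes P: "P \<in> U0" and s: "s \<in> carrier S" and a: "a \<in> carrier R" "\<psi> s * \<psi> (h F) ^ n = \<psi> (h a)"
  shows "s \<in> extend P \<longleftrightarrow> a \<in> P"
proof
  have PS: "P \<in> Spec R" using P by (simp add: U0_def)
  assume "s \<in> extend P"
  then obtain b m where b: "b \<in> P" "\<psi> s * \<psi> (h F) ^ m = \<psi> (h b)" by (auto simp: extend_def)
  have bR: "b \<in> carrier R" using b SpecD(1)[OF PS] by auto
  have "(\<psi> \<circ> h) (F [^]\<^bsub>R\<^esub> m \<otimes>\<^bsub>R\<^esub> a) = (\<psi> \<circ> h) (F [^]\<^bsub>R\<^esub> n \<otimes>\<^bsub>R\<^esub> b)"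
    using a b(2) bR F by (simp only: E.phi_mult R.nat_pow_closed E.phi_power) (simp flip: a(2) b(2))
  then have "F [^]\<^bsub>R\<^esub> m \<otimes>\<^bsub>R\<^esub> a = F [^]\<^bsub>R\<^esub> n \<otimes>\<^bsub>R\<^esub> b" using E.phi_eq a bR F by auto
  moreover have "F [^]\<^bsub>R\<^esub> n \<otimes>\<^bsub>R\<^esub> b \<in> P" using SpecD(4)[OF PS, of "F [^]\<^bsub>R\<^esub> n" b] bR b F by auto
  ultimately show "a \<in> P" using SpecD(4)[OF PS, of "F [^]\<^bsub>R\<^esub> m" a] power_notin[OF P, of m] a F by auto
qed (use s a in \<open>auto simp: extend_def\<close>)

lemma extend_Spec:
  assumes P: "P \<in> U0" shows "extend P \<in> Spec S"
proof -
  have PS: "P \<in> Spec R" using P by (simp add: U0_def)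
  note PD = SpecD[OF PS]
  have hom: "\<psi> (h (a \<otimes>\<^bsub>R\<^esub> b)) = \<psi> (h a) * \<psi> (h b)" "\<psi> (h (a \<oplus>\<^bsub>R\<^esub> b)) = \<psi> (h a) + \<psi> (h b)"
    if "a \<in> carrier R" "b \<in> carrier R" for a b
    using E.phi_mult[OF that] E.phi_add[OF that] by simp_all
  show ?thesis
  proof (rule SpecI[OF S.cring_R])
    show "extend P \<subseteq> carrier S" by (auto simp: extend_def)
    have "\<psi> (h \<zero>\<^bsub>R\<^esub>) = 0" using E.phi_zero by simp
    then show "\<zero>\<^bsub>S\<^esub> \<in> extend P"
      by (subst extend_iff[OF P, of _ "\<zero>\<^bsub>R\<^esub>" 0]) (auto simp: S.phi_zero PD(2))
    have "\<psi> (h \<one>\<^bsub>R\<^esub>) = 1" using E.phi_one by simp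
    then show "\<one>\<^bsub>S\<^esub> \<notin> extend P"
      by (subst extend_iff[OF P, of _ "\<one>\<^bsub>R\<^esub>" 0]) (auto simp: S.phi_one PD(3))
  next
    fix s t assume "s \<in> extend P" "t \<in> extend P"
    then obtain a n b m where *: "s \<in> carrier S" "t \<in> carrier S" "a \<in> P" "b \<in> P"
      "\<psi> s * \<psi> (h F) ^ n = \<psi> (h a)" "\<psi> t * \<psi> (h F) ^ m = \<psi> (h b)" by (auto simp: extend_def)
    let ?c = "F [^]\<^bsub>R\<^esub> m \<otimes>\<^bsub>R\<^esub> a \<oplus>\<^bsub>R\<^esub> F [^]\<^bsub>R\<^esub> n \<otimes>\<^bsub>R\<^esub> b"
    have ab: "a \<in> carrier R" "b \<in> carrier R" using * PD(1) by auto
    have "\<psi> (s \<oplus>\<^bsub>S\<^esub> t) * \<psi> (h F) ^ (n + m) = \<psi> (h ?c)"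
      using * ab F by (simp add: hom S.phi_add power_F[symmetric] *(5,6)[symmetric] algebra_simps power_add)
    moreover have "?c \<in> P" using PD(4)[of "F [^]\<^bsub>R\<^esub> m" a] PD(4)[of "F [^]\<^bsub>R\<^esub> n" b] PD(5) * ab F by auto
    ultimately show "s \<oplus>\<^bsub>S\<^esub> t \<in> extend P" using * ab F by (subst extend_iff[OF P, of _ ?c "n + m"]) auto
  next
    fix s t assume "s \<in> extend P" and t: "t \<in> carrier S"
    then obtain a n where *: "s \<in> carrier S" "a \<in> P" "\<psi> s * \<psi> (h F) ^ n = \<psi> (h a)" by (auto simp: extend_def)
    obtain b m where b: "b \<in> carrier R" "\<psi> t * \<psi> (h F) ^ m = \<psi> (h b)" using fracs[OF t] by auto
    have a: "a \<in> carrier R" using * PD(1) by auto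
    have "\<psi> (t \<otimes>\<^bsub>S\<^esub> s) * \<psi> (h F) ^ (n + m) = \<psi> (h (b \<otimes>\<^bsub>R\<^esub> a))"
      using * b t a by (simp add: hom S.phi_mult *(3)[symmetric] b(2)[symmetric] power_add)
    then show "t \<otimes>\<^bsub>S\<^esub> s \<in> extend P"
      using * b t a PD(4)[of b a] by (subst extend_iff[OF P, of _ "b \<otimes>\<^bsub>R\<^esub> a" "n + m"]) auto
  next
    fix s t assume st: "s \<in> carrier S" "t \<in> carrier S" "s \<otimes>\<^bsub>S\<^esub> t \<in> extend P"
    obtain a n where a: "a \<in> carrier R" "\<psi> s * \<psi> (h F) ^ n = \<psi> (h a)" using fracs[OF st(1)] by auto
    obtain b m where b: "b \<in> carrier R" "\<psi> t * \<psi> (h F) ^ m = \<psi> (h b)" using fracs[OF st(2)] by auto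
    have "\<psi> (s \<otimes>\<^bsub>S\<^esub> t) * \<psi> (h F) ^ (n + m) = \<psi> (h (a \<otimes>\<^bsub>R\<^esub> b))"
      using a b st by (simp add: hom S.phi_mult a(2)[symmetric] b(2)[symmetric] power_add)
    then have "a \<otimes>\<^bsub>R\<^esub> b \<in> P" using extend_iff[OF P, of "s \<otimes>\<^bsub>S\<^esub> t" "a \<otimes>\<^bsub>R\<^esub> b"] st a b by auto
    then have "a \<in> P \<or> b \<in> P" using PD(4) a b by auto
    then show "s \<in> extend P \<or> t \<in> extend P" using extend_iff[OF P] st a b by blast
  qed
qed

lemma spec_map_extend:
  assumes P: "P \<in> U0" shows "spec_map R h (extend P) = P"
proof -
  have "h a \<in> extend P \<longleftrightarrow> a \<in> P" if "a \<in> carrier R" for a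
    using extend_iff[OF P h_closed[OF that] that, of 0] by simp
  moreover have "P \<subseteq> carrier R" using SpecD(1) P by (auto simp: U0_def)
  ultimately show ?thesis by (auto simp: spec_map_def)
qed

lemma extend_spec_map:
  assumes Q: "Q \<in> Spec S" shows "extend (spec_map R h Q) = Q"
proof -
  have "s \<in> extend (spec_map R h Q) \<longleftrightarrow> s \<in> Q" if s: "s \<in> carrier S" for s
  proof -
    obtain a n where a: "a \<in> carrier R" "\<psi> s * \<psi> (h F) ^ n = \<psi> (h a)" using fracs[OF s] by auto
    have hn: "h F [^]\<^bsub>S\<^esub> (k::nat) \<notin> Q" for k
      by (induction k) (use SpecD(3,4)[OF Q] unit_notin[OF Q] h_closed[OF F] in auto)
    have "\<psi> (s \<otimes>\<^bsub>S\<^esub> h F [^]\<^bsub>S\<^esub> n) = \<psi> (h a)"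
      using a s h_closed[OF F] by (simp add: S.phi_mult S.phi_power)
    then have "h a = s \<otimes>\<^bsub>S\<^esub> h F [^]\<^bsub>S\<^esub> n" using h_eq a(1) s h_closed[OF F] by simp
    then have "h a \<in> Q \<longleftrightarrow> s \<in> Q" using SpecD(4)[OF Q, of s "h F [^]\<^bsub>S\<^esub> n"] s hn h_closed[OF F] by auto
    then show ?thesis using extend_iff[OF spec_map_U0[OF Q] s a] a by (simp add: mem_spec_map)
  qed
  moreover have "Q \<subseteq> carrier S" using SpecD(1)[OF Q] .
  ultimately show ?thesis by (auto simp: extend_def)
qed

text \<open>
  A fraction of elements of \<open>S\<close> becomes a fraction of elements of \<open>R\<close> when it is extended by a
  power of \<open>F\<close>; thus corresponding points have the same local ring in the field.
\<close>

lemma loc_eq: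
  assumes Q: "Q \<in> Spec S" shows "S.loc Q = E.loc (spec_map R h Q)"
proof (intro equalityI subsetI)
  fix z assume "z \<in> S.loc Q"
  then obtain b t where b: "b \<in> carrier S" "t \<in> carrier S - Q" "z = \<psi> b / \<psi> t" by (auto simp: S.loc_def)
  obtain b' n where b': "b' \<in> carrier R" "\<psi> b * \<psi> (h F) ^ n = \<psi> (h b')" using fracs[OF b(1)] by auto
  obtain t' m where t': "t' \<in> carrier R" "\<psi> t * \<psi> (h F) ^ m = \<psi> (h t')" using fracs[of t] b by auto
  have PU: "spec_map R h Q \<in> U0" and PS: "spec_map R h Q \<in> Spec R" using spec_map_U0[OF Q] map_Spec[OF Q] .
  have "t' \<notin> spec_map R h Q" using extend_iff[OF PU _ t'] extend_spec_map[OF Q] b by auto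
  then have "t' \<otimes>\<^bsub>R\<^esub> F [^]\<^bsub>R\<^esub> n \<notin> spec_map R h Q"
    using SpecD(4)[OF PS, of t' "F [^]\<^bsub>R\<^esub> n"] power_notin[OF PU, of n] t' F by auto
  then have in_loc: "(\<psi> \<circ> h) (b' \<otimes>\<^bsub>R\<^esub> F [^]\<^bsub>R\<^esub> m) / (\<psi> \<circ> h) (t' \<otimes>\<^bsub>R\<^esub> F [^]\<^bsub>R\<^esub> n) \<in> E.loc (spec_map R h Q)"
    using b' t' F by (intro E.locI) auto
  have "(\<psi> \<circ> h) (b' \<otimes>\<^bsub>R\<^esub> F [^]\<^bsub>R\<^esub> m) = \<psi> b * \<psi> (h F) ^ (n + m)"
    "(\<psi> \<circ> h) (t' \<otimes>\<^bsub>R\<^esub> F [^]\<^bsub>R\<^esub> n) = \<psi> t * \<psi> (h F) ^ (n + m)"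
    using b' t' F by (simp_all only: E.phi_mult R.nat_pow_closed E.phi_power)
      (simp_all flip: b'(2) t'(2) add: power_add)
  then have "(\<psi> \<circ> h) (b' \<otimes>\<^bsub>R\<^esub> F [^]\<^bsub>R\<^esub> m) / (\<psi> \<circ> h) (t' \<otimes>\<^bsub>R\<^esub> F [^]\<^bsub>R\<^esub> n) = z"
    using psiF b(3) by simp
  with in_loc show "z \<in> E.loc (spec_map R h Q)" by simp
qed (rule loc_mono)

text \<open>
  If elements \<open>s\<close> of \<open>S\<close> cut out a closed set, then the elements \<open>a\<close> of \<open>R\<close> with \<open>s = a / F\<^sup>n\<close> cut out
  its image in the complement of the zero locus of \<open>F\<close>.
\<close>

lemma open_extend:
  assumes "openin (zariski S) V" shows "openin (zariski R) {P \<in> U0. extend P \<in> V}"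
proof -
  obtain D where D: "D \<subseteq> carrier S" "V = Spec S - zero_locus S D"
    using assms unfolding S.open_zariski by blast
  define C where "C = {a \<in> carrier R. \<exists>s\<in>D. \<exists>n::nat. \<psi> s * \<psi> (h F) ^ n = \<psi> (h a)}"
  have "D \<subseteq> extend P \<longleftrightarrow> C \<subseteq> P" if P: "P \<in> U0" for P
  proof
    show "C \<subseteq> P" if D': "D \<subseteq> extend P"
    proof
      fix a assume "a \<in> C"
      then obtain s n where s: "s \<in> D" "a \<in> carrier R" "\<psi> s * \<psi> (h F) ^ n = \<psi> (h a)"
        unfolding C_def by blast
      show "a \<in> P" using extend_iff[OF P _ s(2,3)] s(1) D(1) D' by auto
    qed
    show "D \<subseteq> extend P" if C: "C \<subseteq> P"
    proof
      fix s assume s: "s \<in> D"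
      then obtain a n where a: "a \<in> carrier R" "\<psi> s * \<psi> (h F) ^ n = \<psi> (h a)" using fracs[of s] D(1) by blast
      then have "a \<in> P" using C s by (auto simp: C_def)
      then show "s \<in> extend P" using extend_iff[OF P _ a] s D(1) by auto
    qed
  qed
  then have "{P \<in> U0. extend P \<in> V} = U0 \<inter> (Spec R - zero_locus R C)"
    using D(2) extend_Spec by (auto simp: U0_def zero_locus_def)
  moreover have "C \<subseteq> carrier R" by (auto simp: C_def)
  then have "openin (zariski R) (Spec R - zero_locus R C)" unfolding E.open_zariski by blast
  ultimately show ?thesis using U0 by auto
qed

text \<open>
  The inverse morphism sends the section with value \<open>z\<close> to the section with value \<open>z\<close>. It is well
  defined because the local rings agree, and both composites are identities because neither map
  changes values.
\<close>

theorem iso: "lrs_iso (affine_scheme S) (open_subspace (affine_scheme R) U0) (spec_map R h) (spec_comap R S h)"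
proof -
  have US: "openin (zariski S) (Spec S)" using topspace_zariski[OF S.cring_R] by (metis openin_topspace)
  have tops: "topspace (points (affine_scheme S)) = Spec S"
    "topspace (points (open_subspace (affine_scheme R) U0)) = U0"
    using topspace_zariski[OF S.cring_R] topspace_zariski[OF R.is_cring] E.open_subset[OF U0] by auto
  have pre: "preim (affine_scheme S) (spec_map R h) V = {Q \<in> Spec S. spec_map R h Q \<in> V}"
    "preim (open_subspace (affine_scheme R) U0) extend W = {P \<in> U0. extend P \<in> W}" for V W
    by (simp_all only: preim_def tops)
  \<comment> \<open>The value of a section; over the empty set, where it is not unique, the choice does not matter.\<close>
  define val where "val U s = (SOME z. z \<in> S.reg U \<and> s = S.sec U z)" for U s
  define gs where "gs U s = E.sec {P \<in> U0. extend P \<in> U} (val U s)" for U s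
  have gs: "gs U (S.sec U z) = E.sec {P \<in> U0. extend P \<in> U} z" if "z \<in> S.reg U" for U z
  proof (cases "U = {}")
    case True then show ?thesis by (simp add: gs_def E.sec_def restrict_def)
  next
    case False
    have "val U (S.sec U z) \<in> S.reg U \<and> S.sec U z = S.sec U (val U (S.sec U z))"
      unfolding val_def by (rule someI[of _ z]) (use that in auto)
    then have "z = val U (S.sec U z)" using S.sec_inj[OF that] False by blast
    then show ?thesis by (simp add: gs_def)
  qed
  have reg: "z \<in> E.reg {P \<in> U0. extend P \<in> U}" if z: "z \<in> S.reg U" for U z
  proof -
    have "z \<in> E.loc P" if P: "P \<in> U0" "extend P \<in> U" for P
      using loc_eq[OF extend_Spec[OF P(1)]] spec_map_extend[OF P(1)] z P(2) by (auto simp: S.reg_def)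
    then show ?thesis by (auto simp: E.reg_def)
  qed
  have m2: "lrs_morphism (open_subspace (affine_scheme R) U0) (open_subspace (affine_scheme S) (Spec S)) extend gs"
  proof (rule lrs_morphism_embedded[OF S.embedded_axioms E.embedded_axioms US U0])
    show "\<And>P. P \<in> U0 \<Longrightarrow> extend P \<in> Spec S" by (rule extend_Spec)
    show "\<And>V. openin (zariski S) V \<Longrightarrow> openin (zariski R) {P \<in> U0. extend P \<in> V}" by (rule open_extend)
    show "\<And>V z. z \<in> S.reg V \<Longrightarrow> z \<in> E.reg {Q \<in> U0. extend Q \<in> V} \<and>
           gs V (S.sec V z) = E.sec {Q \<in> U0. extend Q \<in> V} z" using gs reg by simp
    show "inverse z \<in> S.loc (extend P)" if "P \<in> U0" "inverse z \<in> E.loc P" for P z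
      using that loc_eq[OF extend_Spec[OF that(1)]] spec_map_extend[OF that(1)] by simp
  qed
  show ?thesis
    unfolding lrs_iso_def
  proof (intro conjI exI[of _ extend] exI[of _ gs])
    show "lrs_morphism (affine_scheme S) (open_subspace (affine_scheme R) U0) (spec_map R h) (spec_comap R S h)"
      by (rule morphism[OF U0 spec_map_U0])
    show "lrs_morphism (open_subspace (affine_scheme R) U0) (affine_scheme S) extend gs"
      using m2 by (simp only: S.open_subspace_whole)
    show "\<forall>Q\<in>topspace (points (affine_scheme S)). extend (spec_map R h Q) = Q"
      "\<forall>P\<in>topspace (points (open_subspace (affine_scheme R) U0)). spec_map R h (extend P) = P"
      unfolding tops using extend_spec_map spec_map_extend by auto
  next
    show "\<forall>V s. openin (points (open_subspace (affine_scheme R) U0)) V \<and>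
        s \<in> carrier (sections (open_subspace (affine_scheme R) U0) V) \<longrightarrow>
        gs (preim (affine_scheme S) (spec_map R h) V) (spec_comap R S h V s) = s"
    proof (intro allI impI, elim conjE)
      fix V s assume "openin (points (open_subspace (affine_scheme R) U0)) V"
        and s: "s \<in> carrier (sections (open_subspace (affine_scheme R) U0) V)"
      then have V: "openin (zariski R) V" "V \<subseteq> U0" by (auto simp: E.open_in_subspace[OF U0])
      obtain z where z: "z \<in> E.reg V" "s = E.sec V z" using s V by (auto simp: E.spec_sections_eq)
      have "{P \<in> U0. extend P \<in> {Q \<in> Spec S. spec_map R h Q \<in> V}} = V"
        using V(2) spec_map_extend extend_Spec by auto
      then show "gs (preim (affine_scheme S) (spec_map R h) V) (spec_comap R S h V s) = s"
        unfolding pre z(2) comap_sec[OF z(1)] gs[OF reg_pull[OF z(1)]] by simp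
    qed
    show "\<forall>U s. openin (points (affine_scheme S)) U \<and> s \<in> carrier (sections (affine_scheme S) U) \<longrightarrow>
        spec_comap R S h (preim (open_subspace (affine_scheme R) U0) extend U) (gs U s) = s"
    proof (intro allI impI, elim conjE)
      fix U s assume "openin (points (affine_scheme S)) U" and s: "s \<in> carrier (sections (affine_scheme S) U)"
      then have U: "openin (zariski S) U" by simp
      obtain z where z: "z \<in> S.reg U" "s = S.sec U z" using s U by (auto simp: S.spec_sections_eq)
      have "{Q \<in> Spec S. spec_map R h Q \<in> {P \<in> U0. extend P \<in> U}} = U"
        using S.open_subset[OF U] spec_map_U0 extend_spec_map by auto
      then show "spec_comap R S h (preim (open_subspace (affine_scheme R) U0) extend U) (gs U s) = s"
        unfolding pre z(2) gs[OF z(1)] comap_sec[OF reg[OF z(1)]] by simp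
    qed
  qed
qed

end


section \<open>Spectra of subrings of a field\<close>

lemma finsum_transport:
  assumes S: "cring S" and A: "subring_set A"
    and closed: "\<And>x. x \<in> A \<Longrightarrow> f x \<in> carrier S"
    and f_add: "\<And>x y. x \<in> A \<Longrightarrow> y \<in> A \<Longrightarrow> f x \<oplus>\<^bsub>S\<^esub> f y = f (x + y)"
    and f0: "\<zero>\<^bsub>S\<^esub> = f 0" and g: "\<And>i. i \<in> I \<Longrightarrow> g i \<in> A"
  shows "(\<Oplus>\<^bsub>S\<^esub>i\<in>I. f (g i)) = f (\<Sum>i\<in>I. g i)"
proof -
  interpret cring S by fact
  show ?thesis using g
  proof (induction I rule: infinite_finite_induct)
    case (infinite I)
    then show ?case by (simp add: f0)
  next
    case empty then show ?case by (simp add: f0)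
  next
    case (insert i I)
    then show ?case
      by (subst finsum_insert) (auto simp: closed f_add subring_set_sum[OF A])
  qed
qed

lemma power_transport:
  assumes "subring_set A"
    and mult: "\<And>x y. x \<in> A \<Longrightarrow> y \<in> A \<Longrightarrow> f x \<otimes>\<^bsub>S\<^esub> f y = f (x * y)"
    and one: "\<one>\<^bsub>S\<^esub> = f 1" and x: "x \<in> A"
  shows "f x [^]\<^bsub>S\<^esub> (n::nat) = f (x ^ n)"
proof (induction n)
  case (Suc n)
  then show ?case using mult[of "x ^ n" x] subring_set_power[OF assms(1) x] x by (simp add: mult.commute)
qed (simp add: one)

text \<open>
  Integral closedness in the fraction field, with the fraction field taken inside the ambient field.
  A monic polynomial is given by its degree and its lower coefficients.
\<close>

definition int_closed :: "'l::field set \<Rightarrow> bool" where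
  "int_closed A \<longleftrightarrow> (\<forall>z. (\<exists>a\<in>A. \<exists>s\<in>A. s \<noteq> 0 \<and> z = a / s) \<and>
     (\<exists>(n::nat) c. (\<forall>i<n. c i \<in> A) \<and> z ^ n + (\<Sum>i<n. c i * z ^ i) = 0) \<longrightarrow> z \<in> A)"

lemma int_closedD:
  fixes n :: nat
  assumes "int_closed A" "\<exists>a\<in>A. \<exists>s\<in>A. s \<noteq> 0 \<and> z = a / s"
    and "\<And>i. i < n \<Longrightarrow> c i \<in> A" "z ^ n + (\<Sum>i<n. c i * z ^ i) = 0"
  shows "z \<in> A"
proof -
  have "\<exists>(n::nat) c. (\<forall>i<n. c i \<in> A) \<and> z ^ n + (\<Sum>i<n. c i * z ^ i) = 0"
    by (rule exI[of _ n], rule exI[of _ c], intro conjI allI impI assms(3,4))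
  then show ?thesis using assms(1,2) unfolding int_closed_def by blast
qed

text \<open>
  The fraction field of \<open>R\<close> is the local ring at the zero ideal, so an integral equation in it is
  an integral equation between values.
\<close>

lemma (in embedded) integrally_closed_domain:
  assumes "int_closed (\<phi> ` carrier R)"
  shows "integrally_closed_domain R"
  unfolding integrally_closed_domain_def Let_def
proof (intro conjI ballI impI domain)
  let ?F = "local_ring_at R {\<zero>}" and ?L = "loc {\<zero>}"
  note Z = zero_in_Spec
  note sr = subring_loc[OF Z]
  have emb: "fraction R {\<zero>} a \<one> = fr {\<zero>} (\<phi> a)" if "a \<in> carrier R" for a
    using fraction_eq[OF Z that, of \<one>] SpecD(3)[OF Z] by (simp add: phi_one)
  fix q assume "q \<in> carrier ?F"
  then obtain z where z: "z \<in> ?L" "q = fr {\<zero>} z" by (auto simp: local_ring_carrier[OF Z])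
  assume "\<exists>(n::nat) c. (\<forall>i<n. c i \<in> carrier R) \<and>
           q [^]\<^bsub>?F\<^esub> n \<oplus>\<^bsub>?F\<^esub> (\<Oplus>\<^bsub>?F\<^esub>i\<in>{..<n}. fraction R {\<zero>} (c i) \<one> \<otimes>\<^bsub>?F\<^esub> q [^]\<^bsub>?F\<^esub> i) = \<zero>\<^bsub>?F\<^esub>"
  then obtain n c where c: "\<And>i. i < n \<Longrightarrow> c i \<in> carrier R"
    and eq: "q [^]\<^bsub>?F\<^esub> (n::nat) \<oplus>\<^bsub>?F\<^esub> (\<Oplus>\<^bsub>?F\<^esub>i\<in>{..<n}. fraction R {\<zero>} (c i) \<one> \<otimes>\<^bsub>?F\<^esub> q [^]\<^bsub>?F\<^esub> i) = \<zero>\<^bsub>?F\<^esub>"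
    by blast
  have pw: "q [^]\<^bsub>?F\<^esub> k = fr {\<zero>} (z ^ k)" for k :: nat
    unfolding z(2) by (rule power_transport[OF sr local_ring_ops(3)[OF Z] local_ring_ops(1)[OF Z] z(1)])
  have pl: "z ^ k \<in> ?L" for k using subring_set_power[OF sr z(1)] .
  have cl: "\<phi> (c i) * z ^ i \<in> ?L" if "i < n" for i
    using subring_setD(6)[OF sr loc_carrier[OF Z c[OF that]] pl] .
  have "(\<Oplus>\<^bsub>?F\<^esub>i\<in>{..<n}. fraction R {\<zero>} (c i) \<one> \<otimes>\<^bsub>?F\<^esub> q [^]\<^bsub>?F\<^esub> i) =
      (\<Oplus>\<^bsub>?F\<^esub>i\<in>{..<n}. fr {\<zero>} (\<phi> (c i) * z ^ i))"
  proof (rule abelian_monoid.finsum_cong')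
    show "abelian_monoid ?F" using cring_local_ring[OF Z]
      by (simp add: cring_def ring_def abelian_group_def)
    show "(\<lambda>i. fr {\<zero>} (\<phi> (c i) * z ^ i)) \<in> {..<n} \<rightarrow> carrier ?F"
      using cl by (auto simp: local_ring_carrier[OF Z])
    show "fraction R {\<zero>} (c i) \<one> \<otimes>\<^bsub>?F\<^esub> q [^]\<^bsub>?F\<^esub> i = fr {\<zero>} (\<phi> (c i) * z ^ i)" if "i \<in> {..<n}" for i
      using that emb[OF c] pw local_ring_ops(3)[OF Z loc_carrier[OF Z c] pl] by simp
  qed simp
  also have "\<dots> = fr {\<zero>} (\<Sum>i<n. \<phi> (c i) * z ^ i)"
    by (rule finsum_transport[OF cring_local_ring[OF Z] sr])
      (use cl in \<open>auto simp: local_ring_carrier[OF Z] local_ring_ops[OF Z]\<close>)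
  finally have "fr {\<zero>} (z ^ n) \<oplus>\<^bsub>?F\<^esub> fr {\<zero>} (\<Sum>i<n. \<phi> (c i) * z ^ i) = fr {\<zero>} 0"
    using eq pw by (simp add: local_ring_ops(2)[OF Z])
  moreover have sl: "(\<Sum>i<n. \<phi> (c i) * z ^ i) \<in> ?L" by (rule subring_set_sum[OF sr]) (use cl in auto)
  ultimately have "fr {\<zero>} 0 = fr {\<zero>} (z ^ n + (\<Sum>i<n. \<phi> (c i) * z ^ i))"
    using local_ring_ops(4)[OF Z pl sl] by simp
  then have eq0: "z ^ n + (\<Sum>i<n. \<phi> (c i) * z ^ i) = 0"
    using fr_inj[OF subring_setD(2)[OF sr]] by metis
  obtain a s where as: "a \<in> carrier R" "s \<in> carrier R - {\<zero>}" "z = \<phi> a / \<phi> s"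
    using z(1) unfolding loc_def by blast
  have "\<phi> s \<noteq> 0" using phi_nz[OF Z as(2)] .
  then have frac: "\<exists>a\<in>\<phi> ` carrier R. \<exists>s\<in>\<phi> ` carrier R. s \<noteq> 0 \<and> z = a / s"
    by (intro bexI[of _ "\<phi> a"] bexI[of _ "\<phi> s"]) (use as in simp_all)
  have "z \<in> \<phi> ` carrier R"
    by (rule int_closedD[OF assms frac _ eq0]) (use c in auto)
  then obtain a where "a \<in> carrier R" "z = \<phi> a" by blast
  then show "q \<in> (\<lambda>a. fraction R {\<zero>} a \<one>) ` carrier R" using emb[of a] z(2) by (intro image_eqI[of _ _ a]) simp_all
qed

locale field_subring =
  fixes A :: "'l::field set"
  assumes A: "subring_set A"
begin

sublocale embedded "sub_ring A" "\<lambda>x. x"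
  by (intro embedded.intro embedded_axioms.intro cring_sub_ring A)
    (auto intro!: ring_hom_memI)

abbreviation "\<XX> \<equiv> affine_scheme (sub_ring A)"
abbreviation "spec \<equiv> Spec (sub_ring A)"

lemma open_spec: "openin (zariski (sub_ring A)) spec"
  using topspace_zariski[OF cring_R] by (metis openin_topspace)

lemma top_X: "topspace (points \<XX>) = spec"
  by (simp add: topspace_zariski[OF cring_R])

lemma stalk_embedded:
  assumes P: "P \<in> spec" shows "embedded (stalk \<XX> P) (inv_into (loc P) (gm spec P))"
proof (rule embedded_transport)
  show "subring_set (loc P)" by (rule subring_loc[OF P])
  show "inj_on (gm spec P) (loc P)" using gm_inj[OF open_spec P] by (auto simp: inj_on_def)
qed (use stalk_carrier[OF open_spec P] stalk_ops[OF open_spec P] in \<open>simp_all add: open_subspace_whole\<close>)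

lemma stalk_simps:
  assumes P: "P \<in> spec"
  shows "carrier (stalk \<XX> P) = gm spec P ` loc P" "\<one>\<^bsub>stalk \<XX> P\<^esub> = gm spec P 1" "\<zero>\<^bsub>stalk \<XX> P\<^esub> = gm spec P 0"
    "z \<in> loc P \<Longrightarrow> w \<in> loc P \<Longrightarrow> gm spec P z \<otimes>\<^bsub>stalk \<XX> P\<^esub> gm spec P w = gm spec P (z * w)"
    "z \<in> loc P \<Longrightarrow> w \<in> loc P \<Longrightarrow> gm spec P z \<oplus>\<^bsub>stalk \<XX> P\<^esub> gm spec P w = gm spec P (z + w)"
  using stalk_carrier[OF open_spec P] stalk_ops[OF open_spec P] by (simp_all add: open_subspace_whole)

lemma locE:
  assumes "z \<in> loc P" obtains a s where "a \<in> A" "s \<in> A" "s \<notin> P" "z = a / s"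
  using assms by (auto simp: loc_def)

lemma locI': "a \<in> A \<Longrightarrow> s \<in> A \<Longrightarrow> s \<notin> P \<Longrightarrow> a / s \<in> loc P"
  using locI[of a s P] by simp

text \<open>
  If \<open>d\<close> is a common denominator of the coefficients of an integral equation of degree \<open>n\<close> for \<open>z\<close>
  over the local ring, then multiplication by \<open>d ^ n\<close> gives an integral equation for \<open>d * z\<close> over \<open>A\<close>.
\<close>

lemma int_closed_loc:
  assumes ic: "int_closed A" and P: "P \<in> spec" shows "int_closed (loc P)"
  unfolding int_closed_def
proof (intro allI impI, elim conjE bexE exE)
  fix z a s c and n :: nat
  assume as: "a \<in> loc P" "s \<in> loc P" "s \<noteq> 0" "z = a / s"
    and c: "\<forall>i<n. c i \<in> loc P" and eq: "z ^ n + (\<Sum>i<n. c i * z ^ i) = 0"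
  note PD = SpecD[OF P, simplified] and AD = subring_setD[OF A]
  have P0: "0 \<in> P" using PD(2) .
  obtain a1 a2 where a: "a1 \<in> A" "a2 \<in> A" "a2 \<notin> P" "a = a1 / a2" using locE[OF as(1)] .
  obtain s1 s2 where s: "s1 \<in> A" "s2 \<in> A" "s2 \<notin> P" "s = s1 / s2" using locE[OF as(2)] .
  have "\<exists>d\<in>A - P. \<forall>i<m. d * c i \<in> A" if "m \<le> n" for m using that
  proof (induction m)
    case 0 then show ?case using AD(1) PD(3) by auto
  next
    case (Suc m)
    then obtain d where d: "d \<in> A" "d \<notin> P" "\<forall>i<m. d * c i \<in> A" by auto
    obtain b t where b: "b \<in> A" "t \<in> A" "t \<notin> P" "c m = b / t" using locE[of "c m" P] c Suc by auto
    have "t \<noteq> 0" using b P0 by auto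
    have "t * d * c i \<in> A" if "i < Suc m" for i
    proof (cases "i = m")
      case True then show ?thesis using b d \<open>t \<noteq> 0\<close> AD(6) by simp
    next
      case False then show ?thesis using d(3) b(2) that AD(6)[of t "d * c i"] by (simp add: mult.assoc)
    qed
    moreover have "t * d \<in> A - P" using PD(4)[of t d] b d AD(6) by auto
    ultimately show ?case by blast
  qed
  then obtain d where d: "d \<in> A" "d \<notin> P" "\<And>i. i < n \<Longrightarrow> d * c i \<in> A" by blast
  have d0: "d \<noteq> 0" using d P0 by auto
  have "(d * z) ^ n + (\<Sum>i<n. (c i * d ^ (n - i)) * (d * z) ^ i) = d ^ n * (z ^ n + (\<Sum>i<n. c i * z ^ i))"
    by (auto simp: power_mult_distrib distrib_left sum_distrib_left mult_ac power_add[symmetric] intro!: sum.cong)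
  then have eq': "(d * z) ^ n + (\<Sum>i<n. (c i * d ^ (n - i)) * (d * z) ^ i) = 0" using eq by simp
  have coeff: "c i * d ^ (n - i) \<in> A" if "i < n" for i
  proof -
    have "n - i = Suc (n - i - 1)" using that by simp
    then have "d ^ (n - i) = d * d ^ (n - i - 1)" by (metis power_Suc)
    then have split: "c i * d ^ (n - i) = d * c i * d ^ (n - i - 1)" by (simp add: mult_ac)
    show ?thesis unfolding split by (rule AD(6)[OF d(3)[OF that] subring_set_power[OF A d(1)]])
  qed
  have "\<exists>x\<in>A. \<exists>y\<in>A. y \<noteq> 0 \<and> d * z = x / y"
  proof (intro bexI conjI)
    show "d * z = (d * a1 * s2) / (a2 * s1)" unfolding as(4) a(4) s(4) by simp
    show "d * a1 * s2 \<in> A" "a2 * s1 \<in> A" using d a s AD(6) by auto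
    show "a2 * s1 \<noteq> 0" using as(3) s(4) a(3) P0 by auto
  qed
  then have "d * z \<in> A" by (rule int_closedD[OF ic _ coeff eq'])
  then have "(d * z) / d \<in> loc P" using locI' d by blast
  then show "z \<in> loc P" using d0 by simp
qed

lemma normal: "int_closed A \<Longrightarrow> normal_scheme \<XX>"
  unfolding normal_scheme_def top_X
proof
  fix P assume ic: "int_closed A" and P: "P \<in> spec"
  interpret S: embedded "stalk \<XX> P" "inv_into (loc P) (gm spec P)" by (rule stalk_embedded[OF P])
  have "inj_on (gm spec P) (loc P)" using gm_inj[OF open_spec P] by (auto simp: inj_on_def)
  then have "inv_into (loc P) (gm spec P) ` carrier (stalk \<XX> P) = loc P"
    by (simp add: stalk_simps(1)[OF P])
  then show "integrally_closed_domain (stalk \<XX> P)"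
    using S.integrally_closed_domain int_closed_loc[OF ic P] by simp
qed

lemma integral: "integral_scheme \<XX>"
  unfolding integral_scheme_def
proof (intro conjI allI impI; (elim conjE)?)
  show "topspace (points \<XX>) \<noteq> {}" using zero_in_Spec top_X by auto
  fix U assume "openin (points \<XX>) U" and ne: "U \<noteq> {}"
  then have U: "openin (zariski (sub_ring A)) U" by simp
  have "embedded (sections \<XX> U) (inv_into (reg U) (sec U))"
  proof (rule embedded_transport)
    show "subring_set (reg U)" by (rule subring_reg[OF open_subset[OF U]])
    show "inj_on (sec U) (reg U)" using sec_inj ne by (fastforce intro!: inj_onI)
  qed (use spec_sections_eq[OF U] sections_ops[OF open_subset[OF U]] in simp_all)
  then show "domain (sections \<XX> U)" by (rule embedded.domain)
qed

end

text \<open>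
  Finite generation is expressed by minimality among ideals, which avoids linear combinations and
  transports along isomorphisms without effort.
\<close>

definition ideal_set :: "'l::field set \<Rightarrow> 'l set \<Rightarrow> bool" where
  "ideal_set A J \<longleftrightarrow> J \<subseteq> A \<and> 0 \<in> J \<and> (\<forall>x\<in>J. \<forall>y\<in>J. x + y \<in> J) \<and> (\<forall>a\<in>A. \<forall>x\<in>J. a * x \<in> J)"

definition noeth :: "'l::field set \<Rightarrow> bool" where
  "noeth A \<longleftrightarrow> (\<forall>J. ideal_set A J \<longrightarrow>
     (\<exists>G. finite G \<and> G \<subseteq> J \<and> (\<forall>J'. ideal_set A J' \<and> G \<subseteq> J' \<longrightarrow> J \<subseteq> J')))"

lemma noetherian_transport:
  assumes "subring_set A" "noeth A" and im: "f ` A = carrier S" and inj: "inj_on f A"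
    and mult: "\<And>x y. x \<in> A \<Longrightarrow> y \<in> A \<Longrightarrow> f x \<otimes>\<^bsub>S\<^esub> f y = f (x * y)"
    and add: "\<And>x y. x \<in> A \<Longrightarrow> y \<in> A \<Longrightarrow> f x \<oplus>\<^bsub>S\<^esub> f y = f (x + y)"
    and one: "\<one>\<^bsub>S\<^esub> = f 1" and zero: "\<zero>\<^bsub>S\<^esub> = f 0"
  shows "noetherian_ring S"
proof -
  interpret S: embedded S "inv_into A f" by (rule embedded_transport) fact+
  show ?thesis
  proof (rule S.R.noetherian_ringI)
    fix I assume "ideal I S"
    have pull: "ideal_set A {a \<in> A. f a \<in> I}" if "ideal I S" for I
    proof -
      interpret I: ideal I S by fact
      have "f (a * x) \<in> I" if "a \<in> A" "x \<in> A" "f x \<in> I" for a x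
      proof -
        have "f a \<in> carrier S" using im that by auto
        then have "f a \<otimes>\<^bsub>S\<^esub> f x \<in> I" using I.I_l_closed that by blast
        then show ?thesis using mult that by simp
      qed
      moreover have "f (x + y) \<in> I" if "x \<in> A" "y \<in> A" "f x \<in> I" "f y \<in> I" for x y
        using additive_subgroup.a_closed[OF I.additive_subgroup_axioms that(3,4)] add that by simp
      moreover have "f 0 \<in> I" using additive_subgroup.zero_closed[OF I.additive_subgroup_axioms] zero by simp
      ultimately show ?thesis using subring_setD[OF assms(1)] by (auto simp: ideal_set_def)
    qed
    obtain G where "finite G \<and> G \<subseteq> {a \<in> A. f a \<in> I} \<and>
        (\<forall>J'. ideal_set A J' \<and> G \<subseteq> J' \<longrightarrow> {a \<in> A. f a \<in> I} \<subseteq> J')"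
      using \<open>noeth A\<close>[unfolded noeth_def, rule_format, OF pull[OF \<open>ideal I S\<close>]] ..
    then have G: "finite G" "G \<subseteq> {a \<in> A. f a \<in> I}"
      "\<And>J'. ideal_set A J' \<Longrightarrow> G \<subseteq> J' \<Longrightarrow> {a \<in> A. f a \<in> I} \<subseteq> J'" by simp_all
    have GS: "f ` G \<subseteq> carrier S" using G im by auto
    have "I = genideal S (f ` G)"
    proof
      show "genideal S (f ` G) \<subseteq> I" by (rule S.R.genideal_minimal[OF \<open>ideal I S\<close>]) (use G in auto)
      have "G \<subseteq> {a \<in> A. f a \<in> genideal S (f ` G)}"
        using S.R.genideal_self[OF GS] G by auto
      then have "{a \<in> A. f a \<in> I} \<subseteq> {a \<in> A. f a \<in> genideal S (f ` G)}"
        using G(3) pull[OF S.R.genideal_ideal[OF GS]] by blast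
      moreover have "I \<subseteq> f ` A" using ideal.Icarr[OF \<open>ideal I S\<close>] im by auto
      ultimately show "I \<subseteq> genideal S (f ` G)" by auto
    qed
    then show "\<exists>B\<subseteq>carrier S. finite B \<and> I = genideal S B" using GS G(1) by blast
  qed
qed

context field_subring
begin

text \<open>
  The definition of a noetherian scheme asks for rings of the type of sections, so the spectrum is
  compared with that of a copy of \<open>A\<close> on constant functions.
\<close>

lemma noetherian:
  assumes "noeth A" shows "noetherian_scheme \<XX>"
proof -
  define e :: "'l \<Rightarrow> 'l set \<Rightarrow> ('l \<times> 'l) set" where "e a = (\<lambda>_. {(a, a)})" for a
  have e_inj: "inj_on e B" for B by (auto simp: inj_on_def e_def fun_eq_iff)
  define d where "d = inv_into A e"
  have de: "d (e a) = a" if "a \<in> A" for a using inv_into_f_f[OF e_inj that] by (simp add: d_def)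
  define S :: "('l set \<Rightarrow> ('l \<times> 'l) set) ring" where
    "S = \<lparr>carrier = e ` A, monoid.mult = (\<lambda>x y. e (d x * d y)), one = e 1, ring.zero = e 0, add = (\<lambda>x y. e (d x + d y))\<rparr>"
  have S: "e ` A = carrier S" "\<And>x y. x \<in> A \<Longrightarrow> y \<in> A \<Longrightarrow> e x \<otimes>\<^bsub>S\<^esub> e y = e (x * y)"
    "\<And>x y. x \<in> A \<Longrightarrow> y \<in> A \<Longrightarrow> e x \<oplus>\<^bsub>S\<^esub> e y = e (x + y)" "\<one>\<^bsub>S\<^esub> = e 1" "\<zero>\<^bsub>S\<^esub> = e 0"
    by (simp_all add: S_def de)
  have noeth: "noetherian_ring S" by (rule noetherian_transport[OF A assms S(1) e_inj]) (simp_all add: S)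
  have emb: "embedded S d" unfolding d_def by (rule embedded_transport[OF A S(1) e_inj]) (simp_all add: S)
  interpret E: embedded S d by fact
  have AD: "1 \<in> A" "0 \<in> A" "\<And>x y. x \<in> A \<Longrightarrow> y \<in> A \<Longrightarrow> x * y \<in> A" "\<And>x y. x \<in> A \<Longrightarrow> y \<in> A \<Longrightarrow> x + y \<in> A"
    by (simp_all add: subring_setD[OF A])
  have d_hom: "d \<in> ring_hom S (sub_ring A)"
    by (rule ring_hom_memI) (auto simp: S(1)[symmetric] S(2-5) de AD)
  \<comment> \<open>An isomorphism is a localization at \<open>1\<close>.\<close>
  interpret L: localization "sub_ring A" "\<lambda>x. x" S d "\<one>\<^bsub>S\<^esub>"
  proof (intro localization.intro localization_axioms.intro embedded_hom.intro embedded_hom_axioms.intro)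
    show "embedded (sub_ring A) (\<lambda>x. x)" by (rule embedded_axioms)
    show "inj_on d (carrier S)" by (rule E.inj)
    show "d \<one>\<^bsub>S\<^esub> \<in> Units (sub_ring A)" by (auto simp: S(4) de AD Units_def intro!: bexI[of _ 1])
    show "\<exists>a\<in>carrier S. \<exists>n. s * d \<one>\<^bsub>S\<^esub> ^ n = d a" if "s \<in> carrier (sub_ring A)" for s
      by (rule bexI[of _ "e s"]) (use that in \<open>auto simp: S(1)[symmetric] de intro!: exI[of _ 0]\<close>)
  qed (simp_all add: E.cring_R d_hom)
  have "L.U0 = Spec S" using SpecD(3) by (auto simp: L.U0_def)
  then have "lrs_iso \<XX> (affine_scheme S) (spec_map S d) (spec_comap S (sub_ring A) d)"
    using L.iso by (simp add: E.open_subspace_whole)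
  then have "lrs_iso (open_subspace \<XX> spec) (affine_scheme S) (spec_map S d) (spec_comap S (sub_ring A) d)"
    by (simp add: open_subspace_whole)
  then have "\<exists>(R :: ('l set \<Rightarrow> ('l \<times> 'l) set) ring) f fs. cring R \<and> noetherian_ring R \<and>
           lrs_iso (open_subspace \<XX> spec) (affine_scheme R) f fs"
    using noeth E.cring_R by blast
  then show ?thesis
    unfolding noetherian_scheme_def using open_spec top_X
    by (intro exI[of _ "{spec}"]) simp
qed

end


section \<open>Generic points and the valuation of a principal prime divisor\<close>

context embedded
begin

lemma closed_zariski: "closedin (zariski R) Z \<longleftrightarrow> (\<exists>E\<subseteq>carrier R. Z = zero_locus R E)"
proof
  assume Z: "closedin (zariski R) Z"
  then have "openin (zariski R) (Spec R - Z)" "Z \<subseteq> Spec R"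
    by (auto simp: closedin_def topspace_zariski[OF cring_R])
  then obtain E where E: "E \<subseteq> carrier R" "Spec R - Z = Spec R - zero_locus R E"
    unfolding open_zariski by blast
  moreover have "zero_locus R E \<subseteq> Spec R" by (auto simp: zero_locus_def)
  ultimately have "Z = zero_locus R E" using \<open>Z \<subseteq> Spec R\<close> by blast
  then show "\<exists>E\<subseteq>carrier R. Z = zero_locus R E" using E by blast
next
  assume "\<exists>E\<subseteq>carrier R. Z = zero_locus R E"
  then obtain E where E: "E \<subseteq> carrier R" "Z = zero_locus R E" by blast
  then have "openin (zariski R) (Spec R - Z)" unfolding open_zariski by blast
  then show "closedin (zariski R) Z"
    using E(2) by (auto simp: closedin_def topspace_zariski[OF cring_R] zero_locus_def)
qed

lemma closure_point:
  assumes P: "P \<in> Spec R" shows "zariski R closure_of {P} = zero_locus R P"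
proof (rule closure_of_unique)
  show "{P} \<subseteq> zero_locus R P" using P by (auto simp: zero_locus_def)
  show "closedin (zariski R) (zero_locus R P)"
    unfolding closed_zariski using SpecD(1)[OF P] by blast
  fix T assume T: "{P} \<subseteq> T" "closedin (zariski R) T"
  then obtain E where "T = zero_locus R E" unfolding closed_zariski by blast
  then show "zero_locus R P \<subseteq> T" using T(1) by (auto simp: zero_locus_def)
qed

lemma zero_locus_inj:
  "P \<in> Spec R \<Longrightarrow> Q \<in> Spec R \<Longrightarrow> zero_locus R P = zero_locus R Q \<Longrightarrow> P = Q"
  by (auto simp: zero_locus_def)

lemma irreducible_zero_locus:
  assumes P: "P \<in> Spec R" shows "irreducible_closed (zariski R) (zero_locus R P)"
  unfolding irreducible_closed_def irreducible_in_def
proof (intro conjI allI impI; (elim conjE)?)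
  show "closedin (zariski R) (zero_locus R P)" unfolding closed_zariski using SpecD(1)[OF P] by blast
  show "zero_locus R P \<subseteq> topspace (zariski R)" by (auto simp: topspace_zariski[OF cring_R] zero_locus_def)
  have PP: "P \<in> zero_locus R P" using P by (simp add: zero_locus_def)
  then show "zero_locus R P \<noteq> {}" by blast
  fix F G assume FG: "closedin (zariski R) F" "closedin (zariski R) G" "zero_locus R P \<subseteq> F \<union> G"
  then obtain E E' where "F = zero_locus R E" "G = zero_locus R E'" unfolding closed_zariski by blast
  moreover have "P \<in> F \<or> P \<in> G" using FG(3) PP by blast
  ultimately show "zero_locus R P \<subseteq> F \<or> zero_locus R P \<subseteq> G" by (auto simp: zero_locus_def)
qed

text \<open>
  The ideal of functions vanishing on an irreducible closed set is prime: if \<open>a * b\<close> vanishes on the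
  set, then the zero loci of \<open>a\<close> and \<open>b\<close> cover it.
\<close>

lemma irreducible_closedE:
  assumes Z: "irreducible_closed (zariski R) Z"
  obtains P where "P \<in> Spec R" "Z = zero_locus R P"
proof -
  have ne: "Z \<noteq> {}" and irr: "\<And>F G. closedin (zariski R) F \<Longrightarrow> closedin (zariski R) G \<Longrightarrow> Z \<subseteq> F \<union> G \<Longrightarrow> Z \<subseteq> F \<or> Z \<subseteq> G"
    using Z by (auto simp: irreducible_closed_def irreducible_in_def)
  obtain E where E: "E \<subseteq> carrier R" "Z = zero_locus R E"
    using Z unfolding irreducible_closed_def closed_zariski by blast
  define P where "P = {a \<in> carrier R. \<forall>Q\<in>Z. a \<in> Q}"
  have ZS: "Q \<in> Spec R" if "Q \<in> Z" for Q using that E by (simp add: zero_locus_def)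
  have "P \<in> Spec R"
  proof (rule SpecI[OF cring_R])
    show "\<one> \<notin> P" using ne ZS SpecD(3) by (auto simp: P_def)
    fix a b assume ab: "a \<in> carrier R" "b \<in> carrier R" "a \<otimes> b \<in> P"
    have "Z \<subseteq> zero_locus R {a} \<union> zero_locus R {b}"
    proof
      fix Q assume Q: "Q \<in> Z"
      then have "a \<in> Q \<or> b \<in> Q" using SpecD(4)[OF ZS[OF Q] ab(1,2)] ab(3) by (auto simp: P_def)
      then show "Q \<in> zero_locus R {a} \<union> zero_locus R {b}" using ZS[OF Q] by (auto simp: zero_locus_def)
    qed
    moreover have "closedin (zariski R) (zero_locus R {c})" if "c \<in> carrier R" for c
      unfolding closed_zariski using that by blast
    ultimately have "Z \<subseteq> zero_locus R {a} \<or> Z \<subseteq> zero_locus R {b}" using irr ab by blast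
    then show "a \<in> P \<or> b \<in> P" using ab by (auto simp: P_def zero_locus_def)
  next
    show "\<zero> \<in> P" using ZS SpecD(2) by (auto simp: P_def)
    show "\<And>a b. a \<in> P \<Longrightarrow> b \<in> P \<Longrightarrow> a \<oplus> b \<in> P" using SpecD(5)[OF ZS] by (auto simp: P_def)
    show "\<And>a r. a \<in> P \<Longrightarrow> r \<in> carrier R \<Longrightarrow> r \<otimes> a \<in> P" using SpecD(4)[OF ZS] by (auto simp: P_def)
  qed (auto simp: P_def)
  moreover have "Z = zero_locus R P"
  proof
    show "Z \<subseteq> zero_locus R P" using ZS by (auto simp: zero_locus_def P_def)
    have "E \<subseteq> P" using E by (auto simp: P_def zero_locus_def)
    then show "zero_locus R P \<subseteq> Z" using E(2) by (auto simp: zero_locus_def)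
  qed
  ultimately show ?thesis using that by blast
qed

lemma generic_point_zero_locus:
  assumes P: "P \<in> Spec R" shows "generic_point (affine_scheme R) (zero_locus R P) = P"
  unfolding generic_point_def
proof (rule the_equality)
  show "P \<in> topspace (points (affine_scheme R)) \<and> points (affine_scheme R) closure_of {P} = zero_locus R P"
    using P closure_point[OF P] topspace_zariski[OF cring_R] by simp
  fix Q assume "Q \<in> topspace (points (affine_scheme R)) \<and> points (affine_scheme R) closure_of {Q} = zero_locus R P"
  then show "Q = P" using closure_point[of Q] zero_locus_inj[OF _ P] topspace_zariski[OF cring_R] by simp
qed

lemma zero_locus_zero: "zero_locus R {\<zero>} = Spec R"
  using SpecD(2) by (auto simp: zero_locus_def)

lemma generic_point_Spec: "generic_point (affine_scheme R) (topspace (points (affine_scheme R))) = {\<zero>}"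
  using generic_point_zero_locus[OF zero_in_Spec] by (simp add: zero_locus_zero topspace_zariski[OF cring_R])

lemma irreducible_Spec: "irreducible_in (points (affine_scheme R)) (topspace (points (affine_scheme R)))"
  using irreducible_zero_locus[OF zero_in_Spec]
  by (simp add: irreducible_closed_def zero_locus_zero topspace_zariski[OF cring_R])

end

text \<open>
  A prime element \<open>p\<close> such that every nonzero element is divisible by only finitely many powers of
  \<open>p\<close>. The local ring at the ideal generated by \<open>p\<close> is then a discrete valuation ring with
  uniformizer \<open>p\<close>, which makes the zero locus of \<open>p\<close> a prime divisor.
\<close>

locale prime_element = field_subring A for A :: "'l::field set" +
  fixes p :: 'l
  assumes p: "p \<in> A" "p \<noteq> 0"
    and prime: "(*) p ` A \<in> Spec (sub_ring A)"
    and factor: "\<And>f. f \<in> A \<Longrightarrow> f \<noteq> 0 \<Longrightarrow> \<exists>n. \<exists>g\<in>A - (*) p ` A. f = p ^ n * g"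
begin

abbreviation "PP \<equiv> (*) p ` A"
abbreviation "K \<equiv> loc {0}"

lemmas AD = subring_setD[OF A]

lemma zero_Spec: "{0} \<in> spec"
  using zero_in_Spec by simp

lemma generic: "generic_point \<XX> (topspace (points \<XX>)) = {0}"
  using generic_point_Spec by simp

lemma locus: "zero_locus (sub_ring A) {p} = zero_locus (sub_ring A) PP"
proof -
  have "p \<in> Q \<longleftrightarrow> PP \<subseteq> Q" if Q: "Q \<in> spec" for Q
    using SpecD(4)[OF Q, of p] p AD(1) by (auto intro: image_eqI[of _ _ 1])
  then show ?thesis by (auto simp: zero_locus_def)
qed

lemma notin_PP: "g \<in> A - PP \<Longrightarrow> h \<in> A - PP \<Longrightarrow> g * h \<in> A - PP"
  using SpecD(4)[OF prime, of g h] AD(6) by auto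

lemma notin_nonzero: "g \<in> A - PP \<Longrightarrow> g \<noteq> 0"
  using SpecD(2)[OF prime] by auto

text \<open>
  A prime ideal inside \<open>PP\<close> that contains some \<open>p\<^sup>n * g \<noteq> 0\<close> with \<open>g\<close> outside \<open>PP\<close> contains \<open>p\<close>. So
  nothing lies strictly between \<open>PP\<close> and zero, which bounds the codimension of the divisor by one.
\<close>

lemma prime_below: 
  assumes Q: "Q \<in> spec" "Q \<subseteq> PP" "Q \<noteq> PP" shows "Q = {0}"
proof (rule ccontr)
  assume "Q \<noteq> {0}"
  then obtain f where f: "f \<in> Q" "f \<noteq> 0" using SpecD(2)[OF Q(1)] by auto
  obtain n g where g: "g \<in> A - PP" "f = p ^ n * g" using factor[of f] f SpecD(1)[OF Q(1)] by auto
  have pQ: "p \<in> Q" if "p ^ m \<in> Q" for m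
    using that
  proof (induction m)
    case 0 then show ?case using SpecD(3)[OF Q(1)] by simp
  next
    case (Suc m) then show ?case
      using SpecD(4)[OF Q(1), of p "p ^ m"] p subring_set_power[OF A p(1)] by auto
  qed
  have "p ^ n \<in> Q \<or> g \<in> Q" using SpecD(4)[OF Q(1), of "p ^ n" g] subring_set_power[OF A p(1)] g f by auto
  then have "p \<in> Q" using pQ g Q(2) by auto
  then have "PP \<subseteq> Q" using SpecD(4)[OF Q(1), of p] p by auto
  then show False using Q by auto
qed

lemma prime_divisor: "prime_divisor \<XX> (zero_locus (sub_ring A) {p})"
  unfolding prime_divisor_def affine_simps locus
proof (intro conjI)
  show "irreducible_closed (zariski (sub_ring A)) (zero_locus (sub_ring A) PP)"
    by (rule irreducible_zero_locus[OF prime])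
  have ne: "PP \<noteq> {0}" using p AD(1) by (auto intro: image_eqI[of _ _ 1])
  have "zero_locus (sub_ring A) PP \<subset> zero_locus (sub_ring A) {0}"
  proof
    show "zero_locus (sub_ring A) PP \<subseteq> zero_locus (sub_ring A) {0}"
      using SpecD(2)[OF prime] by (auto simp: zero_locus_def)
    show "zero_locus (sub_ring A) PP \<noteq> zero_locus (sub_ring A) {0}"
      using zero_locus_inj[OF prime zero_Spec] ne by blast
  qed
  then show "\<exists>W. irreducible_closed (zariski (sub_ring A)) W \<and> zero_locus (sub_ring A) PP \<subset> W"
    using irreducible_zero_locus[OF zero_Spec] by blast
  show "\<nexists>W W'. irreducible_closed (zariski (sub_ring A)) W \<and> irreducible_closed (zariski (sub_ring A)) W' \<and>
        zero_locus (sub_ring A) PP \<subset> W \<and> W \<subset> W'"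
  proof (rule notI, elim exE conjE)
    fix W W' assume W: "irreducible_closed (zariski (sub_ring A)) W" "irreducible_closed (zariski (sub_ring A)) W'"
      "zero_locus (sub_ring A) PP \<subset> W" "W \<subset> W'"
    obtain Q where Q: "Q \<in> spec" "W = zero_locus (sub_ring A) Q" using irreducible_closedE[OF W(1)] .
    obtain Q' where Q': "Q' \<in> spec" "W' = zero_locus (sub_ring A) Q'" using irreducible_closedE[OF W(2)] .
    have "PP \<in> W" using W(3) prime by (auto simp: zero_locus_def)
    then have "Q \<subseteq> PP" using Q by (simp add: zero_locus_def)
    moreover have "Q \<noteq> PP" using W(3) Q by auto
    ultimately have "Q = {0}" using prime_below Q by blast
    then have "W = spec" using Q zero_locus_zero by simp
    moreover have "W' \<subseteq> spec" using Q' by (auto simp: zero_locus_def)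
    ultimately show False using W(4) by auto
  qed
qed

lemma irreducible: "irreducible_in (points \<XX>) (zero_locus (sub_ring A) {p})"
  using irreducible_zero_locus[OF prime] unfolding locus by (simp add: irreducible_closed_def)

lemma sr: "subring_set K" "subring_set (loc PP)"
  using subring_loc zero_Spec prime by auto

lemma K_inverse: "z \<in> K \<Longrightarrow> inverse z \<in> K"
proof -
  assume "z \<in> K"
  then obtain a s where as: "a \<in> A" "s \<in> A" "s \<noteq> 0" "z = a / s" by (auto elim!: locE)
  then show ?thesis using locI'[of s a "{0}"] locI'[of 0 1 "{0}"] AD(1,2) by (cases "a = 0") auto
qed

lemma loc_PP_K: "z \<in> loc PP \<Longrightarrow> z \<in> K"
  using notin_nonzero by (elim locE) (auto intro: locI')

lemma A_loc: "a \<in> A \<Longrightarrow> a \<in> loc Q" if "Q \<in> spec"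
  using loc_carrier[OF that] by simp

text \<open>
  The multiplicity of \<open>p\<close> in an element of the fraction field, whose nonzero elements are
  \<open>p\<^sup>k * g / h\<close> with \<open>g\<close> and \<open>h\<close> prime to \<open>p\<close>.
\<close>

definition ord :: "'l \<Rightarrow> int" where
  "ord z = (THE k. \<exists>g\<in>A - PP. \<exists>h\<in>A - PP. z = p powi k * (g / h))"

lemma ord_eq:
  assumes g: "g \<in> A - PP" and h: "h \<in> A - PP" shows "ord (p powi k * (g / h)) = k"
proof -
  have less: False
    if "k < l" "g \<in> A - PP" "h \<in> A - PP" "g' \<in> A - PP" "h' \<in> A - PP" "p powi k * (g / h) = p powi l * (g' / h')"
    for k l g h g' h'
  proof -
    have nz: "g \<noteq> 0" "h \<noteq> 0" "g' \<noteq> 0" "h' \<noteq> 0" using that notin_nonzero by auto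
    define n where "n = nat (l - k - 1)"
    have "l = k + 1 + int n" using that(1) by (simp add: n_def)
    then have "p powi l = p powi k * p * p ^ n" using p by (simp add: power_int_add)
    then have "g * h' = p * (p ^ n * (g' * h))" using that(6) nz p by (simp add: field_simps)
    moreover have "p ^ n * (g' * h) \<in> A" using that AD(6) subring_set_power[OF A p(1)] by auto
    ultimately have "g * h' \<in> PP" by blast
    then show False using notin_PP that by blast
  qed
  show ?thesis
    unfolding ord_def
  proof (rule the_equality)
    show "\<exists>g'\<in>A - PP. \<exists>h'\<in>A - PP. p powi k * (g / h) = p powi k * (g' / h')" using g h by blast
    fix l assume "\<exists>g'\<in>A - PP. \<exists>h'\<in>A - PP. p powi k * (g / h) = p powi l * (g' / h')"
    then obtain g' h' where *: "g' \<in> A - PP" "h' \<in> A - PP" "p powi k * (g / h) = p powi l * (g' / h')" by blast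
    show "l = k"
      using less[OF _ g h *(1,2,3)] less[OF _ *(1,2) g h *(3)[symmetric]] by (cases k l rule: linorder_cases) auto
  qed
qed

lemma K_decomp:
  assumes "z \<in> K" "z \<noteq> 0"
  obtains k g h where "g \<in> A - PP" "h \<in> A - PP" "z = p powi k * (g / h)"
proof -
  obtain a s where as: "a \<in> A" "s \<in> A" "s \<noteq> 0" "z = a / s" using assms(1) by (auto elim!: locE)
  then have "a \<noteq> 0" using assms by auto
  obtain n g where g: "g \<in> A - PP" "a = p ^ n * g" using factor[OF as(1) \<open>a \<noteq> 0\<close>] by blast
  obtain m h where h: "h \<in> A - PP" "s = p ^ m * h" using factor[OF as(2,3)] by blast
  have "z = p powi (int n - int m) * (g / h)"
    using p as(4) g(2) h(2) by (simp add: power_int_diff)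
  then show ?thesis using that g h by blast
qed

lemma ord_mult:
  assumes "z \<in> K" "z \<noteq> 0" "w \<in> K" "w \<noteq> 0" shows "ord (z * w) = ord z + ord w"
proof -
  obtain k g h where z: "g \<in> A - PP" "h \<in> A - PP" "z = p powi k * (g / h)" using K_decomp[OF assms(1,2)] .
  obtain l g' h' where w: "g' \<in> A - PP" "h' \<in> A - PP" "w = p powi l * (g' / h')" using K_decomp[OF assms(3,4)] .
  have zw: "z * w = p powi (k + l) * ((g * g') / (h * h'))" using z(3) w(3) p by (simp add: power_int_add)
  have "ord (z * w) = k + l" unfolding zw by (rule ord_eq[OF notin_PP[OF z(1) w(1)] notin_PP[OF z(2) w(2)]])
  moreover have "ord z = k" "ord w = l" unfolding z(3) w(3) using ord_eq z w by blast+
  ultimately show ?thesis by simp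
qed

lemma powi_K: "p powi k \<in> K" "ord (p powi k) = k"
proof -
  have 1: "1 \<in> A - PP" using SpecD(3)[OF prime] AD(1) by auto
  show "ord (p powi k) = k" using ord_eq[OF 1 1, of k] by simp
  have "p ^ n \<in> K" for n using subring_set_power[OF sr(1) A_loc[OF zero_Spec p(1)]] .
  then show "p powi k \<in> K" using K_inverse by (auto simp: power_int_def power_inverse)
qed

lemma ord_nonneg:
  assumes "z \<in> K" "z \<noteq> 0" shows "0 \<le> ord z \<longleftrightarrow> z \<in> loc PP"
proof
  obtain k g h where z: "g \<in> A - PP" "h \<in> A - PP" "z = p powi k * (g / h)" using K_decomp[OF assms] .
  show "z \<in> loc PP" if "0 \<le> ord z"
  proof -
    have "k \<ge> 0" using that ord_eq z by simp
    then have "z = (p ^ nat k * g) / h" using z(3) by (simp add: power_int_def)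
    then show ?thesis using locI' z AD(6) subring_set_power[OF A p(1)] by auto
  qed
  show "0 \<le> ord z" if zl: "z \<in> loc PP"
  proof -
    obtain a s where as: "a \<in> A" "s \<in> A" "s \<notin> PP" "z = a / s" using locE[OF zl] .
    have "a \<noteq> 0" using as(4) assms(2) by auto
    then obtain n g where g: "g \<in> A - PP" "a = p ^ n * g" using factor[OF as(1)] by blast
    have zn: "z = p powi (int n) * (g / s)" using as g by simp
    have "ord z = int n" unfolding zn by (rule ord_eq) (use g as in auto)
    then show ?thesis by simp
  qed
qed

text \<open>
  After division by \<open>p\<^sup>k\<close> for \<open>k\<close> the smaller order, both summands lie in the local ring, and so does
  their sum.
\<close>

lemma ord_add:
  assumes z: "z \<in> K" "z \<noteq> 0" and w: "w \<in> K" "w \<noteq> 0" and zw: "z + w \<noteq> 0"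
  shows "min (ord z) (ord w) \<le> ord (z + w)"
proof -
  define k where "k = min (ord z) (ord w)"
  let ?q = "p powi (- k)"
  have q: "?q \<in> K" "?q \<noteq> 0" "ord ?q = - k" using powi_K p by auto
  have K: "z + w \<in> K" using z w sr by (auto intro: subring_setD)
  have "z * ?q \<in> loc PP" "w * ?q \<in> loc PP"
    using ord_nonneg[of "z * ?q"] ord_nonneg[of "w * ?q"] z w q ord_mult subring_setD(6)[OF sr(1)]
    by (auto simp: k_def)
  then have "(z + w) * ?q \<in> loc PP" using subring_setD(4)[OF sr(2)] by (simp add: distrib_right)
  then have "0 \<le> ord ((z + w) * ?q)" using ord_nonneg[of "(z + w) * ?q"] K q zw subring_setD(6)[OF sr(1)] by auto
  then show ?thesis using ord_mult[OF K zw q(1,2)] q(3) by (simp add: k_def)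
qed

abbreviation "germ0 \<equiv> gm spec {0}"

lemma function_field: "function_field \<XX> = stalk \<XX> {0}"
  by (simp add: function_field_def generic del: affine_simps)

lemmas ff = stalk_simps[OF zero_Spec, folded function_field]

lemma germ0_inj: "z \<in> K \<Longrightarrow> germ0 z = germ0 w \<Longrightarrow> z = w"
  using gm_inj[OF open_spec zero_Spec] by blast

lemma field: "field (function_field \<XX>)"
proof -
  interpret F: cring "function_field \<XX>"
    unfolding function_field using embedded.cring_R[OF stalk_embedded[OF zero_Spec]] .
  show ?thesis
  proof (rule F.cring_fieldI)
    have U: "germ0 z \<in> Units (function_field \<XX>) \<longleftrightarrow> z \<noteq> 0" if "z \<in> K" for z
      using gm_Units[OF open_spec zero_Spec that] K_inverse[OF that]
      by (simp add: function_field open_subspace_whole)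
    show "Units (function_field \<XX>) = carrier (function_field \<XX>) - {\<zero>\<^bsub>function_field \<XX>\<^esub>}"
    proof (intro equalityI subsetI)
      fix u assume u: "u \<in> Units (function_field \<XX>)"
      then have "u \<in> carrier (function_field \<XX>)" by (auto simp: Units_def)
      then obtain z where z: "z \<in> K" "u = germ0 z" unfolding ff(1) by blast
      then have "u \<noteq> \<zero>\<^bsub>function_field \<XX>\<^esub>" using u U[OF z(1)] germ0_inj[OF z(1), of 0] ff(3) by auto
      then show "u \<in> carrier (function_field \<XX>) - {\<zero>\<^bsub>function_field \<XX>\<^esub>}" using z ff(1) by auto
    next
      fix u assume "u \<in> carrier (function_field \<XX>) - {\<zero>\<^bsub>function_field \<XX>\<^esub>}"
      then obtain z where z: "z \<in> K" "u = germ0 z" "u \<noteq> \<zero>\<^bsub>function_field \<XX>\<^esub>" unfolding ff(1) by blast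
      then show "u \<in> Units (function_field \<XX>)" using U[OF z(1)] ff(3) by auto
    qed
  qed
qed

text \<open>
  A section near the generic point of the divisor is also defined at the generic point of the
  spectrum, which lies in every nonempty open set. Comparing values shows that these sections form
  the local ring at \<open>PP\<close> inside the function field.
\<close>

lemma divisor_ring:
  "{rational_function \<XX> U s | U s. openin (points \<XX>) U \<and> generic_point \<XX> (zero_locus (sub_ring A) {p}) \<in> U \<and>
      s \<in> carrier (sections \<XX> U)} = germ0 ` loc PP"
proof -
  have gen: "generic_point \<XX> (zero_locus (sub_ring A) {p}) = PP"
    unfolding locus by (rule generic_point_zero_locus[OF prime])
  have germ: "rational_function \<XX> U (sec U z) = germ0 z"
    if U: "openin (zariski (sub_ring A)) U" "PP \<in> U" "z \<in> reg U" for U z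
  proof -
    have "{0} \<in> U" using zero_in_open[OF U(1)] U(2) by auto
    then have "germ (open_subspace \<XX> spec) {0} U (sec U z) = germ0 z"
      by (rule germ_eq[OF open_spec U(1) open_subset[OF U(1)] _ U(3)])
    then show ?thesis by (simp add: rational_function_def generic open_subspace_whole del: affine_simps)
  qed
  show ?thesis
    unfolding gen affine_simps
  proof (intro equalityI subsetI)
    fix q assume "q \<in> {rational_function \<XX> U s |U s. openin (zariski (sub_ring A)) U \<and> PP \<in> U \<and> s \<in> spec_sections (sub_ring A) U}"
    then obtain U s where U: "q = rational_function \<XX> U s" "openin (zariski (sub_ring A)) U" "PP \<in> U" "s \<in> spec_sections (sub_ring A) U"
      by blast
    obtain z where z: "z \<in> reg U" "s = sec U z" using U(4) unfolding spec_sections_eq[OF U(2)] by blast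
    have "z \<in> loc PP" using z(1) U(3) by (auto simp: reg_def)
    then show "q \<in> germ0 ` loc PP" using germ[OF U(2,3) z(1)] U(1) z(2) by auto
  next
    fix q assume "q \<in> germ0 ` loc PP"
    then obtain z where z: "z \<in> loc PP" "q = germ0 z" by blast
    obtain V where V: "openin (zariski (sub_ring A)) V" "PP \<in> V" "z \<in> reg V"
      using loc_reg[OF open_spec prime z(1)] by blast
    have "sec V z \<in> spec_sections (sub_ring A) V" using spec_sections_eq[OF V(1)] V(3) by blast
    then show "q \<in> {rational_function \<XX> U s |U s. openin (zariski (sub_ring A)) U \<and> PP \<in> U \<and> s \<in> spec_sections (sub_ring A) U}"
      using germ[OF V] z(2) V by blast
  qed
qed

lemma divisor_valuation_exists: "\<exists>v. divisor_valuation \<XX> (zero_locus (sub_ring A) {p}) v"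
proof -
  define val where "val z = (if z = 0 then Pinf else Fin (ord z))" for z
  define v where "v q = val (inv_into K germ0 q)" for q
  have v: "v (germ0 z) = val z" if "z \<in> K" for z
  proof -
    have "inj_on germ0 K" using germ0_inj by (auto simp: inj_on_def)
    then show ?thesis using that by (simp add: v_def)
  qed
  have closed: "z * w \<in> K" "z + w \<in> K" if "z \<in> K" "w \<in> K" for z w
    using that sr by (auto intro: subring_setD)
  have "discrete_valuation (function_field \<XX>) v"
    unfolding discrete_valuation_def ff(1)
  proof (intro conjI field ballI; (elim imageE)?; hypsubst?)
    fix z assume z: "z \<in> K"
    show "v (germ0 z) \<noteq> Minf" using v[OF z] by (simp add: val_def)
    show "(v (germ0 z) = Pinf) = (germ0 z = \<zero>\<^bsub>function_field \<XX>\<^esub>)"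
      using v[OF z] germ0_inj[OF z, of 0] ff(3) by (auto simp: val_def)
  next
    fix z w assume zw: "z \<in> K" "w \<in> K"
    have "val (z * w) = val z + val w"
      using ord_mult[OF zw(1) _ zw(2)] by (auto simp: val_def)
    then show "v (germ0 z \<otimes>\<^bsub>function_field \<XX>\<^esub> germ0 w) = v (germ0 z) + v (germ0 w)"
      using v zw closed ff(4) by simp
    have "min (val z) (val w) \<le> val (z + w)"
      using ord_add[OF zw(1) _ zw(2)] by (auto simp: val_def)
    then show "min (v (germ0 z)) (v (germ0 w)) \<le> v (germ0 z \<oplus>\<^bsub>function_field \<XX>\<^esub> germ0 w)"
      using v zw closed ff(5) by simp
  next
    have "v (germ0 p) = 1"
      using v[of p] powi_K[of 1] p by (simp add: val_def one_extended_def)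
    moreover have "p \<in> K" using powi_K(1)[of 1] by simp
    ultimately show "\<exists>q\<in>germ0 ` K. v q = 1" by blast
  qed
  moreover have "{q \<in> carrier (function_field \<XX>). 0 \<le> v q} = germ0 ` loc PP"
  proof -
    have "0 \<le> v (germ0 z) \<longleftrightarrow> z \<in> loc PP" if z: "z \<in> K" for z
      using v[OF z] ord_nonneg[OF z] subring_setD(2)[OF sr(2)] by (auto simp: val_def zero_extended_def)
    then show ?thesis unfolding ff(1) using loc_PP_K by blast
  qed
  ultimately show ?thesis
    unfolding divisor_valuation_def divisor_ring using prime_divisor by blast
qed

text \<open>
  The valuation is determined by its ring: elements outside \<open>PP\<close> are units of the ring, and since
  the value of every element is a multiple of the value of \<open>p\<close>, normalization gives \<open>p\<close> value one.
\<close>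

lemma divisor_valuation_values:
  assumes v: "divisor_valuation \<XX> (zero_locus (sub_ring A) {p}) v"
  shows "v (germ0 p) = Fin 1" "g \<in> A - PP \<Longrightarrow> v (germ0 g) = Fin 0"
proof -
  have dv: "discrete_valuation (function_field \<XX>) v"
    and ring: "{q \<in> carrier (function_field \<XX>). 0 \<le> v q} = germ0 ` loc PP"
    using v unfolding divisor_valuation_def divisor_ring by auto
  have nonneg: "0 \<le> v (germ0 z)" if "z \<in> loc PP" for z using ring that by blast
  have val: "\<exists>k. v (germ0 z) = Fin k" if "z \<in> K" "z \<noteq> 0" for z
  proof -
    have "germ0 z \<in> carrier (function_field \<XX>)" using that ff(1) by blast
    moreover have "germ0 z \<noteq> \<zero>\<^bsub>function_field \<XX>\<^esub>" using that germ0_inj[OF that(1), of 0] ff(3) by auto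
    ultimately show ?thesis using dv unfolding discrete_valuation_def by (cases "v (germ0 z)") auto
  qed
  \<comment> \<open>The given valuation as an integer-valued function on the nonzero elements of the fraction field.\<close>
  define w where "w z = (THE k. v (germ0 z) = Fin k)" for z
  have w: "v (germ0 z) = Fin (w z)" if "z \<in> K" "z \<noteq> 0" for z
    using val[OF that] by (auto simp: w_def)
  have wm: "w (y * z) = w y + w z" if "y \<in> K" "y \<noteq> 0" "z \<in> K" "z \<noteq> 0" for y z
  proof -
    have "v (germ0 (y * z)) = v (germ0 y) + v (germ0 z)"
      using dv that ff(4)[of y z, symmetric] unfolding discrete_valuation_def ff(1) by auto
    moreover have "y * z \<in> K" using that sr by (auto intro: subring_setD)
    ultimately show ?thesis using w[of y] w[of z] w[of "y * z"] that by simp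
  qed
  have w1: "w 1 = 0" using wm[of 1 1] powi_K(1)[of 0] by simp
  have winv: "w (inverse z) = - w z" if "z \<in> K" "z \<noteq> 0" for z
    using wm[of z "inverse z"] that K_inverse w1 by simp
  \<comment> \<open>Both the quotient and its inverse lie in the valuation ring.\<close>
  have unit: "w (g / h) = 0" if "g \<in> A - PP" "h \<in> A - PP" for g h
  proof -
    have "g / h \<in> loc PP" "h / g \<in> loc PP" using that locI' by auto
    moreover have nz: "g / h \<noteq> 0" "h / g \<noteq> 0" using that notin_nonzero by auto
    ultimately have "0 \<le> w (g / h)" "0 \<le> w (h / g)"
      using nonneg w loc_PP_K by (metis less_eq_extended.simps(1) zero_extended_def)+
    moreover have "w (h / g) = - w (g / h)" using winv[of "g / h"] \<open>g / h \<in> loc PP\<close> loc_PP_K nz by simp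
    ultimately show ?thesis by simp
  qed
  have pK: "p \<in> K" using powi_K(1)[of 1] by simp
  have wpow: "w (p ^ n) = int n * w p" for n
  proof (induction n)
    case (Suc n)
    have "p ^ n \<in> K" using powi_K(1)[of "int n"] by simp
    then show ?case using Suc wm[OF pK p(2), of "p ^ n"] p by (simp add: algebra_simps)
  qed (simp add: w1)
  have wpowi: "w (p powi k) = k * w p" for k
  proof (cases "k \<ge> 0")
    case True then show ?thesis using wpow[of "nat k"] by (simp add: power_int_def)
  next
    case False
    have "p ^ nat (- k) \<in> K" using powi_K(1)[of "int (nat (- k))"] by (simp only: power_int_of_nat)
    then have "w (inverse (p ^ nat (- k))) = - w (p ^ nat (- k))" using winv p by simp
    then show ?thesis using False wpow[of "nat (- k)"] by (simp add: power_int_def power_inverse)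
  qed
  \<comment> \<open>Normalization: for an element \<open>q = p\<^sup>k * g / h\<close> of value one, \<open>k * w p = 1\<close> with \<open>w p \<ge> 0\<close>.\<close>
  obtain q where q: "q \<in> K" "v (germ0 q) = 1" using dv unfolding discrete_valuation_def ff(1) by blast
  have "q \<noteq> 0"
  proof
    assume "q = 0"
    then have "v (germ0 q) = Pinf" using dv q(1) ff(3) unfolding discrete_valuation_def ff(1) by auto
    then show False using q(2) by (simp add: one_extended_def)
  qed
  obtain k g0 h0 where qd: "g0 \<in> A - PP" "h0 \<in> A - PP" "q = p powi k * (g0 / h0)"
    using K_decomp[OF q(1) \<open>q \<noteq> 0\<close>] .
  have gh: "g0 / h0 \<in> K" "g0 / h0 \<noteq> 0" using qd locI' loc_PP_K notin_nonzero by auto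
  have "w q = k * w p" using wm[OF powi_K(1)[of k] _ gh] wpowi unit[OF qd(1,2)] p qd(3) by simp
  moreover have "w q = 1" using w[OF q(1) \<open>q \<noteq> 0\<close>] q(2) by (simp add: one_extended_def)
  moreover have "p \<in> loc PP" using A_loc[OF prime p(1)] .
  then have "0 \<le> w p" using nonneg[of p] w[OF pK p(2)] by (simp add: zero_extended_def)
  ultimately have "w p = 1" using zmult_eq_1_iff[of k "w p"] by auto
  then show "v (germ0 p) = Fin 1" using w[OF pK p(2)] by simp
  assume g: "g \<in> A - PP"
  have "1 \<in> A - PP" using SpecD(3)[OF prime] AD(1) by auto
  then have "w g = 0" using unit[OF g, of 1] by simp
  then show "v (germ0 g) = Fin 0" using w[of g] g A_loc[OF zero_Spec] notin_nonzero by auto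
qed

lemma (in field_subring) rational_global_section:
  assumes "a \<in> A"
  shows "rational_function \<XX> (topspace (points \<XX>)) (global_section (sub_ring A) a) = gm spec {0} a"
proof -
  have "a \<in> reg spec" using loc_carrier assms by (auto simp: reg_def)
  then show ?thesis
    using germ_eq[OF open_spec open_spec subset_refl, of "{0}" a] zero_in_Spec generic_point_Spec top_X
      global_section_eq[of a] assms
    by (simp add: rational_function_def open_subspace_whole)
qed

end


section \<open>Adjoining one element to a subring of a field\<close>

definition coeffs_in :: "'l::field set \<Rightarrow> 'l Polynomial.poly \<Rightarrow> bool" where
  "coeffs_in R p \<longleftrightarrow> (\<forall>i. Polynomial.coeff p i \<in> R)"

definition adjoin :: "'l::field set \<Rightarrow> 'l \<Rightarrow> 'l set" where
  "adjoin R a = {poly p a | p. coeffs_in R p}"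

text \<open>
  For nonzero \<open>a\<close> this is the subring generated by \<open>R\<close>, \<open>a\<close> and \<open>1 / a\<close>. The form with cleared
  denominators gives access to polynomials over \<open>R\<close>.
\<close>

definition adjoin_unit :: "'l::field set \<Rightarrow> 'l \<Rightarrow> 'l set" where
  "adjoin_unit R a = {z. \<exists>n. a ^ n * z \<in> adjoin R a}"

definition transcendental_over :: "'l::field set \<Rightarrow> 'l \<Rightarrow> bool" where
  "transcendental_over R a \<longleftrightarrow> (\<forall>p. coeffs_in R p \<and> poly p a = 0 \<longrightarrow> p = 0)"

lemma coeffs_in_closed:
  assumes R: "subring_set R"
  shows "coeffs_in R 0" "coeffs_in R p \<Longrightarrow> coeffs_in R q \<Longrightarrow> coeffs_in R (p + q)"
    "coeffs_in R p \<Longrightarrow> coeffs_in R q \<Longrightarrow> coeffs_in R (p - q)"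
    "coeffs_in R p \<Longrightarrow> coeffs_in R q \<Longrightarrow> coeffs_in R (p * q)"
    "c \<in> R \<Longrightarrow> coeffs_in R (monom c n)" "coeffs_in R p \<Longrightarrow> coeffs_in R (p ^ n)" "coeffs_in R 1"
proof -
  note RD = subring_setD[OF R]
  show 0: "coeffs_in R 0" by (simp add: coeffs_in_def RD(2))
  show "coeffs_in R p \<Longrightarrow> coeffs_in R q \<Longrightarrow> coeffs_in R (p + q)" for p q by (simp add: coeffs_in_def RD(4))
  show "coeffs_in R p \<Longrightarrow> coeffs_in R q \<Longrightarrow> coeffs_in R (p - q)" by (simp add: coeffs_in_def RD(5))
  show m: "coeffs_in R p \<Longrightarrow> coeffs_in R q \<Longrightarrow> coeffs_in R (p * q)" for p q
    by (simp add: coeffs_in_def coeff_mult RD(6) subring_set_sum[OF R])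
  show mon: "c \<in> R \<Longrightarrow> coeffs_in R (monom c n)" for c n by (simp add: coeffs_in_def RD(2))
  show 1: "coeffs_in R 1" using mon[OF RD(1), of 0] by (simp add: monom_eq_1)
  show "coeffs_in R p \<Longrightarrow> coeffs_in R (p ^ n)" by (induction n) (auto simp: 1 m)
qed

lemma coeffs_in_sum:
  assumes "subring_set R" "\<And>i. i \<in> I \<Longrightarrow> coeffs_in R (f i)" shows "coeffs_in R (sum f I)"
  using assms(2) by (induction I rule: infinite_finite_induct) (auto simp: coeffs_in_closed[OF assms(1)])

lemma adjoin_subring: assumes R: "subring_set R" shows "subring_set (adjoin R a)"
  unfolding subring_set_def
proof (intro conjI ballI)
  show "1 \<in> adjoin R a" unfolding adjoin_def using coeffs_in_closed(7)[OF R] by (auto intro!: exI[of _ 1])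
  fix x y assume "x \<in> adjoin R a" "y \<in> adjoin R a"
  then obtain p q where "x = poly p a" "coeffs_in R p" "y = poly q a" "coeffs_in R q" by (auto simp: adjoin_def)
  then have "x - y = poly (p - q) a \<and> coeffs_in R (p - q)" "x * y = poly (p * q) a \<and> coeffs_in R (p * q)"
    using coeffs_in_closed(3,4)[OF R, of p q] by simp_all
  then show "x - y \<in> adjoin R a" "x * y \<in> adjoin R a" unfolding adjoin_def by blast+
qed

lemma adjoin_incl:
  assumes R: "subring_set R" shows "R \<subseteq> adjoin R a" "a \<in> adjoin R a"
proof -
  show "R \<subseteq> adjoin R a"
  proof
    fix c assume "c \<in> R"
    then have "c = poly (monom c 0) a \<and> coeffs_in R (monom c 0)"
      using coeffs_in_closed(5)[OF R] by (simp add: poly_monom)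
    then show "c \<in> adjoin R a" unfolding adjoin_def by blast
  qed
  have "poly (monom 1 1) a = a" by (simp add: poly_monom)
  then show "a \<in> adjoin R a" unfolding adjoin_def
    using coeffs_in_closed(5)[OF R subring_setD(1)[OF R], of 1] by (intro CollectI exI[of _ "monom 1 1"]) simp
qed

lemma adjoin_least:
  assumes "subring_set T" "R \<subseteq> T" "a \<in> T" shows "adjoin R a \<subseteq> T"
proof
  fix z assume "z \<in> adjoin R a"
  then obtain p where p: "z = poly p a" "coeffs_in R p" by (auto simp: adjoin_def)
  then show "z \<in> T" unfolding p(1) poly_altdef
    using assms subring_set_power[OF assms(1,3)]
    by (auto simp: coeffs_in_def intro!: subring_set_sum[OF assms(1)] subring_setD(6)[OF assms(1)])
qed

lemma adjoin_unit_subring: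
  assumes R: "subring_set R" shows "subring_set (adjoin_unit R a)"
  unfolding adjoin_unit_def by (rule fractions_subring(1)[OF adjoin_subring[OF R] adjoin_incl(2)[OF R]])

lemma adjoin_unit_incl:
  assumes R: "subring_set R"
  shows "adjoin R a \<subseteq> adjoin_unit R a" "a \<noteq> 0 \<Longrightarrow> inverse a \<in> adjoin_unit R a"
proof -
  show "adjoin R a \<subseteq> adjoin_unit R a" by (auto simp: adjoin_unit_def intro!: exI[of _ 0])
  show "inverse a \<in> adjoin_unit R a" if "a \<noteq> 0"
    unfolding adjoin_unit_def using subring_setD(1)[OF adjoin_subring[OF R, of a]] that
    by (auto intro!: exI[of _ 1])
qed

lemma adjoin_unit_least:
  assumes T: "subring_set T" "R \<subseteq> T" "a \<in> T" "inverse a \<in> T" "a \<noteq> 0" shows "adjoin_unit R a \<subseteq> T"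
proof
  fix z assume "z \<in> adjoin_unit R a"
  then obtain n where "a ^ n * z \<in> adjoin R a" by (auto simp: adjoin_unit_def)
  then have "a ^ n * z \<in> T" using adjoin_least[OF T(1-3)] by blast
  then have "inverse a ^ n * (a ^ n * z) \<in> T" using T subring_set_power subring_setD(6) by metis
  moreover have "inverse a ^ n * (a ^ n * z) = z" using T(5) by (simp add: power_inverse)
  ultimately show "z \<in> T" by simp
qed

subsection \<open>Finite generation of ideals\<close>

lemma ideal_setD:
  assumes "ideal_set A J"
  shows "J \<subseteq> A" "0 \<in> J" "x \<in> J \<Longrightarrow> y \<in> J \<Longrightarrow> x + y \<in> J" "a \<in> A \<Longrightarrow> x \<in> J \<Longrightarrow> a * x \<in> J"
  using assms by (auto simp: ideal_set_def)

lemma ideal_set_diff: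
  assumes A: "subring_set A" and J: "ideal_set A J" and "x \<in> J" "y \<in> J" shows "x - y \<in> J"
proof -
  have "-1 * y \<in> J" using ideal_setD(4)[OF J] subring_setD(1,3)[OF A] assms(4) by blast
  then show ?thesis using ideal_setD(3)[OF J assms(3), of "- y"] by simp
qed

text \<open>
  Hilbert's argument: \<open>L n\<close> is the ideal of leading coefficients in degree \<open>n\<close>. The
  \<open>L n\<close> form an increasing sequence that stops at some \<open>N\<close>, and an ideal is generated by
  elements whose leading coefficients generate \<open>L 0, \<dots>, L N\<close>.
\<close>

theorem noeth_adjoin:
  assumes R: "subring_set R" and N: "noeth R" shows "noeth (adjoin R a)"
  unfolding noeth_def
proof (intro allI impI)
  note RD = subring_setD[OF R] and C = coeffs_in_closed[OF R]
  have B: "subring_set (adjoin R a)" by (rule adjoin_subring[OF R])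
  have inB: "poly p a \<in> adjoin R a" if "coeffs_in R p" for p using that by (auto simp: adjoin_def)
  have aB: "a ^ n \<in> adjoin R a" for n using subring_set_power[OF B] adjoin_incl(2)[OF R] .
  \<comment> \<open>The leading coefficient is taken formally in degree \<open>n\<close> and may be zero. Distinct polynomials
    may represent the same element.\<close>
  define lead where "lead J n = {c \<in> R. \<exists>p. coeffs_in R p \<and> poly p a \<in> J \<and> Polynomial.degree p \<le> n \<and> Polynomial.coeff p n = c}" for J n
  have lead_ideal: "ideal_set R (lead J n)" if J: "ideal_set (adjoin R a) J" for J n
    unfolding ideal_set_def
  proof (intro conjI ballI)
    show "lead J n \<subseteq> R" by (auto simp: lead_def)
    show "0 \<in> lead J n" unfolding lead_def using RD(2) C(1) ideal_setD(2)[OF J] by (auto intro!: exI[of _ 0])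
    fix c d assume "c \<in> lead J n" "d \<in> lead J n"
    then obtain p q where p: "coeffs_in R p" "poly p a \<in> J" "Polynomial.degree p \<le> n" "Polynomial.coeff p n = c" "c \<in> R"
      and q: "coeffs_in R q" "poly q a \<in> J" "Polynomial.degree q \<le> n" "Polynomial.coeff q n = d" "d \<in> R"
      by (auto simp: lead_def)
    show "c + d \<in> lead J n"
      unfolding lead_def using p q C(2) RD(4) ideal_setD(3)[OF J] degree_add_le[of p n q]
      by (auto intro!: exI[of _ "p + q"])
  next
    fix r c assume r: "r \<in> R" and "c \<in> lead J n"
    then obtain p where p: "coeffs_in R p" "poly p a \<in> J" "Polynomial.degree p \<le> n" "Polynomial.coeff p n = c" "c \<in> R"
      by (auto simp: lead_def)
    have "r * poly p a \<in> J" using ideal_setD(4)[OF J _ p(2)] adjoin_incl(1)[OF R] r by blast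
    moreover have "coeffs_in R (smult r p)" using p(1) r RD(6) by (auto simp: coeffs_in_def)
    ultimately show "r * c \<in> lead J n"
      unfolding lead_def using p RD(6)[OF r p(5)] degree_smult_le[of r p]
      by (auto intro!: exI[of _ "smult r p"])
  qed
  fix J assume J: "ideal_set (adjoin R a) J"
  have step: "lead J n \<subseteq> lead J (Suc n)" for n
  proof
    fix c assume "c \<in> lead J n"
    then obtain p where p: "coeffs_in R p" "poly p a \<in> J" "Polynomial.degree p \<le> n" "Polynomial.coeff p n = c" "c \<in> R"
      by (auto simp: lead_def)
    have "coeffs_in R (pCons 0 p)" using p(1) RD(2) by (auto simp: coeffs_in_def coeff_pCons split: nat.splits)
    moreover have "poly (pCons 0 p) a \<in> J" using ideal_setD(4)[OF J adjoin_incl(2)[OF R] p(2)] by simp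
    moreover have "Polynomial.degree (pCons 0 p) \<le> Suc n" using p(3) degree_pCons_le[of 0 p] by simp
    ultimately show "c \<in> lead J (Suc n)" unfolding lead_def using p by (auto intro!: exI[of _ "pCons 0 p"])
  qed
  have mono: "lead J m \<subseteq> lead J n" if "m \<le> n" for m n using lift_Suc_mono_le[of "lead J", OF step that] .
  have "ideal_set R (\<Union>n. lead J n)"
    unfolding ideal_set_def
  proof (intro conjI ballI)
    show "(\<Union>n. lead J n) \<subseteq> R" by (auto simp: lead_def)
    show "0 \<in> (\<Union>n. lead J n)" using ideal_setD(2)[OF lead_ideal[OF J]] by blast
    fix c d assume "c \<in> (\<Union>n. lead J n)" "d \<in> (\<Union>n. lead J n)"
    then obtain m n where "c \<in> lead J m" "d \<in> lead J n" by blast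
    then have "c \<in> lead J (max m n)" "d \<in> lead J (max m n)" using mono[of m "max m n"] mono[of n "max m n"] by auto
    then show "c + d \<in> (\<Union>n. lead J n)" using ideal_setD(3)[OF lead_ideal[OF J]] by blast
  next
    fix r c assume "r \<in> R" "c \<in> (\<Union>n. lead J n)"
    then show "r * c \<in> (\<Union>n. lead J n)" using ideal_setD(4)[OF lead_ideal[OF J]] by blast
  qed
  then obtain G0 where G0: "finite G0" "G0 \<subseteq> (\<Union>n. lead J n)"
    "\<And>J'. ideal_set R J' \<Longrightarrow> G0 \<subseteq> J' \<Longrightarrow> (\<Union>n. lead J n) \<subseteq> J'"
    using N unfolding noeth_def by meson
  have "\<exists>n. G0 \<subseteq> lead J n" using G0(1,2)
  proof (induction G0)
    case (insert c G)
    then obtain m n where "G \<subseteq> lead J m" "c \<in> lead J n" by blast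
    then have "insert c G \<subseteq> lead J (max m n)" using mono[of m "max m n"] mono[of n "max m n"] by auto
    then show ?case by blast
  qed auto
  then obtain M where M: "G0 \<subseteq> lead J M" by blast
  have stop: "lead J n \<subseteq> lead J M" for n using G0(3)[OF lead_ideal[OF J] M] by blast
  have "\<exists>G. finite G \<and> G \<subseteq> lead J n \<and> (\<forall>J'. ideal_set R J' \<and> G \<subseteq> J' \<longrightarrow> lead J n \<subseteq> J')" for n
    using N lead_ideal[OF J] unfolding noeth_def by blast
  then obtain G where G: "\<And>n. finite (G n)" "\<And>n. G n \<subseteq> lead J n"
    "\<And>n J'. ideal_set R J' \<Longrightarrow> G n \<subseteq> J' \<Longrightarrow> lead J n \<subseteq> J'" by metis
  have "\<forall>n c. \<exists>p. c \<in> G n \<longrightarrow> coeffs_in R p \<and> poly p a \<in> J \<and> Polynomial.degree p \<le> n \<and> Polynomial.coeff p n = c"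
    using G(2) unfolding lead_def by blast
  then obtain q where q: "\<And>n c. c \<in> G n \<Longrightarrow> coeffs_in R (q n c) \<and> poly (q n c) a \<in> J \<and>
      Polynomial.degree (q n c) \<le> n \<and> Polynomial.coeff (q n c) n = c" by metis
  define H where "H = (\<Union>n\<le>M. (\<lambda>c. poly (q n c) a) ` G n)"
  show "\<exists>H. finite H \<and> H \<subseteq> J \<and> (\<forall>J'. ideal_set (adjoin R a) J' \<and> H \<subseteq> J' \<longrightarrow> J \<subseteq> J')"
  proof (intro exI[of _ H] conjI allI impI; (elim conjE)?)
    show "finite H" using G(1) by (auto simp: H_def)
    show "H \<subseteq> J" using q by (auto simp: H_def)
    fix J' assume J': "ideal_set (adjoin R a) J'" and HJ: "H \<subseteq> J'"
    \<comment> \<open>The ideals \<open>lead J n\<close> and \<open>lead (J \<inter> J') n\<close> agree for \<open>n \<le> M\<close>, so subtracting suitable elements of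
      \<open>J \<inter> J'\<close> lowers the degree of any element of \<open>J\<close>.\<close>
    have JJ: "ideal_set (adjoin R a) (J \<inter> J')" using J J' by (auto simp: ideal_set_def)
    have lead_sub: "lead J n \<subseteq> lead (J \<inter> J') n" if "n \<le> M" for n
    proof (rule G(3)[OF lead_ideal[OF JJ]], rule subsetI)
      fix c assume c: "c \<in> G n"
      then have "poly (q n c) a \<in> J'" using HJ that by (auto simp: H_def)
      moreover have "c \<in> R" using c G(2) by (auto simp: lead_def)
      ultimately show "c \<in> lead (J \<inter> J') n" using q[OF c] unfolding lead_def by blast
    qed
    have "poly p a \<in> J'" if "coeffs_in R p" "poly p a \<in> J" for p
      using that
    proof (induction "Polynomial.degree p" arbitrary: p rule: less_induct)
      case less
      show ?case
      proof (cases "p = 0")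
        case True then show ?thesis using ideal_setD(2)[OF J'] by simp
      next
        case False
        define d where "d = Polynomial.degree p"
        define n where "n = min d M"
        have "lead_coeff p \<in> lead J d"
          unfolding lead_def using less.prems by (auto simp: coeffs_in_def d_def)
        then have "lead_coeff p \<in> lead J n" using stop by (cases "d \<le> M") (auto simp: n_def min_def)
        then have "lead_coeff p \<in> lead (J \<inter> J') n" using lead_sub[of n] by (auto simp: n_def)
        then obtain r where r: "coeffs_in R r" "poly r a \<in> J" "poly r a \<in> J'" "Polynomial.degree r \<le> n"
          "Polynomial.coeff r n = lead_coeff p" unfolding lead_def by blast
        define s where "s = monom 1 (d - n) * r"
        have s: "coeffs_in R s" "poly s a = a ^ (d - n) * poly r a"
          using C(4)[OF C(5)[OF RD(1)] r(1)] by (auto simp: s_def poly_monom)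
        have sd: "Polynomial.degree s \<le> d"
        proof -
          have "Polynomial.degree s \<le> (d - n) + n"
            unfolding s_def by (rule order_trans[OF degree_mult_le add_mono[OF degree_monom_le r(4)]])
          then show ?thesis by (simp add: n_def)
        qed
        have sl: "Polynomial.coeff s d = lead_coeff p"
          using r(5) by (simp add: s_def coeff_monom_mult n_def min_def)
        have sJ: "poly s a \<in> J" "poly s a \<in> J'"
          using ideal_setD(4)[OF J aB r(2)] ideal_setD(4)[OF J' aB r(3)] s(2) by auto
        have "poly (p - s) a \<in> J'"
        proof (cases "p - s = 0")
          case True then show ?thesis using ideal_setD(2)[OF J'] by simp
        next
          case False
          have "Polynomial.degree (p - s) \<le> d" using degree_diff_le[of p d s] sd by (simp add: d_def)
          moreover have "Polynomial.coeff (p - s) d = 0" using sl by (simp add: d_def)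
          ultimately have "Polynomial.degree (p - s) < Polynomial.degree p"
            using False by (metis d_def le_neq_implies_less leading_coeff_0_iff)
          moreover have "poly (p - s) a \<in> J" using ideal_set_diff[OF B J less.prems(2) sJ(1)] by simp
          ultimately show ?thesis using less.hyps C(3)[OF less.prems(1) s(1)] by blast
        qed
        then show ?thesis using ideal_setD(3)[OF J' _ sJ(2), of "poly (p - s) a"] by simp
      qed
    qed
    then show "J \<subseteq> J'" using ideal_setD(1)[OF J] by (auto simp: adjoin_def)
  qed
qed

subsection \<open>Complete integral closure\<close>

text \<open>
  If \<open>c * z ^ n\<close> and \<open>c\<close> lie in \<open>A\<close> then so does the numerator of \<open>z = (c * z) / c\<close>, so this
  is complete integral closedness of \<open>A\<close> in its fraction field. Since the condition does not mention
  the fraction field, it passes to intersections.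
\<close>

definition completely_closed :: "'l::field set \<Rightarrow> bool" where
  "completely_closed A \<longleftrightarrow> (\<forall>z c. c \<noteq> 0 \<and> (\<forall>n. c * z ^ n \<in> A) \<longrightarrow> z \<in> A)"

lemma completely_closed_Inter: "(\<And>A. A \<in> \<A> \<Longrightarrow> completely_closed A) \<Longrightarrow> completely_closed (\<Inter>\<A>)"
  unfolding completely_closed_def by blast

text \<open>An integral equation of degree \<open>n\<close> for \<open>a / s\<close> bounds the denominators of all its powers by \<open>s ^ n\<close>.\<close>

lemma completely_closed_int_closed:
  assumes A: "subring_set A" and cc: "completely_closed A" shows "int_closed A"
  unfolding int_closed_def
proof (intro allI impI, elim conjE bexE exE)
  fix z a s c and n :: nat
  assume as: "a \<in> A" "s \<in> A" "s \<noteq> 0" "z = a / s"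
    and c: "\<forall>i<n. c i \<in> A" and eq: "z ^ n + (\<Sum>i<n. c i * z ^ i) = 0"
  have "s ^ n * z ^ m \<in> A" for m
  proof (induction m rule: less_induct)
    case (less m)
    show ?case
    proof (cases "m < n")
      case True
      have "s ^ n = s ^ (n - m) * s ^ m" using True by (simp flip: power_add)
      then have "s ^ n * z ^ m = s ^ (n - m) * a ^ m" using as(3,4) by (simp add: power_divide)
      then show ?thesis using subring_setD(6)[OF A subring_set_power[OF A as(2)] subring_set_power[OF A as(1)]] by simp
    next
      case False
      have "z ^ m = z ^ (m - n) * z ^ n" using False by (simp flip: power_add)
      also have "z ^ n = - (\<Sum>i<n. c i * z ^ i)" using eq by (simp add: eq_neg_iff_add_eq_0)
      finally have "s ^ n * z ^ m = - (\<Sum>i<n. c i * (s ^ n * z ^ (m - n + i)))"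
        by (simp add: sum_distrib_left power_add mult_ac)
      moreover have "c i * (s ^ n * z ^ (m - n + i)) \<in> A" if "i < n" for i
        using c that less[of "m - n + i"] False subring_setD(6)[OF A] by simp
      ultimately show ?thesis using subring_setD(3)[OF A] subring_set_sum[OF A, of "{..<n}"] by simp
    qed
  qed
  then show "z \<in> A" using cc as(3) unfolding completely_closed_def by (metis power_not_zero)
qed

text \<open>
  The polynomials \<open>d\<close> with \<open>q ^ n dvd d * p ^ n\<close> for all \<open>n\<close> form an ideal that is stable
  under \<open>d \<mapsto> d * p / q\<close>; comparing a generator with its image gives the claim.
\<close>

lemma power_dvd_imp_dvd:
  fixes p q c :: "'l::field Polynomial.poly"
  assumes c: "c \<noteq> 0" and q: "q \<noteq> 0" and dvd: "\<And>n. q ^ n dvd c * p ^ n" shows "q dvd p"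
proof -
  define D where "D d \<longleftrightarrow> (\<forall>n. q ^ n dvd d * p ^ n)" for d
  define d where "d = (ARG_MIN Polynomial.degree d. D d \<and> d \<noteq> 0)"
  have "D c \<and> c \<noteq> 0" using dvd c by (simp add: D_def)
  then have d: "D d" "d \<noteq> 0" and min: "\<And>e. D e \<Longrightarrow> e \<noteq> 0 \<Longrightarrow> Polynomial.degree d \<le> Polynomial.degree e"
    using arg_min_nat_lemma[of "\<lambda>d. D d \<and> d \<noteq> 0" c Polynomial.degree] unfolding d_def by auto
  obtain e where e: "d * p = q * e" using d(1)[unfolded D_def, rule_format, of 1] by (auto elim: dvdE)
  have "D e"
    unfolding D_def
  proof
    fix n
    have "q * q ^ n dvd q * (e * p ^ n)" using d(1)[unfolded D_def, rule_format, of "Suc n"] e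
      by (simp add: mult.assoc[symmetric])
    then show "q ^ n dvd e * p ^ n" using q by simp
  qed
  have "D (e mod d)"
    unfolding D_def
  proof
    fix n
    have "q ^ n dvd e * p ^ n - (e div d) * (d * p ^ n)"
      using \<open>D e\<close> d(1) by (auto simp: D_def intro: dvd_diff dvd_mult)
    also have "e * p ^ n - (e div d) * (d * p ^ n) = (e mod d) * p ^ n"
      by (simp add: minus_div_mult_eq_mod[symmetric] algebra_simps)
    finally show "q ^ n dvd (e mod d) * p ^ n" .
  qed
  then have "e mod d = 0" using min[of "e mod d"] degree_mod_less[OF d(2), of e] by force
  then obtain f where "e = d * f" by (auto elim: dvdE)
  then have "d * p = d * (q * f)" using e by (simp add: mult_ac)
  then show ?thesis using d(2) by simp
qed

text \<open>
  The leading coefficients of the \<open>c * s ^ n\<close> show that the leading coefficient of \<open>s\<close> lies in \<open>R\<close>.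
  The hypothesis survives removal of the leading term, by the binomial theorem.
\<close>

lemma completely_closed_coeffs:
  assumes R: "subring_set R" and cc: "completely_closed R"
    and c: "c \<noteq> 0" and cs: "\<And>n. coeffs_in R (c * s ^ n)"
  shows "coeffs_in R s"
  using cs
proof (induction "Polynomial.degree s" arbitrary: s rule: less_induct)
  case less
  show ?case
  proof (cases "s = 0")
    case True then show ?thesis using coeffs_in_closed(1)[OF R] by simp
  next
    case False
    define m where "m = monom (lead_coeff s) (Polynomial.degree s)"
    have "lead_coeff c * lead_coeff s ^ n \<in> R" for n
      using less.prems[of n, unfolded coeffs_in_def, rule_format, of "Polynomial.degree (c * s ^ n)"]
      by (simp add: lead_coeff_mult lead_coeff_power)
    then have lc: "lead_coeff s \<in> R" using cc c unfolding completely_closed_def by (metis leading_coeff_0_iff)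
    then have m: "coeffs_in R m" "coeffs_in R (- m)"
      using coeffs_in_closed(5)[OF R] coeffs_in_closed(3)[OF R coeffs_in_closed(1)[OF R], of m] by (auto simp: m_def)
    have "coeffs_in R (s - m)"
    proof (cases "s - m = 0")
      case True then show ?thesis using coeffs_in_closed(1)[OF R] by simp
    next
      case nz: False
      have "Polynomial.degree (s - m) \<le> Polynomial.degree s"
        using degree_diff_le[of s "Polynomial.degree s" m] degree_monom_le[of "lead_coeff s" "Polynomial.degree s"] by (simp add: m_def)
      moreover have "Polynomial.coeff (s - m) (Polynomial.degree s) = 0" by (simp add: m_def)
      ultimately have "Polynomial.degree (s - m) < Polynomial.degree s"
        using nz by (metis le_neq_implies_less leading_coeff_0_iff)
      moreover have "coeffs_in R (c * (s - m) ^ n)" for n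
      proof -
        have "c * (s - m) ^ n = (\<Sum>k\<le>n. of_nat (n choose k) * (c * s ^ k) * (- m) ^ (n - k))"
          using binomial_ring[of s "- m" n] by (simp add: sum_distrib_left mult_ac)
        moreover have "coeffs_in R (of_nat k)" for k
          by (induction k) (simp_all add: coeffs_in_closed[OF R])
        then have "coeffs_in R (of_nat (n choose k) * (c * s ^ k) * (- m) ^ (n - k))" for k
          using coeffs_in_closed(4)[OF R coeffs_in_closed(4)[OF R _ less.prems] coeffs_in_closed(6)[OF R m(2)]] by blast
        ultimately show ?thesis
          using coeffs_in_sum[OF R, of "{..n}" "\<lambda>k. of_nat (n choose k) * (c * s ^ k) * (- m) ^ (n - k)"] by simp
      qed
      ultimately show ?thesis using less.hyps by blast
    qed
    then have "coeffs_in R ((s - m) + m)" using coeffs_in_closed(2)[OF R _ m(1)] by blast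
    then show ?thesis by simp
  qed
qed

lemma transcendental_eq:
  assumes "transcendental_over R a" "subring_set R" "coeffs_in R p" "coeffs_in R q" "poly p a = poly q a"
  shows "p = q"
  using assms coeffs_in_closed(3)[OF assms(2-4)] by (auto simp: transcendental_over_def)

lemma transcendental_nonzero:
  assumes "transcendental_over R a" "subring_set R" shows "a \<noteq> 0"
proof
  assume "a = 0"
  then have "monom 1 1 = (0 :: 'a Polynomial.poly)"
    using assms coeffs_in_closed(5)[OF assms(2) subring_setD(1)[OF assms(2)], of 1]
    by (intro transcendental_eq[OF assms]) (auto simp: poly_monom coeffs_in_closed[OF assms(2)])
  then show False by (simp add: monom_eq_0_iff)
qed

text \<open>
  Writing \<open>c * z ^ n = E n\<close> as polynomials in \<open>a\<close>, the relation \<open>(E 0) ^ n * E n = E 0 * (E 1) ^ n\<close>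
  shows first, over the ambient field, that \<open>E 0\<close> divides \<open>E 1\<close>, so that \<open>z\<close> is a polynomial in \<open>a\<close>;
  its coefficients then lie in \<open>R\<close>.
\<close>

theorem completely_closed_adjoin:
  assumes R: "subring_set R" and cc: "completely_closed R" and tr: "transcendental_over R a"
  shows "completely_closed (adjoin R a)"
  unfolding completely_closed_def
proof (intro allI impI, elim conjE)
  fix z c assume c: "c \<noteq> 0" and all: "\<forall>n. c * z ^ n \<in> adjoin R a"
  have "\<exists>p. coeffs_in R p \<and> c * z ^ n = poly p a" for n using all unfolding adjoin_def by blast
  then obtain E where E: "\<And>n. coeffs_in R (E n)" "\<And>n. c * z ^ n = poly (E n) a" by metis
  define C where "C = E 0"
  define Q where "Q = E 1"
  have Ca: "poly C a = c" and Qa: "poly Q a = c * z" using E(2)[of 0] E(2)[of 1] by (auto simp: C_def Q_def)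
  have C0: "C \<noteq> 0" using Ca c by auto
  have CE: "C ^ n * E n = C * Q ^ n" for n
    by (rule transcendental_eq[OF tr R])
      (use E(2)[of n] in \<open>auto simp: Ca Qa C_def[symmetric] Q_def[symmetric] power_mult_distrib mult_ac
        intro!: coeffs_in_closed[OF R] E(1) E(1)[of 0, folded C_def] E(1)[of 1, folded Q_def]\<close>)
  have "C dvd Q" by (rule power_dvd_imp_dvd[OF C0 C0]) (metis CE dvd_triv_left)
  then obtain S where S: "Q = C * S" by (auto elim: dvdE)
  have "C * S ^ n = E n" for n
  proof -
    have "C ^ n * (C * S ^ n) = C * Q ^ n" unfolding S by (simp add: power_mult_distrib mult_ac)
    then have "C ^ n * (C * S ^ n) = C ^ n * E n" using CE[of n] by simp
    then show ?thesis using C0 by (metis mult_cancel_left power_not_zero)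
  qed
  then have "coeffs_in R S" using completely_closed_coeffs[OF R cc C0] E(1) by metis
  moreover have "z = poly S a" using Qa S Ca c by simp
  ultimately show "z \<in> adjoin R a" by (auto simp: adjoin_def)
qed

text \<open>The variable is a prime polynomial, and \<open>p\<close> is not a multiple of it.\<close>

lemma power_monom_dvd:
  fixes p q :: "'l::field Polynomial.poly"
  assumes "monom 1 e dvd p * q" "poly p 0 \<noteq> 0" shows "monom 1 e dvd q"
  using assms(1)
proof (induction e arbitrary: q)
  case (Suc e)
  have m: "monom 1 (Suc e) = [:0, 1:] * monom (1::'l) e" by (simp add: monom_Suc)
  then have "[:0, 1:] dvd p * q" using Suc.prems by (metis dvd_mult_left)
  then have "poly (p * q) 0 = 0" using poly_eq_0_iff_dvd[of "p * q" 0] by simp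
  then have "poly q 0 = 0" using assms(2) by simp
  then obtain r where r: "q = [:0, 1:] * r" using poly_eq_0_iff_dvd[of q 0] by (auto elim: dvdE)
  have "[:0, 1:] * monom 1 e dvd [:0, 1:] * (p * r)" using Suc.prems m r by (simp add: mult_ac)
  then have "monom 1 e dvd p * r" by (subst (asm) dvd_mult_cancel_left) simp
  then show ?case using Suc.IH m r by (metis dvd_refl mult_dvd_mono)
qed simp

lemma coeffs_in_shift: "coeffs_in R (monom 1 e * p) \<Longrightarrow> coeffs_in R p"
  unfolding coeffs_in_def
proof
  fix i assume "\<forall>i. Polynomial.coeff (monom 1 e * p) i \<in> R"
  then have "Polynomial.coeff (monom 1 e * p) (i + e) \<in> R" by blast
  then show "Polynomial.coeff p i \<in> R" by (simp add: coeff_monom_mult)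
qed

text \<open>
  The argument for polynomials, up to powers of \<open>a\<close>. First \<open>c\<close> and \<open>z\<close> are multiplied by powers of
  \<open>a\<close> until \<open>c = C a\<close> and \<open>c * z = Q a\<close> for polynomials \<open>C\<close> and \<open>Q\<close>. With \<open>C = t ^ j * C'\<close> and \<open>C' 0 \<noteq> 0\<close>,
  where \<open>t\<close> is the variable, a power of \<open>t\<close> that divides a multiple of \<open>C' ^ n\<close> divides the cofactor;
  so \<open>C' ^ n\<close> divides \<open>C * Q ^ n\<close> for all \<open>n\<close>, and \<open>C'\<close> divides \<open>Q\<close>.
\<close>

theorem completely_closed_adjoin_unit:
  assumes R: "subring_set R" and cc: "completely_closed R" and tr: "transcendental_over R a"
  shows "completely_closed (adjoin_unit R a)"
  unfolding completely_closed_def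
proof (intro allI impI, elim conjE)
  fix z0 c0 assume c0: "c0 \<noteq> 0" and all0: "\<forall>n. c0 * z0 ^ n \<in> adjoin_unit R a"
  have a0: "a \<noteq> 0" using transcendental_nonzero[OF tr R] .
  have U: "subring_set (adjoin_unit R a)" by (rule adjoin_unit_subring[OF R])
  have aU: "a ^ n \<in> adjoin_unit R a" "inverse a ^ n \<in> adjoin_unit R a" for n
    using subring_set_power[OF U] adjoin_unit_incl[OF R] adjoin_incl(2)[OF R] a0 by blast+
  obtain k where k: "a ^ k * (c0 * z0 ^ 0) \<in> adjoin R a" using all0 unfolding adjoin_unit_def by blast
  define c where "c = a ^ k * c0"
  obtain l where l: "a ^ l * (c * z0) \<in> adjoin R a"
    using subring_setD(6)[OF U aU(1)[of k] all0[rule_format, of 1]] unfolding adjoin_unit_def c_def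
    by (auto simp: mult_ac)
  define z where "z = a ^ l * z0"
  have c: "c \<noteq> 0" using a0 c0 by (simp add: c_def)
  have "c * z ^ n \<in> adjoin_unit R a" for n
  proof -
    have "c * z ^ n = a ^ (k + l * n) * (c0 * z0 ^ n)" by (simp add: c_def z_def power_mult_distrib power_add power_mult mult_ac)
    then show ?thesis using subring_setD(6)[OF U aU(1) all0[rule_format]] by simp
  qed
  then have "\<exists>e p. coeffs_in R p \<and> a ^ e * (c * z ^ n) = poly p a" for n
    unfolding adjoin_unit_def adjoin_def by blast
  then obtain e E where E: "\<And>n. coeffs_in R (E n)" "\<And>n. a ^ e n * (c * z ^ n) = poly (E n) a" by metis
  obtain C where C: "coeffs_in R C" "poly C a = c" using k unfolding adjoin_def c_def by auto
  obtain Q where Q: "coeffs_in R Q" "poly Q a = c * z" using l unfolding adjoin_def z_def by (auto simp: mult_ac)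
  have C0: "C \<noteq> 0" using C(2) c by auto
  have CE: "C ^ n * E n = monom 1 (e n) * (C * Q ^ n)" for n
    by (rule transcendental_eq[OF tr R])
      (use E(2)[of n] in \<open>auto simp: C(2) Q(2) poly_monom power_mult_distrib mult_ac
        intro!: coeffs_in_closed[OF R] E(1) C(1) Q(1) subring_setD(1)[OF R]\<close>)
  define j where "j = Polynomial.order 0 C"
  obtain C' where C': "C = [:0, 1:] ^ j * C'" "\<not> [:0, 1:] dvd C'"
    using order_decomp[OF C0, of 0] by (auto simp: j_def)
  have mj: "[:0, 1:] ^ n = monom (1::'a) n" for n by (induction n) (simp_all add: monom_Suc)
  have C'0: "poly C' 0 \<noteq> 0" "C' \<noteq> 0" using C'(2) poly_eq_0_iff_dvd[of C' 0] by auto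
  have "C' ^ n dvd C * Q ^ n" for n
  proof -
    have "C' ^ n * (monom 1 j ^ n * E n) = monom 1 (e n) * (C * Q ^ n)"
      using CE[of n] C'(1) by (simp add: power_mult_distrib mj mult_ac)
    then have "monom 1 (e n) dvd C' ^ n * (monom 1 j ^ n * E n)" by simp
    then have "monom 1 (e n) dvd monom 1 j ^ n * E n" by (rule power_monom_dvd) (simp add: C'0)
    then obtain r where r: "monom 1 j ^ n * E n = monom 1 (e n) * r" by (auto elim: dvdE)
    have "monom 1 (e n) * (C * Q ^ n) = C' ^ n * (monom 1 j ^ n * E n)"
      using CE[of n, symmetric] C'(1) by (simp add: power_mult_distrib mj mult_ac)
    also have "\<dots> = monom 1 (e n) * (C' ^ n * r)" unfolding r by (simp add: mult_ac)
    finally have "C * Q ^ n = C' ^ n * r" by (simp add: monom_eq_0_iff)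
    then show ?thesis by simp
  qed
  then have "C' dvd Q" by (rule power_dvd_imp_dvd[OF C0 C'0(2)])
  then obtain S where S: "Q = C' * S" by (auto elim: dvdE)
  have "monom 1 (e n) * (C * S ^ n) = monom 1 j ^ n * E n" for n
  proof -
    have "C' ^ n * (monom 1 (e n) * (C * S ^ n)) = monom 1 (e n) * (C * Q ^ n)"
      unfolding S by (simp add: power_mult_distrib mult_ac)
    also have "\<dots> = C' ^ n * (monom 1 j ^ n * E n)"
      using CE[of n, symmetric] C'(1) by (simp add: power_mult_distrib mj mult_ac)
    finally have "C' ^ n * (monom 1 (e n) * (C * S ^ n)) = C' ^ n * (monom 1 j ^ n * E n)" .
    then show ?thesis using C'0 by simp
  qed
  moreover have "coeffs_in R (monom 1 j ^ n * E n)" for n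
    by (intro coeffs_in_closed[OF R] E(1) subring_setD(1)[OF R])
  ultimately have "coeffs_in R (C * S ^ n)" for n using coeffs_in_shift[of R "e n" "C * S ^ n"] by metis
  then have "coeffs_in R S" by (rule completely_closed_coeffs[OF R cc C0])
  then have Sa: "poly S a \<in> adjoin_unit R a" using adjoin_unit_incl(1)[OF R] by (auto simp: adjoin_def)
  have "poly C' a * a ^ j = c" using C(2) C'(1) by (simp add: mult_ac)
  moreover have "poly C' a * poly S a = c * z" using Q(2) S by simp
  ultimately have "poly C' a \<noteq> 0" "poly S a = a ^ j * z" using c by (auto simp: mult_ac)
  then have "z0 = inverse a ^ (l + j) * poly S a" using a0 by (simp add: z_def power_add power_inverse field_simps)
  then show "z0 \<in> adjoin_unit R a" using subring_setD(6)[OF U aU(2) Sa] by simp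
qed

subsection \<open>A transcendental element is prime in the ring it generates\<close>

text \<open>
  This identifies the quotient modulo \<open>a\<close> with \<open>R\<close>, by the constant coefficient.
\<close>

lemma adjoin_multiple_iff:
  assumes R: "subring_set R" and tr: "transcendental_over R a" and p: "coeffs_in R p"
  shows "poly p a \<in> (*) a ` adjoin R a \<longleftrightarrow> Polynomial.coeff p 0 = 0"
proof
  assume "poly p a \<in> (*) a ` adjoin R a"
  then obtain q where q: "coeffs_in R q" "poly p a = a * poly q a" by (auto simp: adjoin_def)
  have "coeffs_in R (pCons 0 q)" using q(1) subring_setD(2)[OF R] by (auto simp: coeffs_in_def coeff_pCons split: nat.splits)
  then have "p = pCons 0 q" using transcendental_eq[OF tr R p] q(2) by simp
  then show "Polynomial.coeff p 0 = 0" by simp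
next
  assume p0: "Polynomial.coeff p 0 = 0"
  obtain c q where q: "p = pCons c q" by (cases p)
  then have "c = 0" using p0 by simp
  moreover have "coeffs_in R q" unfolding coeffs_in_def
  proof
    fix i show "Polynomial.coeff q i \<in> R" using p[unfolded coeffs_in_def, rule_format, of "Suc i"] q by simp
  qed
  ultimately show "poly p a \<in> (*) a ` adjoin R a" using q by (auto simp: adjoin_def)
qed

lemma adjoin_prime:
  assumes R: "subring_set R" and tr: "transcendental_over R a"
    and "x \<in> adjoin R a" "y \<in> adjoin R a" "x * y \<in> (*) a ` adjoin R a"
  shows "x \<in> (*) a ` adjoin R a \<or> y \<in> (*) a ` adjoin R a"
proof -
  obtain p q where p: "coeffs_in R p" "x = poly p a" and q: "coeffs_in R q" "y = poly q a"
    using assms(3,4) by (auto simp: adjoin_def)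
  have "poly (p * q) a \<in> (*) a ` adjoin R a" using assms(5) p q by simp
  then have "Polynomial.coeff (p * q) 0 = 0" using adjoin_multiple_iff[OF R tr coeffs_in_closed(4)[OF R p(1) q(1)]] by blast
  then show ?thesis using adjoin_multiple_iff[OF R tr p(1)] adjoin_multiple_iff[OF R tr q(1)] p q
    by (simp add: coeff_mult)
qed

lemma adjoin_bounded_powers:
  assumes R: "subring_set R" and tr: "transcendental_over R a" and f: "f \<in> adjoin R a" "f \<noteq> 0"
  shows "\<exists>N. \<forall>n. \<forall>g\<in>adjoin R a. f = a ^ n * g \<longrightarrow> n \<le> N"
proof -
  obtain p where p: "coeffs_in R p" "f = poly p a" using f by (auto simp: adjoin_def)
  have "n \<le> Polynomial.degree p" if g: "g \<in> adjoin R a" "f = a ^ n * g" for n g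
  proof -
    obtain q where q: "coeffs_in R q" "g = poly q a" using g by (auto simp: adjoin_def)
    have "p = monom 1 n * q"
      by (rule transcendental_eq[OF tr R p(1)])
        (use p q g in \<open>auto simp: poly_monom intro!: coeffs_in_closed[OF R] subring_setD(1)[OF R]\<close>)
    moreover have "q \<noteq> 0" using q g f by auto
    ultimately show ?thesis by (simp add: degree_mult_eq monom_eq_0_iff degree_monom_eq)
  qed
  then show ?thesis by blast
qed

text \<open>Reversing a polynomial in \<open>y / a\<close> of degree \<open>n\<close> gives \<open>a ^ n\<close> times it as a polynomial in \<open>a\<close>.\<close>

lemma transcendental_quotient:
  assumes R: "subring_set R" and tr: "transcendental_over R a" and y: "y \<in> R" "y \<noteq> 0"
  shows "transcendental_over R (y / a)"
  unfolding transcendental_over_def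
proof (intro allI impI, elim conjE)
  fix p assume p: "coeffs_in R p" "poly p (y / a) = 0"
  define n where "n = Polynomial.degree p"
  define q where "q = (\<Sum>i\<le>n. monom (Polynomial.coeff p i * y ^ i) (n - i))"
  have a0: "a \<noteq> 0" using transcendental_nonzero[OF tr R] .
  have "coeffs_in R q" unfolding q_def
    using p(1)[unfolded coeffs_in_def] subring_set_power[OF R y(1)]
    by (intro coeffs_in_sum[OF R] coeffs_in_closed(5)[OF R] subring_setD(6)[OF R]) auto
  moreover have "poly q a = a ^ n * poly p (y / a)"
  proof -
    have "a ^ n * (Polynomial.coeff p i * (y / a) ^ i) = Polynomial.coeff p i * y ^ i * a ^ (n - i)" if "i \<le> n" for i
    proof -
      have "a ^ n = a ^ (n - i) * a ^ i" using that by (simp flip: power_add)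
      then show ?thesis using a0 by (simp add: power_divide)
    qed
    then have "(\<Sum>i\<le>n. a ^ n * (Polynomial.coeff p i * (y / a) ^ i)) =
        (\<Sum>i\<le>n. Polynomial.coeff p i * y ^ i * a ^ (n - i))" by (intro sum.cong) auto
    then show ?thesis
      by (simp add: q_def poly_sum poly_monom poly_altdef[of p] n_def[symmetric] sum_distrib_left)
  qed
  ultimately have q0: "q = 0" using tr p(2) by (auto simp: transcendental_over_def)
  have "Polynomial.coeff p i = 0" if "i \<le> n" for i
  proof -
    have "Polynomial.coeff q (n - i) = (\<Sum>k\<le>n. if k = i then Polynomial.coeff p k * y ^ k else 0)"
      unfolding q_def coeff_sum coeff_monom by (rule sum.cong) (use that in auto)
    also have "\<dots> = Polynomial.coeff p i * y ^ i" using that by (simp add: sum.delta)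
    finally show ?thesis using q0 y by simp
  qed
  then show "p = 0" by (metis le_refl leading_coeff_0_iff n_def)
qed

lemma transcendental_over_subset: "transcendental_over S a \<Longrightarrow> R \<subseteq> S \<Longrightarrow> transcendental_over R a"
  unfolding transcendental_over_def coeffs_in_def by blast


section \<open>Laurent monomials and independence\<close>

text \<open>
  Exponent vectors vanish outside the index set, so that a Laurent monomial determines its exponent
  vector.
\<close>

definition expo :: "'v set \<Rightarrow> ('v \<Rightarrow> int) set" where
  "expo I = {m. \<forall>i. i \<notin> I \<longrightarrow> m i = 0}"

definition lmon :: "'v set \<Rightarrow> ('v \<Rightarrow> 'l::field) \<Rightarrow> ('v \<Rightarrow> int) \<Rightarrow> 'l" where
  "lmon I x m = (\<Prod>i\<in>I. x i powi m i)"

text \<open>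
  \<open>c\<close> is the coefficient function of an expression of \<open>z\<close> as a Laurent polynomial over \<open>S\<close>. Working
  with coefficient functions makes uniqueness of coefficients, \<open>lin_indep\<close>, a statement on the
  representation of zero.
\<close>

definition lrep :: "'l::field set \<Rightarrow> 'v set \<Rightarrow> ('v \<Rightarrow> 'l) \<Rightarrow> (('v \<Rightarrow> int) \<Rightarrow> 'l) \<Rightarrow> 'l \<Rightarrow> bool" where
  "lrep S I x c z \<longleftrightarrow> finite {m. c m \<noteq> 0} \<and> {m. c m \<noteq> 0} \<subseteq> expo I \<and> (\<forall>m. c m \<in> S) \<and>
     z = (\<Sum>m | c m \<noteq> 0. c m * lmon I x m)"

definition lspan :: "'l::field set \<Rightarrow> 'v set \<Rightarrow> ('v \<Rightarrow> 'l) \<Rightarrow> 'l set" where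
  "lspan S I x = {z. \<exists>c. lrep S I x c z}"

definition lin_indep :: "'l::field set \<Rightarrow> 'v set \<Rightarrow> ('v \<Rightarrow> 'l) \<Rightarrow> bool" where
  "lin_indep F I x \<longleftrightarrow> (\<forall>i\<in>I. x i \<noteq> 0) \<and> (\<forall>c. lrep F I x c 0 \<longrightarrow> (\<forall>m. c m = 0))"

lemma lrep_sum:
  assumes "lrep S I x c z" "finite M" "{m. c m \<noteq> 0} \<subseteq> M"
  shows "z = (\<Sum>m\<in>M. c m * lmon I x m)"
proof -
  have "z = (\<Sum>m | c m \<noteq> 0. c m * lmon I x m)" using assms(1) by (simp add: lrep_def)
  also have "\<dots> = (\<Sum>m\<in>M. c m * lmon I x m)"
    by (rule sum.mono_neutral_left[OF assms(2,3)]) auto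
  finally show ?thesis .
qed

lemma lrepI:
  assumes "finite M" "M \<subseteq> expo I" "\<And>m. m \<in> M \<Longrightarrow> c m \<in> S" "\<And>m. m \<notin> M \<Longrightarrow> c m = 0" "0 \<in> S"
    and "z = (\<Sum>m\<in>M. c m * lmon I x m)"
  shows "lrep S I x c z"
proof -
  have sub: "{m. c m \<noteq> 0} \<subseteq> M" using assms(4) by blast
  have "(\<Sum>m\<in>M. c m * lmon I x m) = (\<Sum>m | c m \<noteq> 0. c m * lmon I x m)"
    by (rule sum.mono_neutral_right[OF assms(1) sub]) auto
  moreover have "c m \<in> S" for m using assms(3-5) by (cases "m \<in> M") auto
  ultimately show ?thesis
    unfolding lrep_def using assms(2,6) sub finite_subset[OF sub assms(1)] by auto
qed

lemma lrepD:
  assumes "lrep S I x c z"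
  shows "finite {m. c m \<noteq> 0}" "m \<notin> expo I \<Longrightarrow> c m = 0" "c m \<in> S"
  using assms by (auto simp: lrep_def)

lemma lrep_mono: "lrep S I x c z \<Longrightarrow> (\<And>m. c m \<in> T) \<Longrightarrow> lrep T I x c z"
  by (auto simp: lrep_def)

lemma lrep_combine:
  assumes S: "subring_set S" and c: "lrep S I x c z" and d: "lrep S I x d w" and u: "u \<in> S"
  shows "lrep S I x (\<lambda>m. u * c m + d m) (u * z + w)"
proof (rule lrepI)
  let ?M = "{m. c m \<noteq> 0} \<union> {m. d m \<noteq> 0}"
  show fin: "finite ?M" using lrepD(1)[OF c] lrepD(1)[OF d] by blast
  show "?M \<subseteq> expo I" using lrepD(2)[OF c] lrepD(2)[OF d] by blast
  show "u * c m + d m \<in> S" for m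
    using subring_setD(4)[OF S subring_setD(6)[OF S u lrepD(3)[OF c]] lrepD(3)[OF d]] .
  show "m \<notin> ?M \<Longrightarrow> u * c m + d m = 0" for m by simp
  show "0 \<in> S" using subring_setD(2)[OF S] .
  have "z = (\<Sum>m\<in>?M. c m * lmon I x m)" by (rule lrep_sum[OF c fin]) auto
  moreover have "w = (\<Sum>m\<in>?M. d m * lmon I x m)" by (rule lrep_sum[OF d fin]) auto
  ultimately show "u * z + w = (\<Sum>m\<in>?M. (u * c m + d m) * lmon I x m)"
    by (simp only: sum_distrib_left sum.distrib[symmetric] distrib_right mult.assoc)
qed

lemma lrep_diff:
  assumes S: "subring_set S" and "lrep S I x c z" "lrep S I x d w"
  shows "lrep S I x (\<lambda>m. c m - d m) (z - w)"
proof -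
  have "-1 \<in> S" using subring_setD(1,3)[OF S] by blast
  then show ?thesis using lrep_combine[OF S assms(3,2), of "-1"] by simp
qed

lemma lrep_zero: "0 \<in> S \<Longrightarrow> lrep S I x (\<lambda>m. 0) 0"
  by (simp add: lrep_def)

lemma lrep_mon:
  assumes S: "subring_set S" and m: "m \<in> expo I" and a: "a \<in> S"
  shows "lrep S I x (\<lambda>n. if n = m then a else 0) (a * lmon I x m)"
  by (rule lrepI[of "{m}"]) (use m a subring_setD(2)[OF S] in auto)

lemma lin_indep_unique:
  assumes S: "subring_set S" and li: "lin_indep S I x" and "lrep S I x c z" "lrep S I x d z"
  shows "c = d"
proof -
  have "lrep S I x (\<lambda>m. c m - d m) 0" using lrep_diff[OF assms(1,3,4)] by simp
  then show ?thesis using li unfolding lin_indep_def by (auto simp: fun_eq_iff)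
qed

lemma lmon_add:
  assumes "\<And>i. i \<in> I \<Longrightarrow> x i \<noteq> 0" shows "lmon I x (\<lambda>i. m i + n i) = lmon I x m * lmon I x n"
  unfolding lmon_def prod.distrib[symmetric] by (rule prod.cong) (use assms in \<open>auto simp: power_int_add\<close>)

lemma lmon_nonzero: "(\<And>i. i \<in> I \<Longrightarrow> x i \<noteq> 0) \<Longrightarrow> lmon I x m \<noteq> 0"
  unfolding lmon_def by (induction I rule: infinite_finite_induct) auto

lemma lmon_zero [simp]: "lmon I x (\<lambda>i. 0) = 1"
  by (simp add: lmon_def)

lemma lmon_unit:
  assumes "finite I" "i \<in> I"
  shows "lmon I x (\<lambda>j. if j = i then k else 0) = x i powi k"
proof -
  have "lmon I x (\<lambda>j. if j = i then k else 0) = (\<Prod>j\<in>I. if j = i then x i powi k else 1)"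
    unfolding lmon_def by (rule prod.cong) auto
  then show ?thesis using assms by (simp add: prod.delta)
qed

lemma expo_closed: "(\<lambda>i. 0) \<in> expo I" "m \<in> expo I \<Longrightarrow> n \<in> expo I \<Longrightarrow> (\<lambda>i. m i + n i) \<in> expo I"
  "i \<in> I \<Longrightarrow> (\<lambda>j. if j = i then k else 0) \<in> expo I"
  by (auto simp: expo_def)

lemma lspan_mon: "subring_set S \<Longrightarrow> m \<in> expo I \<Longrightarrow> a \<in> S \<Longrightarrow> a * lmon I x m \<in> lspan S I x"
  unfolding lspan_def using lrep_mon by blast

lemma lspan_combine:
  assumes "subring_set S" "u \<in> S" "z \<in> lspan S I x" "w \<in> lspan S I x" shows "u * z + w \<in> lspan S I x"
  using lrep_combine[OF assms(1) _ _ assms(2)] assms(3,4) unfolding lspan_def by blast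

lemma lspan_sum:
  assumes S: "subring_set S" and "\<And>i. i \<in> M \<Longrightarrow> f i \<in> lspan S I x" shows "sum f M \<in> lspan S I x"
  using assms(2)
proof (induction M rule: infinite_finite_induct)
  case (insert i M)
  then show ?case using lspan_combine[OF S subring_setD(1)[OF S], of "f i" I x "sum f M"] by simp
qed (use lrep_zero[OF subring_setD(2)[OF S]] in \<open>auto simp: lspan_def\<close>)

lemma lspan_subring:
  assumes S: "subring_set S" and nz: "\<And>i. i \<in> I \<Longrightarrow> x i \<noteq> 0"
  shows "subring_set (lspan S I x)"
  unfolding subring_set_def
proof (intro conjI ballI)
  show "1 \<in> lspan S I x" using lspan_mon[OF S expo_closed(1) subring_setD(1)[OF S], of I x] by simp
  fix z w assume z: "z \<in> lspan S I x" and w: "w \<in> lspan S I x"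
  have "-1 \<in> S" using subring_setD(1,3)[OF S] by blast
  then show "z - w \<in> lspan S I x" using lspan_combine[OF S _ w z, of "-1"] by simp
  obtain c where c: "lrep S I x c z" using z by (auto simp: lspan_def)
  obtain d where d: "lrep S I x d w" using w by (auto simp: lspan_def)
  have "z * w = (\<Sum>m | c m \<noteq> 0. \<Sum>n | d n \<noteq> 0. (c m * d n) * lmon I x (\<lambda>i. m i + n i))"
    using lrep_sum[OF c lrepD(1)[OF c] subset_refl] lrep_sum[OF d lrepD(1)[OF d] subset_refl]
    by (simp add: sum_product lmon_add[OF nz] mult_ac)
  also have "\<dots> \<in> lspan S I x"
  proof (intro lspan_sum[OF S] lspan_mon[OF S])
    fix m n assume "m \<in> {m. c m \<noteq> 0}" "n \<in> {n. d n \<noteq> 0}"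
    then show "(\<lambda>i. m i + n i) \<in> expo I" using lrepD(2)[OF c] lrepD(2)[OF d] expo_closed(2) by blast
    show "c m * d n \<in> S" using subring_setD(6)[OF S lrepD(3)[OF c] lrepD(3)[OF d]] .
  qed
  finally show "z * w \<in> lspan S I x" .
qed

lemma lspan_incl:
  assumes S: "subring_set S" and I: "finite I"
  shows "S \<subseteq> lspan S I x" "i \<in> I \<Longrightarrow> x i powi k \<in> lspan S I x"
    "i \<in> I \<Longrightarrow> x i \<in> lspan S I x" "i \<in> I \<Longrightarrow> inverse (x i) \<in> lspan S I x"
proof -
  show "S \<subseteq> lspan S I x"
  proof
    fix a assume "a \<in> S" then show "a \<in> lspan S I x" using lspan_mon[OF S expo_closed(1), of a I x] by simp
  qed
  show *: "x i powi k \<in> lspan S I x" if "i \<in> I" for k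
    using lspan_mon[OF S expo_closed(3)[OF that, of k] subring_setD(1)[OF S], of x] lmon_unit[OF I that, of x k] by simp
  show "x i \<in> lspan S I x" if "i \<in> I" using *[OF that, of 1] by simp
  show "inverse (x i) \<in> lspan S I x" if "i \<in> I" using *[OF that, of "-1"] by (simp add: power_int_minus)
qed

lemma subring_powi:
  assumes "subring_set T" "a \<in> T" "inverse a \<in> T" shows "a powi k \<in> T"
  using subring_set_power[OF assms(1,2)] subring_set_power[OF assms(1,3)]
  by (auto simp: power_int_def)

lemma lspan_least:
  assumes T: "subring_set T" "S \<subseteq> T" "\<And>i. i \<in> I \<Longrightarrow> x i \<in> T \<and> inverse (x i) \<in> T"
  shows "lspan S I x \<subseteq> T"
proof
  fix z assume "z \<in> lspan S I x"
  then obtain c where c: "lrep S I x c z" by (auto simp: lspan_def)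
  have "lmon I x m \<in> T" for m unfolding lmon_def
    by (rule subring_set_prod[OF T(1)]) (use subring_powi[OF T(1)] T(3) in auto)
  then have "c m * lmon I x m \<in> T" for m using lrepD(3)[OF c] T(2) subring_setD(6)[OF T(1)] by blast
  then have "(\<Sum>m | c m \<noteq> 0. c m * lmon I x m) \<in> T" by (intro subring_set_sum[OF T(1)])
  then show "z \<in> T" using lrep_sum[OF c lrepD(1)[OF c] subset_refl] by simp
qed

lemma lspan_cong: "(\<And>i. i \<in> I \<Longrightarrow> x i = y i) \<Longrightarrow> lspan S I x = lspan S I y"
proof -
  assume "\<And>i. i \<in> I \<Longrightarrow> x i = y i"
  then have "lmon I x m = lmon I y m" for m unfolding lmon_def by (intro prod.cong) auto
  then show ?thesis by (simp add: lspan_def lrep_def)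
qed

lemma lin_indep_cong: "(\<And>i. i \<in> I \<Longrightarrow> x i = y i) \<Longrightarrow> lin_indep F I x = lin_indep F I y"
proof -
  assume *: "\<And>i. i \<in> I \<Longrightarrow> x i = y i"
  then have "lmon I x m = lmon I y m" for m unfolding lmon_def by (intro prod.cong) auto
  then show ?thesis using * by (simp add: lin_indep_def lrep_def)
qed

text \<open>
  Clearing the denominators of a relation between Laurent monomials by a large common power of the
  variables turns it into a polynomial relation.
\<close>

lemma algebraically_independent_lin_indep:
  fixes x :: "'v \<Rightarrow> 'l::field"
  assumes ai: "algebraically_independent F I x" and I: "finite I" and F: "subring_set F"
  shows "lin_indep F I x"
proof -
  let ?ev = "\<lambda>p :: ('v \<Rightarrow>\<^sub>0 nat) \<Rightarrow>\<^sub>0 'l. (\<Sum>m\<in>Poly_Mapping.keys p. Poly_Mapping.lookup p m *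
           (\<Prod>i\<in>Poly_Mapping.keys m. x i ^ Poly_Mapping.lookup m i))"
  have ai: "p = 0" if "\<And>m. m \<in> Poly_Mapping.keys p \<Longrightarrow> Poly_Mapping.keys m \<subseteq> I"
    "\<And>m. m \<in> Poly_Mapping.keys p \<Longrightarrow> Poly_Mapping.lookup p m \<in> F" "?ev p = 0" for p
    using ai that unfolding algebraically_independent_def by blast
  have nz: "x i \<noteq> 0" if "i \<in> I" for i
  proof
    assume "x i = 0"
    then have "Poly_Mapping.single (Poly_Mapping.single i (1 :: nat)) (1 :: 'l) = 0"
      using subring_setD(1)[OF F] that by (intro ai) auto
    from arg_cong[OF this, of "\<lambda>p. Poly_Mapping.lookup p (Poly_Mapping.single i 1)"]
    show False by simp
  qed
  show ?thesis
    unfolding lin_indep_def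
  proof (intro conjI ballI allI impI nz)
    fix c m0 assume c: "lrep F I x c 0"
    define M where "M = {m. c m \<noteq> 0}"
    have M: "finite M" "M \<subseteq> expo I" using lrepD(1,2)[OF c] by (auto simp: M_def)
    \<comment> \<open>Any bound for the negative exponents will do; the sum of all absolute values avoids maxima.\<close>
    define N where "N = (\<Sum>m\<in>M. \<Sum>i\<in>I. nat \<bar>m i\<bar>)"
    have N: "m i + int N \<ge> 0" if "m \<in> M" "i \<in> I" for m i
    proof -
      have "nat \<bar>m i\<bar> \<le> (\<Sum>i\<in>I. nat \<bar>m i\<bar>)" using member_le_sum[of i I "\<lambda>i. nat \<bar>m i\<bar>"] that I by simp
      also have "\<dots> \<le> N" unfolding N_def using member_le_sum[of m M "\<lambda>m. \<Sum>i\<in>I. nat \<bar>m i\<bar>"] that M by simp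
      finally show ?thesis by linarith
    qed
    define e where "e m = Abs_poly_mapping (\<lambda>i. if i \<in> I then nat (m i + int N) else 0)" for m
    have e: "Poly_Mapping.lookup (e m) = (\<lambda>i. if i \<in> I then nat (m i + int N) else 0)" for m
      unfolding e_def using I by (intro lookup_Abs_poly_mapping) (auto intro: finite_subset)
    have ek: "Poly_Mapping.keys (e m) \<subseteq> I" for m by (auto simp: in_keys_iff e split: if_splits)
    have e_inj: "inj_on e M"
    proof (rule inj_onI)
      fix m n assume mn: "m \<in> M" "n \<in> M" "e m = e n"
      show "m = n"
      proof
        fix i
        show "m i = n i"
        proof (cases "i \<in> I")
          case True
          then have "nat (m i + int N) = nat (n i + int N)" using fun_cong[OF e[of m], of i] fun_cong[OF e[of n], of i] mn(3) by simp
          then show ?thesis using N[OF mn(1) True] N[OF mn(2) True] by linarith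
        next
          case False then show ?thesis using subsetD[OF M(2) mn(1)] subsetD[OF M(2) mn(2)] by (simp add: expo_def)
        qed
      qed
    qed
    define P where "P = (\<Sum>m\<in>M. Poly_Mapping.single (e m) (c m))"
    have lk: "Poly_Mapping.lookup P (e m) = c m" if "m \<in> M" for m
    proof -
      have "Poly_Mapping.lookup P (e m) = (\<Sum>n\<in>M. if n = m then c n else 0)"
        unfolding P_def lookup_sum lookup_single
        by (rule sum.cong) (use inj_onD[OF e_inj] that in \<open>auto simp: when_def\<close>)
      then show ?thesis using that M(1) by (simp add: sum.delta)
    qed
    have keys: "Poly_Mapping.keys P = e ` M"
    proof (intro equalityI subsetI)
      fix k assume k: "k \<in> Poly_Mapping.keys P"
      show "k \<in> e ` M"
      proof (rule ccontr)
        assume "k \<notin> e ` M"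
        then have "Poly_Mapping.lookup P k = 0" unfolding P_def lookup_sum lookup_single
          by (intro sum.neutral) (auto simp: when_def)
        then show False using k by (simp add: in_keys_iff)
      qed
    qed (use lk in \<open>auto simp: in_keys_iff M_def\<close>)
    have mon: "(\<Prod>i\<in>Poly_Mapping.keys (e m). x i ^ Poly_Mapping.lookup (e m) i) = (\<Prod>i\<in>I. x i ^ N) * lmon I x m"
      if m: "m \<in> M" for m
    proof -
      have "(\<Prod>i\<in>Poly_Mapping.keys (e m). x i ^ Poly_Mapping.lookup (e m) i) = (\<Prod>i\<in>I. x i ^ Poly_Mapping.lookup (e m) i)"
        by (rule prod.mono_neutral_left[OF I ek]) (auto simp: in_keys_iff)
      also have "\<dots> = (\<Prod>i\<in>I. x i ^ N * x i powi m i)"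
      proof (rule prod.cong[OF HOL.refl])
        fix i assume i: "i \<in> I"
        have "x i ^ nat (m i + int N) = x i powi (int N + m i)" using N[OF m i] by (simp add: power_int_def add.commute)
        then show "x i ^ Poly_Mapping.lookup (e m) i = x i ^ N * x i powi m i"
          using i nz[OF i] by (simp add: e power_int_add)
      qed
      finally show ?thesis by (simp add: prod.distrib lmon_def)
    qed
    have "?ev P = (\<Sum>m\<in>M. c m * ((\<Prod>i\<in>I. x i ^ N) * lmon I x m))"
      unfolding keys sum.reindex[OF e_inj] using lk mon by (intro sum.cong) auto
    also have "\<dots> = (\<Prod>i\<in>I. x i ^ N) * (\<Sum>m\<in>M. c m * lmon I x m)" by (simp add: sum_distrib_left mult_ac)
    also have "(\<Sum>m\<in>M. c m * lmon I x m) = 0" using lrep_sum[OF c M(1)] by (simp add: M_def)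
    finally have "?ev P = 0" by simp
    then have "P = 0" using ek lk lrepD(3)[OF c] by (intro ai) (auto simp: keys)
    then show "c m0 = 0" using lk[of m0] by (cases "m0 \<in> M") (auto simp: M_def)
  qed
qed

subsection \<open>One variable at a time\<close>

lemma lmon_insert:
  assumes "finite J" "k \<notin> J"
  shows "lmon (insert k J) x m = x k powi m k * lmon J x (m(k := 0))"
proof -
  have "lmon J x m = lmon J x (m(k := 0))" unfolding lmon_def by (rule prod.cong) (use assms in auto)
  then show ?thesis using assms by (simp add: lmon_def)
qed

lemma expo_insert:
  assumes "k \<notin> J" shows "m(k := 0) \<in> expo J \<longleftrightarrow> m \<in> expo (insert k J)"
  using assms by (auto simp: expo_def)

text \<open>
  A polynomial relation for \<open>x k\<close> over the Laurent polynomials in the other variables is a Laurent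
  relation in which the exponent of \<open>x k\<close> records the degree.
\<close>

lemma lin_indep_insertD:
  assumes F: "subring_set F" and J: "finite J" "k \<notin> J" and li: "lin_indep F (insert k J) x"
  shows "lin_indep F J x" "transcendental_over (lspan F J x) (x k)"
proof -
  have nz: "x i \<noteq> 0" if "i \<in> insert k J" for i using li that by (auto simp: lin_indep_def)
  \<comment> \<open>The common core: constant polynomials give independence of the remaining variables.\<close>
  have key: "c i m = 0"
    if c: "\<And>i. i \<le> n \<Longrightarrow> lrep F J x (c i) (z i)" and 0: "(\<Sum>i\<le>n. z i * x k ^ i) = 0" and i: "i \<le> n"
    for c z and n :: nat and i m
  proof -
    define S where "S = (SIGMA i:{..n}. {m. c i m \<noteq> 0})"
    define g where "g = (\<lambda>(i::nat, m). m(k := int i))"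
    define c' where "c' m = (if 0 \<le> m k \<and> nat (m k) \<le> n then c (nat (m k)) (m(k := 0)) else 0)" for m
    have fin: "finite S" unfolding S_def using lrepD(1)[OF c] by auto
    have S_expo: "m \<in> expo J" "m k = 0" if "(i, m) \<in> S" for i m
    proof -
      show "m \<in> expo J" using that lrepD(2)[OF c, of i m] by (auto simp: S_def)
      then show "m k = 0" using J by (auto simp: expo_def)
    qed
    have g_inj: "inj_on g S"
    proof (rule inj_onI)
      fix p q assume pq: "p \<in> S" "q \<in> S" "g p = g q"
      obtain i m where p: "p = (i, m)" by (cases p)
      obtain j n where q: "q = (j, n)" by (cases q)
      have *: "p = (i, m)" "q = (j, n)" "(i, m) \<in> S" "(j, n) \<in> S" "m(k := int i) = n(k := int j)"
        using pq p q by (simp_all add: g_def)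
      have "i = j" using fun_cong[OF *(5), of k] by simp
      moreover have "m a = n a" for a using fun_cong[OF *(5), of a] S_expo(2)[OF *(3)] S_expo(2)[OF *(4)] by (cases "a = k") auto
      ultimately show "p = q" using * by auto
    qed
    have cg: "c' (g (i, m)) = c i m" if "(i, m) \<in> S" for i m
      using that S_expo(2)[OF that] by (auto simp: c'_def g_def S_def fun_upd_idem)
    have "lrep F (insert k J) x c' 0"
    proof (rule lrepI)
      show "finite (g ` S)" using fin by simp
      show "g ` S \<subseteq> expo (insert k J)" using S_expo(1) by (auto simp: g_def expo_def)
      show "c' m \<in> F" for m using lrepD(3)[OF c] subring_setD(2)[OF F] by (auto simp: c'_def)
      show "0 \<in> F" using subring_setD(2)[OF F] .
      show "c' m = 0" if "m \<notin> g ` S" for m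
      proof (rule ccontr)
        assume "c' m \<noteq> 0"
        then have "(nat (m k), m(k := 0)) \<in> S" "g (nat (m k), m(k := 0)) = m"
          by (auto simp: c'_def S_def g_def split: if_splits)
        then show False using that by (metis image_eqI)
      qed
      have "(\<Sum>m\<in>g ` S. c' m * lmon (insert k J) x m) = (\<Sum>p\<in>S. c' (g p) * lmon (insert k J) x (g p))"
        by (rule sum.reindex[OF g_inj, unfolded o_def])
      also have "\<dots> = (\<Sum>(i, m)\<in>S. c i m * lmon J x m * x k ^ i)"
      proof (rule sum.cong[OF HOL.refl], clarify)
        fix i m assume im: "(i, m) \<in> S"
        have "(g (i, m))(k := 0) = m" using S_expo(2)[OF im] by (auto simp: g_def)
        moreover have "g (i, m) k = int i" by (simp add: g_def)
        ultimately show "c' (g (i, m)) * lmon (insert k J) x (g (i, m)) = c i m * lmon J x m * x k ^ i"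
          using cg[OF im] by (simp add: lmon_insert[OF J])
      qed
      also have "\<dots> = (\<Sum>i\<le>n. \<Sum>m | c i m \<noteq> 0. c i m * lmon J x m * x k ^ i)"
        unfolding S_def by (rule sum.Sigma[symmetric]) (use lrepD(1)[OF c] in auto)
      also have "\<dots> = (\<Sum>i\<le>n. z i * x k ^ i)"
        by (rule sum.cong[OF HOL.refl])
          (use lrep_sum[OF c lrepD(1)[OF c] subset_refl] in \<open>auto simp: sum_distrib_right\<close>)
      finally show "0 = (\<Sum>m\<in>g ` S. c' m * lmon (insert k J) x m)" using 0 by simp
    qed
    then have "c' m = 0" for m using li by (auto simp: lin_indep_def)
    then show ?thesis using cg[of i m] i by (cases "c i m = 0") (auto simp: S_def)
  qed
  show "lin_indep F J x"
    unfolding lin_indep_def using key[of 0 "\<lambda>_. c" "\<lambda>_. 0" 0 for c] nz by auto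
  show "transcendental_over (lspan F J x) (x k)"
    unfolding transcendental_over_def
  proof (intro allI impI, elim conjE)
    fix p assume p: "coeffs_in (lspan F J x) p" "poly p (x k) = 0"
    then have "\<exists>c. lrep F J x c (Polynomial.coeff p i)" for i by (auto simp: coeffs_in_def lspan_def)
    then obtain c where c: "\<And>i. lrep F J x (c i) (Polynomial.coeff p i)" by metis
    have "c i m = 0" if "i \<le> Polynomial.degree p" for i m
      by (rule key[OF c _ that]) (use p(2) in \<open>simp add: poly_altdef\<close>)
    then have "lead_coeff p = 0" using c[of "Polynomial.degree p"] by (simp add: lrep_def)
    then show "p = 0" by simp
  qed
qed

text \<open>
  A Laurent relation, multiplied by a power of \<open>x k\<close>, is a polynomial relation for \<open>x k\<close>. Its
  coefficients vanish, and they are Laurent relations in the other variables.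
\<close>

lemma lin_indep_insertI:
  assumes F: "subring_set F" and J: "finite J" "k \<notin> J"
    and li: "lin_indep F J x" and tr: "transcendental_over (lspan F J x) (x k)"
  shows "lin_indep F (insert k J) x"
proof -
  have nzJ: "x i \<noteq> 0" if "i \<in> J" for i using li that by (auto simp: lin_indep_def)
  have span: "subring_set (lspan F J x)" by (rule lspan_subring[OF F nzJ])
  have nzk: "x k \<noteq> 0" by (rule transcendental_nonzero[OF tr span])
  show ?thesis
    unfolding lin_indep_def
  proof (intro conjI ballI allI impI)
    show "x i \<noteq> 0" if "i \<in> insert k J" for i using that nzJ nzk by auto
    fix c m0 assume c: "lrep F (insert k J) x c 0"
    define M where "M = {m. c m \<noteq> 0}"
    have M: "finite M" "M \<subseteq> expo (insert k J)" using lrepD(1,2)[OF c] by (auto simp: M_def)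
    define N where "N = (\<Sum>m\<in>M. nat \<bar>m k\<bar>)"
    have N: "0 \<le> m k + int N" if "m \<in> M" for m
    proof -
      have "nat \<bar>m k\<bar> \<le> N" unfolding N_def using member_le_sum[of m M "\<lambda>m. nat \<bar>m k\<bar>"] that M by simp
      then show ?thesis by linarith
    qed
    let ?t = "\<lambda>m. c m * lmon J x (m(k := 0))"
    define p where "p = (\<Sum>m\<in>M. monom (?t m) (nat (m k + int N)))"
    have t: "?t m \<in> lspan F J x" if "m \<in> M" for m
      using lspan_mon[OF F _ lrepD(3)[OF c]] expo_insert[OF J(2), of m] M(2) that by blast
    have "coeffs_in (lspan F J x) p" unfolding p_def
      by (intro coeffs_in_sum[OF span] coeffs_in_closed(5)[OF span] t)
    moreover have "poly p (x k) = 0"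
    proof -
      have "poly p (x k) = (\<Sum>m\<in>M. x k ^ N * (c m * lmon (insert k J) x m))"
        unfolding p_def poly_sum poly_monom
      proof (rule sum.cong[OF HOL.refl])
        fix m assume m: "m \<in> M"
        have "x k ^ nat (m k + int N) = x k powi (int N + m k)" using N[OF m] by (simp add: power_int_def add.commute)
        then show "?t m * x k ^ nat (m k + int N) = x k ^ N * (c m * lmon (insert k J) x m)"
          using nzk by (simp add: lmon_insert[OF J] power_int_add)
      qed
      also have "\<dots> = x k ^ N * (\<Sum>m\<in>M. c m * lmon (insert k J) x m)" by (simp add: sum_distrib_left)
      also have "(\<Sum>m\<in>M. c m * lmon (insert k J) x m) = 0" using lrep_sum[OF c M(1)] by (simp add: M_def)
      finally show ?thesis by simp
    qed
    ultimately have p0: "p = 0" using tr by (auto simp: transcendental_over_def)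
    show "c m0 = 0"
    proof (cases "m0 \<in> M")
      case False then show ?thesis by (simp add: M_def)
    next
      case True
      define M0 where "M0 = {m \<in> M. m k = m0 k}"
      define c' where "c' m = (if m k = 0 then c (m(k := m0 k)) else 0)" for m
      have M0: "finite M0" using M by (simp add: M0_def)
      have inj: "inj_on (\<lambda>m. m(k := 0)) M0"
        by (rule inj_onI) (metis (mono_tags, lifting) M0_def fun_upd_triv fun_upd_upd mem_Collect_eq)
      have "0 = Polynomial.coeff p (nat (m0 k + int N))" by (simp add: p0)
      also have "\<dots> = (\<Sum>m\<in>M. if m k = m0 k then ?t m else 0)"
        unfolding p_def coeff_sum coeff_monom
      proof (rule sum.cong[OF HOL.refl])
        fix m assume "m \<in> M"
        then have "nat (m k + int N) = nat (m0 k + int N) \<longleftrightarrow> m k = m0 k" using N N[OF True] by fastforce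
        then show "(if nat (m k + int N) = nat (m0 k + int N) then ?t m else 0) = (if m k = m0 k then ?t m else 0)" by simp
      qed
      also have "\<dots> = (\<Sum>m\<in>M0. ?t m)"
        unfolding M0_def by (rule sum.inter_filter[OF M(1), symmetric])
      finally have sum0: "(\<Sum>m\<in>M0. ?t m) = 0" by simp
      have "lrep F J x c' 0"
      proof (rule lrepI)
        show "finite ((\<lambda>m. m(k := 0)) ` M0)" using M0 by simp
        show "(\<lambda>m. m(k := 0)) ` M0 \<subseteq> expo J" using M(2) expo_insert[OF J(2)] by (auto simp: M0_def)
        show "c' m \<in> F" for m using lrepD(3)[OF c] subring_setD(2)[OF F] by (simp add: c'_def)
        show "0 \<in> F" using subring_setD(2)[OF F] .
        show "c' m = 0" if m: "m \<notin> (\<lambda>m. m(k := 0)) ` M0" for m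
        proof (rule ccontr)
          assume "c' m \<noteq> 0"
          then have "m k = 0" "c (m(k := m0 k)) \<noteq> 0" by (auto simp: c'_def split: if_splits)
          then have "m(k := m0 k) \<in> M0" "(m(k := m0 k))(k := 0) = m" by (auto simp: M0_def M_def)
          then show False using m by (metis image_eqI)
        qed
        have "c' (m(k := 0)) = c m" if "m \<in> M0" for m
        proof -
          have "m(k := m0 k) = m" using that by (auto simp: M0_def)
          then show ?thesis by (simp add: c'_def)
        qed
        then have "(\<Sum>m\<in>(\<lambda>m. m(k := 0)) ` M0. c' m * lmon J x m) = (\<Sum>m\<in>M0. ?t m)"
          unfolding sum.reindex[OF inj] o_def by (intro sum.cong) auto
        then show "0 = (\<Sum>m\<in>(\<lambda>m. m(k := 0)) ` M0. c' m * lmon J x m)" using sum0 by simp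
      qed
      then have "c' (m0(k := 0)) = 0" using li by (auto simp: lin_indep_def)
      then show ?thesis by (simp add: c'_def)
    qed
  qed
qed

text \<open>
  The effect of a mutation on a cluster, with \<open>y\<close> the exchange binomial: transcendence of \<open>x k\<close> over
  the ring of the other variables passes to \<open>y / x k\<close>.
\<close>

lemma lin_indep_exchange:
  assumes F: "subring_set F" and I: "finite I" "k \<in> I" and li: "lin_indep F I x"
    and y: "y \<in> lspan F (I - {k}) x" "y \<noteq> 0"
  shows "lin_indep F I (x(k := y / x k))"
proof -
  let ?J = "I - {k}" and ?x = "x(k := y / x k)"
  have J: "finite ?J" "k \<notin> ?J" "insert k ?J = I" using I by auto
  have D: "lin_indep F ?J x" "transcendental_over (lspan F ?J x) (x k)"
    using lin_indep_insertD[OF F J(1,2)] li J(3) by auto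
  have "x i \<noteq> 0" if "i \<in> ?J" for i using D(1) that by (auto simp: lin_indep_def)
  then have "transcendental_over (lspan F ?J x) (y / x k)"
    by (intro transcendental_quotient[OF lspan_subring[OF F] D(2) y])
  moreover have "lspan F ?J ?x = lspan F ?J x" "lin_indep F ?J ?x = lin_indep F ?J x"
    by (rule lspan_cong lin_indep_cong; auto)+
  ultimately have "lin_indep F (insert k ?J) ?x" using D(1) by (intro lin_indep_insertI[OF F J(1,2)]) auto
  then show ?thesis by (simp only: J(3))
qed

subsection \<open>Laurent polynomial rings\<close>

lemma gen_subring: "subring_set (generate_ring (ambient :: 'l::field ring) S)"
  unfolding subring_set_def
proof (intro conjI ballI)
  show "1 \<in> generate_ring (ambient :: 'l ring) S" using generate_ring.one[of "ambient :: 'l ring" S] by simp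
  fix x y assume xy: "x \<in> generate_ring (ambient :: 'l ring) S" "y \<in> generate_ring (ambient :: 'l ring) S"
  show "x - y \<in> generate_ring (ambient :: 'l ring) S"
    using generate_ring.eng_add[OF xy(1) generate_ring.a_inv[OF xy(2)]] by simp
  show "x * y \<in> generate_ring (ambient :: 'l ring) S" using generate_ring.eng_mult[OF xy] by simp
qed

lemma gen_incl: "S \<subseteq> generate_ring (ambient :: 'l::field ring) S"
  by (auto intro: generate_ring.incl)

lemma gen_least:
  assumes T: "subring_set T" "S \<subseteq> T" shows "generate_ring (ambient :: 'l::field ring) S \<subseteq> T"
proof
  fix z assume "z \<in> generate_ring (ambient :: 'l ring) S"
  then show "z \<in> T" by induction (use T subring_setD[OF T(1)] in auto)
qed

text \<open>
  Only the variables indexed by \<open>J\<close> are inverted; the others are the highly-frozen ones.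
\<close>

definition laurent :: "'l::field set \<Rightarrow> 'v set \<Rightarrow> 'v set \<Rightarrow> ('v \<Rightarrow> 'l) \<Rightarrow> 'l set" where
  "laurent F I J x = generate_ring ambient (F \<union> x ` I \<union> (\<lambda>i. inverse (x i)) ` J)"

lemma laurent_subring: "subring_set (laurent F I J x)"
  unfolding laurent_def by (rule gen_subring)

lemma laurent_incl:
  "F \<subseteq> laurent F I J x" "i \<in> I \<Longrightarrow> x i \<in> laurent F I J x" "i \<in> J \<Longrightarrow> inverse (x i) \<in> laurent F I J x"
  unfolding laurent_def using gen_incl[of "F \<union> x ` I \<union> (\<lambda>i. inverse (x i)) ` J"] by auto

lemma laurent_least:
  assumes "subring_set T" "F \<subseteq> T" "\<And>i. i \<in> I \<Longrightarrow> x i \<in> T" "\<And>i. i \<in> J \<Longrightarrow> inverse (x i) \<in> T"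
  shows "laurent F I J x \<subseteq> T"
  unfolding laurent_def by (rule gen_least) (use assms in auto)

lemma laurent_mono: "I \<subseteq> I' \<Longrightarrow> J \<subseteq> J' \<Longrightarrow> laurent F I J x \<subseteq> laurent F I' J' x"
  by (rule laurent_least[OF laurent_subring laurent_incl(1)]) (auto intro: laurent_incl(2,3))

lemma laurent_subset_lspan:
  assumes F: "subring_set F" and I: "finite I" "J \<subseteq> I" "\<And>i. i \<in> I \<Longrightarrow> x i \<noteq> 0"
  shows "laurent F I J x \<subseteq> lspan F I x"
  by (rule laurent_least[OF lspan_subring[OF F I(3)]]) (use lspan_incl[OF F I(1)] I(2) in auto)

lemma lspan_eq_laurent:
  assumes F: "subring_set F" and I: "finite I" "\<And>i. i \<in> I \<Longrightarrow> x i \<noteq> 0"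
  shows "lspan F I x = laurent F I I x"
proof
  show "lspan F I x \<subseteq> laurent F I I x" by (rule lspan_least[OF laurent_subring laurent_incl(1)]) (auto intro: laurent_incl(2,3))
  show "laurent F I I x \<subseteq> lspan F I x" by (rule laurent_subset_lspan[OF F I(1) subset_refl I(2)])
qed

lemma laurent_adjoin:
  assumes "k \<notin> J" shows "laurent F (insert k I) J x = adjoin (laurent F I J x) (x k)"
proof
  note L = laurent_subring[of F I J x]
  show "laurent F (insert k I) J x \<subseteq> adjoin (laurent F I J x) (x k)"
  proof (rule laurent_least[OF adjoin_subring[OF L]])
    note * = adjoin_incl[OF L, of "x k"]
    show "F \<subseteq> adjoin (laurent F I J x) (x k)" using laurent_incl(1) *(1) by blast
    show "x i \<in> adjoin (laurent F I J x) (x k)" if "i \<in> insert k I" for i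
      using that * laurent_incl(2)[of i I x F J] by blast
    show "inverse (x i) \<in> adjoin (laurent F I J x) (x k)" if "i \<in> J" for i
      using that * laurent_incl(3)[of i J x F I] by blast
  qed
  show "adjoin (laurent F I J x) (x k) \<subseteq> laurent F (insert k I) J x"
    by (rule adjoin_least[OF laurent_subring laurent_mono]) (auto intro: laurent_incl)
qed

lemma laurent_adjoin_unit:
  assumes "x k \<noteq> 0" shows "laurent F (insert k I) (insert k J) x = adjoin_unit (laurent F I J x) (x k)"
proof
  note L = laurent_subring[of F I J x]
  note U = adjoin_unit_incl[OF L, of "x k"] adjoin_incl[OF L, of "x k"]
  show "laurent F (insert k I) (insert k J) x \<subseteq> adjoin_unit (laurent F I J x) (x k)"
  proof (rule laurent_least[OF adjoin_unit_subring[OF L]])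
    have *: "laurent F I J x \<subseteq> adjoin_unit (laurent F I J x) (x k)" using U by blast
    then show "F \<subseteq> adjoin_unit (laurent F I J x) (x k)" using laurent_incl(1) by blast
    show "x i \<in> adjoin_unit (laurent F I J x) (x k)" if "i \<in> insert k I" for i
      using that U * laurent_incl(2)[of i I x F J] by blast
    show "inverse (x i) \<in> adjoin_unit (laurent F I J x) (x k)" if "i \<in> insert k J" for i
      using that U(2)[OF assms] * laurent_incl(3)[of i J x F I] by blast
  qed
  show "adjoin_unit (laurent F I J x) (x k) \<subseteq> laurent F (insert k I) (insert k J) x"
    by (rule adjoin_unit_least[OF laurent_subring laurent_mono]) (auto intro: laurent_incl simp: assms)
qed

lemma laurent_transcendental:
  assumes F: "subring_set F" and I: "finite I" "k \<notin> I" "J \<subseteq> I" and li: "lin_indep F (insert k I) x"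
  shows "transcendental_over (laurent F I J x) (x k)"
proof -
  have "x i \<noteq> 0" if "i \<in> I" for i using li that by (auto simp: lin_indep_def)
  then show ?thesis
    using transcendental_over_subset[OF lin_indep_insertD(2)[OF F I(1,2) li] laurent_subset_lspan[OF F I(1,3)]] by blast
qed

text \<open>
  One variable at a time: each is transcendental over the ring generated by the preceding ones.
\<close>

theorem completely_closed_laurent:
  assumes F: "subring_set F" "\<And>a. a \<in> F \<Longrightarrow> inverse a \<in> F"
    and "finite I" "J \<subseteq> I" "lin_indep F I x"
  shows "completely_closed (laurent F I J x)"
  using assms(3-5)
proof (induction I arbitrary: J rule: finite_induct)
  case empty
  have "completely_closed F"
    unfolding completely_closed_def
  proof (intro allI impI, elim conjE)
    fix z c assume c: "c \<noteq> 0" "\<forall>n. c * z ^ n \<in> F"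
    have "inverse (c * z ^ 0) * (c * z ^ 1) \<in> F" using subring_setD(6)[OF F(1) F(2)] c(2) by blast
    then show "z \<in> F" using c(1) by (simp add: mult.assoc[symmetric])
  qed
  moreover have "laurent F {} {} x = F" using gen_least[OF F(1) subset_refl] gen_incl by (auto simp: laurent_def)
  ultimately show ?case using empty by simp
next
  case (insert k I)
  have liI: "lin_indep F I x" by (rule lin_indep_insertD(1)[OF F(1) insert.hyps insert.prems(2)])
  note L = laurent_subring
  show ?case
  proof (cases "k \<in> J")
    case True
    then have J: "J = insert k (J - {k})" "J - {k} \<subseteq> I" using insert.prems by auto
    have "x k \<noteq> 0" using insert.prems by (auto simp: lin_indep_def)
    then have "laurent F (insert k I) J x = adjoin_unit (laurent F I (J - {k}) x) (x k)"
      using laurent_adjoin_unit[of x k F I "J - {k}"] J(1) by simp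
    then show ?thesis
      using completely_closed_adjoin_unit[OF L insert.IH[OF J(2) liI]
          laurent_transcendental[OF F(1) insert.hyps J(2) insert.prems(2)]] by simp
  next
    case False
    then have J: "J \<subseteq> I" using insert.prems by auto
    show ?thesis
      unfolding laurent_adjoin[OF False]
      by (rule completely_closed_adjoin[OF L insert.IH[OF J liI]
          laurent_transcendental[OF F(1) insert.hyps J insert.prems(2)]])
  qed
qed

theorem noeth_generated:
  assumes F: "subring_set F" "\<And>a. a \<in> F \<Longrightarrow> inverse a \<in> F" and S: "finite S"
  shows "noeth (generate_ring ambient (F \<union> S))"
  using S
proof (induction S rule: finite_induct)
  case empty
  have "noeth F"
    unfolding noeth_def
  proof (intro allI impI)
    fix J assume J: "ideal_set F J"
    show "\<exists>G. finite G \<and> G \<subseteq> J \<and> (\<forall>J'. ideal_set F J' \<and> G \<subseteq> J' \<longrightarrow> J \<subseteq> J')"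
    proof (cases "J \<subseteq> {0}")
      case True
      then show ?thesis using ideal_setD(2) by (intro exI[of _ "{}"]) blast
    next
      case False
      then obtain a where a: "a \<in> J" "a \<noteq> 0" by blast
      have "J \<subseteq> J'" if J': "ideal_set F J'" "{a} \<subseteq> J'" for J'
      proof
        fix b assume "b \<in> J"
        then have "b * inverse a \<in> F" using subring_setD(6)[OF F(1)] F(2) a ideal_setD(1)[OF J] by blast
        then have "b * inverse a * a \<in> J'" using ideal_setD(4)[OF J'(1)] J'(2) by blast
        then show "b \<in> J'" using a(2) by (simp add: mult.assoc)
      qed
      then show ?thesis using a(1) by (intro exI[of _ "{a}"]) blast
    qed
  qed
  moreover have "generate_ring ambient F = F" using gen_least[OF F(1) subset_refl] gen_incl by blast
  ultimately show ?case by simp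
next
  case (insert a S)
  let ?R = "generate_ring ambient (F \<union> S)" and ?T = "generate_ring ambient (F \<union> insert a S)"
  have "?T = adjoin ?R a"
  proof
    show "?T \<subseteq> adjoin ?R a"
      by (rule gen_least[OF adjoin_subring[OF gen_subring]])
        (use adjoin_incl(1)[OF gen_subring[of "F \<union> S"], of a] adjoin_incl(2)[OF gen_subring[of "F \<union> S"], of a]
          gen_incl[of "F \<union> S"] in blast)
    show "adjoin ?R a \<subseteq> ?T"
      by (rule adjoin_least[OF gen_subring gen_least[OF gen_subring]]) (use gen_incl[of "F \<union> insert a S"] in blast)+
  qed
  then show ?case using noeth_adjoin[OF gen_subring insert.IH] by simp
qed


section \<open>Seeds\<close>

locale scalars =
  fixes \<iota> :: "complex \<Rightarrow> 'l::field"
  assumes iota: "\<iota> \<in> ring_hom ambient ambient"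
begin

abbreviation "F \<equiv> range \<iota>"

lemma iota_hom: "\<iota> (a + b) = \<iota> a + \<iota> b" "\<iota> (a * b) = \<iota> a * \<iota> b" "\<iota> 1 = 1"
  using iota by (auto simp: ring_hom_def)

lemma iota_0: "\<iota> 0 = 0"
proof -
  have "\<iota> 0 + \<iota> 0 = \<iota> 0 + 0" using iota_hom(1)[of 0 0] by simp
  then show ?thesis by (simp only: add_left_cancel)
qed

lemma iota_minus: "\<iota> (a - b) = \<iota> a - \<iota> b"
  using iota_hom(1)[of "a - b" b] by (simp add: algebra_simps)

lemma iota_inverse: "\<iota> (inverse a) = inverse (\<iota> a)"
proof (cases "a = 0")
  case True then show ?thesis by (simp add: iota_0)
next
  case False
  then have "\<iota> a * \<iota> (inverse a) = 1" by (simp flip: iota_hom(2) add: iota_hom(3))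
  then show ?thesis by (metis inverse_unique)
qed

lemma F: "subring_set F"
  unfolding subring_set_def using iota_hom(3)
  by (auto simp flip: iota_minus iota_hom(2))

lemma F_inverse: "a \<in> F \<Longrightarrow> inverse a \<in> F"
  by (auto simp flip: iota_inverse)

lemma iota_inj: "inj \<iota>"
proof (rule injI)
  fix a b assume "\<iota> a = \<iota> b"
  then have "\<iota> (a - b) = 0" by (simp add: iota_minus)
  then have "a - b = 0" using iota_inverse[of "a - b"] iota_hom(2)[of "a - b" "inverse (a - b)"] iota_hom(3)
    by (metis mult_zero_left right_inverse zero_neq_one)
  then show "a = b" by simp
qed

text \<open>The exchange binomial of an isolated mutable vertex is \<open>1 + 1\<close>.\<close>

lemma two_nonzero: "(2 :: 'l) \<noteq> 0"
proof
  assume "(2 :: 'l) = 0"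
  then have "\<iota> 2 = \<iota> 0" using iota_hom(1)[of 1 1] by (simp add: iota_hom(3) iota_0)
  then show False using iota_inj by (simp add: inj_eq)
qed

text \<open>
  What is needed of a seed: this is preserved by mutation, and the cluster is only required to
  satisfy no relation between Laurent monomials over the scalars.
\<close>

definition good :: "('v, 'l) seed \<Rightarrow> bool" where
  "good t \<longleftrightarrow> finite (uf t) \<and> finite (sf t) \<and> finite (hf t) \<and>
     uf t \<inter> sf t = {} \<and> uf t \<inter> hf t = {} \<and> sf t \<inter> hf t = {} \<and>
     (\<exists>s :: 'v \<Rightarrow> int. (\<forall>i \<in> uf t. s i > 0) \<and>
        (\<forall>i \<in> uf t. \<forall>j \<in> uf t. s i * exm t i j = - (s j * exm t j i))) \<and>
     lin_indep F (vertices t) (clv t)"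

lemma good_skew:
  fixes t :: "('v, 'l) seed"
  shows "good t \<Longrightarrow> \<exists>s :: 'v \<Rightarrow> int. (\<forall>i \<in> uf t. s i > 0) \<and>
        (\<forall>i \<in> uf t. \<forall>j \<in> uf t. s i * exm t i j = - (s j * exm t j i))"
  by (simp add: good_def)

lemma is_seed_good:
  assumes "is_seed \<iota> K t" shows "good t"
proof -
  have "finite (vertices t)" using assms by (auto simp: is_seed_def vertices_def)
  then show ?thesis
    using assms algebraically_independent_lin_indep[OF _ _ F]
    by (auto simp: is_seed_def good_def transcendence_basis_def)
qed

lemma goodD:
  assumes "good t"
  shows "finite (vertices t)" "lin_indep F (vertices t) (clv t)" "i \<in> vertices t \<Longrightarrow> clv t i \<noteq> 0"
    "k \<in> uf t \<Longrightarrow> k \<in> vertices t" "d \<in> hf t \<Longrightarrow> d \<in> vertices t" "k \<in> uf t \<Longrightarrow> d \<in> hf t \<Longrightarrow> d \<noteq> k"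
  using assms by (auto simp: good_def vertices_def lin_indep_def)

lemma diagonal_zero:
  fixes t :: "('v, 'l) seed"
  assumes "good t" "k \<in> uf t" shows "exm t k k = 0"
proof -
  obtain s :: "'v \<Rightarrow> int" where s: "\<forall>i\<in>uf t. s i > 0"
    "\<forall>i\<in>uf t. \<forall>j\<in>uf t. s i * exm t i j = - (s j * exm t j i)"
    using good_skew[OF assms(1)] by blast
  then have "s k > 0" "s k * exm t k k = - (s k * exm t k k)" using assms(2) by blast+
  then show ?thesis by simp
qed

definition exbin :: "'v \<Rightarrow> ('v, 'l) seed \<Rightarrow> 'l" where
  "exbin k t = (\<Prod>i\<in>vertices t. clv t i powi pos_part (exm t i k)) +
               (\<Prod>i\<in>vertices t. clv t i powi neg_part (exm t i k))"

lemma mutate_simps [simp]: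
  "uf (mutate k t) = uf t" "sf (mutate k t) = sf t" "hf (mutate k t) = hf t"
  "vertices (mutate k t) = vertices t"
  "clv (mutate k t) = (clv t)(k := exbin k t / clv t k)"
  by (simp_all add: mutate_def vertices_def exbin_def field_simps)

lemma exm_mutate:
  "exm (mutate k t) i j = (if i = k \<or> j = k then - exm t i j
        else exm t i j + pos_part (exm t i k) * pos_part (exm t k j)
                       - neg_part (exm t i k) * neg_part (exm t k j))"
  by (simp add: mutate_def)

lemma part_simps: "pos_part 0 = 0" "neg_part 0 = 0" "pos_part (- b) = neg_part b" "neg_part (- b) = pos_part b"
  "0 \<le> pos_part b" "0 \<le> neg_part b" "b = pos_part b - neg_part b"
  "s > 0 \<Longrightarrow> pos_part (s * b) = s * pos_part b" "s > 0 \<Longrightarrow> neg_part (s * b) = s * neg_part b"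
  by (auto simp: pos_part_def neg_part_def max_def mult_le_0_iff zero_le_mult_iff)

text \<open>
  The symmetrizer turns \<open>pos_part (b i k)\<close> into \<open>neg_part (b k i)\<close>, so it exchanges the two correction
  terms of the mutation rule.
\<close>

lemma skew_mutate:
  fixes s :: "'v \<Rightarrow> int"
  assumes s: "\<And>i. i \<in> U \<Longrightarrow> s i > 0" and sk: "\<And>i j. i \<in> U \<Longrightarrow> j \<in> U \<Longrightarrow> s i * exm t i j = - (s j * exm t j i)"
    and k: "k \<in> U" and ij: "i \<in> U" "j \<in> U"
  shows "s i * exm (mutate k t) i j = - (s j * exm (mutate k t) j i)"
proof -
  have pn: "s i * pos_part (exm t i k) = s k * neg_part (exm t k i)" "s i * neg_part (exm t i k) = s k * pos_part (exm t k i)"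
    if "i \<in> U" for i
    using part_simps(8,9)[OF s[OF that]] part_simps(8,9)[OF s[OF k]] sk[OF that k] part_simps(3,4) by metis+
  have "s i * (pos_part (exm t i k) * pos_part (exm t k j)) = neg_part (exm t k i) * (s k * pos_part (exm t k j))"
    using pn(1)[OF ij(1)] by (simp add: mult.assoc[symmetric])
  also have "\<dots> = neg_part (exm t k i) * (s j * neg_part (exm t j k))" using pn(2)[OF ij(2)] by simp
  finally have 1: "s i * (pos_part (exm t i k) * pos_part (exm t k j)) = s j * (neg_part (exm t j k) * neg_part (exm t k i))"
    by (simp add: mult_ac)
  have "s i * (neg_part (exm t i k) * neg_part (exm t k j)) = pos_part (exm t k i) * (s k * neg_part (exm t k j))"
    using pn(2)[OF ij(1)] by (simp add: mult.assoc[symmetric])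
  also have "\<dots> = pos_part (exm t k i) * (s j * pos_part (exm t j k))" using pn(1)[OF ij(2)] by simp
  finally have 2: "s i * (neg_part (exm t i k) * neg_part (exm t k j)) = s j * (pos_part (exm t j k) * pos_part (exm t k i))"
    by (simp add: mult_ac)
  show ?thesis using 1 2 sk[OF ij] by (simp add: exm_mutate algebra_simps)
qed

lemma exbin_mutate:
  assumes t: "good t" "k \<in> uf t" shows "exbin k (mutate k t) = exbin k t"
proof -
  have "exm (mutate k t) i k = - exm t i k" for i by (simp add: exm_mutate)
  moreover have "(\<Prod>i\<in>vertices t. clv (mutate k t) i powi f (exm t i k)) = (\<Prod>i\<in>vertices t. clv t i powi f (exm t i k))"
    if "f 0 = 0" for f :: "int \<Rightarrow> int"
    by (rule prod.cong) (use diagonal_zero[OF t] that in auto)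
  ultimately show ?thesis using part_simps(1,2) by (simp add: exbin_def part_simps(3,4) add.commute)
qed

text \<open>
  Every vertex occurs in at most one of the two monomials of the binomial. Hence, as a polynomial
  in a variable that occurs, the binomial has a nonzero constant term; in any other variable it is
  itself the constant term.
\<close>

lemma exbin_poly:
  assumes t: "good t" "k \<in> uf t" and d: "d \<in> vertices t" "d \<noteq> k" "exm t d k \<noteq> 0 \<or> exbin k t \<noteq> 0"
  shows "\<exists>q. coeffs_in (lspan F (vertices t - {d}) (clv t)) q \<and> poly q (clv t d) = exbin k t \<and> Polynomial.coeff q 0 \<noteq> 0"
proof -
  let ?W = "vertices t - {d}" and ?x = "clv t"
  have V: "finite (vertices t)" "finite ?W" and nz: "\<And>i. i \<in> vertices t \<Longrightarrow> ?x i \<noteq> 0" using goodD[OF t(1)] by auto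
  have span: "subring_set (lspan F ?W ?x)" by (rule lspan_subring[OF F]) (use nz in auto)
  define P where "P f = (\<Prod>i\<in>?W. ?x i powi f (exm t i k))" for f :: "int \<Rightarrow> int"
  have P: "P f \<in> lspan F ?W ?x" "P f \<noteq> 0" for f
    unfolding P_def using V nz by (auto intro!: subring_set_prod[OF span] lspan_incl(2)[OF F])
  have split: "(\<Prod>i\<in>vertices t. ?x i powi f (exm t i k)) = P f * ?x d ^ nat (f (exm t d k))" if "f (exm t d k) \<ge> 0" for f
    unfolding P_def using prod.remove[OF V(1) d(1), of "\<lambda>i. ?x i powi f (exm t i k)"] that
    by (simp add: power_int_def mult.commute)
  define q where "q = monom (P pos_part) (nat (pos_part (exm t d k))) + monom (P neg_part) (nat (neg_part (exm t d k)))"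
  have "coeffs_in (lspan F ?W ?x) q" unfolding q_def using P by (intro coeffs_in_closed[OF span])
  moreover have "poly q (?x d) = exbin k t"
    by (simp add: q_def exbin_def poly_monom split part_simps)
  moreover have "Polynomial.coeff q 0 \<noteq> 0"
  proof (cases "exm t d k = 0")
    case True
    then have "Polynomial.coeff q 0 = exbin k t" by (simp add: q_def exbin_def split part_simps)
    then show ?thesis using d(3) True by simp
  next
    case False
    then have "nat (pos_part (exm t d k)) = 0 \<longleftrightarrow> \<not> nat (neg_part (exm t d k)) = 0"
      by (auto simp: pos_part_def neg_part_def)
    then show ?thesis using P(2) by (auto simp: q_def)
  qed
  ultimately show ?thesis by blast
qed

lemma vertex_transcendental:
  assumes t: "good t" and d: "d \<in> vertices t"
  shows "transcendental_over (lspan F (vertices t - {d}) (clv t)) (clv t d)"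
proof -
  have "insert d (vertices t - {d}) = vertices t" using d by auto
  then show ?thesis using lin_indep_insertD(2)[OF F, of "vertices t - {d}" d "clv t"] goodD(1,2)[OF t] by simp
qed

lemma exbin_nonzero:
  assumes t: "good t" "k \<in> uf t" shows "exbin k t \<noteq> 0"
proof (cases "\<exists>d\<in>vertices t. exm t d k \<noteq> 0")
  case True
  then obtain d where d: "d \<in> vertices t" "exm t d k \<noteq> 0" by blast
  then have "d \<noteq> k" using diagonal_zero[OF t] by auto
  then obtain q where q: "coeffs_in (lspan F (vertices t - {d}) (clv t)) q" "poly q (clv t d) = exbin k t" "Polynomial.coeff q 0 \<noteq> 0"
    using exbin_poly[OF t d(1)] d(2) by blast
  then show ?thesis using vertex_transcendental[OF t(1) d(1)] unfolding transcendental_over_def by (metis coeff_0)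
next
  case False
  then have "exbin k t = 2" by (simp add: exbin_def part_simps)
  then show ?thesis using two_nonzero by simp
qed

lemma exbin_laurent:
  assumes t: "good t" "k \<in> uf t" shows "exbin k t \<in> laurent F (vertices t - {k}) J (clv t)"
proof -
  let ?L = "laurent F (vertices t - {k}) J (clv t)"
  have "clv t i powi f (exm t i k) \<in> ?L"
    if i: "i \<in> vertices t" and f: "f 0 = 0" "f (exm t i k) \<ge> 0" for i and f :: "int \<Rightarrow> int"
  proof (cases "i = k")
    case True then show ?thesis using diagonal_zero[OF t] f subring_setD(1)[OF laurent_subring] by simp
  next
    case False
    then have "clv t i \<in> ?L" using i by (intro laurent_incl(2)) auto
    then have "clv t i ^ nat (f (exm t i k)) \<in> ?L" by (rule subring_set_power[OF laurent_subring])
    then show ?thesis using f by (simp add: power_int_def)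
  qed
  then show ?thesis unfolding exbin_def
    by (intro subring_setD(4)[OF laurent_subring] subring_set_prod[OF laurent_subring]) (auto simp: part_simps)
qed

lemma good_mutate:
  fixes t :: "('v, 'l) seed"
  assumes t: "good t" "k \<in> uf t" shows "good (mutate k t)"
proof -
  have "exbin k t \<in> lspan F (vertices t - {k}) (clv t)"
    using exbin_laurent[OF t, of "vertices t - {k}"] goodD[OF t(1)]
    by (subst lspan_eq_laurent[OF F]) auto
  then have "lin_indep F (vertices t) ((clv t)(k := exbin k t / clv t k))"
    by (rule lin_indep_exchange[OF F goodD(1)[OF t(1)] goodD(4)[OF t] goodD(2)[OF t(1)] _ exbin_nonzero[OF t]])
  moreover obtain s :: "'v \<Rightarrow> int" where s: "\<And>i. i \<in> uf t \<Longrightarrow> s i > 0"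
    "\<And>i j. i \<in> uf t \<Longrightarrow> j \<in> uf t \<Longrightarrow> s i * exm t i j = - (s j * exm t j i)"
    using good_skew[OF t(1)] by blast
  have "\<exists>s :: 'v \<Rightarrow> int. (\<forall>i \<in> uf t. s i > 0) \<and> (\<forall>i \<in> uf t. \<forall>j \<in> uf t. s i * exm (mutate k t) i j = - (s j * exm (mutate k t) j i))"
    by (rule exI[of _ s]) (use s skew_mutate[of "uf t" s, OF s t(2)] in blast)
  ultimately show ?thesis using t(1) by (simp add: good_def)
qed

lemma good_equivalent: "mutation_equivalent t t' \<Longrightarrow> good t \<Longrightarrow> good t'"
  by (induction rule: mutation_equivalent.induct) (auto intro: good_mutate)

lemma equivalent_simps:
  fixes t :: "('v, 'l) seed"
  assumes "mutation_equivalent t t'"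
  shows "uf t' = uf t" "sf t' = sf t" "hf t' = hf t" "vertices t' = vertices t"
  using assms by (induction rule: mutation_equivalent.induct) auto

lemma equivalent_frozen:
  fixes t :: "('v, 'l) seed"
  shows "mutation_equivalent t t' \<Longrightarrow> d \<notin> uf t \<Longrightarrow> clv t' d = clv t d"
proof (induction rule: mutation_equivalent.induct)
  case (step t' k)
  then show ?case using equivalent_simps(1)[OF step.hyps(1)] by auto
qed simp

abbreviation "LL \<equiv> seed_laurent \<iota>"
abbreviation "UU \<equiv> upper_cluster_algebra \<iota>"

lemma LL_laurent: "LL t = laurent F (vertices t) (sf t \<union> uf t) (clv t)"
  by (simp add: seed_laurent_def gen_algebra_def laurent_def Un_assoc)

lemma LL_subring: "subring_set (LL t)"
  unfolding LL_laurent by (rule laurent_subring)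

lemma LL_incl: "F \<subseteq> LL t" "i \<in> vertices t \<Longrightarrow> clv t i \<in> LL t" "i \<in> sf t \<union> uf t \<Longrightarrow> inverse (clv t i) \<in> LL t"
  unfolding LL_laurent by (rule laurent_incl; simp)+

lemma UU_def: "UU t = (\<Inter>t'\<in>{t'. mutation_equivalent t t'}. LL t')"
  by (simp add: upper_cluster_algebra_def)

lemma UU_subring: "subring_set (UU t)"
  using LL_subring unfolding UU_def subring_set_def by blast

lemma UU_LL: "UU t \<subseteq> LL t"
  unfolding UU_def using mutation_equivalent.refl by blast

lemma F_UU: "F \<subseteq> UU t"
  unfolding UU_def using LL_incl(1) by blast

lemma exbin_LL: "good t \<Longrightarrow> k \<in> uf t \<Longrightarrow> exbin k t \<in> LL t"
  using exbin_laurent[of t k "sf t \<union> uf t - {k}"] laurent_mono[of "vertices t - {k}" "vertices t" "sf t \<union> uf t - {k}" "sf t \<union> uf t" F "clv t"]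
  unfolding LL_laurent by blast

text \<open>The upper cluster algebra is an intersection of Laurent rings.\<close>

theorem UU_completely_closed:
  assumes "good t" shows "completely_closed (UU t)"
  unfolding UU_def
proof (rule completely_closed_Inter, clarify)
  fix t' assume "mutation_equivalent t t'"
  then have "good t'" using good_equivalent assms by blast
  then show "completely_closed (LL t')"
    unfolding LL_laurent using goodD
    by (intro completely_closed_laurent[OF F F_inverse]) (auto simp: vertices_def)
qed

text \<open>
  The two Laurent rings of adjacent seeds become equal when the exchange binomial is inverted, since
  it is the product of the exchanged variables.
\<close>

lemma LL_mutate:
  assumes t: "good t" "k \<in> uf t" and z: "z \<in> LL t"
  shows "\<exists>n. exbin k t ^ n * z \<in> LL (mutate k t)"
proof -
  let ?L = "LL (mutate k t)" and ?y = "exbin k t"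
  note LD = subring_setD[OF LL_subring[of "mutate k t"]]
  have xk: "clv t k \<noteq> 0" using goodD[OF t(1)] t(2) by auto
  have y: "?y \<in> ?L" using exbin_LL[OF good_mutate[OF t], of k] exbin_mutate[OF t] t(2) by simp
  define T where "T = {z. \<exists>n. ?y ^ n * z \<in> ?L}"
  have LT: "?L \<subseteq> T" and "subring_set T" unfolding T_def using fractions_subring[OF LL_subring y] by blast+
  have "LL t \<subseteq> T"
    unfolding LL_laurent[of t]
  proof (rule laurent_least[OF \<open>subring_set T\<close>])
    show "F \<subseteq> T" using LT LL_incl(1) by blast
    show "clv t i \<in> T" if i: "i \<in> vertices t" for i
    proof (cases "i = k")
      case True
      have "clv t k = ?y * inverse (clv (mutate k t) k)" using exbin_nonzero[OF t] xk by simp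
      also have "\<dots> \<in> ?L" by (rule LD(6)[OF y LL_incl(3)]) (use t(2) in auto)
      finally show ?thesis using True LT by blast
    next
      case False
      then show ?thesis using LL_incl(2)[of i "mutate k t"] i LT by auto
    qed
    show "inverse (clv t i) \<in> T" if i: "i \<in> sf t \<union> uf t" for i
    proof (cases "i = k")
      case True
      have "?y ^ 1 * inverse (clv t k) = clv (mutate k t) k" by (simp add: field_simps)
      also have "\<dots> \<in> ?L" using LL_incl(2)[of k "mutate k t"] goodD(4)[OF t] by simp
      finally show ?thesis unfolding T_def True by blast
    next
      case False
      then show ?thesis using LL_incl(3)[of i "mutate k t"] i LT by auto
    qed
  qed
  then show ?thesis using z by (auto simp: T_def)
qed

subsection \<open>Frozen variables are prime elements\<close>

text \<open>
  The part of the Laurent ring without the variable at \<open>d\<close>, over which that variable is a polynomial generator.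
\<close>

definition coefficient_ring :: "'v \<Rightarrow> ('v, 'l) seed \<Rightarrow> 'l set" where
  "coefficient_ring d t = laurent F (vertices t - {d}) (sf t \<union> uf t) (clv t)"

lemma LL_adjoin:
  assumes t: "good t" and d: "d \<in> hf t"
  shows "LL t = adjoin (coefficient_ring d t) (clv t d)"
    "subring_set (coefficient_ring d t)" "transcendental_over (coefficient_ring d t) (clv t d)"
    "coefficient_ring d t \<subseteq> lspan F (vertices t - {d}) (clv t)"
proof -
  have I: "insert d (vertices t - {d}) = vertices t" using d by (auto simp: vertices_def)
  have dn: "d \<notin> sf t \<union> uf t" using t d by (auto simp: good_def)
  show "LL t = adjoin (coefficient_ring d t) (clv t d)"
    unfolding LL_laurent coefficient_ring_def using laurent_adjoin[OF dn, of F "vertices t - {d}" "clv t"] I by simp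
  show "subring_set (coefficient_ring d t)" unfolding coefficient_ring_def by (rule laurent_subring)
  show sub: "coefficient_ring d t \<subseteq> lspan F (vertices t - {d}) (clv t)"
    unfolding coefficient_ring_def
    by (rule laurent_subset_lspan[OF F]) (use goodD[OF t] dn in \<open>auto simp: vertices_def\<close>)
  show "transcendental_over (coefficient_ring d t) (clv t d)"
    using transcendental_over_subset[OF vertex_transcendental[OF t] sub] d goodD(5)[OF t] by blast
qed

lemma LL_prime:
  assumes "good t" "d \<in> hf t" "a \<in> LL t" "b \<in> LL t" "a * b \<in> (*) (clv t d) ` LL t"
  shows "a \<in> (*) (clv t d) ` LL t \<or> b \<in> (*) (clv t d) ` LL t"
  using adjoin_prime[OF LL_adjoin(2,3)[OF assms(1,2)]] assms(3-5) unfolding LL_adjoin(1)[OF assms(1,2)] by blast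

lemma adjoin_mono: "R \<subseteq> S \<Longrightarrow> adjoin R a \<subseteq> adjoin S a"
  unfolding adjoin_def coeffs_in_def by blast

text \<open>
  Divisibility is tested over the larger ring in which all variables other than the one at \<open>d\<close> are
  inverted, because the coefficients of the exchange binomial are visible there.
\<close>

lemma LL_not_multiple:
  assumes t: "good t" and d: "d \<in> hf t"
    and q: "coeffs_in (lspan F (vertices t - {d}) (clv t)) q" "Polynomial.coeff q 0 \<noteq> 0"
  shows "poly q (clv t d) \<notin> (*) (clv t d) ` LL t"
proof -
  have span: "subring_set (lspan F (vertices t - {d}) (clv t))"
    by (rule lspan_subring[OF F]) (use goodD[OF t] in auto)
  have "poly q (clv t d) \<notin> (*) (clv t d) ` adjoin (lspan F (vertices t - {d}) (clv t)) (clv t d)"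
    using adjoin_multiple_iff[OF span vertex_transcendental[OF t] q(1)] q(2) d goodD(5)[OF t] by blast
  then show ?thesis
    using adjoin_mono[OF LL_adjoin(4)[OF t d], of "clv t d"] unfolding LL_adjoin(1)[OF t d] by blast
qed

lemma LL_not_multiple_const:
  assumes t: "good t" and d: "d \<in> hf t" and c: "c \<in> lspan F (vertices t - {d}) (clv t)" "c \<noteq> 0"
  shows "c \<notin> (*) (clv t d) ` LL t"
proof -
  have span: "subring_set (lspan F (vertices t - {d}) (clv t))"
    by (rule lspan_subring[OF F]) (use goodD[OF t] in auto)
  show ?thesis
    using LL_not_multiple[OF t d coeffs_in_closed(5)[OF span c(1), of 0]] c(2) by (simp add: poly_monom)
qed

lemma one_not_multiple:
  assumes t: "good t" and d: "d \<in> hf t" shows "1 \<notin> (*) (clv t d) ` LL t"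
proof (rule LL_not_multiple_const[OF t d])
  show "1 \<in> lspan F (vertices t - {d}) (clv t)"
    using lspan_incl(1)[OF F, of "vertices t - {d}"] goodD(1)[OF t] subring_setD(1)[OF F] by auto
qed simp

lemma exbin_not_multiple:
  assumes t: "good t" and k: "k \<in> uf t" and d: "d \<in> hf t"
  shows "exbin k t ^ n \<notin> (*) (clv t d) ` LL t"
proof (induction n)
  case 0 then show ?case using one_not_multiple[OF t d] by simp
next
  case (Suc n)
  obtain q where "coeffs_in (lspan F (vertices t - {d}) (clv t)) q" "poly q (clv t d) = exbin k t" "Polynomial.coeff q 0 \<noteq> 0"
    using exbin_poly[OF t k goodD(5)[OF t d] goodD(6)[OF t k d]] exbin_nonzero[OF t k] by blast
  then have "exbin k t \<notin> (*) (clv t d) ` LL t" using LL_not_multiple[OF t d] by metis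
  then show ?case
    using Suc LL_prime[OF t d exbin_LL[OF t k] subring_set_power[OF LL_subring exbin_LL[OF t k]], of n] by auto
qed

text \<open>
  The variable \<open>x\<^sub>d\<close> divides the product of a power of the exchange binomial with \<open>x\<^sub>d\<^sup>m z\<close>. As it is
  prime and does not divide the binomial, it divides \<open>x\<^sub>d\<^sup>m z\<close>, which lowers \<open>m\<close>.
\<close>

lemma remove_frozen_denominator:
  assumes t: "good t" and k: "k \<in> uf t" and d: "d \<in> hf t"
    and y: "exbin k t ^ n * z \<in> LL t" and x: "clv t d ^ m * z \<in> LL t"
  shows "z \<in> LL t"
  using x
proof (induction m)
  case (Suc m)
  let ?x = "clv t d"
  have "?x \<noteq> 0" using goodD[OF t] d by auto
  have xL: "?x ^ m \<in> LL t" using subring_set_power[OF LL_subring LL_incl(2)[OF goodD(5)[OF t d]]] .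
  have "exbin k t ^ n * (?x ^ Suc m * z) = ?x * (?x ^ m * (exbin k t ^ n * z))" by (simp add: mult_ac)
  moreover have "?x ^ m * (exbin k t ^ n * z) \<in> LL t" using subring_setD(6)[OF LL_subring xL y] .
  ultimately have "exbin k t ^ n * (?x ^ Suc m * z) \<in> (*) ?x ` LL t" by blast
  then have "?x ^ Suc m * z \<in> (*) ?x ` LL t"
    using LL_prime[OF t d subring_set_power[OF LL_subring exbin_LL[OF t k]] Suc.prems] exbin_not_multiple[OF t k d] by blast
  then obtain w where "w \<in> LL t" "?x * (?x ^ m * z) = ?x * w" by (auto simp: mult_ac)
  then have "?x ^ m * z \<in> LL t" using \<open>?x \<noteq> 0\<close> by simp
  then show ?case by (rule Suc.IH)
qed simp

lemma remove_frozen_denominators: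
  assumes t: "good t" and k: "k \<in> uf t" and D: "finite D" "D \<subseteq> hf t"
    and y: "exbin k t ^ n * z \<in> LL t" and x: "(\<Prod>d\<in>D. clv t d) ^ m * z \<in> LL t"
  shows "z \<in> LL t"
  using D y x
proof (induction D arbitrary: z rule: finite_induct)
  case (insert d D)
  let ?w = "(\<Prod>d\<in>D. clv t d) ^ m * z"
  have "clv t e \<in> LL t" if "e \<in> D" for e using that insert.prems(1) goodD(5)[OF t] by (intro LL_incl(2)) auto
  then have P: "(\<Prod>d\<in>D. clv t d) ^ m \<in> LL t" by (intro subring_set_power[OF LL_subring] subring_set_prod[OF LL_subring])
  have "exbin k t ^ n * ?w = (\<Prod>d\<in>D. clv t d) ^ m * (exbin k t ^ n * z)" by (simp add: mult_ac)
  then have "exbin k t ^ n * ?w \<in> LL t" using subring_setD(6)[OF LL_subring P insert.prems(2)] by (simp only:)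
  moreover have "clv t d ^ m * ?w \<in> LL t" using insert.prems(3) insert.hyps by (simp add: power_mult_distrib mult_ac)
  ultimately have "?w \<in> LL t" using remove_frozen_denominator[OF t k] insert.prems(1) by blast
  then show ?case using insert.IH insert.prems by auto
qed simp

text \<open>
  If \<open>f / x\<^sub>d\<close> lies in one Laurent ring then it lies in that of every adjacent seed, since there only
  \<open>x\<^sub>d\<close> could be a denominator; so it lies in all of them.
\<close>

lemma UU_multiple_iff:
  assumes t: "good t" and d: "d \<in> hf t" and f: "f \<in> UU t"
  shows "f \<in> (*) (clv t d) ` UU t \<longleftrightarrow> f \<in> (*) (clv t d) ` LL t"
proof
  assume "f \<in> (*) (clv t d) ` LL t"
  then obtain z where z: "z \<in> LL t" "f = clv t d * z" by blast
  have dn: "d \<notin> uf t" using t d by (auto simp: good_def)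
  have "z \<in> LL t'" if "mutation_equivalent t t'" for t'
    using that
  proof (induction rule: mutation_equivalent.induct)
    case refl then show ?case by (rule z(1))
  next
    case (step t' k)
    have t': "good t'" using good_equivalent[OF step.hyps(1) t] .
    have e: "mutation_equivalent t (mutate k t')" by (rule mutation_equivalent.step[OF step.hyps(1,2)])
    have "\<exists>n. exbin k (mutate k t') ^ n * z \<in> LL (mutate k t')"
      using LL_mutate[OF t' step.hyps(2) step.IH] exbin_mutate[OF t' step.hyps(2)] by simp
    moreover have "clv (mutate k t') d ^ 1 * z \<in> LL (mutate k t')"
      using f e z(2) equivalent_frozen[OF e dn] unfolding UU_def by auto
    moreover have "d \<in> hf (mutate k t')" using d equivalent_simps[OF e] by simp
    ultimately show ?case
      using remove_frozen_denominator[OF good_mutate[OF t' step.hyps(2)]] step.hyps(2) by (metis mutate_simps(1))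
  qed
  then show "f \<in> (*) (clv t d) ` UU t" using z(2) by (auto simp: UU_def)
qed (use UU_LL in blast)

lemma frozen_UU: "d \<in> vertices t \<Longrightarrow> d \<notin> uf t \<Longrightarrow> clv t d \<in> UU t"
  unfolding UU_def using equivalent_frozen LL_incl(2) equivalent_simps(4) by (metis (no_types, lifting) INT_I mem_Collect_eq)

text \<open>
  Primality and the bound on multiplicities both hold in the polynomial ring \<open>LL t\<close>, and divisibility
  by \<open>x\<^sub>d\<close> means the same in both rings.
\<close>

theorem frozen_prime:
  assumes t: "good t" and d: "d \<in> hf t"
  shows "prime_element (UU t) (clv t d)"
proof -
  let ?x = "clv t d"
  note UD = subring_setD[OF UU_subring[of t]]
  have xU: "?x \<in> UU t" using frozen_UU[of d t] goodD(5,6)[OF t _] d t by (auto simp: good_def vertices_def)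
  have x0: "?x \<noteq> 0" using goodD[OF t] d by auto
  have sub: "(*) ?x ` UU t \<subseteq> UU t" using UD(6) xU by blast
  show ?thesis
  proof (unfold_locales)
    show "subring_set (UU t)" by (rule UU_subring)
    show "?x \<in> UU t" "?x \<noteq> 0" by fact+
    show "(*) ?x ` UU t \<in> Spec (sub_ring (UU t))"
    proof (rule SpecI[OF cring_sub_ring[OF UU_subring]])
      show "(*) ?x ` UU t \<subseteq> carrier (sub_ring (UU t))" using sub by simp
      show "\<zero>\<^bsub>sub_ring (UU t)\<^esub> \<in> (*) ?x ` UU t" using UD(2) by (auto intro: image_eqI[of _ _ 0])
      show "\<one>\<^bsub>sub_ring (UU t)\<^esub> \<notin> (*) ?x ` UU t" using one_not_multiple[OF t d] UU_LL[of t] by auto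
    next
      fix a b assume "a \<in> (*) ?x ` UU t" "b \<in> (*) ?x ` UU t"
      then obtain u v where "a = ?x * u" "b = ?x * v" "u \<in> UU t" "v \<in> UU t" by blast
      then show "a \<oplus>\<^bsub>sub_ring (UU t)\<^esub> b \<in> (*) ?x ` UU t" using UD(4) by (auto simp: distrib_left[symmetric])
    next
      fix a r assume "a \<in> (*) ?x ` UU t" "r \<in> carrier (sub_ring (UU t))"
      then obtain u where "a = ?x * u" "u \<in> UU t" "r \<in> UU t" by auto
      then show "r \<otimes>\<^bsub>sub_ring (UU t)\<^esub> a \<in> (*) ?x ` UU t" using UD(6)[of r u] by (auto simp: mult.left_commute)
    next
      fix a b assume ab: "a \<in> carrier (sub_ring (UU t))" "b \<in> carrier (sub_ring (UU t))"
        "a \<otimes>\<^bsub>sub_ring (UU t)\<^esub> b \<in> (*) ?x ` UU t"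
      then have "a * b \<in> (*) ?x ` LL t" "a \<in> LL t" "b \<in> LL t" using UU_LL[of t] by auto
      then show "a \<in> (*) ?x ` UU t \<or> b \<in> (*) ?x ` UU t"
        using LL_prime[OF t d] UU_multiple_iff[OF t d] ab by auto
    qed
    fix f assume f: "f \<in> UU t" "f \<noteq> 0"
    \<comment> \<open>A factorization with the largest possible power of \<open>x\<^sub>d\<close>.\<close>
    define S where "S = {n. \<exists>g\<in>UU t. f = ?x ^ n * g}"
    obtain N where N: "\<And>n g. g \<in> LL t \<Longrightarrow> f = ?x ^ n * g \<Longrightarrow> n \<le> N"
      using adjoin_bounded_powers[OF LL_adjoin(2,3)[OF t d], of f] f UU_LL[of t] unfolding LL_adjoin(1)[OF t d, symmetric] by blast
    have "S \<subseteq> {..N}" using N UU_LL[of t] by (auto simp: S_def)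
    then have fin: "finite S" by (rule finite_subset) simp
    have "0 \<in> S" using f by (auto simp: S_def)
    then have "Max S \<in> S" using fin by (intro Max_in) auto
    then obtain g where g: "g \<in> UU t" "f = ?x ^ Max S * g" by (auto simp: S_def)
    have "g \<notin> (*) ?x ` UU t"
    proof
      assume "g \<in> (*) ?x ` UU t"
      then obtain h where "h \<in> UU t" "g = ?x * h" by blast
      then have "Suc (Max S) \<in> S" using g(2) by (auto simp: S_def mult_ac)
      then show False using Max_ge[OF fin] by fastforce
    qed
    then show "\<exists>n. \<exists>g\<in>UU t - (*) ?x ` UU t. f = ?x ^ n * g" using g by blast
  qed
qed

lemma frozen_not_multiple:
  assumes t: "good t" and d: "d \<in> hf t" "e \<in> vertices t" "e \<noteq> d"
  shows "clv t e \<notin> (*) (clv t d) ` UU t"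
proof -
  have "clv t e \<in> lspan F (vertices t - {d}) (clv t)" "clv t e \<noteq> 0"
    using lspan_incl(3)[OF F, of "vertices t - {d}" e] goodD[OF t] d by auto
  then show ?thesis using LL_not_multiple_const[OF t d(1)] UU_LL[of t] by blast
qed

end


section \<open>Monomial liftings\<close>

context scalars
begin

subsection \<open>Making frozen variables invertible\<close>

text \<open>
  This turns \<open>\<up>t\<^sup>D\<close> back into \<open>\<up>t\<close>. Mutation does not distinguish the two kinds of frozen vertices, so
  it commutes with unfreezing, and only the Laurent rings change.
\<close>

definition unfreeze :: "'v set \<Rightarrow> ('v, 'l) seed \<Rightarrow> ('v, 'l) seed" where
  "unfreeze D t = t\<lparr>sf := sf t \<union> D, hf := hf t - D\<rparr>"

lemma unfreeze_simps:
  "uf (unfreeze D t) = uf t" "sf (unfreeze D t) = sf t \<union> D" "hf (unfreeze D t) = hf t - D"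
  "clv (unfreeze D t) = clv t" "exm (unfreeze D t) = exm t"
  "D \<subseteq> hf t \<Longrightarrow> vertices (unfreeze D t) = vertices t"
  by (auto simp: unfreeze_def vertices_def)

lemma mutate_unfreeze: "D \<subseteq> hf t \<Longrightarrow> mutate k (unfreeze D t) = unfreeze D (mutate k t)"
  unfolding mutate_def unfreeze_simps using unfreeze_simps(6)[of D t] by (simp add: unfreeze_def)

lemma equivalent_unfreeze:
  fixes t :: "('v, 'l) seed"
  assumes "D \<subseteq> hf t" "mutation_equivalent t t'"
  shows "mutation_equivalent (unfreeze D t) (unfreeze D t')"
  using assms(2)
proof (induction rule: mutation_equivalent.induct)
  case refl show ?case by (rule mutation_equivalent.refl)
next
  case (step t' k)
  have "mutation_equivalent (unfreeze D t) (mutate k (unfreeze D t'))"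
    using step by (intro mutation_equivalent.step) (auto simp: unfreeze_simps)
  then show ?case using mutate_unfreeze[of D t'] assms(1) equivalent_simps(3)[OF step.hyps(1)] by simp
qed

lemma unfreeze_equivalent:
  fixes t :: "('v, 'l) seed"
  assumes "D \<subseteq> hf t" "mutation_equivalent (unfreeze D t) s"
  shows "\<exists>t'. mutation_equivalent t t' \<and> s = unfreeze D t'"
  using assms(2)
proof (induction rule: mutation_equivalent.induct)
  case refl show ?case using mutation_equivalent.refl by blast
next
  case (step s k)
  then obtain t' where t': "mutation_equivalent t t'" "s = unfreeze D t'" by blast
  have "mutate k s = unfreeze D (mutate k t')"
    using mutate_unfreeze[of D t' k] t' assms(1) equivalent_simps(3)[OF t'(1)] by simp
  moreover have "mutation_equivalent t (mutate k t')"
    using t' step.hyps by (intro mutation_equivalent.step) (auto simp: unfreeze_simps)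
  ultimately show ?case by blast
qed

lemma LL_unfreeze:
  assumes t: "good t" and D: "finite D" "D \<subseteq> hf t" and z: "z \<in> LL (unfreeze D t)"
  shows "\<exists>n. (\<Prod>d\<in>D. clv t d) ^ n * z \<in> LL t"
proof -
  let ?y = "\<Prod>d\<in>D. clv t d"
  let ?T = "{z. \<exists>n. ?y ^ n * z \<in> LL t}"
  have cl: "clv t d \<in> LL t" if "d \<in> D" for d using LL_incl(2)[of d t] goodD(5)[OF t] that D by auto
  have y: "?y \<in> LL t" using cl by (intro subring_set_prod[OF LL_subring])
  note T = fractions_subring[OF LL_subring y]
  have "LL (unfreeze D t) \<subseteq> ?T"
    unfolding LL_laurent[of "unfreeze D t"] unfreeze_simps(1,2,4) unfreeze_simps(6)[OF D(2)]
  proof (rule laurent_least[OF T(1)])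
    show "F \<subseteq> ?T" using LL_incl(1)[of t] T(2) by (rule subset_trans)
    show "clv t i \<in> ?T" if "i \<in> vertices t" for i using LL_incl(2)[OF that] T(2) by (rule subsetD[rotated])
    show "inverse (clv t i) \<in> ?T" if i: "i \<in> sf t \<union> D \<union> uf t" for i
    proof (cases "i \<in> D")
      case True
      have "clv t i \<noteq> 0" using goodD(3)[OF t] goodD(5)[OF t] D True by blast
      then have "?y ^ 1 * inverse (clv t i) = (\<Prod>d\<in>D - {i}. clv t d)"
        using prod.remove[OF D(1) True, of "clv t"] by simp
      also have "\<dots> \<in> LL t" using cl by (intro subring_set_prod[OF LL_subring]) auto
      finally show ?thesis by blast
    next
      case False
      then have "inverse (clv t i) \<in> LL t" using i by (intro LL_incl(3)) auto
      then show ?thesis using T(2) by blast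
    qed
  qed
  then show ?thesis using z by blast
qed

text \<open>
  A denominator that is cleared in one seed is cleared in all of them, by
  \<open>remove_frozen_denominators\<close>; so the upper cluster algebra is localized as well.
\<close>

theorem UU_unfreeze:
  assumes t: "good t" and D: "finite D" "D \<subseteq> hf t"
  shows "UU t \<subseteq> UU (unfreeze D t)"
    and "z \<in> UU (unfreeze D t) \<Longrightarrow> \<exists>n. (\<Prod>d\<in>D. clv t d) ^ n * z \<in> UU t"
proof -
  show "UU t \<subseteq> UU (unfreeze D t)"
  proof
    fix z assume z: "z \<in> UU t"
    have "z \<in> LL s" if s: "mutation_equivalent (unfreeze D t) s" for s
    proof -
      obtain t' where t': "mutation_equivalent t t'" "s = unfreeze D t'" using unfreeze_equivalent[OF D(2) s] by blast
      have "D \<subseteq> hf t'" using D equivalent_simps(3)[OF t'(1)] by simp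
      then have "LL t' \<subseteq> LL s"
        unfolding LL_laurent t'(2) using unfreeze_simps[of D t'] by (simp add: laurent_mono Un_assoc sup.coboundedI2 le_supI1)
      then show ?thesis using z t'(1) unfolding UU_def by blast
    qed
    then show "z \<in> UU (unfreeze D t)" by (simp add: UU_def)
  qed
  assume z: "z \<in> UU (unfreeze D t)"
  then obtain n where n: "(\<Prod>d\<in>D. clv t d) ^ n * z \<in> LL t" using LL_unfreeze[OF t D] UU_LL by blast
  let ?w = "(\<Prod>d\<in>D. clv t d) ^ n * z"
  have "?w \<in> LL t'" if "mutation_equivalent t t'" for t'
    using that
  proof (induction rule: mutation_equivalent.induct)
    case refl show ?case by (rule n)
  next
    case (step t' k)
    let ?s = "mutate k t'"
    have t': "good t'" using good_equivalent[OF step.hyps(1) t] .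
    have e: "mutation_equivalent t ?s" by (rule mutation_equivalent.step[OF step.hyps(1,2)])
    have s: "good ?s" "k \<in> uf ?s" using good_mutate[OF t' step.hyps(2)] step.hyps(2) by auto
    have Ds: "D \<subseteq> hf ?s" using D equivalent_simps(3)[OF e] by simp
    have same: "(\<Prod>d\<in>D. clv ?s d) = (\<Prod>d\<in>D. clv t d)"
    proof (rule prod.cong[OF HOL.refl])
      fix d assume "d \<in> D"
      then have "d \<notin> uf t" using t D(2) by (auto simp: good_def)
      then show "clv ?s d = clv t d" by (rule equivalent_frozen[OF e])
    qed
    obtain a where a: "exbin k ?s ^ a * ?w \<in> LL ?s"
      using LL_mutate[OF t' step.hyps(2) step.IH] exbin_mutate[OF t' step.hyps(2)] by auto
    have "z \<in> LL (unfreeze D ?s)" using z equivalent_unfreeze[OF D(2) e] unfolding UU_def by blast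
    then obtain m where m: "(\<Prod>d\<in>D. clv ?s d) ^ m * z \<in> LL ?s" using LL_unfreeze[OF s(1) D(1) Ds] by blast
    have "clv ?s d \<in> LL ?s" if "d \<in> D" for d
      by (rule LL_incl(2)[OF goodD(5)[OF s(1)]]) (use Ds that in blast)
    then have "(\<Prod>d\<in>D. clv ?s d) ^ n \<in> LL ?s" by (intro subring_set_power[OF LL_subring] subring_set_prod[OF LL_subring])
    then have "(\<Prod>d\<in>D. clv ?s d) ^ n * ((\<Prod>d\<in>D. clv ?s d) ^ m * z) \<in> LL ?s"
      using m by (rule subring_setD(6)[OF LL_subring])
    also have "(\<Prod>d\<in>D. clv ?s d) ^ n * ((\<Prod>d\<in>D. clv ?s d) ^ m * z) = (\<Prod>d\<in>D. clv ?s d) ^ m * ?w"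
      unfolding same by (simp only: mult_ac)
    finally show ?case by (rule remove_frozen_denominators[OF s D(1) Ds a])
  qed
  then show "\<exists>n. (\<Prod>d\<in>D. clv t d) ^ n * z \<in> UU t" unfolding UU_def by blast
qed

subsection \<open>Mutations of liftings\<close>

text \<open>
  The lifting matrix of the mutated seed. The maximum makes both monomials of the exchange binomial
  of the lifting equal to those of the seed up to the same monomial in the \<open>x d\<close>.
\<close>

definition lift_mutate :: "'v \<Rightarrow> ('v, 'l) seed \<Rightarrow> ('v \<Rightarrow> 'v \<Rightarrow> int) \<Rightarrow> ('v \<Rightarrow> 'v \<Rightarrow> int)" where
  "lift_mutate k s \<nu> d i = (if i = k then
       max (\<Sum>i\<in>vertices s. \<nu> d i * pos_part (exm s i k)) (\<Sum>i\<in>vertices s. \<nu> d i * neg_part (exm s i k)) - \<nu> d k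
     else \<nu> d i)"

lemma prod_powi: "a \<noteq> 0 \<Longrightarrow> (\<Prod>i\<in>I. a powi f i) = (a :: 'a::field) powi (\<Sum>i\<in>I. f i)"
  by (induction I rule: infinite_finite_induct) (auto simp: power_int_add)

lemma prod_powi_distrib: "(\<Prod>i\<in>I. f i :: 'a::field) powi n = (\<Prod>i\<in>I. f i powi n)"
  by (induction I rule: infinite_finite_induct) (auto simp: power_int_mult_distrib)

lemma lift_monomial:
  fixes u :: "'v \<Rightarrow> 'l"
  assumes "\<And>d. d \<in> D \<Longrightarrow> x d \<noteq> 0"
  shows "(\<Prod>i\<in>I. (u i * (\<Prod>d\<in>D. x d powi \<nu> d i)) powi f i) =
    (\<Prod>i\<in>I. u i powi f i) * (\<Prod>d\<in>D. x d powi (\<Sum>i\<in>I. \<nu> d i * f i))"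
proof -
  have "(\<Prod>i\<in>I. (u i * (\<Prod>d\<in>D. x d powi \<nu> d i)) powi f i) =
      (\<Prod>i\<in>I. u i powi f i * (\<Prod>d\<in>D. x d powi (\<nu> d i * f i)))"
    by (simp add: power_int_mult_distrib prod_powi_distrib power_int_mult)
  also have "\<dots> = (\<Prod>i\<in>I. u i powi f i) * (\<Prod>d\<in>D. \<Prod>i\<in>I. x d powi (\<nu> d i * f i))"
    by (simp add: prod.distrib prod.swap[of _ D I])
  also have "(\<Prod>d\<in>D. \<Prod>i\<in>I. x d powi (\<nu> d i * f i)) = (\<Prod>d\<in>D. x d powi (\<Sum>i\<in>I. \<nu> d i * f i))"
    using assms by (intro prod.cong) (auto simp: prod_powi)
  finally show ?thesis .
qed

lemma lift_simps:
  "uf (lift_seed D x \<nu> s) = uf s" "sf (lift_seed D x \<nu> s) = sf s \<union> D" "hf (lift_seed D x \<nu> s) = hf s"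
  "clv (lift_seed D x \<nu> s) r = (if r \<in> D then x r else clv s r * (\<Prod>d\<in>D. x d powi \<nu> d r))"
  "exm (lift_seed D x \<nu> s) r j = (if r \<in> D then - (\<Sum>i\<in>vertices s. \<nu> r i * exm s i j) else exm s r j)"
  "vertices (lift_seed D x \<nu> s) = vertices s \<union> D"
  by (auto simp: lift_seed_def vertices_def)

lemma pos_neg_sum: "(\<Sum>i\<in>I. \<nu> i * (b i :: int)) = (\<Sum>i\<in>I. \<nu> i * pos_part (b i)) - (\<Sum>i\<in>I. \<nu> i * neg_part (b i))"
proof -
  have "\<nu> i * b i = \<nu> i * pos_part (b i) - \<nu> i * neg_part (b i)" for i
    using part_simps(7)[of "b i"] by (metis right_diff_distrib)
  then show ?thesis by (simp add: sum_subtractf)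
qed

text \<open>
  If \<open>\<alpha>\<close> and \<open>\<beta>\<close> are the exponents of \<open>x d\<close> that the lifted variables contribute to the two monomials,
  the entry of the matrix at \<open>d\<close> is \<open>\<beta> - \<alpha>\<close>. The variable \<open>x d\<close> itself then raises both exponents to
  their maximum.
\<close>

lemma exbin_lift:
  assumes s: "good s" "k \<in> uf s" and D: "finite D" "D \<inter> vertices s = {}" and x: "\<And>d. d \<in> D \<Longrightarrow> x d \<noteq> 0"
  shows "exbin k (lift_seed D x \<nu> s) = exbin k s * (\<Prod>d\<in>D. x d powi (lift_mutate k s \<nu> d k + \<nu> d k))"
proof -
  let ?t = "lift_seed D x \<nu> s"
  have V: "finite (vertices s)" using goodD[OF s(1)] by simp
  have kD: "k \<notin> D" using D(2) goodD(4)[OF s] by auto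
  define \<alpha> where "\<alpha> d = (\<Sum>i\<in>vertices s. \<nu> d i * pos_part (exm s i k))" for d
  define \<beta> where "\<beta> d = (\<Sum>i\<in>vertices s. \<nu> d i * neg_part (exm s i k))" for d
  have exm_d: "exm ?t d k = \<beta> d - \<alpha> d" if "d \<in> D" for d
    using that pos_neg_sum[where \<nu> = "\<nu> d" and b = "\<lambda>i. exm s i k" and I = "vertices s"]
    by (simp add: lift_simps \<alpha>_def \<beta>_def)
  have split: "(\<Prod>i\<in>vertices s \<union> D. clv ?t i powi f (exm ?t i k)) =
      (\<Prod>i\<in>vertices s. clv s i powi f (exm s i k)) *
      (\<Prod>d\<in>D. x d powi ((\<Sum>i\<in>vertices s. \<nu> d i * f (exm s i k)) + f (\<beta> d - \<alpha> d)))" for f :: "int \<Rightarrow> int"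
  proof -
    have "(\<Prod>i\<in>vertices s \<union> D. clv ?t i powi f (exm ?t i k)) =
        (\<Prod>i\<in>vertices s. clv ?t i powi f (exm ?t i k)) * (\<Prod>d\<in>D. clv ?t d powi f (exm ?t d k))"
      using V D by (intro prod.union_disjoint) auto
    also have "(\<Prod>i\<in>vertices s. clv ?t i powi f (exm ?t i k)) =
        (\<Prod>i\<in>vertices s. (clv s i * (\<Prod>d\<in>D. x d powi \<nu> d i)) powi f (exm s i k))"
      by (rule prod.cong[OF HOL.refl]) (use D in \<open>auto simp: lift_simps\<close>)
    also have "\<dots> = (\<Prod>i\<in>vertices s. clv s i powi f (exm s i k)) *
        (\<Prod>d\<in>D. x d powi (\<Sum>i\<in>vertices s. \<nu> d i * f (exm s i k)))"
      by (rule lift_monomial[OF x])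
    also have "(\<Prod>d\<in>D. clv ?t d powi f (exm ?t d k)) = (\<Prod>d\<in>D. x d powi f (\<beta> d - \<alpha> d))"
      by (rule prod.cong[OF HOL.refl]) (simp add: exm_d lift_simps(4))
    finally show ?thesis
      using x by (simp add: mult.assoc prod.distrib[symmetric] power_int_add cong: prod.cong)
  qed
  have mx: "\<alpha> d + pos_part (\<beta> d - \<alpha> d) = max (\<alpha> d) (\<beta> d)" "\<beta> d + neg_part (\<beta> d - \<alpha> d) = max (\<alpha> d) (\<beta> d)" for d
    by (auto simp: pos_part_def neg_part_def)
  have lm: "lift_mutate k s \<nu> d k + \<nu> d k = max (\<alpha> d) (\<beta> d)" for d by (simp add: lift_mutate_def \<alpha>_def \<beta>_def)
  show ?thesis
    unfolding exbin_def lift_simps(6) split lm \<alpha>_def[symmetric] \<beta>_def[symmetric] mx by (simp add: distrib_right)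
qed

text \<open>
  The new cluster variable is the lift of the old one by \<open>exbin_lift\<close>. For the row of \<open>d\<close> the claim is
  an identity between the entries, in which the maximum of \<open>lift_mutate\<close> cancels against the positive
  and negative parts in the mutation rule.
\<close>

lemma mutate_lift:
  assumes s: "good s" "k \<in> uf s" and D: "finite D" "D \<inter> vertices s = {}" and x: "\<And>d. d \<in> D \<Longrightarrow> x d \<noteq> 0"
  shows "mutate k (lift_seed D x \<nu> s) = lift_seed D x (lift_mutate k s \<nu>) (mutate k s)"
proof -
  let ?t = "lift_seed D x \<nu> s" and ?\<nu> = "lift_mutate k s \<nu>"
  have V: "finite (vertices s)" "k \<in> vertices s" using goodD[OF s(1)] s(2) by auto
  have kD: "k \<notin> D" using D(2) V(2) by auto
  have clv: "clv (mutate k ?t) r = clv (lift_seed D x ?\<nu> (mutate k s)) r" for r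
  proof (cases "r = k")
    case True
    have "(\<Prod>d\<in>D. x d powi (?\<nu> d k + \<nu> d k)) = (\<Prod>d\<in>D. x d powi ?\<nu> d k) * (\<Prod>d\<in>D. x d powi \<nu> d k)"
      using x by (simp add: power_int_add prod.distrib cong: prod.cong)
    moreover have "(\<Prod>d\<in>D. x d powi \<nu> d k) \<noteq> 0" using x D by (simp add: prod_zero_iff)
    ultimately show ?thesis
      using True kD by (simp add: lift_simps exbin_lift[OF s D x])
  next
    case False
    then show ?thesis by (simp add: lift_simps lift_mutate_def)
  qed
  have exm: "exm (mutate k ?t) r j = exm (lift_seed D x ?\<nu> (mutate k s)) r j" for r j
  proof (cases "r \<in> D")
    case False
    then show ?thesis using kD by (auto simp: exm_mutate lift_simps)
  next
    case True
    let ?b = "exm s" and ?W = "vertices s - {k}"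
    define \<alpha> where "\<alpha> = (\<Sum>i\<in>vertices s. \<nu> r i * pos_part (?b i k))"
    define \<beta> where "\<beta> = (\<Sum>i\<in>vertices s. \<nu> r i * neg_part (?b i k))"
    have kk: "?b k k = 0" by (rule diagonal_zero[OF s])
    have rem: "(\<Sum>i\<in>vertices s. f i) = f k + (\<Sum>i\<in>?W. f i)" for f :: "_ \<Rightarrow> int"
      by (rule sum.remove[OF V])
    have \<alpha>W: "\<alpha> = (\<Sum>i\<in>?W. \<nu> r i * pos_part (?b i k))" "\<beta> = (\<Sum>i\<in>?W. \<nu> r i * neg_part (?b i k))"
      unfolding \<alpha>_def \<beta>_def rem by (simp_all add: kk part_simps)
    have rk: "(\<Sum>i\<in>vertices s. \<nu> r i * ?b i k) = \<alpha> - \<beta>" unfolding \<alpha>_def \<beta>_def by (rule pos_neg_sum)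
    have rkW: "(\<Sum>i\<in>?W. \<nu> r i * ?b i k) = \<alpha> - \<beta>" using rk unfolding rem by (simp add: kk)
    have nk: "?\<nu> r k = max \<alpha> \<beta> - \<nu> r k" by (simp add: lift_mutate_def \<alpha>_def \<beta>_def)
    have lhs: "exm (lift_seed D x ?\<nu> (mutate k s)) r j =
        - (?\<nu> r k * exm (mutate k s) k j + (\<Sum>i\<in>?W. \<nu> r i * exm (mutate k s) i j))"
      using True by (simp add: lift_simps rem) (rule sum.cong, auto simp: lift_mutate_def)
    show ?thesis
    proof (cases "j = k")
      case j: True
      have "(\<Sum>i\<in>?W. \<nu> r i * exm (mutate k s) i j) = - (\<alpha> - \<beta>)"
        using rkW by (simp add: exm_mutate j sum_negf)
      then show ?thesis
        unfolding lhs using True kD by (simp add: exm_mutate j kk lift_simps rk)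
    next
      case j: False
      define p where "p = pos_part (?b k j)"
      define q where "q = neg_part (?b k j)"
      have W: "(\<Sum>i\<in>?W. \<nu> r i * exm (mutate k s) i j) = (\<Sum>i\<in>?W. \<nu> r i * ?b i j) + \<alpha> * p - \<beta> * q"
        unfolding \<alpha>W p_def q_def sum_distrib_right sum.distrib[symmetric] sum_subtractf[symmetric]
        by (rule sum.cong) (auto simp: exm_mutate j algebra_simps)
      have "exm (mutate k ?t) r j = - (\<nu> r k * ?b k j + (\<Sum>i\<in>?W. \<nu> r i * ?b i j))
          + pos_part (\<beta> - \<alpha>) * p - neg_part (\<beta> - \<alpha>) * q"
        unfolding p_def q_def using True kD j by (auto simp: exm_mutate lift_simps rk rem[of "\<lambda>i. \<nu> r i * ?b i j"])
      moreover have "exm (mutate k s) k j = - ?b k j" by (simp add: exm_mutate)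
      moreover have bk: "?b k j = p - q" unfolding p_def q_def by (rule part_simps(7))
      moreover have "pos_part (\<beta> - \<alpha>) = max \<alpha> \<beta> - \<alpha>" "neg_part (\<beta> - \<alpha>) = max \<alpha> \<beta> - \<beta>"
        by (auto simp: pos_part_def neg_part_def)
      ultimately show ?thesis unfolding lhs nk W by (simp only:) (simp add: algebra_simps)
    qed
  qed
  have "uf (mutate k ?t) = uf (lift_seed D x ?\<nu> (mutate k s))" "sf (mutate k ?t) = sf (lift_seed D x ?\<nu> (mutate k s))"
    "hf (mutate k ?t) = hf (lift_seed D x ?\<nu> (mutate k s))" by (simp_all add: lift_simps)
  moreover have "more (mutate k ?t) = more (lift_seed D x ?\<nu> (mutate k s))" by simp
  moreover have "clv (mutate k ?t) = clv (lift_seed D x ?\<nu> (mutate k s))" using clv by blast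
  moreover have "exm (mutate k ?t) = exm (lift_seed D x ?\<nu> (mutate k s))" using exm by blast
  ultimately show ?thesis by (intro seed.equality)
qed

lemma equivalent_lift:
  assumes t: "good t" and D: "finite D" "D \<inter> vertices t = {}" and x: "\<And>d. d \<in> D \<Longrightarrow> x d \<noteq> 0"
  shows "mutation_equivalent t t' \<Longrightarrow> \<exists>\<nu>'. mutation_equivalent (lift_seed D x \<nu> t) (lift_seed D x \<nu>' t')"
    and "mutation_equivalent (lift_seed D x \<nu> t) s \<Longrightarrow> \<exists>\<nu>' t'. mutation_equivalent t t' \<and> s = lift_seed D x \<nu>' t'"
proof -
  have lift_step: "mutate k (lift_seed D x \<nu>' t') = lift_seed D x (lift_mutate k t' \<nu>') (mutate k t')"
    if "mutation_equivalent t t'" "k \<in> uf t'" for t' k \<nu>'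
    by (rule mutate_lift[OF good_equivalent[OF that(1) t] that(2) D(1) _ x]) (use D(2) equivalent_simps(4)[OF that(1)] in auto)
  show "\<exists>\<nu>'. mutation_equivalent (lift_seed D x \<nu> t) (lift_seed D x \<nu>' t')" if "mutation_equivalent t t'" for t'
    using that
  proof (induction rule: mutation_equivalent.induct)
    case refl show ?case using mutation_equivalent.refl by blast
  next
    case (step t' k)
    then obtain \<nu>' where "mutation_equivalent (lift_seed D x \<nu> t) (lift_seed D x \<nu>' t')" by blast
    then have "mutation_equivalent (lift_seed D x \<nu> t) (mutate k (lift_seed D x \<nu>' t'))"
      by (rule mutation_equivalent.step) (simp add: lift_simps step.hyps)
    then show ?case unfolding lift_step[OF step.hyps] by blast
  qed
  show "\<exists>\<nu>' t'. mutation_equivalent t t' \<and> s = lift_seed D x \<nu>' t'" if "mutation_equivalent (lift_seed D x \<nu> t) s" for s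
    using that
  proof (induction rule: mutation_equivalent.induct)
    case refl show ?case using mutation_equivalent.refl by blast
  next
    case (step s k)
    then obtain \<nu>' t' where *: "mutation_equivalent t t'" "s = lift_seed D x \<nu>' t'" by blast
    then have "mutation_equivalent t (mutate k t')"
      using step.hyps(2) by (intro mutation_equivalent.step) (auto simp: lift_simps)
    moreover have "k \<in> uf t'" using step.hyps(2) *(2) by (simp add: lift_simps)
    then have "mutate k s = lift_seed D x (lift_mutate k t' \<nu>') (mutate k t')"
      unfolding *(2) by (rule lift_step[OF *(1)])
    ultimately show ?case by blast
  qed
qed

text \<open>
  The monomials in the \<open>x d\<close> that distinguish the lifted variables are units on both sides.
\<close>

lemma LL_lift:
  assumes s: "good s" and D: "finite D" "D \<inter> vertices s = {}" and x: "\<And>d. d \<in> D \<Longrightarrow> x d \<noteq> 0"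
  shows "LL (lift_seed D x \<nu> s) = lspan (LL s) D x"
proof
  let ?t = "lift_seed D x \<nu> s"
  let ?m = "\<lambda>i. \<Prod>d\<in>D. x d powi \<nu> d i"
  have span: "subring_set (lspan (LL s) D x)" by (rule lspan_subring[OF LL_subring x])
  note inc = lspan_incl[OF LL_subring[of s] D(1), where x = x]
  have m: "?m i \<in> lspan (LL s) D x" "inverse (?m i) \<in> lspan (LL s) D x" for i
  proof -
    show "?m i \<in> lspan (LL s) D x" by (rule subring_set_prod[OF span inc(2)])
    have "inverse (?m i) = (\<Prod>d\<in>D. x d powi (- \<nu> d i))" by (simp add: power_int_minus prod_inversef[symmetric])
    also have "\<dots> \<in> lspan (LL s) D x" by (rule subring_set_prod[OF span inc(2)])
    finally show "inverse (?m i) \<in> lspan (LL s) D x" .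
  qed
  show "LL ?t \<subseteq> lspan (LL s) D x"
    unfolding LL_laurent[of ?t]
  proof (rule laurent_least[OF span])
    show "F \<subseteq> lspan (LL s) D x" using LL_incl(1)[of s] inc(1) by (rule subset_trans)
    show "clv ?t i \<in> lspan (LL s) D x" if "i \<in> vertices ?t" for i
    proof (cases "i \<in> D")
      case True then show ?thesis using inc(3) by (simp add: lift_simps)
    next
      case False
      then have "clv s i \<in> lspan (LL s) D x" using that inc(1) LL_incl(2)[of i s] by (auto simp: lift_simps)
      then show ?thesis using False subring_setD(6)[OF span _ m(1)] by (simp add: lift_simps)
    qed
    show "inverse (clv ?t i) \<in> lspan (LL s) D x" if "i \<in> sf ?t \<union> uf ?t" for i
    proof (cases "i \<in> D")
      case True then show ?thesis using inc(4) by (simp add: lift_simps)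
    next
      case False
      then have "inverse (clv s i) \<in> lspan (LL s) D x" using that inc(1) LL_incl(3)[of i s] by (auto simp: lift_simps)
      then show ?thesis using False subring_setD(6)[OF span _ m(2)[of i]] by (simp add: lift_simps)
    qed
  qed
  note LD = subring_setD[OF LL_subring[of ?t]]
  have xL: "x d \<in> LL ?t" "inverse (x d) \<in> LL ?t" if "d \<in> D" for d
    using LL_incl(2)[of d ?t] LL_incl(3)[of d ?t] that by (auto simp: lift_simps)
  have mL: "?m i \<in> LL ?t" "inverse (?m i) \<in> LL ?t" for i
  proof -
    show "?m i \<in> LL ?t" using xL by (intro subring_set_prod[OF LL_subring] subring_powi[OF LL_subring])
    have "inverse (?m i) = (\<Prod>d\<in>D. x d powi (- \<nu> d i))" by (simp add: power_int_minus prod_inversef[symmetric])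
    also have "\<dots> \<in> LL ?t" using xL by (intro subring_set_prod[OF LL_subring] subring_powi[OF LL_subring])
    finally show "inverse (?m i) \<in> LL ?t" .
  qed
  have m0: "?m i \<noteq> 0" for i using x D(1) by (simp add: prod_zero_iff)
  have "LL s \<subseteq> LL ?t"
    unfolding LL_laurent[of s]
  proof (rule laurent_least[OF LL_subring LL_incl(1)])
    show "clv s i \<in> LL ?t" if "i \<in> vertices s" for i
    proof -
      have "i \<notin> D" using D(2) that by blast
      then have "clv s i = clv ?t i * inverse (?m i)" using m0 by (simp add: lift_simps)
      moreover have "clv ?t i \<in> LL ?t" by (rule LL_incl(2)) (use that in \<open>simp add: lift_simps\<close>)
      ultimately show ?thesis using LD(6) mL(2) by simp
    qed
    show "inverse (clv s i) \<in> LL ?t" if "i \<in> sf s \<union> uf s" for i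
    proof -
      have "i \<notin> D" using D(2) that by (auto simp: vertices_def)
      then have "inverse (clv s i) = inverse (clv ?t i) * ?m i" using m0 by (simp add: lift_simps)
      moreover have "inverse (clv ?t i) \<in> LL ?t" using LL_incl(3)[of i ?t] that by (auto simp: lift_simps)
      ultimately show ?thesis using LD(6) mL(1) by simp
    qed
  qed
  then show "lspan (LL s) D x \<subseteq> LL ?t" by (rule lspan_least[OF LL_subring]) (use xL in auto)
qed

text \<open>
  Coefficients of Laurent polynomials in the \<open>x d\<close> over \<open>K\<close> are unique, so membership in all
  rings \<open>LL t' [x d, 1 / x d]\<close> is membership of every coefficient in all rings \<open>LL t'\<close>.
\<close>

theorem UU_lift:
  assumes t: "good t" and D: "finite D" "D \<inter> vertices t = {}"
    and K: "subring_set K" "lin_indep K D x" and sub: "\<And>t'. mutation_equivalent t t' \<Longrightarrow> LL t' \<subseteq> K"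
  shows "UU (lift_seed D x \<nu> t) = lspan (UU t) D x"
proof
  have x: "\<And>d. d \<in> D \<Longrightarrow> x d \<noteq> 0" using K(2) by (simp add: lin_indep_def)
  have LL: "LL (lift_seed D x \<nu>' t') = lspan (LL t') D x" if "mutation_equivalent t t'" for t' \<nu>'
    by (rule LL_lift[OF good_equivalent[OF that t] D(1) _ x]) (use D(2) equivalent_simps(4)[OF that] in auto)
  show "UU (lift_seed D x \<nu> t) \<subseteq> lspan (UU t) D x"
  proof
    fix z assume z: "z \<in> UU (lift_seed D x \<nu> t)"
    have rep: "\<exists>c. lrep (LL t') D x c z" if t': "mutation_equivalent t t'" for t'
    proof -
      obtain \<nu>' where "mutation_equivalent (lift_seed D x \<nu> t) (lift_seed D x \<nu>' t')"
        using equivalent_lift(1)[where x = x, OF t D x t'] by blast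
      then have "z \<in> lspan (LL t') D x" using z LL[OF t'] unfolding UU_def by blast
      then show ?thesis by (simp add: lspan_def)
    qed
    obtain c where c: "lrep (LL t) D x c z" using rep[OF mutation_equivalent.refl] by blast
    have cK: "lrep K D x c z" if "lrep (LL t') D x c z" "mutation_equivalent t t'" for t' c
      using lrep_mono[OF that(1)] lrepD(3)[OF that(1)] sub[OF that(2)] by blast
    have "c m \<in> LL t'" if t': "mutation_equivalent t t'" for t' m
    proof -
      obtain c' where c': "lrep (LL t') D x c' z" using rep[OF t'] by blast
      have "c = c'" by (rule lin_indep_unique[OF K cK[OF c mutation_equivalent.refl] cK[OF c' t']])
      then show ?thesis using lrepD(3)[OF c'] by simp
    qed
    then have "lrep (UU t) D x c z" using lrep_mono[OF c] by (simp add: UU_def)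
    then show "z \<in> lspan (UU t) D x" by (auto simp: lspan_def)
  qed
  show "lspan (UU t) D x \<subseteq> UU (lift_seed D x \<nu> t)"
  proof
    fix z assume "z \<in> lspan (UU t) D x"
    then obtain c where c: "lrep (UU t) D x c z" by (auto simp: lspan_def)
    have "z \<in> LL s" if s: "mutation_equivalent (lift_seed D x \<nu> t) s" for s
    proof -
      obtain \<nu>' t' where t': "mutation_equivalent t t'" "s = lift_seed D x \<nu>' t'" using equivalent_lift(2)[where x = x, OF t D x s] by blast
      have "lrep (LL t') D x c z" using lrep_mono[OF c] lrepD(3)[OF c] t'(1) unfolding UU_def by blast
      then show ?thesis using LL[OF t'(1)] t'(2) by (auto simp: lspan_def)
    qed
    then show "z \<in> UU (lift_seed D x \<nu> t)" by (simp add: UU_def)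
  qed
qed

subsection \<open>The lifted cluster\<close>

text \<open>
  Two exchanges: first \<open>x k\<close> is replaced by \<open>1 / x k\<close>, and this by \<open>u / (1 / x k)\<close>.
\<close>

lemma lin_indep_scale:
  assumes I: "finite I" "k \<in> I" and li: "lin_indep F I x"
    and u: "u \<in> lspan F (I - {k}) x" "u \<noteq> 0"
  shows "lin_indep F I (x(k := x k * u))"
proof -
  have nz: "x i \<noteq> 0" if "i \<in> I" for i using li that by (auto simp: lin_indep_def)
  have span: "subring_set (lspan F (I - {k}) x)" by (rule lspan_subring[OF F]) (use nz in auto)
  let ?x = "x(k := 1 / x k)"
  have 1: "lin_indep F I ?x"
    by (rule lin_indep_exchange[OF F I li]) (use subring_setD(1)[OF span] in auto)
  have "lspan F (I - {k}) ?x = lspan F (I - {k}) x" by (rule lspan_cong) auto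
  then have "lin_indep F I (?x(k := u / ?x k))" by (intro lin_indep_exchange[OF F I 1]) (use u in auto)
  then show ?thesis by (simp add: mult.commute)
qed

text \<open>
  The \<open>x d\<close> are added one at a time: each is transcendental over the Laurent polynomials in the previous
  ones with coefficients in \<open>K\<close>, which contain the variables \<open>u i\<close>.
\<close>

lemma lin_indep_union:
  assumes V: "finite V" "lin_indep F V u" "u ` V \<subseteq> K" "\<And>a. a \<in> K \<Longrightarrow> inverse a \<in> K"
    and K: "subring_set K" "F \<subseteq> K" and D: "finite D" "D \<inter> V = {}" "lin_indep K D x"
  shows "lin_indep F (V \<union> D) (\<lambda>i. if i \<in> D then x i else u i)"
proof -
  let ?w = "\<lambda>i. if i \<in> D then x i else u i"
  have nz: "?w i \<noteq> 0" if "i \<in> V \<union> D" for i using V(2) D that by (auto simp: lin_indep_def)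
  have "lin_indep F (V \<union> D') ?w" if "D' \<subseteq> D" for D'
    using finite_subset[OF that D(1)] that
  proof (induction D' rule: finite_induct)
    case empty
    have "lin_indep F V ?w = lin_indep F V u" by (rule lin_indep_cong) (use D(2) in auto)
    then show ?case using V(2) by simp
  next
    case (insert d D')
    have K_sub: "lin_indep K E x" if "E \<subseteq> D" for E
    proof -
      have "lin_indep K (D - E') x" if "finite E'" "E' \<subseteq> D" for E'
        using that
      proof (induction E' rule: finite_induct)
        case empty then show ?case using D(3) by simp
      next
        case (insert e E')
        have "insert e (D - insert e E') = D - E'" using insert by auto
        then show ?case using lin_indep_insertD(1)[OF K(1), of "D - insert e E'" e x] insert D(1) by auto
      qed
      from this[of "D - E"] show ?thesis using that D(1) by (simp add: double_diff)
    qed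
    have Kx: "lin_indep K (insert d D') x" using K_sub insert.prems by blast
    have D'x: "x i \<noteq> 0" if "i \<in> D'" for i using D(3) that insert.prems by (auto simp: lin_indep_def)
    have span: "subring_set (lspan K D' x)" by (rule lspan_subring[OF K(1) D'x])
    note inc = lspan_incl[OF K(1) insert.hyps(1), where x = x]
    have "lspan F (V \<union> D') ?w \<subseteq> lspan K D' x"
    proof (rule lspan_least[OF span])
      show "F \<subseteq> lspan K D' x" using K(2) inc(1) by blast
      fix i assume i: "i \<in> V \<union> D'"
      show "?w i \<in> lspan K D' x \<and> inverse (?w i) \<in> lspan K D' x"
      proof (cases "i \<in> D'")
        case True then show ?thesis using inc(3,4) insert.prems by auto
      next
        case False
        then have "i \<in> V" "i \<notin> D" using i D(2) by auto
        then show ?thesis using V(3,4) inc(1) by auto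
      qed
    qed
    then have "transcendental_over (lspan F (V \<union> D') ?w) (?w d)"
      using transcendental_over_subset[OF lin_indep_insertD(2)[OF K(1) insert.hyps(1,2) Kx]] insert.prems by simp
    moreover have "d \<notin> V \<union> D'" using insert D(2) by auto
    ultimately have "lin_indep F (insert d (V \<union> D')) ?w"
      using insert V(1) by (intro lin_indep_insertI[OF F]) auto
    then show ?case by simp
  qed
  then show ?thesis by blast
qed

text \<open>
  One variable at a time: each lifted variable is a scaling of \<open>u k\<close> by a monomial in the \<open>x d\<close>.
\<close>

lemma lin_indep_lift:
  assumes V: "finite V" and D: "finite D" "D \<inter> V = {}" and li: "lin_indep F (V \<union> D) (\<lambda>i. if i \<in> D then x i else u i)"
  shows "lin_indep F (V \<union> D) (\<lambda>i. if i \<in> D then x i else u i * (\<Prod>d\<in>D. x d powi \<nu> d i))"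
proof -
  let ?m = "\<lambda>i. \<Prod>d\<in>D. x d powi \<nu> d i"
  have "lin_indep F (V \<union> D) (\<lambda>i. if i \<in> D then x i else if i \<in> W then u i * ?m i else u i)" if "W \<subseteq> V" for W
    using finite_subset[OF that V] that
  proof (induction W rule: finite_induct)
    case empty then show ?case using li by (simp cong: if_cong)
  next
    case (insert k W)
    let ?w = "\<lambda>i. if i \<in> D then x i else if i \<in> W then u i * ?m i else u i"
    have w: "lin_indep F (V \<union> D) ?w" using insert by auto
    have x0: "x d \<noteq> 0" if "d \<in> D" for d using li that unfolding lin_indep_def by (metis UnI2)
    have w0: "?w i \<noteq> 0" if "i \<in> V \<union> D" for i using w that unfolding lin_indep_def by blast
    have kD: "k \<notin> D" using insert.prems D(2) by auto
    have fin: "finite (V \<union> D - {k})" using V D by simp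
    have "?m k \<in> lspan F (V \<union> D - {k}) ?w"
    proof (rule subring_set_prod[OF lspan_subring[OF F]])
      show "x d powi \<nu> d k \<in> lspan F (V \<union> D - {k}) ?w" if "d \<in> D" for d
        using lspan_incl(2)[OF F fin, of d ?w "\<nu> d k"] that kD by auto
    qed (use w0 in blast)
    moreover have "?m k \<noteq> 0" using x0 D(1) by (simp add: prod_zero_iff)
    ultimately have "lin_indep F (V \<union> D) (?w(k := ?w k * ?m k))"
      using insert.prems V D(1) by (intro lin_indep_scale[OF _ _ w]) auto
    moreover have "?w(k := ?w k * ?m k) = (\<lambda>i. if i \<in> D then x i else if i \<in> insert k W then u i * ?m i else u i)"
      using kD insert.hyps(2) by auto
    ultimately show ?case by simp
  qed
  from this[OF subset_refl] have "lin_indep F (V \<union> D) (\<lambda>i. if i \<in> D then x i else if i \<in> V then u i * ?m i else u i)" .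
  moreover have "lin_indep F (V \<union> D) (\<lambda>i. if i \<in> D then x i else if i \<in> V then u i * ?m i else u i) =
      lin_indep F (V \<union> D) (\<lambda>i. if i \<in> D then x i else u i * ?m i)"
    by (rule lin_indep_cong) auto
  ultimately show ?thesis by simp
qed

text \<open>
  The exchange matrix has the same mutable rows as that of \<open>t\<close>, since \<open>D\<close> consists of frozen
  vertices; so the work is in the independence of the lifted cluster.
\<close>

lemma good_lift:
  fixes t :: "('v, 'l) seed"
  assumes t: "good t" and K: "subring_set K" "\<And>a. a \<in> K \<Longrightarrow> inverse a \<in> K" "F \<subseteq> K" "clv t ` vertices t \<subseteq> K"
    and D: "finite D" "D \<inter> vertices t = {}" "lin_indep K D x"
  shows "good (lift_seed_hf D x \<nu> t)"
proof -
  have V: "finite (vertices t)" "lin_indep F (vertices t) (clv t)" using goodD[OF t] by auto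
  have "lin_indep F (vertices t \<union> D) (\<lambda>i. if i \<in> D then x i else clv t i * (\<Prod>d\<in>D. x d powi \<nu> d i))"
    by (rule lin_indep_lift[OF V(1) D(1,2) lin_indep_union[OF V K(4,2,1,3) D]])
  moreover have "vertices (lift_seed_hf D x \<nu> t) = vertices t \<union> D" by (auto simp: lift_seed_hf_def lift_seed_def vertices_def)
  moreover have uD: "uf t \<inter> D = {}" "sf t \<inter> D = {}" using D(2) by (auto simp: vertices_def)
  have exm: "exm (lift_seed_hf D x \<nu> t) i j = exm t i j" if "i \<in> uf t" for i j
    using uD that by (auto simp: lift_seed_hf_def lift_seed_def)
  obtain s :: "'v \<Rightarrow> int" where s: "(\<forall>i \<in> uf t. s i > 0) \<and> (\<forall>i \<in> uf t. \<forall>j \<in> uf t. s i * exm t i j = - (s j * exm t j i))"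
    using good_skew[OF t] by blast
  then have "\<exists>s :: 'v \<Rightarrow> int. (\<forall>i \<in> uf t. s i > 0) \<and> (\<forall>i \<in> uf t. \<forall>j \<in> uf t.
      s i * exm (lift_seed_hf D x \<nu> t) i j = - (s j * exm (lift_seed_hf D x \<nu> t) j i))"
  proof (intro exI[of _ s] conjI ballI)
    show "s i * exm (lift_seed_hf D x \<nu> t) i j = - (s j * exm (lift_seed_hf D x \<nu> t) j i)"
      if "i \<in> uf t" "j \<in> uf t" for i j unfolding exm[OF that(1)] exm[OF that(2)] using s that by blast
  qed (use s in blast)
  ultimately show ?thesis
    using t D(1) uD unfolding good_def by (auto simp: lift_seed_hf_def lift_seed_def)
qed

lemma lift_unfreeze:
  assumes "D \<inter> vertices t = {}" shows "lift_seed D x \<nu> t = unfreeze D (lift_seed_hf D x \<nu> t)"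
  using assms by (auto simp: unfreeze_def lift_seed_hf_def lift_seed_def vertices_def)

end


section \<open>Tensor products\<close>

lemma frag_extend_fun_diff: "frag_extend (\<lambda>p. f p - g p) u = frag_extend f u - frag_extend g u"
  using subset_UNIV by (induction u rule: frag_induction) (auto simp: frag_extend_diff)

text \<open>The counterpart of \<open>frag_extend\<close> for values in a field instead of a free abelian group.\<close>

definition ext :: "('k \<Rightarrow> 'l::field) \<Rightarrow> ('k \<Rightarrow>\<^sub>0 int) \<Rightarrow> 'l" where
  "ext f u = (\<Sum>k\<in>Poly_Mapping.keys u. of_int (Poly_Mapping.lookup u k) * f k)"

lemma ext_superset:
  assumes "finite M" "Poly_Mapping.keys u \<subseteq> M"
  shows "ext f u = (\<Sum>k\<in>M. of_int (Poly_Mapping.lookup u k) * f k)"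
  unfolding ext_def by (rule sum.mono_neutral_left[OF assms]) (auto simp: in_keys_iff)

lemma ext_simps [simp]: "ext f (frag_of k) = f k" "ext f 0 = 0"
  by (simp_all add: ext_def keys_frag_of)

lemma ext_diff: "ext f (u - v) = ext f u - ext f v"
proof -
  let ?M = "Poly_Mapping.keys u \<union> Poly_Mapping.keys v"
  have M: "finite ?M" by simp
  have "Poly_Mapping.keys (u - v) \<subseteq> ?M" by (rule keys_diff)
  then show ?thesis
    by (simp add: ext_superset[OF M, of _ f] lookup_minus left_diff_distrib sum_subtractf)
qed

lemma ext_add: "ext f (u + v) = ext f u + ext f v"
  using ext_diff[of f u "- v"] ext_diff[of f 0 v] by simp

lemma ext_sum: "ext f (sum g M) = (\<Sum>i\<in>M. ext f (g i))"
  by (induction M rule: infinite_finite_induct) (auto simp: ext_add)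

locale tensor_product = R?: cring R + S?: cring S
  for R :: "('a, 'm) ring_scheme" (structure) and S :: "('b, 'n) ring_scheme" (structure) +
  fixes i :: "'c \<Rightarrow> 'a" and j :: "'c \<Rightarrow> 'b"
  assumes i_closed: "i c \<in> carrier R" and j_closed: "j c \<in> carrier S"
begin

abbreviation "pre \<equiv> pre_tensor R S"
abbreviation "rels \<equiv> tensor_ideal i j R S"
abbreviation "TT \<equiv> tensor i j R S"
abbreviation "pure \<equiv> pure_tensor i j R S"

definition tm :: "('a \<times> 'b \<Rightarrow>\<^sub>0 int) \<Rightarrow> ('a \<times> 'b \<Rightarrow>\<^sub>0 int) \<Rightarrow> ('a \<times> 'b \<Rightarrow>\<^sub>0 int)" where
  "tm u v = frag_extend (\<lambda>(a, b). frag_extend (\<lambda>(a', b'). frag_of (a \<otimes>\<^bsub>R\<^esub> a', b \<otimes>\<^bsub>S\<^esub> b')) v) u"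

lemma pre_simps [simp]:
  "carrier pre = {u. Poly_Mapping.keys u \<subseteq> carrier R \<times> carrier S}"
  "u \<otimes>\<^bsub>pre\<^esub> v = tm u v" "u \<oplus>\<^bsub>pre\<^esub> v = u + v" "\<one>\<^bsub>pre\<^esub> = frag_of (\<one>\<^bsub>R\<^esub>, \<one>\<^bsub>S\<^esub>)" "\<zero>\<^bsub>pre\<^esub> = 0"
  by (simp_all add: pre_tensor_def tm_def)

lemma tm_of [simp]: "tm (frag_of (a, b)) (frag_of (a', b')) = frag_of (a \<otimes>\<^bsub>R\<^esub> a', b \<otimes>\<^bsub>S\<^esub> b')"
  by (simp add: tm_def)

lemma tm_zero [simp]: "tm 0 v = 0" "tm u 0 = 0"
  by (simp_all add: tm_def case_prod_beta frag_extend_eq_0)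

lemma tm_diff: "tm (u - v) w = tm u w - tm v w" "tm w (u - v) = tm w u - tm w v"
  unfolding tm_def case_prod_beta by (simp_all only: frag_extend_diff frag_extend_fun_diff)

lemma tm_add: "tm (u + v) w = tm u w + tm v w" "tm w (u + v) = tm w u + tm w v"
  using tm_diff(1)[of u "- v" w] tm_diff(1)[of 0 v w] tm_diff(2)[of w u "- v"] tm_diff(2)[of w 0 v] by simp_all

lemma tm_sum: "tm (sum f M) w = (\<Sum>k\<in>M. tm (f k) w)" "tm w (sum f M) = (\<Sum>k\<in>M. tm w (f k))"
  by (induction M rule: infinite_finite_induct) (auto simp: tm_add)

text \<open>
  Closure under differences suffices, because the formal combinations have integer coefficients.
\<close>

lemma pre_induct [consumes 1, case_names zero one diff]:
  assumes "u \<in> carrier pre" "P 0" "\<And>a b. a \<in> carrier R \<Longrightarrow> b \<in> carrier S \<Longrightarrow> P (frag_of (a, b))"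
    "\<And>u v. P u \<Longrightarrow> P v \<Longrightarrow> P (u - v)"
  shows "P u"
proof -
  have "Poly_Mapping.keys u \<subseteq> carrier R \<times> carrier S" using assms(1) by simp
  then show ?thesis by (induction u rule: frag_induction) (use assms in auto)
qed

lemma pre_closed:
  "a \<in> carrier R \<Longrightarrow> b \<in> carrier S \<Longrightarrow> frag_of (a, b) \<in> carrier pre" "0 \<in> carrier pre"
  "u \<in> carrier pre \<Longrightarrow> v \<in> carrier pre \<Longrightarrow> u - v \<in> carrier pre"
  "u \<in> carrier pre \<Longrightarrow> v \<in> carrier pre \<Longrightarrow> u + v \<in> carrier pre"
  "u \<in> carrier pre \<Longrightarrow> - u \<in> carrier pre"
  using keys_diff[of u v] keys_add[of u v] by (auto simp: keys_frag_of)

lemma pre_sum: "(\<And>m. m \<in> M \<Longrightarrow> f m \<in> carrier pre) \<Longrightarrow> sum f M \<in> carrier pre"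
  by (induction M rule: infinite_finite_induct) (use pre_closed(2,4) in \<open>auto simp del: pre_simps(1)\<close>)

lemma tm_closed:
  assumes "u \<in> carrier pre" "v \<in> carrier pre" shows "tm u v \<in> carrier pre"
  using assms(1)
proof (induction u rule: pre_induct)
  case (one a b)
  show ?case using assms(2)
    by (induction v rule: pre_induct) (use one pre_closed in \<open>auto simp del: pre_simps(1) simp: tm_diff\<close>)
qed (use pre_closed in \<open>auto simp del: pre_simps(1) simp: tm_diff\<close>)

lemma tm_comm:
  assumes "u \<in> carrier pre" "v \<in> carrier pre" shows "tm u v = tm v u"
  using assms(1)
proof (induction u rule: pre_induct)
  case (one a b)
  show ?case using assms(2)
    by (induction v rule: pre_induct) (use one in \<open>auto simp: tm_diff R.m_comm S.m_comm\<close>)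
qed (simp_all add: tm_diff)

lemma tm_assoc:
  assumes "u \<in> carrier pre" "v \<in> carrier pre" "w \<in> carrier pre" shows "tm (tm u v) w = tm u (tm v w)"
  using assms(1)
proof (induction u rule: pre_induct)
  case u: (one a b)
  show ?case using assms(2)
  proof (induction v rule: pre_induct)
    case v: (one a' b')
    show ?case using assms(3)
      by (induction w rule: pre_induct) (use u v in \<open>auto simp: tm_diff R.m_assoc S.m_assoc\<close>)
  qed (simp_all add: tm_diff)
qed (simp_all add: tm_diff)

lemma tm_one: "u \<in> carrier pre \<Longrightarrow> tm (frag_of (\<one>\<^bsub>R\<^esub>, \<one>\<^bsub>S\<^esub>)) u = u"
  by (induction u rule: pre_induct) (auto simp: tm_diff)

lemma cring_pre: "cring pre"
proof (rule cringI)
  show "abelian_group pre"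
  proof (rule abelian_groupI)
    fix u assume u: "u \<in> carrier pre"
    show "\<exists>v\<in>carrier pre. v \<oplus>\<^bsub>pre\<^esub> u = \<zero>\<^bsub>pre\<^esub>" by (rule bexI[OF _ pre_closed(5)[OF u]]) simp
  qed (use pre_closed in \<open>auto simp del: pre_simps(1)\<close>)
  show "comm_monoid pre"
  proof (rule comm_monoidI)
    show "\<one>\<^bsub>pre\<^esub> \<in> carrier pre" using pre_closed(1) by simp
    show "u \<otimes>\<^bsub>pre\<^esub> v \<in> carrier pre" if "u \<in> carrier pre" "v \<in> carrier pre" for u v
      using tm_closed[OF that] by simp
    show "u \<otimes>\<^bsub>pre\<^esub> v \<otimes>\<^bsub>pre\<^esub> w = u \<otimes>\<^bsub>pre\<^esub> (v \<otimes>\<^bsub>pre\<^esub> w)"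
      if "u \<in> carrier pre" "v \<in> carrier pre" "w \<in> carrier pre" for u v w using tm_assoc[OF that] by simp
    show "\<one>\<^bsub>pre\<^esub> \<otimes>\<^bsub>pre\<^esub> u = u" if "u \<in> carrier pre" for u using tm_one[OF that] by simp
    show "u \<otimes>\<^bsub>pre\<^esub> v = v \<otimes>\<^bsub>pre\<^esub> u" if "u \<in> carrier pre" "v \<in> carrier pre" for u v
      using tm_comm[OF that] by simp
  qed
  show "(u \<oplus>\<^bsub>pre\<^esub> v) \<otimes>\<^bsub>pre\<^esub> w = u \<otimes>\<^bsub>pre\<^esub> w \<oplus>\<^bsub>pre\<^esub> v \<otimes>\<^bsub>pre\<^esub> w" for u v w by (simp add: tm_add)
qed

definition gens :: "('a \<times> 'b \<Rightarrow>\<^sub>0 int) set" where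
  "gens = {frag_of (a \<oplus>\<^bsub>R\<^esub> a', b) - frag_of (a, b) - frag_of (a', b) | a a' b.
         a \<in> carrier R \<and> a' \<in> carrier R \<and> b \<in> carrier S} \<union>
      {frag_of (a, b \<oplus>\<^bsub>S\<^esub> b') - frag_of (a, b) - frag_of (a, b') | a b b'.
         a \<in> carrier R \<and> b \<in> carrier S \<and> b' \<in> carrier S} \<union>
      {frag_of (i c \<otimes>\<^bsub>R\<^esub> a, b) - frag_of (a, j c \<otimes>\<^bsub>S\<^esub> b) | a b c.
         a \<in> carrier R \<and> b \<in> carrier S}"

lemma rels_def: "rels = genideal pre gens"
  by (simp add: tensor_ideal_def gens_def)

lemma gens_carrier: "gens \<subseteq> carrier pre"
  unfolding gens_def
  by (intro Un_least subsetI; elim CollectE exE conjE; hypsubst;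
      intro pre_closed R.add.m_closed S.add.m_closed R.m_closed S.m_closed i_closed j_closed; assumption)

lemma rels_ideal: "ideal rels pre"
  unfolding rels_def by (rule ring.genideal_ideal[OF cring.axioms(1)[OF cring_pre] gens_carrier])

lemma rels_carrier: "rels \<subseteq> carrier pre"
  using ideal.Icarr[OF rels_ideal] by blast

lemma rels_closed:
  "0 \<in> rels" "u \<in> rels \<Longrightarrow> v \<in> rels \<Longrightarrow> u + v \<in> rels" "u \<in> rels \<Longrightarrow> - u \<in> rels"
  "u \<in> rels \<Longrightarrow> v \<in> rels \<Longrightarrow> u - v \<in> rels" "u \<in> rels \<Longrightarrow> w \<in> carrier pre \<Longrightarrow> tm w u \<in> rels"
proof -
  note as = ideal.axioms(1)[OF rels_ideal]
  show "0 \<in> rels" using additive_subgroup.zero_closed[OF as] by simp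
  show add: "u \<in> rels \<Longrightarrow> v \<in> rels \<Longrightarrow> u + v \<in> rels" for u v using additive_subgroup.a_closed[OF as, of u v] by simp
  show mult: "u \<in> rels \<Longrightarrow> w \<in> carrier pre \<Longrightarrow> tm w u \<in> rels" for u w
    using ideal.I_l_closed[OF rels_ideal, of u w] by simp
  show neg: "- u \<in> rels" if u: "u \<in> rels" for u
  proof -
    have uc: "u \<in> carrier pre" using rels_carrier u by blast
    have "- frag_of (\<one>\<^bsub>R\<^esub>, \<one>\<^bsub>S\<^esub>) \<in> carrier pre" by (intro pre_closed) auto
    from mult[OF u this] show ?thesis using tm_diff(1)[of 0 "frag_of (\<one>\<^bsub>R\<^esub>, \<one>\<^bsub>S\<^esub>)" u] tm_one[OF uc] by simp
  qed
  show "u \<in> rels \<Longrightarrow> v \<in> rels \<Longrightarrow> u - v \<in> rels" using add[of u "- v"] neg[of v] by simp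
qed

lemma rels_sum: "(\<And>k. k \<in> M \<Longrightarrow> f k \<in> rels) \<Longrightarrow> sum f M \<in> rels"
  by (induction M rule: infinite_finite_induct) (auto intro: rels_closed(1,2))

lemma rels_gens:
  "a \<in> carrier R \<Longrightarrow> a' \<in> carrier R \<Longrightarrow> b \<in> carrier S \<Longrightarrow> frag_of (a \<oplus>\<^bsub>R\<^esub> a', b) - frag_of (a, b) - frag_of (a', b) \<in> rels"
  "a \<in> carrier R \<Longrightarrow> b \<in> carrier S \<Longrightarrow> b' \<in> carrier S \<Longrightarrow> frag_of (a, b \<oplus>\<^bsub>S\<^esub> b') - frag_of (a, b) - frag_of (a, b') \<in> rels"
  "a \<in> carrier R \<Longrightarrow> b \<in> carrier S \<Longrightarrow> frag_of (i c \<otimes>\<^bsub>R\<^esub> a, b) - frag_of (a, j c \<otimes>\<^bsub>S\<^esub> b) \<in> rels"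
proof -
  have *: "gens \<subseteq> rels" unfolding rels_def by (rule ring.genideal_self[OF cring.axioms(1)[OF cring_pre] gens_carrier])
  show "a \<in> carrier R \<Longrightarrow> a' \<in> carrier R \<Longrightarrow> b \<in> carrier S \<Longrightarrow> frag_of (a \<oplus>\<^bsub>R\<^esub> a', b) - frag_of (a, b) - frag_of (a', b) \<in> rels"
    by (rule subsetD[OF *]) (unfold gens_def, blast)
  show "a \<in> carrier R \<Longrightarrow> b \<in> carrier S \<Longrightarrow> b' \<in> carrier S \<Longrightarrow> frag_of (a, b \<oplus>\<^bsub>S\<^esub> b') - frag_of (a, b) - frag_of (a, b') \<in> rels"
    by (rule subsetD[OF *]) (unfold gens_def, blast)
  show "a \<in> carrier R \<Longrightarrow> b \<in> carrier S \<Longrightarrow> frag_of (i c \<otimes>\<^bsub>R\<^esub> a, b) - frag_of (a, j c \<otimes>\<^bsub>S\<^esub> b) \<in> rels"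
    by (rule subsetD[OF *]) (unfold gens_def, blast)
qed

lemma rels_zero:
  "b \<in> carrier S \<Longrightarrow> frag_of (\<zero>\<^bsub>R\<^esub>, b) \<in> rels" "a \<in> carrier R \<Longrightarrow> frag_of (a, \<zero>\<^bsub>S\<^esub>) \<in> rels"
  using rels_closed(3)[OF rels_gens(1)[of "\<zero>\<^bsub>R\<^esub>" "\<zero>\<^bsub>R\<^esub>" b]] rels_closed(3)[OF rels_gens(2)[of a "\<zero>\<^bsub>S\<^esub>" "\<zero>\<^bsub>S\<^esub>"]]
  by simp_all

text \<open>
  A balanced map vanishes on the relations. The kernel of its extension is not visibly an
  ideal, so the statement is proved for all multiples of a relation at once.
\<close>

lemma ext_rels:
  fixes f :: "'a \<times> 'b \<Rightarrow> 'l::field"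
  assumes add1: "\<And>a a' b. a \<in> carrier R \<Longrightarrow> a' \<in> carrier R \<Longrightarrow> b \<in> carrier S \<Longrightarrow> f (a \<oplus>\<^bsub>R\<^esub> a', b) = f (a, b) + f (a', b)"
    and add2: "\<And>a b b'. a \<in> carrier R \<Longrightarrow> b \<in> carrier S \<Longrightarrow> b' \<in> carrier S \<Longrightarrow> f (a, b \<oplus>\<^bsub>S\<^esub> b') = f (a, b) + f (a, b')"
    and bal: "\<And>a b c. a \<in> carrier R \<Longrightarrow> b \<in> carrier S \<Longrightarrow> f (i c \<otimes>\<^bsub>R\<^esub> a, b) = f (a, j c \<otimes>\<^bsub>S\<^esub> b)"
    and u: "u \<in> rels"
  shows "ext f u = 0"
proof -
  define J where "J = {u \<in> carrier pre. \<forall>w\<in>carrier pre. ext f (tm w u) = 0}"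
  have "ideal J pre"
  proof (rule cring_idealI[OF cring_pre])
    fix u r assume u: "u \<in> J" and r: "r \<in> carrier pre"
    have "ext f (tm w (tm r u)) = 0" if w: "w \<in> carrier pre" for w
      using u tm_assoc[OF w r, of u, symmetric] tm_closed[OF w r] by (simp add: J_def)
    then show "r \<otimes>\<^bsub>pre\<^esub> u \<in> J" using tm_closed[OF r, of u] u by (simp add: J_def)
  next
    fix u v assume "u \<in> J" "v \<in> J"
    then show "u \<oplus>\<^bsub>pre\<^esub> v \<in> J" using pre_closed(4)[of u v] by (simp add: J_def tm_add ext_add)
  qed (auto simp: J_def)
  moreover have "gens \<subseteq> J"
  proof
    fix g assume g: "g \<in> gens"
    have "ext f (tm w g) = 0" if "w \<in> carrier pre" for w
      using that
    proof (induction w rule: pre_induct)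
      case (one p q)
      show ?case using g unfolding gens_def
      proof (elim UnE CollectE exE conjE)
        fix a a' b assume *: "g = frag_of (a \<oplus>\<^bsub>R\<^esub> a', b) - frag_of (a, b) - frag_of (a', b)"
          "a \<in> carrier R" "a' \<in> carrier R" "b \<in> carrier S"
        show ?thesis unfolding *(1) using one * add1[of "p \<otimes>\<^bsub>R\<^esub> a" "p \<otimes>\<^bsub>R\<^esub> a'" "q \<otimes>\<^bsub>S\<^esub> b"]
          by (simp add: tm_diff ext_diff R.r_distr)
      next
        fix a b b' assume *: "g = frag_of (a, b \<oplus>\<^bsub>S\<^esub> b') - frag_of (a, b) - frag_of (a, b')"
          "a \<in> carrier R" "b \<in> carrier S" "b' \<in> carrier S"
        show ?thesis unfolding *(1) using one * add2[of "p \<otimes>\<^bsub>R\<^esub> a" "q \<otimes>\<^bsub>S\<^esub> b" "q \<otimes>\<^bsub>S\<^esub> b'"]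
          by (simp add: tm_diff ext_diff S.r_distr)
      next
        fix a b c assume *: "g = frag_of (i c \<otimes>\<^bsub>R\<^esub> a, b) - frag_of (a, j c \<otimes>\<^bsub>S\<^esub> b)" "a \<in> carrier R" "b \<in> carrier S"
        show ?thesis unfolding *(1) using one * bal[of "p \<otimes>\<^bsub>R\<^esub> a" "q \<otimes>\<^bsub>S\<^esub> b" c] i_closed j_closed
          by (simp add: tm_diff ext_diff R.m_lcomm S.m_lcomm)
      qed
    qed (simp_all add: tm_diff ext_diff)
    then show "g \<in> J" using g gens_carrier by (auto simp: J_def)
  qed
  ultimately have "rels \<subseteq> J" unfolding rels_def by (rule ring.genideal_minimal[OF cring.axioms(1)[OF cring_pre]])
  moreover have "frag_of (\<one>\<^bsub>R\<^esub>, \<one>\<^bsub>S\<^esub>) \<in> carrier pre" by (rule pre_closed) auto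
  ultimately have "ext f (tm (frag_of (\<one>\<^bsub>R\<^esub>, \<one>\<^bsub>S\<^esub>)) u) = 0" "u \<in> carrier pre" using u rels_carrier unfolding J_def by blast+
  then show ?thesis using tm_one by simp
qed

definition cls :: "('a \<times> 'b \<Rightarrow>\<^sub>0 int) \<Rightarrow> ('a \<times> 'b \<Rightarrow>\<^sub>0 int) set" where
  "cls u = rels +>\<^bsub>pre\<^esub> u"

lemma cls_eq_set: "cls u = (\<lambda>r. r + u) ` rels"
  by (auto simp: cls_def a_r_coset_def')

lemma cls_eq: "cls u = cls v \<longleftrightarrow> u - v \<in> rels"
proof
  assume "cls u = cls v"
  moreover have "u \<in> cls u" using rels_closed(1) unfolding cls_eq_set by (auto intro: image_eqI[of _ _ 0])
  ultimately obtain r where "r \<in> rels" "u = r + v" unfolding cls_eq_set by blast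
  then show "u - v \<in> rels" by simp
next
  have sub: "cls u \<subseteq> cls v" if "u - v \<in> rels" for u v
  proof
    fix p assume "p \<in> cls u"
    then obtain r where "r \<in> rels" "p = r + u" unfolding cls_eq_set by blast
    then have "r + (u - v) \<in> rels" "p = (r + (u - v)) + v" using rels_closed(2) that by auto
    then show "p \<in> cls v" unfolding cls_eq_set by blast
  qed
  assume "u - v \<in> rels"
  then have "u - v \<in> rels" "v - u \<in> rels" using rels_closed(3)[of "u - v"] by auto
  then show "cls u = cls v" using sub by blast
qed

lemma cring_tensor: "cring TT"
  unfolding tensor_def by (rule ideal.quotient_is_cring[OF rels_ideal cring_pre])

lemma cls_hom: "cls \<in> ring_hom pre TT"
  using ideal.rcos_ring_hom[OF rels_ideal] unfolding tensor_def cls_def by (simp add: cls_def[abs_def])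

lemma cls_simps:
  "carrier TT = cls ` carrier pre" "\<one>\<^bsub>TT\<^esub> = cls (frag_of (\<one>\<^bsub>R\<^esub>, \<one>\<^bsub>S\<^esub>))" "\<zero>\<^bsub>TT\<^esub> = cls 0"
  "u \<in> carrier pre \<Longrightarrow> v \<in> carrier pre \<Longrightarrow> cls u \<otimes>\<^bsub>TT\<^esub> cls v = cls (tm u v)"
  "u \<in> carrier pre \<Longrightarrow> v \<in> carrier pre \<Longrightarrow> cls u \<oplus>\<^bsub>TT\<^esub> cls v = cls (u + v)"
  "pure a b = cls (frag_of (a, b))"
proof -
  show "carrier TT = cls ` carrier pre"
    unfolding tensor_def FactRing_def A_RCOSETS_def' cls_def by auto
  show "\<one>\<^bsub>TT\<^esub> = cls (frag_of (\<one>\<^bsub>R\<^esub>, \<one>\<^bsub>S\<^esub>))" using ring_hom_one[OF cls_hom] by simp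
  show "\<zero>\<^bsub>TT\<^esub> = cls 0"
    using ring_hom_zero[OF cls_hom cring.axioms(1)[OF cring_pre] cring.axioms(1)[OF cring_tensor]] by simp
  show "u \<in> carrier pre \<Longrightarrow> v \<in> carrier pre \<Longrightarrow> cls u \<otimes>\<^bsub>TT\<^esub> cls v = cls (tm u v)"
    using ring_hom_mult[OF cls_hom, of u v] by simp
  show "u \<in> carrier pre \<Longrightarrow> v \<in> carrier pre \<Longrightarrow> cls u \<oplus>\<^bsub>TT\<^esub> cls v = cls (u + v)"
    using ring_hom_add[OF cls_hom, of u v] by simp
  show "pure a b = cls (frag_of (a, b))" by (simp add: pure_tensor_def cls_def)
qed

lemma sum_frag_left:
  assumes "finite M" "\<And>k. k \<in> M \<Longrightarrow> a k \<in> carrier R" "b \<in> carrier S"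
  shows "frag_of (finsum R a M, b) - (\<Sum>k\<in>M. frag_of (a k, b)) \<in> rels"
  using assms
proof (induction M rule: finite_induct)
  case empty then show ?case using rels_zero(1) by simp
next
  case (insert k M)
  have "finsum R a M \<in> carrier R" using insert by (intro R.finsum_closed) auto
  then have "frag_of (a k \<oplus>\<^bsub>R\<^esub> finsum R a M, b) - frag_of (a k, b) - frag_of (finsum R a M, b) \<in> rels"
    using insert by (intro rels_gens) auto
  moreover have "frag_of (finsum R a M, b) - (\<Sum>k\<in>M. frag_of (a k, b)) \<in> rels" using insert by auto
  ultimately have "frag_of (a k \<oplus>\<^bsub>R\<^esub> finsum R a M, b) - frag_of (a k, b) - frag_of (finsum R a M, b) +
      (frag_of (finsum R a M, b) - (\<Sum>k\<in>M. frag_of (a k, b))) \<in> rels" by (rule rels_closed(2))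
  moreover have "finsum R a (insert k M) = a k \<oplus>\<^bsub>R\<^esub> finsum R a M"
    using insert by (intro R.finsum_insert) auto
  ultimately show ?case using insert.hyps by (simp add: algebra_simps)
qed

end

lemma finsum_sub_ring:
  assumes "subring_set A" "\<And>k. k \<in> M \<Longrightarrow> f k \<in> A" shows "finsum (sub_ring A) f M = sum f M"
  by (rule finsum_transport[OF cring_sub_ring[OF assms(1)] assms(1), of "\<lambda>x. x"]) (use assms in auto)

subsection \<open>Tensor products with a Laurent polynomial ring\<close>

text \<open>
  \<open>P = F [x d, 1 / x d]\<close> and a subring \<open>Q\<close> of \<open>K\<close>, over which the \<open>x d\<close> are independent: an
  element of the tensor product is a sum of tensors of Laurent monomials with elements of \<open>Q\<close>, and
  multiplication determines these elements.
\<close>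

locale laurent_tensor = scalars \<iota> for \<iota> :: "complex \<Rightarrow> 'l::field" +
  fixes D :: "'v set" and x :: "'v \<Rightarrow> 'l" and Q K :: "'l set"
  assumes D: "finite D" and K: "subring_set K" and indep: "lin_indep K D x"
    and Q: "subring_set Q" and FQ: "F \<subseteq> Q" and QK: "Q \<subseteq> K"
begin

abbreviation "P \<equiv> lspan F D x"
abbreviation "xm \<equiv> lmon D x"

lemma xd: "d \<in> D \<Longrightarrow> x d \<noteq> 0"
  using indep by (auto simp: lin_indep_def)

lemma P: "subring_set P"
  by (rule lspan_subring[OF F xd])

lemma xm_P: "m \<in> expo D \<Longrightarrow> xm m \<in> P"
  using lspan_mon[OF F _ subring_setD(1)[OF F], of m D x] by simp

lemma FP: "F \<subseteq> P"
  by (rule lspan_incl(1)[OF F D])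

sublocale tensor_product "sub_ring P" "sub_ring Q" \<iota> \<iota>
  by (intro tensor_product.intro tensor_product_axioms.intro cring_sub_ring P Q) (use FP FQ in auto)

abbreviation "mul \<equiv> ext (\<lambda>(a, b). a * b)"

lemma mul_rels: "u \<in> rels \<Longrightarrow> mul u = 0"
  by (rule ext_rels) (auto simp: algebra_simps)

text \<open>
  A tensor \<open>p \<otimes> q\<close> is expanded along the monomials of \<open>p\<close>, whose scalar coefficients move to the
  second factor.
\<close>

lemma normal_form:
  assumes "u \<in> carrier pre"
  shows "\<exists>M c. finite M \<and> M \<subseteq> expo D \<and> (\<forall>m. c m \<in> Q) \<and> (\<forall>m. m \<notin> M \<longrightarrow> c m = 0) \<and>
    u - (\<Sum>m\<in>M. frag_of (xm m, c m)) \<in> rels"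
  using assms
proof (induction u rule: pre_induct)
  case zero
  show ?case by (rule exI[of _ "{}"], rule exI[of _ "\<lambda>_. 0"]) (use subring_setD(2)[OF Q] rels_closed(1) in auto)
next
  case (one p q)
  then have p: "p \<in> P" and q: "q \<in> Q" by auto
  obtain c where c: "lrep F D x c p" using p by (auto simp: lspan_def)
  let ?M = "{m. c m \<noteq> 0}"
  note cD = lrepD[OF c]
  have M: "?M \<subseteq> expo D" using cD(2) by blast
  have cQ: "c m \<in> Q" "c m \<in> P" for m using cD(3) FQ FP by auto
  have cm: "c m * xm m \<in> P" if "m \<in> ?M" for m using subring_setD(6)[OF P cQ(2) xm_P] M that by blast
  have psum: "p = finsum (sub_ring P) (\<lambda>m. c m * xm m) ?M"
    using lrep_sum[OF c cD(1) subset_refl] finsum_sub_ring[OF P, of ?M "\<lambda>m. c m * xm m"] cm by simp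
  have 1: "frag_of (p, q) - (\<Sum>m\<in>?M. frag_of (c m * xm m, q)) \<in> rels"
    unfolding psum by (rule sum_frag_left[OF cD(1)]) (use cm q in auto)
  have "(\<Sum>m\<in>?M. frag_of (c m * xm m, q) - frag_of (xm m, c m * q)) \<in> rels"
  proof (rule rels_sum)
    fix m assume m: "m \<in> ?M"
    obtain e where e: "c m = \<iota> e" using cD(3)[of m] by auto
    show "frag_of (c m * xm m, q) - frag_of (xm m, c m * q) \<in> rels"
      unfolding e using rels_gens(3)[of "xm m" q e] xm_P M m q by auto
  qed
  from rels_closed(2)[OF 1 this] have "frag_of (p, q) - (\<Sum>m\<in>?M. frag_of (xm m, c m * q)) \<in> rels"
    by (simp add: sum_subtractf)
  moreover have "c m * q \<in> Q" for m using subring_setD(6)[OF Q cQ(1) q] .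
  ultimately show ?case using cD(1) M by (intro exI[of _ ?M] exI[of _ "\<lambda>m. c m * q"]) auto
next
  case (diff u v)
  obtain M c where M: "finite M" "M \<subseteq> expo D" "\<And>m. c m \<in> Q" "\<And>m. m \<notin> M \<Longrightarrow> c m = 0"
    and u: "u - (\<Sum>m\<in>M. frag_of (xm m, c m)) \<in> rels" using diff(1) by blast
  obtain N d where N: "finite N" "N \<subseteq> expo D" "\<And>m. d m \<in> Q" "\<And>m. m \<notin> N \<Longrightarrow> d m = 0"
    and v: "v - (\<Sum>m\<in>N. frag_of (xm m, d m)) \<in> rels" using diff(2) by blast
  \<comment> \<open>Before normal forms can be subtracted they must be indexed by the same monomials; the new terms are \<open>x\<^sup>m \<otimes> 0\<close>.\<close>
  have enlarge: "u - (\<Sum>m\<in>M \<union> N. frag_of (xm m, c m)) \<in> rels"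
    if M: "finite M" "\<And>m. m \<notin> M \<Longrightarrow> c m = 0" and N: "finite N" "N \<subseteq> expo D"
      and u: "u - (\<Sum>m\<in>M. frag_of (xm m, c m)) \<in> rels" for u M N and c :: "('v \<Rightarrow> int) \<Rightarrow> 'l"
  proof -
    have "(\<Sum>m\<in>N - M. frag_of (xm m, c m)) \<in> rels"
      by (rule rels_sum) (use M N xm_P rels_zero(2) in auto)
    from rels_closed(4)[OF u this] show ?thesis
      using sum.union_disjoint[of M "N - M" "\<lambda>m. frag_of (xm m, c m)"] M N by (simp add: Un_Diff_cancel diff_diff_add)
  qed
  have u': "u - (\<Sum>m\<in>M \<union> N. frag_of (xm m, c m)) \<in> rels" by (rule enlarge[OF M(1,4) N(1,2) u])
  have v': "v - (\<Sum>m\<in>M \<union> N. frag_of (xm m, d m)) \<in> rels"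
    using enlarge[OF N(1,4) M(1,2) v] by (simp add: Un_commute)
  have w: "(\<Sum>m\<in>M \<union> N. frag_of (xm m, (c m - d m) + d m) - frag_of (xm m, c m - d m) - frag_of (xm m, d m)) \<in> rels"
  proof (rule rels_sum)
    fix m assume "m \<in> M \<union> N"
    then have "m \<in> expo D" using M N by auto
    then show "frag_of (xm m, (c m - d m) + d m) - frag_of (xm m, c m - d m) - frag_of (xm m, d m) \<in> rels"
      using rels_gens(2)[of "xm m" "c m - d m" "d m"] xm_P M(3) N(3) subring_setD(5)[OF Q] by simp
  qed
  have "u - v - (\<Sum>m\<in>M \<union> N. frag_of (xm m, c m - d m)) \<in> rels"
  proof -
    have "u - A - (v - B) + (A - C - B) = u - v - C" for A B C :: "'l \<times> 'l \<Rightarrow>\<^sub>0 int" by simp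
    then show ?thesis
      using rels_closed(2)[OF rels_closed(4)[OF u' v'] w] by (simp only: sum_subtractf diff_add_cancel)
  qed
  moreover have "c m - d m \<in> Q" for m using subring_setD(5)[OF Q M(3) N(3)] .
  ultimately show ?case
    using M N by (intro exI[of _ "M \<union> N"] exI[of _ "\<lambda>m. c m - d m"]) auto
qed

text \<open>
  The product of a normal form determines its coefficients, by independence over \<open>K\<close>.
\<close>

lemma mul_injective:
  assumes u: "u \<in> carrier pre" "mul u = 0" shows "u \<in> rels"
proof -
  obtain M c where M: "finite M" "M \<subseteq> expo D" "\<And>m. c m \<in> Q" "\<And>m. m \<notin> M \<Longrightarrow> c m = 0"
    and r: "u - (\<Sum>m\<in>M. frag_of (xm m, c m)) \<in> rels" using normal_form[OF u(1)] by blast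
  have "mul u - (\<Sum>m\<in>M. xm m * c m) = 0"
    using mul_rels[OF r] by (simp add: ext_diff ext_sum)
  then have "lrep K D x c 0"
    using M QK subring_setD(2)[OF K] u(2) by (intro lrepI[of M]) (auto simp: mult.commute)
  then have "c m = 0" for m using indep by (auto simp: lin_indep_def)
  then have "(\<Sum>m\<in>M. frag_of (xm m, c m)) \<in> rels"
    using M(2) xm_P rels_zero(2) by (intro rels_sum) auto
  from rels_closed(2)[OF r this] show ?thesis by simp
qed

lemma mul_tm:
  assumes "u \<in> carrier pre" "v \<in> carrier pre" shows "mul (tm u v) = mul u * mul v"
  using assms(1)
proof (induction u rule: pre_induct)
  case (one a b)
  show ?case using assms(2)
    by (induction v rule: pre_induct) (auto simp: tm_diff ext_diff algebra_simps)
qed (simp_all add: tm_diff ext_diff left_diff_distrib)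

lemma mul_image: "mul ` carrier pre = lspan Q D x"
proof (intro equalityI subsetI)
  have span: "subring_set (lspan Q D x)" by (rule lspan_subring[OF Q xd])
  have PQ: "P \<subseteq> lspan Q D x"
    by (rule lspan_least[OF span]) (use FQ lspan_incl[OF Q D, where x = x] in auto)
  fix z assume "z \<in> mul ` carrier pre"
  then obtain u where "u \<in> carrier pre" "z = mul u" by blast
  then show "z \<in> lspan Q D x"
  proof (induction u arbitrary: z rule: pre_induct)
    case (one a b)
    then show ?case using PQ lspan_incl(1)[OF Q D, where x = x] subring_setD(6)[OF span] by auto
  qed (auto simp: ext_diff subring_setD[OF span])
next
  fix z assume "z \<in> lspan Q D x"
  then obtain c where c: "lrep Q D x c z" by (auto simp: lspan_def)
  let ?u = "\<Sum>m | c m \<noteq> 0. frag_of (xm m, c m)"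
  have "mul ?u = z" using lrep_sum[OF c lrepD(1)[OF c] subset_refl] by (simp add: ext_sum mult.commute)
  moreover have "?u \<in> carrier pre"
  proof -
    have "frag_of (xm m, c m) \<in> carrier pre" if "c m \<noteq> 0" for m
      by (rule pre_closed) (use xm_P lrepD(2,3)[OF c] that in auto)
    then show ?thesis by (intro pre_sum) simp
  qed
  ultimately show "z \<in> mul ` carrier pre" by blast
qed

text \<open>Multiplication, as a map on the classes that make up the tensor product.\<close>

definition theta :: "('l \<times> 'l \<Rightarrow>\<^sub>0 int) set \<Rightarrow> 'l" where
  "theta q = mul (SOME u. u \<in> q)"

lemma theta_cls: "theta (cls u) = mul u"
proof -
  have "u \<in> cls u" using rels_closed(1) unfolding cls_eq_set by (auto intro: image_eqI[of _ _ 0])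
  then have "(SOME v. v \<in> cls u) \<in> cls u" by (rule someI)
  then obtain r where "r \<in> rels" "(SOME v. v \<in> cls u) = r + u" unfolding cls_eq_set by blast
  then show ?thesis by (simp add: theta_def ext_add mul_rels)
qed

theorem theta_iso: "theta \<in> ring_iso TT (sub_ring (lspan Q D x))"
proof (rule ring_iso_memI)
  show "theta q \<in> carrier (sub_ring (lspan Q D x))" if "q \<in> carrier TT" for q
    using that mul_image by (auto simp: cls_simps(1) theta_cls simp del: pre_simps(1))
  show "theta (q \<otimes>\<^bsub>TT\<^esub> r) = theta q \<otimes>\<^bsub>sub_ring (lspan Q D x)\<^esub> theta r"
    "theta (q \<oplus>\<^bsub>TT\<^esub> r) = theta q \<oplus>\<^bsub>sub_ring (lspan Q D x)\<^esub> theta r"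
    if "q \<in> carrier TT" "r \<in> carrier TT" for q r
    using that mul_tm by (auto simp: cls_simps theta_cls ext_add simp del: pre_simps(1))
  show "theta \<one>\<^bsub>TT\<^esub> = \<one>\<^bsub>sub_ring (lspan Q D x)\<^esub>" by (simp add: cls_simps theta_cls)
  show "bij_betw theta (carrier TT) (carrier (sub_ring (lspan Q D x)))"
    unfolding bij_betw_def
  proof
    show "inj_on theta (carrier TT)"
    proof (rule inj_onI)
      fix q r assume "q \<in> carrier TT" "r \<in> carrier TT" and eq: "theta q = theta r"
      then obtain u v where uv: "u \<in> carrier pre" "v \<in> carrier pre" "q = cls u" "r = cls v" unfolding cls_simps(1) by blast
      have "mul (u - v) = 0" using eq uv by (simp add: theta_cls ext_diff)
      then show "q = r" using mul_injective[OF pre_closed(3)[OF uv(1,2)]] uv by (simp add: cls_eq)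
    qed
    have "theta ` carrier TT = mul ` carrier pre" unfolding cls_simps(1) by (simp add: image_image theta_cls)
    then show "theta ` carrier TT = carrier (sub_ring (lspan Q D x))" using mul_image by simp
  qed
qed

lemma identification_exists:
  "\<exists>h \<in> ring_iso (sub_ring (lspan Q D x)) TT. \<forall>p\<in>P. \<forall>a\<in>Q. h (p * a) = pure p a"
proof -
  let ?h = "inv_into (carrier TT) theta"
  have inj: "inj_on theta (carrier TT)" using theta_iso by (auto simp: ring_iso_def bij_betw_def)
  have "?h (p * a) = pure p a" if "p \<in> P" "a \<in> Q" for p a
  proof -
    have "pure p a \<in> carrier TT" unfolding cls_simps(1,6) using pre_closed(1)[of p a] that by (auto simp del: pre_simps(1))
    moreover have "theta (pure p a) = p * a" unfolding cls_simps(6) theta_cls by simp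
    ultimately show ?thesis using inv_into_f_f[OF inj] by metis
  qed
  moreover have "?h \<in> ring_iso (sub_ring (lspan Q D x)) TT"
    by (rule ring_iso_set_sym[OF cring.axioms(1)[OF cring_tensor] theta_iso])
  ultimately show ?thesis by blast
qed

end


section \<open>Characters of the torus\<close>

locale torus = scalars \<iota> for \<iota> :: "complex \<Rightarrow> 'l::field" +
  fixes D :: "'v set" and x :: "'v \<Rightarrow> 'l"
  assumes D: "finite D" and indep: "lin_indep F D x"
begin

abbreviation "P \<equiv> lspan F D x"
abbreviation "xm \<equiv> lmon D x"

lemma xd: "d \<in> D \<Longrightarrow> x d \<noteq> 0"
  using indep by (auto simp: lin_indep_def)

lemma P: "subring_set P"
  by (rule lspan_subring[OF F xd])

lemma torus_ring_eq: "torus_ring \<iota> D x = sub_ring P"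
proof -
  have "P = laurent F D D x" by (rule lspan_eq_laurent[OF F D xd])
  then show ?thesis by (simp add: torus_ring_def gen_algebra_def laurent_def Un_assoc)
qed

lemma mono_P: "m \<in> expo D \<Longrightarrow> a \<in> F \<Longrightarrow> a * xm m \<in> P" "m \<in> expo D \<Longrightarrow> xm m \<in> P"
  using lspan_mon[OF F, of m D a x] lspan_mon[OF F _ subring_setD(1)[OF F], of m D x] by auto

lemma FP: "F \<subseteq> P"
  by (rule lspan_incl(1)[OF F D])

lemma xP: "d \<in> D \<Longrightarrow> x d \<in> P" "d \<in> D \<Longrightarrow> inverse (x d) \<in> P"
  using lspan_incl(3,4)[OF F D] by auto

sublocale tensor_product "sub_ring P" "sub_ring P" \<iota> \<iota>
  by (intro tensor_product.intro tensor_product_axioms.intro cring_sub_ring P) (use FP in auto)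

definition coef :: "'l \<Rightarrow> ('v \<Rightarrow> int) \<Rightarrow> 'l" where
  "coef z = (SOME c. lrep F D x c z)"

lemma coef: "z \<in> P \<Longrightarrow> lrep F D x (coef z) z"
proof -
  assume "z \<in> P"
  then have "\<exists>c. lrep F D x c z" by (simp add: lspan_def)
  then show ?thesis unfolding coef_def by (rule someI_ex)
qed

lemma coef_unique: "lrep F D x c z \<Longrightarrow> coef z = c"
  using lin_indep_unique[OF F indep coef] by (auto simp: lspan_def)

lemma coef_add: "z \<in> P \<Longrightarrow> w \<in> P \<Longrightarrow> coef (z + w) = (\<lambda>m. coef z m + coef w m)"
  using coef_unique[OF lrep_combine[OF F coef coef subring_setD(1)[OF F]]] by simp

lemma coef_zero: "coef 0 = (\<lambda>m. 0)"
  by (rule coef_unique[OF lrep_zero[OF subring_setD(2)[OF F]]])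

lemma coef_mult: "a \<in> F \<Longrightarrow> z \<in> P \<Longrightarrow> coef (a * z) = (\<lambda>m. a * coef z m)"
  using coef_unique[OF lrep_combine[OF F coef lrep_zero[OF subring_setD(2)[OF F]]]] by simp

lemma coef_mon: "m \<in> expo D \<Longrightarrow> a \<in> F \<Longrightarrow> coef (a * xm m) = (\<lambda>n. if n = m then a else 0)"
  by (rule coef_unique[OF lrep_mon[OF F]])

text \<open>
  The comultiplication sends a combination of Laurent monomials \<open>x\<^sup>m\<close> to the same combination of
  the \<open>x\<^sup>m \<otimes> x\<^sup>m\<close>.
\<close>

definition delta :: "'l \<Rightarrow> ('l \<times> 'l \<Rightarrow>\<^sub>0 int)" where
  "delta z = (\<Sum>m | coef z m \<noteq> 0. frag_of (coef z m * xm m, xm m))"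

abbreviation cong (infix \<open>\<sim>\<sim>\<close> 50) where "u \<sim>\<sim> v \<equiv> u - v \<in> rels"

lemma cong_trans: "u \<sim>\<sim> v \<Longrightarrow> v \<sim>\<sim> w \<Longrightarrow> u \<sim>\<sim> w"
  using rels_closed(2)[of "u - v" "v - w"] by simp

lemma cong_sym: "u \<sim>\<sim> v \<Longrightarrow> v \<sim>\<sim> u"
  using rels_closed(3)[of "u - v"] by simp

lemma cong_add: "u \<sim>\<sim> v \<Longrightarrow> u' \<sim>\<sim> v' \<Longrightarrow> u + u' \<sim>\<sim> v + v'"
  using rels_closed(2)[of "u - v" "u' - v'"] by (simp add: algebra_simps)

lemma cong_sum: "(\<And>k. k \<in> M \<Longrightarrow> f k \<sim>\<sim> g k) \<Longrightarrow> sum f M \<sim>\<sim> sum g M"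
  using rels_sum[of M "\<lambda>k. f k - g k"] by (simp add: sum_subtractf)

text \<open>
  Formal combinations do not cancel a term \<open>0 \<otimes> x\<^sup>m\<close>, so identities between values of \<open>delta\<close> hold only
  modulo the relations.
\<close>

lemma delta_superset:
  assumes z: "z \<in> P" and M: "finite M" "{m. coef z m \<noteq> 0} \<subseteq> M" "M \<subseteq> expo D"
  shows "delta z \<sim>\<sim> (\<Sum>m\<in>M. frag_of (coef z m * xm m, xm m))"
proof -
  have "(\<Sum>m\<in>M - {m. coef z m \<noteq> 0}. frag_of (coef z m * xm m, xm m)) \<in> rels"
    by (rule rels_sum) (use M mono_P rels_zero(1) in auto)
  then have "- (\<Sum>m\<in>M - {m. coef z m \<noteq> 0}. frag_of (coef z m * xm m, xm m)) \<in> rels" by (rule rels_closed(3))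
  moreover have "(\<Sum>m\<in>M. frag_of (coef z m * xm m, xm m)) =
      (\<Sum>m\<in>M - {m. coef z m \<noteq> 0}. frag_of (coef z m * xm m, xm m)) + delta z"
    unfolding delta_def by (rule sum.subset_diff[OF M(2,1)])
  ultimately show ?thesis by simp
qed

lemma delta_closed:
  assumes z: "z \<in> P" shows "delta z \<in> carrier pre"
  unfolding delta_def
proof (intro pre_sum pre_closed(1))
  fix m assume "m \<in> {m. coef z m \<noteq> 0}"
  then have "m \<in> expo D" using lrepD(2)[OF coef[OF z]] by blast
  then show "coef z m * xm m \<in> carrier (sub_ring P)" "xm m \<in> carrier (sub_ring P)"
    using mono_P lrepD(3)[OF coef[OF z]] by auto
qed

lemma delta_mon:
  assumes "m \<in> expo D" "a \<in> F" shows "delta (a * xm m) \<sim>\<sim> frag_of (a * xm m, xm m)"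
proof -
  have "{n. coef (a * xm m) n \<noteq> 0} \<subseteq> {m}" by (auto simp: coef_mon[OF assms] split: if_splits)
  then show ?thesis using delta_superset[of "a * xm m" "{m}"] mono_P(1)[OF assms] assms(1) by (simp add: coef_mon[OF assms])
qed

lemma delta_add:
  assumes zw: "z \<in> P" "w \<in> P" shows "delta (z + w) \<sim>\<sim> delta z + delta w"
proof -
  let ?M = "{m. coef z m \<noteq> 0} \<union> {m. coef w m \<noteq> 0}"
  let ?f = "\<lambda>z m. frag_of (coef z m * xm m, xm m)"
  have M: "finite ?M" "?M \<subseteq> expo D" using lrepD(1,2)[OF coef] zw by auto
  have zwP: "z + w \<in> P" using subring_setD(4)[OF P zw] .
  have 1: "delta (z + w) \<sim>\<sim> (\<Sum>m\<in>?M. ?f (z + w) m)"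
    by (rule delta_superset[OF zwP M(1) _ M(2)]) (auto simp: coef_add[OF zw])
  have 2: "(\<Sum>m\<in>?M. ?f (z + w) m) \<sim>\<sim> (\<Sum>m\<in>?M. ?f z m + ?f w m)"
  proof (rule cong_sum)
    fix m assume "m \<in> ?M"
    then have "m \<in> expo D" using M(2) by blast
    then have "coef z m * xm m \<in> P" "coef w m * xm m \<in> P" "xm m \<in> P" using mono_P lrepD(3)[OF coef] zw by auto
    then show "?f (z + w) m \<sim>\<sim> ?f z m + ?f w m"
      using rels_gens(1)[of "coef z m * xm m" "coef w m * xm m" "xm m"]
      by (simp add: coef_add[OF zw] distrib_right diff_diff_add)
  qed
  have 3: "(\<Sum>m\<in>?M. ?f z m) + (\<Sum>m\<in>?M. ?f w m) \<sim>\<sim> delta z + delta w"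
    by (intro cong_add cong_sym[OF delta_superset]) (use zw M in auto)
  show ?thesis by (rule cong_trans[OF 1 cong_trans[OF 2]]) (unfold sum.distrib, rule 3)
qed

lemma delta_sum:
  assumes "finite M" "\<And>k. k \<in> M \<Longrightarrow> f k \<in> P" shows "delta (sum f M) \<sim>\<sim> (\<Sum>k\<in>M. delta (f k))"
  using assms
proof (induction M rule: finite_induct)
  case empty then show ?case using rels_closed(1) by (simp add: delta_def coef_zero)
next
  case (insert k M)
  have "sum f M \<in> P" using insert by (intro subring_set_sum[OF P]) auto
  then have "delta (f k + sum f M) \<sim>\<sim> delta (f k) + delta (sum f M)" using insert by (intro delta_add) auto
  moreover have "delta (f k) + delta (sum f M) \<sim>\<sim> delta (f k) + (\<Sum>k\<in>M. delta (f k))"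
    using insert by (intro cong_add) (auto simp: rels_closed(1))
  ultimately show ?case unfolding sum.insert[OF insert.hyps] by (rule cong_trans)
qed

text \<open>
  Both sides are expanded into monomials, where \<open>x\<^sup>m x\<^sup>n \<otimes> x\<^sup>m x\<^sup>n\<close> is the product of the tensors.
\<close>

lemma delta_mult:
  assumes zw: "z \<in> P" "w \<in> P" shows "delta (z * w) \<sim>\<sim> tm (delta z) (delta w)"
proof -
  let ?M = "{m. coef z m \<noteq> 0}" and ?N = "{m. coef w m \<noteq> 0}"
  let ?t = "\<lambda>m n. (coef z m * coef w n) * xm (\<lambda>i. m i + n i)"
  note c = coef[OF zw(1)] and d = coef[OF zw(2)]
  have fin: "finite ?M" "finite ?N" using lrepD(1)[OF c] lrepD(1)[OF d] by auto
  have ex: "(\<lambda>i. m i + n i) \<in> expo D" if "m \<in> ?M" "n \<in> ?N" for m n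
    using that lrepD(2)[OF c] lrepD(2)[OF d] expo_closed(2) by blast
  have cF: "coef z m * coef w n \<in> F" for m n using subring_setD(6)[OF F lrepD(3)[OF c] lrepD(3)[OF d]] .
  have tP: "?t m n \<in> P" if "m \<in> ?M" "n \<in> ?N" for m n using mono_P(1)[OF ex[OF that] cF] .
  have add: "xm (\<lambda>i. m i + n i) = xm m * xm n" for m n by (rule lmon_add[OF xd])
  have "z * w = (\<Sum>m\<in>?M. coef z m * xm m) * (\<Sum>n\<in>?N. coef w n * xm n)"
    using lrep_sum[OF c fin(1) subset_refl] lrep_sum[OF d fin(2) subset_refl] by simp
  also have "\<dots> = (\<Sum>m\<in>?M. \<Sum>n\<in>?N. ?t m n)"
    unfolding sum_product by (intro sum.cong HOL.refl) (simp add: add mult_ac)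
  finally have 0: "delta (z * w) = delta (\<Sum>m\<in>?M. \<Sum>n\<in>?N. ?t m n)" by simp
  have 1: "delta (\<Sum>m\<in>?M. \<Sum>n\<in>?N. ?t m n) \<sim>\<sim> (\<Sum>m\<in>?M. delta (\<Sum>n\<in>?N. ?t m n))"
    by (rule delta_sum[OF fin(1)], rule subring_set_sum[OF P], rule tP)
  have 2: "(\<Sum>m\<in>?M. delta (\<Sum>n\<in>?N. ?t m n)) \<sim>\<sim> (\<Sum>m\<in>?M. \<Sum>n\<in>?N. delta (?t m n))"
    by (rule cong_sum, rule delta_sum[OF fin(2)], rule tP)
  have 3: "(\<Sum>m\<in>?M. \<Sum>n\<in>?N. delta (?t m n)) \<sim>\<sim>
      (\<Sum>m\<in>?M. \<Sum>n\<in>?N. frag_of (?t m n, xm (\<lambda>i. m i + n i)))"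
    by (rule cong_sum, rule cong_sum, rule delta_mon[OF ex cF])
  have 4: "(\<Sum>m\<in>?M. \<Sum>n\<in>?N. frag_of (?t m n, xm (\<lambda>i. m i + n i))) = tm (delta z) (delta w)"
    unfolding delta_def unfolding tm_sum(1) unfolding tm_sum(2) by (intro sum.cong HOL.refl) (simp add: add mult_ac)
  show ?thesis unfolding 0 4[symmetric] by (rule cong_trans[OF 1 cong_trans[OF 2 3]])
qed

definition Delta :: "'l \<Rightarrow> ('l \<times> 'l \<Rightarrow>\<^sub>0 int) set" where
  "Delta z = cls (delta z)"

lemma Delta_mon: "m \<in> expo D \<Longrightarrow> a \<in> F \<Longrightarrow> Delta (a * xm m) = pure (a * xm m) (xm m)"
  unfolding Delta_def cls_simps(6) cls_eq by (rule delta_mon)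

lemma Delta_hom: "Delta \<in> ring_hom (sub_ring P) TT"
proof (rule ring_hom_memI)
  show "Delta z \<in> carrier TT" if "z \<in> carrier (sub_ring P)" for z
    using delta_closed that unfolding Delta_def cls_simps(1) by simp
  show "Delta (z \<otimes>\<^bsub>sub_ring P\<^esub> w) = Delta z \<otimes>\<^bsub>TT\<^esub> Delta w"
    "Delta (z \<oplus>\<^bsub>sub_ring P\<^esub> w) = Delta z \<oplus>\<^bsub>TT\<^esub> Delta w"
    if "z \<in> carrier (sub_ring P)" "w \<in> carrier (sub_ring P)" for z w
    using that delta_closed[of z] delta_closed[of w] delta_mult[of z w] delta_add[of z w]
    by (simp_all add: Delta_def cls_simps(4,5) cls_eq del: pre_simps(1))
  show "Delta \<one>\<^bsub>sub_ring P\<^esub> = \<one>\<^bsub>TT\<^esub>"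
    using Delta_mon[OF expo_closed(1) subring_setD(1)[OF F]] by (simp add: cls_simps(2,6))
qed

lemma Delta_comultiplication: "torus_comultiplication \<iota> D x Delta"
  unfolding torus_comultiplication_def Let_def torus_ring_eq
proof (intro conjI allI ballI Delta_hom)
  show "Delta (\<iota> c) = pure (\<iota> c) 1" for c using Delta_mon[OF expo_closed(1), of "\<iota> c"] by simp
  show "Delta (x d) = pure (x d) (x d)" if "d \<in> D" for d
    using Delta_mon[OF expo_closed(3)[OF that, of 1] subring_setD(1)[OF F]] lmon_unit[OF D that, of x 1] by simp
qed

text \<open>
  The elements on which two comultiplications agree form a subring with the generators; inverses are
  included since they are unique in the tensor product.
\<close>

lemma comultiplication_unique:
  assumes \<Delta>: "torus_comultiplication \<iota> D x \<Delta>" and z: "z \<in> P" shows "\<Delta> z = Delta z"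
proof -
  interpret T: cring TT by (rule cring_tensor)
  have h: "\<Delta> \<in> ring_hom (sub_ring P) TT" and i: "\<And>c. \<Delta> (\<iota> c) = pure (\<iota> c) 1" and
    xx: "\<And>d. d \<in> D \<Longrightarrow> \<Delta> (x d) = pure (x d) (x d)"
    using \<Delta> unfolding torus_comultiplication_def Let_def torus_ring_eq by auto
  have i0: "\<And>c. Delta (\<iota> c) = pure (\<iota> c) 1" and x0: "\<And>d. d \<in> D \<Longrightarrow> Delta (x d) = pure (x d) (x d)"
    using Delta_comultiplication unfolding torus_comultiplication_def Let_def torus_ring_eq by auto
  note hm = ring_hom_memE[OF h, simplified] ring_hom_memE[OF Delta_hom, simplified]
  note PD = subring_setD[OF P]
  define E where "E = {z \<in> P. \<Delta> z = Delta z}"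
  have "subring_set E"
    unfolding subring_set_def
  proof (intro conjI ballI)
    show "1 \<in> E" using PD(1) hm(4,8) by (simp add: E_def)
    fix u v assume "u \<in> E" "v \<in> E"
    then have u: "u \<in> P" "\<Delta> u = Delta u" and v: "v \<in> P" "\<Delta> v = Delta v" by (auto simp: E_def)
    show "u * v \<in> E" using u v hm PD(6) by (simp add: E_def)
    have uv: "u - v \<in> P" using PD(5) u v by blast
    have "\<Delta> (u - v) \<oplus>\<^bsub>TT\<^esub> \<Delta> v = \<Delta> u" "Delta (u - v) \<oplus>\<^bsub>TT\<^esub> Delta v = Delta u"
      using hm(3)[OF uv v(1)] hm(7)[OF uv v(1)] by simp_all
    then have "\<Delta> (u - v) \<oplus>\<^bsub>TT\<^esub> Delta v = Delta (u - v) \<oplus>\<^bsub>TT\<^esub> Delta v" using u v by simp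
    then have "\<Delta> (u - v) = Delta (u - v)" using T.add.right_cancel[OF hm(5)[OF v(1)] hm(1)[OF uv] hm(5)[OF uv]] by simp
    then show "u - v \<in> E" using uv by (simp add: E_def)
  qed
  moreover have "F \<subseteq> E" using FP i i0 by (auto simp: E_def)
  moreover have "x d \<in> E \<and> inverse (x d) \<in> E" if d: "d \<in> D" for d
  proof
    show xE: "x d \<in> E" using xP d xx x0 by (simp add: E_def)
    have "\<Delta> (x d) \<otimes>\<^bsub>TT\<^esub> \<Delta> (inverse (x d)) = \<one>\<^bsub>TT\<^esub>" "Delta (x d) \<otimes>\<^bsub>TT\<^esub> Delta (inverse (x d)) = \<one>\<^bsub>TT\<^esub>"
      using hm(2)[OF xP[OF d]] hm(6)[OF xP[OF d]] hm(4,8) xd[OF d] by simp_all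
    then have "\<Delta> (inverse (x d)) = Delta (inverse (x d))"
      using T.inv_unique[of "\<Delta> (inverse (x d))" "Delta (x d)" "Delta (inverse (x d))"]
        hm(1)[OF xP(2)[OF d]] hm(5)[OF xP(1)[OF d]] hm(5)[OF xP(2)[OF d]] xx x0 d T.m_comm by simp
    then show "inverse (x d) \<in> E" using xP d by (simp add: E_def)
  qed
  ultimately have "P \<subseteq> E" by (rule lspan_least)
  then show ?thesis using z by (auto simp: E_def)
qed

text \<open>
  The tensors \<open>x\<^sup>m \<otimes> x\<^sup>n\<close> are independent, as the products of coefficients are balanced. So
  the coefficients \<open>c\<close> of a grouplike element satisfy \<open>c m * c n = 0\<close> for \<open>m \<noteq> n\<close> and
  \<open>c m * c m = c m\<close>.
\<close>

lemma grouplike_monomial: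
  assumes u: "u \<in> P" "u \<noteq> 0" and g: "Delta u = pure u u" shows "\<exists>m\<in>expo D. u = xm m"
proof -
  have rel: "delta u - frag_of (u, u) \<in> rels" using g unfolding Delta_def cls_simps(6) cls_eq .
  note c = coef[OF u(1)]
  let ?M = "{m. coef u m \<noteq> 0}"
  have M: "finite ?M" using lrepD(1)[OF c] .
  have prod: "coef u m * coef u n = (if m = n then coef u m else 0)" for m n
  proof -
    \<comment> \<open>A balanced map, whose value on \<open>a \<otimes> b\<close> is the coefficient of \<open>x\<^sup>m \<otimes> x\<^sup>n\<close>.\<close>
    let ?f = "\<lambda>(a, b). coef a m * coef b n"
    have "ext ?f (delta u - frag_of (u, u)) = 0"
    proof (rule ext_rels[OF _ _ _ rel])
      show "?f (\<iota> e \<otimes>\<^bsub>sub_ring P\<^esub> a, b) = ?f (a, \<iota> e \<otimes>\<^bsub>sub_ring P\<^esub> b)"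
        if "a \<in> carrier (sub_ring P)" "b \<in> carrier (sub_ring P)" for a b e
        using that by (simp add: coef_mult)
    qed (auto simp: coef_add algebra_simps)
    moreover have "ext ?f (delta u) = (\<Sum>k\<in>?M. coef (coef u k * xm k) m * coef (1 * xm k) n)"
      by (simp add: delta_def ext_sum)
    moreover have "\<dots> = (\<Sum>k\<in>?M. if k = m then (if m = n then coef u m else 0) else 0)"
    proof (rule sum.cong[OF HOL.refl])
      fix k assume "k \<in> ?M"
      then have k: "k \<in> expo D" using lrepD(2)[OF c] by blast
      show "coef (coef u k * xm k) m * coef (1 * xm k) n = (if k = m then (if m = n then coef u m else 0) else 0)"
        unfolding coef_mon[OF k lrepD(3)[OF c]] coef_mon[OF k subring_setD(1)[OF F]] by auto
    qed
    moreover have "\<dots> = (if m = n then coef u m else 0)" using M by (simp add: sum.delta')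
    ultimately show ?thesis by (simp add: ext_diff)
  qed
  have "\<exists>m. coef u m \<noteq> 0"
  proof (rule ccontr)
    assume "\<nexists>m. coef u m \<noteq> 0"
    then show False using lrep_sum[OF c M subset_refl] u(2) by simp
  qed
  then obtain m where m: "coef u m \<noteq> 0" by blast
  then have "coef u m = 1" using prod[of m m] by simp
  moreover have "coef u n = 0" if "n \<noteq> m" for n using prod[of m n] m that by simp
  ultimately have "?M = {m}" by auto
  then have "u = xm m" using lrep_sum[OF c M subset_refl] \<open>coef u m = 1\<close> by simp
  then show ?thesis using lrepD(2)[OF c, of m] m by blast
qed

lemma xm_inverse: "inverse (xm m) = xm (\<lambda>i. - m i)"
  by (simp add: lmon_def power_int_minus prod_inversef[symmetric])

lemma expo_minus: "m \<in> expo D \<Longrightarrow> (\<lambda>i. - m i) \<in> expo D"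
  by (simp add: expo_def)

lemma xm_add: "xm (\<lambda>i. m i + n i) = xm m * xm n"
  by (rule lmon_add[OF xd])

lemma xm_nonzero: "xm m \<noteq> 0"
  by (rule lmon_nonzero[OF xd])

lemma characters_carrier: "carrier (torus_characters \<iota> D x) = xm ` expo D"
proof (intro equalityI subsetI)
  fix u assume "u \<in> carrier (torus_characters \<iota> D x)"
  then obtain \<Delta> where u: "u \<in> Units (sub_ring P)" and \<Delta>: "torus_comultiplication \<iota> D x \<Delta>" "\<Delta> u = pure u u"
    unfolding torus_characters_def Let_def torus_ring_eq by auto
  have "u \<in> P" "u \<noteq> 0" using u by (auto simp: Units_def)
  then show "u \<in> xm ` expo D"
    using grouplike_monomial comultiplication_unique[OF \<Delta>(1)] \<Delta>(2) by auto
next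
  fix u assume "u \<in> xm ` expo D"
  then obtain m where m: "m \<in> expo D" "u = xm m" by blast
  have "u \<in> P" "inverse u \<in> P" "u \<noteq> 0"
    unfolding m(2) xm_inverse by (rule mono_P(2) expo_minus xm_nonzero m(1))+
  then have "u \<in> Units (sub_ring P)" by (auto simp: Units_def intro!: bexI[of _ "inverse u"])
  moreover have "Delta u = pure u u" using Delta_mon[OF m(1) subring_setD(1)[OF F]] m(2) by simp
  ultimately show "u \<in> carrier (torus_characters \<iota> D x)"
    unfolding torus_characters_def Let_def torus_ring_eq using Delta_comultiplication by auto
qed

lemma characters_simps:
  "u \<otimes>\<^bsub>torus_characters \<iota> D x\<^esub> v = u * v" "\<one>\<^bsub>torus_characters \<iota> D x\<^esub> = 1"
  by (simp_all add: torus_characters_def Let_def)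

lemma characters_group: "comm_group (torus_characters \<iota> D x)"
proof (rule comm_groupI)
  fix u v assume "u \<in> carrier (torus_characters \<iota> D x)" "v \<in> carrier (torus_characters \<iota> D x)"
  then obtain m n where "m \<in> expo D" "u = xm m" "n \<in> expo D" "v = xm n" unfolding characters_carrier by blast
  then show "u \<otimes>\<^bsub>torus_characters \<iota> D x\<^esub> v \<in> carrier (torus_characters \<iota> D x)"
    unfolding characters_carrier characters_simps
    by (intro image_eqI[of _ _ "\<lambda>i. m i + n i"]) (simp_all add: xm_add expo_closed(2))
next
  show "\<one>\<^bsub>torus_characters \<iota> D x\<^esub> \<in> carrier (torus_characters \<iota> D x)"
    unfolding characters_carrier characters_simps using expo_closed(1)[of D] by (intro image_eqI[of _ _ "\<lambda>i. 0"]) auto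
next
  fix u assume "u \<in> carrier (torus_characters \<iota> D x)"
  then obtain m where m: "m \<in> expo D" "u = xm m" unfolding characters_carrier by blast
  have "xm (\<lambda>i. - m i) * u = 1" unfolding xm_inverse[symmetric] m(2) using xm_nonzero by simp
  then show "\<exists>v\<in>carrier (torus_characters \<iota> D x). v \<otimes>\<^bsub>torus_characters \<iota> D x\<^esub> u = \<one>\<^bsub>torus_characters \<iota> D x\<^esub>"
    unfolding characters_carrier characters_simps using expo_minus[OF m(1)] by blast
qed (auto simp: characters_simps mult_ac)

theorem characters_basis: "abelian_group_basis (torus_characters \<iota> D x) D x"
proof -
  let ?G = "torus_characters \<iota> D x"
  interpret G: comm_group ?G by (rule characters_group)
  have x_carrier: "x d \<in> carrier ?G" if "d \<in> D" for d
    unfolding characters_carrier using lmon_unit[OF D that, of x 1] expo_closed(3)[OF that, of 1] by (intro image_eqI) auto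
  have pow: "x d [^]\<^bsub>?G\<^esub> (k::int) = x d powi k" if d: "d \<in> D" for d k
  proof -
    have nat: "x d [^]\<^bsub>?G\<^esub> (n::nat) = x d ^ n" for n by (induction n) (simp_all add: characters_simps)
    have "inv\<^bsub>?G\<^esub> (x d ^ n) = inverse (x d ^ n)" for n
    proof (rule G.inv_equality)
      show "x d ^ n \<in> carrier ?G" using G.nat_pow_closed[OF x_carrier[OF d], of n] nat by simp
      then obtain m where "m \<in> expo D" "x d ^ n = xm m" unfolding characters_carrier by blast
      then show "inverse (x d ^ n) \<in> carrier ?G" unfolding characters_carrier using xm_inverse[of m] expo_minus by auto
      show "inverse (x d ^ n) \<otimes>\<^bsub>?G\<^esub> x d ^ n = \<one>\<^bsub>?G\<^esub>" using xd[OF d] by (simp add: characters_simps)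
    qed
    then show ?thesis by (simp add: int_pow_def2 nat power_int_def power_inverse)
  qed
  have prod: "(\<Otimes>\<^bsub>?G\<^esub>d\<in>D'. x d [^]\<^bsub>?G\<^esub> n d) = (\<Prod>d\<in>D'. x d powi n d)"
    if "D' \<subseteq> D" for D' and n :: "'v \<Rightarrow> int"
    using finite_subset[OF that D] that
  proof (induction D' rule: finite_induct)
    case (insert d D')
    have "(\<lambda>d. x d [^]\<^bsub>?G\<^esub> n d) \<in> insert d D' \<rightarrow> carrier ?G"
      using insert.prems x_carrier by (auto intro!: G.int_pow_closed)
    then have "(\<Otimes>\<^bsub>?G\<^esub>e\<in>insert d D'. x e [^]\<^bsub>?G\<^esub> n e) = x d [^]\<^bsub>?G\<^esub> n d \<otimes>\<^bsub>?G\<^esub> (\<Otimes>\<^bsub>?G\<^esub>e\<in>D'. x e [^]\<^bsub>?G\<^esub> n e)"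
      by (intro G.finprod_insert[OF insert.hyps]) auto
    then show ?case using insert pow by (simp add: characters_simps)
  qed (simp add: characters_simps)
  let ?f = "\<lambda>n. \<Otimes>\<^bsub>?G\<^esub>d\<in>D. x d [^]\<^bsub>?G\<^esub> n d"
  have f: "?f n = xm n" for n :: "'v \<Rightarrow> int" unfolding lmon_def by (rule prod[OF subset_refl])
  \<comment> \<open>The index functions of the basis are undefined outside \<open>D\<close>, while exponent vectors vanish there.\<close>
  have cut: "xm n = xm (\<lambda>i. if i \<in> D then n i else 0)" for n unfolding lmon_def by (rule prod.cong) auto
  have cutE: "(\<lambda>i. if i \<in> D then n i else 0) \<in> expo D" for n :: "'v \<Rightarrow> int" by (simp add: expo_def)
  have "bij_betw xm (D \<rightarrow>\<^sub>E UNIV) (xm ` expo D)"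
    unfolding bij_betw_def
  proof
    show "inj_on xm (D \<rightarrow>\<^sub>E UNIV)"
    proof (rule inj_onI)
      fix n n' :: "'v \<Rightarrow> int" assume n: "n \<in> D \<rightarrow>\<^sub>E UNIV" "n' \<in> D \<rightarrow>\<^sub>E UNIV" and eq: "xm n = xm n'"
      let ?n = "\<lambda>i. if i \<in> D then n i else 0" and ?n' = "\<lambda>i. if i \<in> D then n' i else 0"
      have "coef (1 * xm ?n) = coef (1 * xm ?n')" using eq cut[of n] cut[of n'] by simp
      then have "(\<lambda>k. if k = ?n then 1 else 0 :: 'l) = (\<lambda>k. if k = ?n' then 1 else 0)"
        unfolding coef_mon[OF cutE subring_setD(1)[OF F]] .
      from fun_cong[OF this, of ?n] have "?n = ?n'" by (simp split: if_splits)
      then have "n i = n' i" if "i \<in> D" for i using fun_cong[of ?n ?n' i] that by simp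
      then show "n = n'" using n by (intro PiE_ext) auto
    qed
    show "xm ` (D \<rightarrow>\<^sub>E UNIV) = xm ` expo D"
    proof (intro equalityI subsetI)
      fix u assume "u \<in> xm ` (D \<rightarrow>\<^sub>E UNIV)"
      then obtain n where n: "u = xm n" by blast
      show "u \<in> xm ` expo D" by (rule image_eqI[where f = xm, OF trans[OF n cut[of n]] cutE[of n]])
    next
      fix u assume "u \<in> xm ` expo D"
      then obtain n where n: "u = xm n" by blast
      have "xm n = xm (restrict n D)" unfolding lmon_def by (rule prod.cong) auto
      then show "u \<in> xm ` (D \<rightarrow>\<^sub>E UNIV)" using n by (intro image_eqI[of _ _ "restrict n D"]) auto
    qed
  qed
  then show ?thesis
    unfolding abelian_group_basis_def f characters_carrier
    using characters_group x_carrier characters_carrier by auto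
qed

end


section \<open>The spectrum of the upper cluster algebra of a lifting\<close>

lemma Spec_prod_mem:
  assumes P: "P \<in> Spec (sub_ring A)" and A: "subring_set A" and D: "finite D" "\<And>d. d \<in> D \<Longrightarrow> f d \<in> A"
  shows "(\<Prod>d\<in>D. f d) \<in> P \<longleftrightarrow> (\<exists>d\<in>D. f d \<in> P)"
  using D
proof (induction D rule: finite_induct)
  case empty then show ?case using SpecD(3)[OF P] by simp
next
  case (insert d D)
  have "(\<Prod>d\<in>D. f d) \<in> A" using insert by (intro subring_set_prod[OF A]) auto
  then show ?case using insert SpecD(4)[OF P, of "f d" "\<Prod>d\<in>D. f d"] by auto
qed

lemma subfield_ambient:
  assumes "subfield K (ambient :: 'l::field ring)"
  shows "subring_set K" "a \<in> K \<Longrightarrow> inverse a \<in> K"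
proof -
  note SR = subringE[OF subfieldE(1)[OF assms], simplified]
  show "subring_set K" unfolding subring_set_def
  proof (intro conjI ballI)
    show "1 \<in> K" using SR(3) by simp
    fix u v assume uv: "u \<in> K" "v \<in> K"
    show "u * v \<in> K" using SR uv by blast
    have "u + - v \<in> K" using SR uv by blast
    then show "u - v \<in> K" by simp
  qed
  show "inverse a \<in> K" if a: "a \<in> K"
  proof (cases "a = 0")
    case True then show ?thesis using a by simp
  next
    case False
    interpret F: field "ambient :: 'l ring" by (rule field_from_type_algebra)
    have "inv\<^bsub>(ambient :: 'l ring)\<^esub> a = inverse a"
      by (rule F.comm_inv_char) (use False in auto)
    moreover have "inv\<^bsub>(ambient :: 'l ring)\<^esub> a \<in> K" using F.subfield_m_inv(1)[OF assms] a False by auto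
    ultimately show ?thesis by simp
  qed
qed

locale lifting = scalars \<iota> for \<iota> :: "complex \<Rightarrow> 'l::field" +
  fixes K :: "'l set" and t :: "('v, 'l) seed" and D :: "'v set" and x :: "'v \<Rightarrow> 'l" and \<nu> :: "'v \<Rightarrow> 'v \<Rightarrow> int"
  assumes K: "subfield K ambient" "F \<subseteq> K" and t: "is_seed \<iota> K t"
    and D: "finite D" "D \<inter> vertices t = {}" and indep: "algebraically_independent K D x"
begin

abbreviation "tD \<equiv> lift_seed_hf D x \<nu> t"

lemmas KS = subfield_ambient[OF K(1)]

lemma good_t: "good t"
  using is_seed_good[OF t] .

lemma K_indep: "lin_indep K D x"
  by (rule algebraically_independent_lin_indep[OF indep D(1) KS(1)])

lemma F_indep: "lin_indep F D x"
proof -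
  have "lrep K D x c 0" if "lrep F D x c 0" for c
    using lrep_mono[OF that] lrepD(3)[OF that] K(2) by blast
  then show ?thesis using K_indep unfolding lin_indep_def by blast
qed

lemma clv_K: "clv t ` vertices t \<subseteq> K"
  using t by (simp add: is_seed_def transcendence_basis_def)

lemma good_tD: "good tD"
  by (rule good_lift[OF good_t KS K(2) clv_K D K_indep])

lemma tD_simps: "hf tD = hf t \<union> D" "d \<in> D \<Longrightarrow> clv tD d = x d" "vertices tD = vertices t \<union> D"
  by (auto simp: lift_seed_hf_def lift_seed_def vertices_def)

text \<open>
  Mutation stays inside the field \<open>K\<close>, so the \<open>x d\<close> are independent over everything that is obtained
  from \<open>t\<close>.
\<close>

lemma LL_K:
  assumes "mutation_equivalent t t'" shows "LL t' \<subseteq> K"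
proof -
  have "clv t' ` vertices t' \<subseteq> K"
    using assms
  proof (induction rule: mutation_equivalent.induct)
    case refl show ?case by (rule clv_K)
  next
    case (step t' k)
    have g: "good t'" using good_equivalent[OF step.hyps(1) good_t] .
    have "LL t' \<subseteq> K"
      unfolding LL_laurent by (rule laurent_least[OF KS(1) K(2)]) (use step.IH KS(2) in \<open>auto simp: vertices_def\<close>)
    then have "exbin k t' \<in> K" using exbin_LL[OF g step.hyps(2)] by blast
    moreover have "inverse (clv t' k) \<in> K" using KS(2) step goodD(4)[OF g] by blast
    ultimately have "exbin k t' / clv t' k \<in> K" using subring_setD(6)[OF KS(1)] by (simp add: field_class.field_divide_inverse)
    then show ?case using step.IH by auto
  qed
  then show ?thesis
    unfolding LL_laurent by (intro laurent_least[OF KS(1) K(2)]) (use KS(2) in \<open>auto simp: vertices_def\<close>)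
qed

lemma UU_K: "UU t \<subseteq> K"
  using UU_LL LL_K[OF mutation_equivalent.refl] by blast

lemma UU_lift_eq: "UU (lift_seed D x \<nu> t) = lspan (UU t) D x"
  by (rule UU_lift[OF good_t D KS(1) K_indep LL_K])

sublocale A: field_subring "UU tD"
  by unfold_locales (rule UU_subring)

sublocale Q: field_subring "UU t"
  by unfold_locales (rule UU_subring)

sublocale T: laurent_tensor \<iota> D x "UU t" K
  by unfold_locales (use D(1) KS(1) K_indep UU_subring F_UU UU_K in auto)

sublocale C: torus \<iota> D x
  by unfold_locales (use D(1) F_indep in auto)

abbreviation "A \<equiv> sub_ring (UU tD)"
abbreviation "V d \<equiv> zero_locus A {clv tD d}"

lemma xA: "d \<in> D \<Longrightarrow> x d \<in> UU tD"
proof -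
  assume d: "d \<in> D"
  then have "d \<in> hf tD" using tD_simps(1) by simp
  moreover then have "d \<notin> uf tD" using goodD(6)[OF good_tD] by blast
  ultimately show ?thesis using frozen_UU[of d tD] tD_simps(2)[OF d] by (simp add: vertices_def)
qed

lemma divisor:
  assumes d: "d \<in> D"
  shows "prime_element (UU tD) (clv tD d)"
  by (rule frozen_prime[OF good_tD]) (use d tD_simps(1) in auto)

lemma int_closed: "int_closed (UU tD)"
  by (rule completely_closed_int_closed[OF UU_subring UU_completely_closed[OF good_tD]])

lemma noeth_UU:
  assumes "finitely_generated_algebra \<iota> (UU tD)" shows "noeth (UU tD)"
proof -
  obtain S where "finite S" "UU tD = gen_algebra \<iota> S" using assms by (auto simp: finitely_generated_algebra_def)
  then show ?thesis using noeth_generated[OF F F_inverse] by (simp add: gen_algebra_def)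
qed

lemma divisor_values:
  assumes d: "d1 \<in> D" "d2 \<in> D" and v: "divisor_valuation A.\<XX> (V d1) v"
  shows "v (rational_function A.\<XX> (topspace (points A.\<XX>)) (global_section A (clv tD d2))) = Fin (if d1 = d2 then 1 else 0)"
proof -
  interpret p: prime_element "UU tD" "clv tD d1" by (rule divisor[OF d(1)])
  have x2: "clv tD d2 \<in> UU tD" using xA d tD_simps(2) by simp
  have hf1: "d1 \<in> hf tD" using d(1) tD_simps(1) by auto
  show ?thesis
  proof (cases "d1 = d2")
    case True
    then show ?thesis using A.rational_global_section[OF x2] p.divisor_valuation_values(1)[OF v] by simp
  next
    case False
    then have "clv tD d2 \<notin> (*) (clv tD d1) ` UU tD"
      by (intro frozen_not_multiple[OF good_tD hf1]) (use d tD_simps in auto)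
    then show ?thesis using A.rational_global_section[OF x2] p.divisor_valuation_values(2)[OF v] x2 False by simp
  qed
qed

subsection \<open>The open complement of the divisors\<close>

text \<open>
  Turning the vertices in \<open>D\<close> into semi-frozen ones inverts the \<open>x d\<close> and gives the upper cluster
  algebra of the lifting, which consists of Laurent polynomials over that of \<open>t\<close>.
\<close>

lemma localized:
  "UU tD \<subseteq> lspan (UU t) D x" "z \<in> lspan (UU t) D x \<Longrightarrow> \<exists>n. (\<Prod>d\<in>D. x d) ^ n * z \<in> UU tD"
proof -
  have sub: "D \<subseteq> hf tD" using tD_simps(1) by auto
  have eq: "UU (unfreeze D tD) = lspan (UU t) D x"
    using UU_lift_eq lift_unfreeze[OF D(2)] by simp
  show "UU tD \<subseteq> lspan (UU t) D x" using UU_unfreeze(1)[OF good_tD D(1) sub] eq by simp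
  have "(\<Prod>d\<in>D. clv tD d) = (\<Prod>d\<in>D. x d)" by (rule prod.cong) (use tD_simps(2) in auto)
  then show "\<exists>n. (\<Prod>d\<in>D. x d) ^ n * z \<in> UU tD" if "z \<in> lspan (UU t) D x"
    using UU_unfreeze(2)[OF good_tD D(1) sub, of z] eq that by simp
qed

lemma lifting_identification_iff:
  "lifting_identification \<iota> D x \<nu> t h \<longleftrightarrow>
    h \<in> ring_iso (sub_ring (lspan (UU t) D x)) T.TT \<and> (\<forall>p\<in>C.P. \<forall>a\<in>UU t. h (p * a) = T.pure p a)"
  by (simp add: lifting_identification_def Let_def C.torus_ring_eq UU_lift_eq)

text \<open>
  The tensor product is embedded in the field by the inverse of the identification, and there it is
  the Laurent polynomial ring, a localization of the upper cluster algebra at the product of the \<open>x d\<close>.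
\<close>

lemma identification_localization:
  assumes h: "h \<in> ring_iso (sub_ring (lspan (UU t) D x)) T.TT"
  shows "localization T.TT (inv_into (lspan (UU t) D x) h) A h (\<Prod>d\<in>D. x d)"
proof -
  let ?B = "lspan (UU t) D x" and ?f = "\<Prod>d\<in>D. x d"
  let ?\<psi> = "inv_into ?B h"
  have B: "subring_set ?B" by (rule lspan_subring[OF UU_subring T.xd])
  have hh: "h \<in> ring_hom (sub_ring ?B) T.TT" and bij: "bij_betw h ?B (carrier T.TT)"
    using h by (auto simp: ring_iso_def)
  note hm = ring_hom_memE[OF hh, simplified]
  have inj: "inj_on h ?B" and im: "h ` ?B = carrier T.TT" using bij by (auto simp: bij_betw_def)
  have inv: "?\<psi> (h z) = z" if "z \<in> ?B" for z using inv_into_f_f[OF inj that] .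
  have zero: "\<zero>\<^bsub>T.TT\<^esub> = h 0"
    using ring_hom_zero[OF hh cring.axioms(1)[OF cring_sub_ring[OF B]] cring.axioms(1)[OF T.cring_tensor]] by simp
  have emb: "embedded T.TT ?\<psi>"
    by (rule embedded_transport[OF B im inj]) (use hm zero in auto)
  have sub: "UU tD \<subseteq> ?B" by (rule localized(1))
  have fA: "?f \<in> UU tD" using xA by (intro subring_set_prod[OF UU_subring])
  have f0: "?f \<noteq> 0" using T.xd D(1) by simp
  have "inverse ?f = (\<Prod>d\<in>D. inverse (x d))" by (rule prod_inversef[symmetric, unfolded o_def])
  also have "\<dots> \<in> ?B" by (rule subring_set_prod[OF B lspan_incl(4)[OF UU_subring D(1)]])
  finally have fB: "inverse ?f \<in> ?B" "?f \<in> ?B" using fA sub by auto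
  show ?thesis
  proof (intro localization.intro localization_axioms.intro embedded_hom.intro embedded_hom_axioms.intro emb)
    show "cring A" by (rule cring_sub_ring[OF UU_subring])
    show "h \<in> ring_hom A T.TT" by (rule ring_hom_memI) (use hm sub in \<open>auto simp: subset_iff\<close>)
    show "inj_on h (carrier A)" using inj_on_subset[OF inj sub] by simp
    show "?f \<in> carrier A" using fA by simp
    show "h ?f \<in> Units T.TT"
      unfolding Units_def
    proof (intro CollectI conjI bexI[of _ "h (inverse ?f)"])
      show "h (inverse ?f) \<otimes>\<^bsub>T.TT\<^esub> h ?f = \<one>\<^bsub>T.TT\<^esub>" "h ?f \<otimes>\<^bsub>T.TT\<^esub> h (inverse ?f) = \<one>\<^bsub>T.TT\<^esub>"
        using hm(2)[OF fB] hm(2)[OF fB(2,1)] hm(4) f0 by simp_all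
    qed (use hm(1) fB in auto)
    fix s assume "s \<in> carrier T.TT"
    then obtain z where z: "z \<in> ?B" "s = h z" using im by blast
    then obtain n where n: "?f ^ n * z \<in> UU tD" using localized(2) by blast
    then have "?\<psi> s * ?\<psi> (h ?f) ^ n = ?\<psi> (h (?f ^ n * z))"
      using inv[OF z(1)] inv[OF fB(2)] inv[of "?f ^ n * z"] sub z(2) by (auto simp: mult.commute)
    then show "\<exists>a\<in>carrier A. \<exists>n. ?\<psi> s * ?\<psi> (h ?f) ^ n = ?\<psi> (h a)" using n by auto
  qed
qed

text \<open>
  A prime ideal contains the product of the \<open>x d\<close> iff it contains one of them.
\<close>

lemma complement_eq: "{P \<in> Spec A. (\<Prod>d\<in>D. x d) \<notin> P} = topspace (points A.\<XX>) - (\<Union>d\<in>D. V d)"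
proof -
  have "(\<Prod>d\<in>D. x d) \<in> P \<longleftrightarrow> (\<exists>d\<in>D. P \<in> V d)" if P: "P \<in> Spec A" for P
    using Spec_prod_mem[OF P UU_subring D(1) xA] P tD_simps(2) by (auto simp: zero_locus_def)
  then show ?thesis unfolding A.top_X by auto
qed

lemma open_embedding:
  assumes h: "lifting_identification \<iota> D x \<nu> t h"
  shows "lrs_iso (affine_scheme T.TT) (open_subspace A.\<XX> (topspace (points A.\<XX>) - (\<Union>d\<in>D. V d)))
      (spec_map A h) (spec_comap A T.TT h)"
    and "d \<in> D \<Longrightarrow> spec_comap A T.TT h (topspace (points A.\<XX>)) (global_section A (clv tD d)) =
      global_section T.TT (T.pure (x d) 1)"
proof -
  have hi: "h \<in> ring_iso (sub_ring (lspan (UU t) D x)) T.TT" and hp: "\<And>p a. p \<in> C.P \<Longrightarrow> a \<in> UU t \<Longrightarrow> h (p * a) = T.pure p a"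
    using h unfolding lifting_identification_iff by auto
  interpret L: localization T.TT "inv_into (lspan (UU t) D x) h" A h "\<Prod>d\<in>D. x d"
    by (rule identification_localization[OF hi])
  show "lrs_iso (affine_scheme T.TT) (open_subspace A.\<XX> (topspace (points A.\<XX>) - (\<Union>d\<in>D. V d)))
      (spec_map A h) (spec_comap A T.TT h)"
    using L.iso unfolding L.U0_def complement_eq .
  assume d: "d \<in> D"
  have "h (x d) = T.pure (x d) 1"
    using hp[OF C.xP(1)[OF d] subring_setD(1)[OF UU_subring]] by simp
  then show "spec_comap A T.TT h (topspace (points A.\<XX>)) (global_section A (clv tD d)) =
      global_section T.TT (T.pure (x d) 1)"
    using L.comap_global_section[of "x d"] xA[OF d] tD_simps(2)[OF d] unfolding A.top_X by simp
qed

text \<open>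
  The scalars embed into the upper cluster algebra, so the structure morphism is the case of a
  morphism of spectra induced by an injective homomorphism.
\<close>

lemma structure_morphism:
  "lrs_morphism Q.\<XX> (affine_scheme (ambient :: complex ring)) (spec_map ambient \<iota>) (spec_comap ambient (sub_ring (UU t)) \<iota>)"
proof -
  have emb: "embedded (ambient :: complex ring) (\<lambda>c. c)"
    by (intro embedded.intro embedded_axioms.intro cring_ambient) (auto intro!: ring_hom_memI)
  interpret E: embedded "ambient :: complex ring" "\<lambda>c. c" by (rule emb)
  interpret H: embedded_hom "sub_ring (UU t)" "\<lambda>x. x" "ambient :: complex ring" \<iota>
  proof (intro embedded_hom.intro embedded_hom_axioms.intro Q.embedded_axioms cring_ambient)
    show "\<iota> \<in> ring_hom ambient (sub_ring (UU t))"
      by (rule ring_hom_memI) (use F_UU iota_hom in auto)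
    show "inj_on \<iota> (carrier ambient)" using iota_inj by simp
  qed
  have "openin (zariski (ambient :: complex ring)) (Spec ambient)"
    using topspace_zariski[OF cring_ambient] by (metis openin_topspace)
  from H.morphism[OF this H.map_Spec] show ?thesis by (simp only: E.open_subspace_whole)
qed

end

theorem proposition1p0p4:
  fixes \<iota> :: "complex \<Rightarrow> 'l::field" and K :: "'l set"
    and t :: "('v, 'l) seed" and D :: "'v set"
    and x :: "'v \<Rightarrow> 'l" and \<nu> :: "'v \<Rightarrow> 'v \<Rightarrow> int"
  assumes "\<iota> \<in> ring_hom ambient ambient"
    and "subfield K ambient" and "range \<iota> \<subseteq> K"
    and "is_seed \<iota> K t" and "maximal_rank t"
    and "finite D" and "D \<inter> vertices t = {}"
    and "algebraically_independent K D x"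
    and "generate_field ambient (K \<union> x ` D) = UNIV"
    and "finitely_generated_algebra \<iota> (upper_cluster_algebra \<iota> (lift_seed_hf D x \<nu> t))"
  shows
    "let tD = lift_seed_hf D x \<nu> t;
         A = sub_ring (upper_cluster_algebra \<iota> tD);
         \<XX> = affine_scheme A;
         Q = sub_ring (upper_cluster_algebra \<iota> t);
         Y = affine_scheme Q;
         P = torus_ring \<iota> D x;
         T = tensor \<iota> \<iota> P Q;
         V = (\<lambda>d. zero_locus A {clv tD d})
     in (noetherian_scheme \<XX> \<and> normal_scheme \<XX> \<and> integral_scheme \<XX>) \<and>
        ((\<forall>d \<in> D. irreducible_in (points \<XX>) (V d) \<and> (\<exists>v. divisor_valuation \<XX> (V d) v)) \<and>
         (\<forall>d1 \<in> D. \<forall>d2 \<in> D. \<forall>v. divisor_valuation \<XX> (V d1) v \<longrightarrow>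
            v (rational_function \<XX> (topspace (points \<XX>)) (global_section A (clv tD d2))) =
            Fin (if d1 = d2 then 1 else 0))) \<and>
        ((\<exists>h. lifting_identification \<iota> D x \<nu> t h) \<and>
         (\<forall>h. lifting_identification \<iota> D x \<nu> t h \<longrightarrow>
            lrs_iso (affine_scheme T) (open_subspace \<XX> (topspace (points \<XX>) - (\<Union>d\<in>D. V d)))
              (spec_map A h) (spec_comap A T h) \<and>
            (\<forall>d \<in> D. spec_comap A T h (topspace (points \<XX>)) (global_section A (clv tD d)) =
                     global_section T (pure_tensor \<iota> \<iota> P Q (x d) 1))) \<and>
         abelian_group_basis (torus_characters \<iota> D x) D x \<and>
         irreducible_in (points Y) (topspace (points Y)) \<and>
         lrs_morphism Y (affine_scheme (ambient :: complex ring))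
           (spec_map ambient \<iota>) (spec_comap ambient Q \<iota>))"
proof -
  interpret lifting \<iota> K t D x \<nu>
    by (intro lifting.intro scalars.intro lifting_axioms.intro) (fact assms)+
  have "irreducible_in (points A.\<XX>) (V d) \<and> (\<exists>v. divisor_valuation A.\<XX> (V d) v)" if "d \<in> D" for d
    using prime_element.irreducible[OF divisor[OF that]] prime_element.divisor_valuation_exists[OF divisor[OF that]] by blast
  moreover have "\<exists>h. lifting_identification \<iota> D x \<nu> t h"
    using T.identification_exists unfolding lifting_identification_iff by blast
  ultimately show ?thesis
    unfolding Let_def C.torus_ring_eq
    using A.noetherian[OF noeth_UU[OF assms(10)]] A.normal[OF int_closed] A.integral divisor_values
      open_embedding C.characters_basis Q.irreducible_Spec structure_morphism
    by blast
qed

end
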